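(* Let $M$ be a compact, orientable $3$-manifold with prime decomposition $M = M_1 \sharp M_2 \sharp \cdots \sharp M_n$. Then: (1) $\pi_1(M)$ has a generalized torsion element if and only if $\pi_1(M_i)$ has a generalized torsion element for some $i \in \{1, \dots, n\}$. (2) If $\pi_1(M_i)$ is torsion-free for all $1 \le i \le n$, then any generalized torsion element in $\pi_1(M)$ is conjugate (in $\pi_1(M)$) to a generalized torsion element in $\pi_1(M_i)$ for some $i$.
   Context: A nontrivial element $g$ of a group $G$ is a generalized torsion element of $G$ if some nonempty finite product of its conjugates is the identity, i.e. there are $k \ge 1$ and $x_1, \dots, x_k \in G$ with $(x_1 g x_1^{-1})(x_2 g x_2^{-1}) \cdots (x_k g x_k^{-1}) = 1$. A compact orientable $3$-manifold $P$ is prime if it can be decomposed as a connected sum only in the trivial way $P = P \sharp S^3$. Every compact orientable (connected) $3$-manifold $M$ decomposes uniquely as a connected sum $M = M_1 \sharp \cdots \sharp M_n$ of prime $3$-manifolds; this is the prime decomposition. Correspondingly $\pi_1(M)$ is the free product $\pi_1(M_1) * \cdots * \pi_1(M_n)$, and each $\pi_1(M_i)$ is regarded as a subgroup (free factor) of $\pi_1(M)$; a generalized torsion element in $\pi_1(M_i)$ is one for which the conjugating elements are taken in $\pi_1(M_i)$. *)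

theory Defs
  imports "HOL-Analysis.Analysis" "HOL-Homology.Homology"
begin

section \<open>Torsion and generalized torsion in groups\<close>

definition torsion_free :: "('a, 'b) monoid_scheme \<Rightarrow> bool" where
  "torsion_free G \<longleftrightarrow>
     (\<forall>g\<in>carrier G. \<forall>k::nat. k \<ge> 1 \<and> g [^]\<^bsub>G\<^esub> k = \<one>\<^bsub>G\<^esub> \<longrightarrow> g = \<one>\<^bsub>G\<^esub>)"

definition conjugate_product :: "('a, 'b) monoid_scheme \<Rightarrow> 'a \<Rightarrow> 'a list \<Rightarrow> 'a" where
  "conjugate_product G g xs =
     foldr (\<lambda>x acc. (x \<otimes>\<^bsub>G\<^esub> g \<otimes>\<^bsub>G\<^esub> inv\<^bsub>G\<^esub> x) \<otimes>\<^bsub>G\<^esub> acc) xs \<one>\<^bsub>G\<^esub>"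

definition generalized_torsion :: "('a, 'b) monoid_scheme \<Rightarrow> 'a \<Rightarrow> bool" where
  "generalized_torsion G g \<longleftrightarrow>
     g \<in> carrier G \<and> g \<noteq> \<one>\<^bsub>G\<^esub> \<and>
     (\<exists>xs. xs \<noteq> [] \<and> set xs \<subseteq> carrier G \<and> conjugate_product G g xs = \<one>\<^bsub>G\<^esub>)"

definition conjugate_in :: "('a, 'b) monoid_scheme \<Rightarrow> 'a \<Rightarrow> 'a \<Rightarrow> bool" where
  "conjugate_in G g h \<longleftrightarrow>
     g \<in> carrier G \<and> h \<in> carrier G \<and>
     (\<exists>a\<in>carrier G. g = a \<otimes>\<^bsub>G\<^esub> h \<otimes>\<^bsub>G\<^esub> inv\<^bsub>G\<^esub> a)"


section \<open>The fundamental group of an abstract topology\<close>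

text \<open>The library's \<open>joinpaths\<close> and \<open>reversepath\<close> require the carrier type to be a topological
  space; the same formulas are used here for arbitrary types.\<close>

definition path_concat :: "(real \<Rightarrow> 'a) \<Rightarrow> (real \<Rightarrow> 'a) \<Rightarrow> real \<Rightarrow> 'a" where
  "path_concat g1 g2 = (\<lambda>t. if t \<le> 1/2 then g1 (2 * t) else g2 (2 * t - 1))"

definition path_reverse :: "(real \<Rightarrow> 'a) \<Rightarrow> real \<Rightarrow> 'a" where
  "path_reverse g = (\<lambda>t. g (1 - t))"

definition is_loop :: "'a topology \<Rightarrow> 'a \<Rightarrow> (real \<Rightarrow> 'a) \<Rightarrow> bool" where
  "is_loop X p \<gamma> \<longleftrightarrow> pathin X \<gamma> \<and> \<gamma> 0 = p \<and> \<gamma> 1 = p"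

definition loop_class :: "'a topology \<Rightarrow> 'a \<Rightarrow> (real \<Rightarrow> 'a) \<Rightarrow> (real \<Rightarrow> 'a) set" where
  "loop_class X p \<gamma> =
     {\<delta>. homotopic_with (\<lambda>r. r 0 = p \<and> r 1 = p) (top_of_set {0..1::real}) X \<gamma> \<delta>}"

definition fundamental_group :: "'a topology \<Rightarrow> 'a \<Rightarrow> (real \<Rightarrow> 'a) set monoid" where
  "fundamental_group X p =
     \<lparr>carrier = loop_class X p ` {\<gamma>. is_loop X p \<gamma>},
      mult = (\<lambda>A B. \<Union>\<gamma>\<in>A. \<Union>\<delta>\<in>B. loop_class X p (path_concat \<gamma> \<delta>)),
      one = loop_class X p (\<lambda>_. p)\<rparr>"


section \<open>Compact orientable 3-manifolds, possibly with boundary\<close>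

definition manifold3 :: "'a topology \<Rightarrow> bool" where
  "manifold3 X \<longleftrightarrow>
     Hausdorff_space X \<and> second_countable X \<and>
     (\<forall>x\<in>topspace X. \<exists>U V. openin X U \<and> x \<in> U \<and>
        openin (top_of_set {v :: real^3. v $ 1 \<ge> 0}) V \<and>
        subtopology X U homeomorphic_space top_of_set V)"

definition manifold_interior :: "'a topology \<Rightarrow> 'a set" where
  "manifold_interior X =
     {x. \<exists>U V. openin X U \<and> x \<in> U \<and> open (V :: (real^3) set) \<and>
           subtopology X U homeomorphic_space top_of_set V}"

text \<open>An orientation is a choice, at every interior point \<open>x\<close>, of a generator of the local homology
  group \<open>H\<^sub>3(N, N - {x})\<close>, where \<open>N\<close> is the manifold interior; locally the choices must
  come from one class in \<open>H\<^sub>3(N, N - B)\<close>.\<close>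

definition orientable3 :: "'a topology \<Rightarrow> bool" where
  "orientable3 X \<longleftrightarrow>
     (let I = manifold_interior X; N = subtopology X I in
      \<exists>\<mu>. (\<forall>x\<in>I. \<mu> x \<in> carrier (relative_homology_group 3 N (I - {x})) \<and>
                 generate (relative_homology_group 3 N (I - {x})) {\<mu> x}
                   = carrier (relative_homology_group 3 N (I - {x}))) \<and>
          (\<forall>x\<in>I. \<exists>B. openin N B \<and> x \<in> B \<and>
             (\<exists>\<beta>\<in>carrier (relative_homology_group 3 N (I - B)).
                \<forall>y\<in>B. hom_induced 3 N (I - B) N (I - {y}) id \<beta> = \<mu> y)))"

definition compact_orientable_3manifold :: "'a topology \<Rightarrow> bool" where
  "compact_orientable_3manifold X \<longleftrightarrow>
     topspace X \<noteq> {} \<and> connected_space X \<and> compact_space X \<and> manifold3 X \<and> orientable3 X"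


section \<open>Connected sums and prime decompositions\<close>

text \<open>A parametrised tame ball in the interior of \<open>X\<close> is given as an open embedding \<open>e\<close> of the whole
  of \<open>\<real>\<^sup>3\<close>; the ball itself is the image of \<open>cball 0 1\<close>. This excludes wildly embedded spheres.\<close>

definition tame_ball :: "'a topology \<Rightarrow> (real^3 \<Rightarrow> 'a) \<Rightarrow> bool" where
  "tame_ball X e \<longleftrightarrow> embedding_map euclidean X e \<and> openin X (range e)"

definition punctured_set :: "'a topology \<Rightarrow> (real^3 \<Rightarrow> 'a) \<Rightarrow> 'a set" where
  "punctured_set X e = topspace X - e ` ball 0 1"

text \<open>\<open>X\<close>, with the structure maps \<open>h1\<close> and \<open>h2\<close>, is obtained from the disjoint union of \<open>Y\<close> minus
  an open ball and \<open>P\<close> minus an open ball by gluing the two boundary spheres: \<open>h1\<close> and \<open>h2\<close>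
  together form a quotient map whose only identifications are \<open>e1 s \<sim> e2 s\<close> for \<open>s\<close> in the unit
  sphere. A gluing along an arbitrary homeomorphism of the sphere is covered, since such a
  homeomorphism extends radially to \<open>\<real>\<^sup>3\<close> and can be absorbed into \<open>e2\<close>. The summands are orientable
  but not oriented, so no condition on orientations is imposed on the gluing.\<close>

definition connected_sum_via ::
  "'a topology \<Rightarrow> 'a topology \<Rightarrow> 'a topology \<Rightarrow>
   (real^3 \<Rightarrow> 'a) \<Rightarrow> (real^3 \<Rightarrow> 'a) \<Rightarrow> ('a \<Rightarrow> 'a) \<Rightarrow> ('a \<Rightarrow> 'a) \<Rightarrow> bool" where
  "connected_sum_via X Y P e1 e2 h1 h2 \<longleftrightarrow>
     compact_orientable_3manifold Y \<and> compact_orientable_3manifold P \<and>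
     tame_ball Y e1 \<and> tame_ball P e2 \<and>
     quotient_map
       (sum_topology (\<lambda>b. if b then subtopology Y (punctured_set Y e1)
                               else subtopology P (punctured_set P e2)) UNIV)
       X (\<lambda>(b, z). if b then h1 z else h2 z) \<and>
     inj_on h1 (punctured_set Y e1) \<and> inj_on h2 (punctured_set P e2) \<and>
     (\<forall>y\<in>punctured_set Y e1. \<forall>z\<in>punctured_set P e2.
        h1 y = h2 z \<longleftrightarrow> (\<exists>s\<in>sphere 0 1. y = e1 s \<and> z = e2 s))"

definition connected_sum :: "'a topology \<Rightarrow> 'a topology \<Rightarrow> 'a topology \<Rightarrow> bool" where
  "connected_sum X Y P \<longleftrightarrow> (\<exists>e1 e2 h1 h2. connected_sum_via X Y P e1 e2 h1 h2)"

abbreviation sphere3 :: "(real^4) topology" where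
  "sphere3 \<equiv> top_of_set (sphere 0 1)"

text \<open>The summands range over topologies on the same type \<open>'a\<close>. This loses nothing: a nonempty
  3-manifold on \<open>'a\<close> has exactly continuum many points, so \<open>'a\<close> carries a homeomorphic copy of every
  3-manifold.\<close>

definition prime_3manifold :: "'a topology \<Rightarrow> bool" where
  "prime_3manifold P \<longleftrightarrow>
     compact_orientable_3manifold P \<and>
     (\<forall>Q R :: 'a topology. connected_sum P Q R \<longrightarrow>
        (Q homeomorphic_space P \<and> R homeomorphic_space sphere3) \<or>
        (Q homeomorphic_space sphere3 \<and> R homeomorphic_space P))"

text \<open>The map from the fundamental group of a summand to that of the connected sum. Here \<open>D\<close> is the
  punctured summand, \<open>h\<close> its structure map into \<open>X\<close>, and \<open>\<alpha>\<close> a path in \<open>X\<close> from the base point \<open>p\<close> to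
  the image of the base point of the summand. Removing a ball does not change the fundamental
  group of a 3-manifold, so a class \<open>c\<close> has a representative \<open>\<gamma>\<close> inside \<open>D\<close>, and it is sent to the
  class of \<open>\<alpha> * (h \<circ> \<gamma>) * \<alpha>\<^sup>-\<close> (\<open>\<alpha>\<^sup>-\<close> the reversed path), independently of the representative.\<close>

definition summand_map ::
  "'a topology \<Rightarrow> 'a \<Rightarrow> 'a set \<Rightarrow> ('a \<Rightarrow> 'a) \<Rightarrow> (real \<Rightarrow> 'a) \<Rightarrow>
   (real \<Rightarrow> 'a) set \<Rightarrow> (real \<Rightarrow> 'a) set" where
  "summand_map X p D h \<alpha> c =
     (\<Union>\<gamma>\<in>{\<gamma>\<in>c. \<gamma> ` {0..1} \<subseteq> D}.
        loop_class X p (path_concat \<alpha> (path_concat (h \<circ> \<gamma>) (path_reverse \<alpha>))))"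

text \<open>\<open>iterated_connected_sum [M\<^sub>1, ..., M\<^sub>n] [x\<^sub>1, ..., x\<^sub>n] M p [\<iota>\<^sub>1, ..., \<iota>\<^sub>n]\<close> says that \<open>M\<close> is a connected
  sum \<open>(...(M\<^sub>1 # M\<^sub>2) # ...) # M\<^sub>n\<close>, and that \<open>\<iota>\<^sub>i\<close> is the resulting identification of the
  fundamental group of \<open>M\<^sub>i\<close> at \<open>x\<^sub>i\<close> with a free factor of the fundamental group of \<open>M\<close> at \<open>p\<close>. These
  identifications depend on the connecting paths \<open>\<alpha>\<close>, \<open>\<beta>\<close> only up to conjugation.\<close>

inductive iterated_connected_sum ::
  "'a topology list \<Rightarrow> 'a list \<Rightarrow> 'a topology \<Rightarrow> 'a \<Rightarrow>
   ((real \<Rightarrow> 'a) set \<Rightarrow> (real \<Rightarrow> 'a) set) list \<Rightarrow> bool" where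
  single:
  "\<lbrakk>homeomorphic_map P X f; x \<in> topspace P; pathin X \<alpha>; \<alpha> 0 = p; \<alpha> 1 = f x\<rbrakk> \<Longrightarrow>
   iterated_connected_sum [P] [x] X p [summand_map X p (topspace P) f \<alpha>]"
| step:
  "\<lbrakk>iterated_connected_sum Ps xs Y y \<iota>s;
    connected_sum_via X Y P e1 e2 h1 h2;
    y \<in> punctured_set Y e1; x \<in> punctured_set P e2;
    pathin X \<alpha>; \<alpha> 0 = p; \<alpha> 1 = h1 y;
    pathin X \<beta>; \<beta> 0 = p; \<beta> 1 = h2 x\<rbrakk> \<Longrightarrow>
   iterated_connected_sum (Ps @ [P]) (xs @ [x]) X p
     (map (\<lambda>\<iota>. summand_map X p (punctured_set Y e1) h1 \<alpha> \<circ> \<iota>) \<iota>s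
      @ [summand_map X p (punctured_set P e2) h2 \<beta>])"

definition prime_decomposition ::
  "'a topology list \<Rightarrow> 'a list \<Rightarrow> 'a topology \<Rightarrow> 'a \<Rightarrow>
   ((real \<Rightarrow> 'a) set \<Rightarrow> (real \<Rightarrow> 'a) set) list \<Rightarrow> bool" where
  "prime_decomposition Ms xs M p \<iota>s \<longleftrightarrow>
     (\<forall>P\<in>set Ms. prime_3manifold P) \<and> iterated_connected_sum Ms xs M p \<iota>s"

end

theory Submission
  imports Defs "HOL-Algebra.Bij" "HOL-Algebra.Generated_Groups"
begin

text \<open>
  The fundamental group of a connected sum is a free product, and the theorem is at bottom a
  statement about free products \<open>G = A * B\<close> of torsion-free groups: a generalized torsion element of
  \<open>G\<close> is conjugate into \<open>A\<close> or \<open>B\<close> (\<open>generalized_torsion_conjugate_into_factor\<close>). There it is a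
  generalized torsion element of the factor, because the retraction of \<open>G\<close> onto the factor moves the
  conjugating elements into it. Conversely the factors embed, so their generalized torsion survives.
  If some factor has torsion, then a torsion element of that factor is already a generalized torsion
  element, which settles the remaining case of the equivalence.

  \<^bold>\<open>Free products.\<close> An element that is not conjugate into a factor is conjugate to a cyclically reduced
  \<open>w = a\<^sub>0 b\<^sub>0 \<dots> a\<^sub>m b\<^sub>m\<close>; let \<open>n = m + 1\<close>. Suppose that a product of \<open>k\<close> conjugates \<open>x w x\<^sup>-\<close> is
  trivial, where the \<open>x\<close> are written as alternating words that begin in \<open>A\<close>, and read the product as one
  cyclic word. As it is trivial, it can be emptied by deleting runs of letters of one factor whose
  product is \<open>1\<close>. The deleted runs, here called blocks, are at least \<open>S + k (n - 1) + 1\<close> in number, where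
  \<open>S\<close> is the total length of the conjugators \<open>x\<close> (\<open>block_decomposition\<close>). Each letter of a conjugator
  also occurs inverted in \<open>x\<^sup>-\<close>. Regard the blocks as cycles and cancel such a pair by joining or
  cutting cycles; this destroys at most one cycle with trivial product (\<open>glue_step\<close>). After \<open>S\<close>
  cancellations at least \<open>k (n - 1) + 1\<close> cycles with trivial product are left, and they contain only
  letters of the \<open>k\<close> copies of \<open>w\<close>. The letters of such a cycle do not all have the same index, since a
  power of a single letter is nontrivial by torsion-freeness; so the index increases somewhere along
  it. But an increase from
  \<open>a\<^sub>i\<close> to \<open>a\<^sub>j\<close> forces the letter \<open>b\<^bsub>j-1\<^esub>\<close> just before this \<open>a\<^sub>j\<close> to be followed by a \<open>b\<^sub>i\<close>
  (\<open>chain_duality\<close>), which is no increase. Hence each of the \<open>k (n - 1)\<close> places inside the copies of \<open>w\<close>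
  where a \<open>b\<close> is followed by an \<open>a\<close> is charged by at most one cycle. This is a
  contradiction (\<open>product_of_conjugates_nontrivial\<close>).

  \<^bold>\<open>Connected sums.\<close> A connected sum is covered by two open sets, each a copy of a summand with one
  point removed: inversion in the unit sphere identifies the punctured ball of one summand with a
  collar in the other. These open sets meet in a copy of \<open>\<real>\<^sup>3 - {0}\<close>, which is simply connected. For the
  same reason, removing a point does not affect the fundamental group of a summand. The theorem of
  Seifert and van Kampen is proved for a simply connected intersection and arbitrary target groups
  (\<open>van_kampen_hom\<close>). With the permutations of reduced words as target, it shows that the fundamental
  group of the sum is the free product (\<open>fundamental_group_free_product\<close>); with the groups of the
  summands as targets, it gives the retractions. The maps in the statement are the inclusions of the
  factors up to a change of base points (\<open>summand_map_eq\<close>), and the theorem follows by induction over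
  the iterated connected sum.
\<close>

section \<open>Cyclic words\<close>

fun adjacent_pairs :: "'l list \<Rightarrow> ('l \<times> 'l) list" where
  "adjacent_pairs (x # y # zs) = (x, y) # adjacent_pairs (y # zs)"
| "adjacent_pairs _ = []"

text \<open>The list is read as a cycle: its last letter is followed by its first, and a single letter is
  followed by itself.\<close>

definition cyclic_pairs :: "'l list \<Rightarrow> ('l \<times> 'l) list" where
  "cyclic_pairs W = adjacent_pairs W @ (if W = [] then [] else [(last W, hd W)])"

abbreviation cyc :: "'l list \<Rightarrow> ('l \<times> 'l) set" where
  "cyc W \<equiv> set (cyclic_pairs W)"

text \<open>The common successor relation of a family of disjoint cycles.\<close>

definition next_in :: "'l list list \<Rightarrow> ('l \<times> 'l) set" where
  "next_in Bs = (\<Union>B\<in>set Bs. cyc B)"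

text \<open>The truth value \<open>ty l\<close> tells from which of the two factors of a free product the letter \<open>l\<close> is
  taken. Letters are formal symbols, kept distinct from one another, and \<open>val\<close> sends them to group
  elements.\<close>

definition crossings :: "('l \<Rightarrow> bool) \<Rightarrow> 'l list \<Rightarrow> nat" where
  "crossings ty W = length (filter (\<lambda>(z, y). ty z \<noteq> ty y) (cyclic_pairs W))"

definition monochrome :: "('l \<Rightarrow> bool) \<Rightarrow> 'l list \<Rightarrow> bool" where
  "monochrome ty W \<longleftrightarrow> (\<forall>l\<in>set W. \<forall>l'\<in>set W. ty l = ty l')"

lemma adjacent_pairs_Cons: "xs \<noteq> [] \<Longrightarrow> adjacent_pairs (x # xs) = (x, hd xs) # adjacent_pairs xs"
  by (cases xs) auto

lemma adjacent_pairs_append: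
  "u \<noteq> [] \<Longrightarrow> v \<noteq> [] \<Longrightarrow>
   adjacent_pairs (u @ v) = adjacent_pairs u @ (last u, hd v) # adjacent_pairs v"
proof (induction u)
  case (Cons x u)
  then show ?case by (cases "u = []") (auto simp: adjacent_pairs_Cons)
qed auto

lemma cyclic_pairs_append:
  "u \<noteq> [] \<Longrightarrow> v \<noteq> [] \<Longrightarrow>
   cyclic_pairs (u @ v) = adjacent_pairs u @ (last u, hd v) # adjacent_pairs v @ [(last v, hd u)]"
  by (simp add: cyclic_pairs_def adjacent_pairs_append)

lemma cyclic_pairs_Nil [simp]: "cyclic_pairs [] = []"
  by (simp add: cyclic_pairs_def)

lemma cyclic_pairs_rotate1: "cyclic_pairs (rotate1 W) = rotate1 (cyclic_pairs W)"
proof (cases W)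
  case (Cons x xs)
  show ?thesis
  proof (cases "xs = []")
    case False
    then show ?thesis
      using cyclic_pairs_append[of xs "[x]"] cyclic_pairs_append[of "[x]" xs] Cons by simp
  qed (simp add: Cons cyclic_pairs_def)
qed simp

lemma cyclic_pairs_rotate: "cyclic_pairs (rotate n W) = rotate n (cyclic_pairs W)"
  by (induction n) (auto simp: cyclic_pairs_rotate1)

lemma cyc_rotate [simp]: "cyc (rotate n W) = cyc W"
  by (simp add: cyclic_pairs_rotate)

lemma map_fst_adjacent_pairs: "map fst (adjacent_pairs W) = butlast W"
  by (induction W rule: adjacent_pairs.induct) auto

lemma map_snd_adjacent_pairs: "map snd (adjacent_pairs W) = tl W"
  by (induction W rule: adjacent_pairs.induct) auto

lemma map_fst_cyclic_pairs: "map fst (cyclic_pairs W) = W"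
  by (simp add: cyclic_pairs_def map_fst_adjacent_pairs)

lemma map_snd_cyclic_pairs: "map snd (cyclic_pairs W) = rotate1 W"
  by (cases W) (auto simp: cyclic_pairs_def map_snd_adjacent_pairs)

lemma cyc_in_set: "(z, y) \<in> cyc W \<Longrightarrow> z \<in> set W \<and> y \<in> set W"
proof -
  assume a: "(z, y) \<in> cyc W"
  have "z \<in> set (map fst (cyclic_pairs W))" "y \<in> set (map snd (cyclic_pairs W))"
    using a by force+
  then show ?thesis by (simp add: map_fst_cyclic_pairs map_snd_cyclic_pairs)
qed

lemma cyc_successor_exists: "z \<in> set W \<Longrightarrow> \<exists>y. (z, y) \<in> cyc W"
proof -
  assume "z \<in> set W"
  then have "z \<in> set (map fst (cyclic_pairs W))" by (simp add: map_fst_cyclic_pairs)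
  then show ?thesis by force
qed

lemma distinct_map_fst_unique:
  "distinct (map f ps) \<Longrightarrow> p \<in> set ps \<Longrightarrow> q \<in> set ps \<Longrightarrow> f p = f q \<Longrightarrow> p = q"
  by (simp add: distinct_map inj_on_def)

lemma cyc_functional:
  "distinct W \<Longrightarrow> (z, y) \<in> cyc W \<Longrightarrow> (z, y') \<in> cyc W \<Longrightarrow> y = y'"
  using distinct_map_fst_unique[of fst "cyclic_pairs W" "(z,y)" "(z,y')"]
  by (simp add: map_fst_cyclic_pairs)

lemma cyc_injective:
  "distinct W \<Longrightarrow> (z, y) \<in> cyc W \<Longrightarrow> (z', y) \<in> cyc W \<Longrightarrow> z = z'"
  using distinct_map_fst_unique[of snd "cyclic_pairs W" "(z,y)" "(z',y)"]
  by (simp add: map_snd_cyclic_pairs)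

lemma crossings_rotate [simp]: "crossings ty (rotate n W) = crossings ty W"
proof (induction n)
  case (Suc n)
  have "length (filter P (rotate1 xs)) = length (filter P xs)" for P and xs :: "('a\<times>'a) list"
    by (cases xs) auto
  then show ?case using Suc by (simp add: crossings_def cyclic_pairs_rotate cyclic_pairs_rotate1)
qed simp

lemma distinct_concat_same:
  "distinct (concat Bs) \<Longrightarrow> B \<in> set Bs \<Longrightarrow> B' \<in> set Bs \<Longrightarrow> z \<in> set B \<Longrightarrow> z \<in> set B' \<Longrightarrow> B = B'"
  by (induction Bs) auto

lemma distinct_concat_member: "distinct (concat Bs) \<Longrightarrow> B \<in> set Bs \<Longrightarrow> distinct B"
  by (induction Bs) auto

lemma next_in_functional:
  assumes "distinct (concat Bs)" "(z, y) \<in> next_in Bs" "(z, y') \<in> next_in Bs"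
  shows "y = y'"
proof -
  obtain B B' where B: "B \<in> set Bs" "(z, y) \<in> cyc B" and B': "B' \<in> set Bs" "(z, y') \<in> cyc B'"
    using assms(2,3) unfolding next_in_def by blast
  have "B = B'"
    using distinct_concat_same[OF assms(1) B(1) B'(1)] cyc_in_set[OF B(2)] cyc_in_set[OF B'(2)] by blast
  then show ?thesis
    using cyc_functional[OF distinct_concat_member[OF assms(1) B(1)] B(2)] B'(2) by blast
qed

lemma next_in_injective:
  assumes "distinct (concat Bs)" "(z, y) \<in> next_in Bs" "(z', y) \<in> next_in Bs"
  shows "z = z'"
proof -
  obtain B B' where B: "B \<in> set Bs" "(z, y) \<in> cyc B" and B': "B' \<in> set Bs" "(z', y) \<in> cyc B'"
    using assms(2,3) unfolding next_in_def by blast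
  have "B = B'"
    using distinct_concat_same[OF assms(1) B(1) B'(1)] cyc_in_set[OF B(2)] cyc_in_set[OF B'(2)] by blast
  then show ?thesis
    using cyc_injective[OF distinct_concat_member[OF assms(1) B(1)] B(2)] B'(2) by blast
qed

lemma next_in_set: "(z, y) \<in> next_in Bs \<Longrightarrow> z \<in> set (concat Bs) \<and> y \<in> set (concat Bs)"
  using cyc_in_set by (fastforce simp: next_in_def)

section \<open>Products of lists and free products\<close>

context group begin

definition lprod :: "'a list \<Rightarrow> 'a" where
  "lprod vs = foldr (\<otimes>) vs \<one>"

lemma lprod_simps [simp]: "lprod [] = \<one>" "lprod (v # vs) = v \<otimes> lprod vs"
  by (auto simp: lprod_def)

lemma lprod_closed [simp]: "set vs \<subseteq> carrier G \<Longrightarrow> lprod vs \<in> carrier G"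
  by (induction vs) auto

lemma lprod_append [simp]:
  "set us \<subseteq> carrier G \<Longrightarrow> set vs \<subseteq> carrier G \<Longrightarrow> lprod (us @ vs) = lprod us \<otimes> lprod vs"
  by (induction us) (auto simp: m_assoc)

lemma lprod_rotate1:
  assumes "set vs \<subseteq> carrier G"
  shows "lprod (rotate1 vs) = \<one> \<longleftrightarrow> lprod vs = \<one>"
proof (cases vs)
  case (Cons x xs)
  then have "x \<in> carrier G" "set xs \<subseteq> carrier G" using assms by auto
  then show ?thesis using Cons inv_comm[of x "lprod xs"] inv_comm[of "lprod xs" x] by auto
qed simp

lemma lprod_rotate:
  assumes "set vs \<subseteq> carrier G"
  shows "lprod (rotate n vs) = \<one> \<longleftrightarrow> lprod vs = \<one>"
  using assms by (induction n) (auto simp: lprod_rotate1)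

lemma lprod_in_subgroup: "subgroup H G \<Longrightarrow> set vs \<subseteq> H \<Longrightarrow> lprod vs \<in> H"
  by (induction vs) (auto simp: subgroup.one_closed subgroup.m_closed)

lemma lprod_rev_inv:
  "set vs \<subseteq> carrier G \<Longrightarrow> lprod (rev (map (\<lambda>v. inv v) vs)) = inv (lprod vs)"
proof (induction vs)
  case (Cons a vs)
  have s: "set (rev (map (\<lambda>v. inv v) vs)) \<subseteq> carrier G" using Cons.prems by auto
  have "lprod (rev (map (\<lambda>v. inv v) (a # vs))) = lprod (rev (map (\<lambda>v. inv v) vs) @ [inv a])" by simp
  also have "\<dots> = lprod (rev (map (\<lambda>v. inv v) vs)) \<otimes> lprod [inv a]"
    using s Cons.prems by (intro lprod_append) auto
  also have "\<dots> = inv (lprod vs) \<otimes> inv a" using Cons by simp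
  also have "\<dots> = inv (lprod (a # vs))" using Cons.prems by (simp add: inv_mult_group)
  finally show ?case .
qed simp

end

text \<open>Generation by \<open>A\<close> and \<open>B\<close> is separated from the absence of relations, because the alternating
  lists in terms of which the latter is expressed are defined in between.\<close>

locale internal_free_product = group G for G (structure) +
  fixes A B :: "'a set"
  assumes A: "subgroup A G" and B: "subgroup B G"
    and generated: "generate G (A \<union> B) = carrier G"
begin

definition fac :: "bool \<Rightarrow> 'a set" where "fac t = (if t then A else B)"

fun alternating :: "bool \<Rightarrow> 'a list \<Rightarrow> bool" where
  "alternating t [] = True"
| "alternating t (v # vs) = (v \<in> fac t \<and> v \<noteq> \<one> \<and> alternating (\<not> t) vs)"

end

text \<open>The normal form theorem serves as the definition of a free product. Together with generation
  it is equivalent to the universal property of the free product.\<close>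

locale free_product = internal_free_product +
  assumes normal_form: "\<And>t vs. alternating t vs \<Longrightarrow> vs \<noteq> [] \<Longrightarrow> lprod vs \<noteq> \<one>"
begin

lemma subgroup_fac: "subgroup (fac t) G"
  using A B by (simp add: fac_def)

lemma fac_closed: "v \<in> fac t \<Longrightarrow> v \<in> carrier G"
  by (rule subgroup.mem_carrier[OF subgroup_fac])

lemma alternating_closed: "alternating t vs \<Longrightarrow> set vs \<subseteq> carrier G"
  by (induction vs arbitrary: t) (auto simp: fac_closed)

end

section \<open>Trivial words in a free product\<close>

context free_product begin

text \<open>Multiply the letters of each maximal run of letters of one factor. Unless some run has product
  \<open>1\<close>, the results form an alternating list with the same product.\<close>

lemma trivial_run_or_alternating:
  assumes "W \<noteq> []" "\<forall>l\<in>set W. val l \<in> fac (ty l)"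
  shows "(\<exists>U R U' c. W = U @ R @ U' \<and> R \<noteq> [] \<and> (\<forall>l\<in>set R. ty l = c) \<and> lprod (map val R) = \<one> \<and>
            (U \<noteq> [] \<longrightarrow> ty (last U) \<noteq> c) \<and> (U' \<noteq> [] \<longrightarrow> ty (hd U') \<noteq> c))
       \<or> (\<exists>vs. vs \<noteq> [] \<and> alternating (ty (hd W)) vs \<and> lprod vs = lprod (map val W))"
  using assms
proof (induction W rule: length_induct)
  case (1 W)
  define c where "c = ty (hd W)"
  define R where "R = takeWhile (\<lambda>l. ty l = c) W"
  define V where "V = dropWhile (\<lambda>l. ty l = c) W"
  have WRV: "W = R @ V" by (simp add: R_def V_def)
  have Rne: "R \<noteq> []" using "1.prems" by (cases W) (auto simp: R_def c_def)
  have mono: "\<forall>l\<in>set R. ty l = c" unfolding R_def using set_takeWhileD by fast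
  have lastR: "ty (last R) = c" using mono Rne by auto
  have hdV: "V \<noteq> [] \<Longrightarrow> ty (hd V) = (\<not> c)"
    using hd_dropWhile[of "\<lambda>l. ty l = c" W] by (auto simp: V_def)
  have clR: "set (map val R) \<subseteq> carrier G" "set (map val V) \<subseteq> carrier G"
    using "1.prems"(2) fac_closed WRV by auto
  have pW: "lprod (map val W) = lprod (map val R) \<otimes> lprod (map val V)"
    using clR by (simp add: WRV)
  have inR: "lprod (map val R) \<in> fac c"
    using mono "1.prems"(2) WRV by (intro lprod_in_subgroup subgroup_fac) auto
  show ?case
  proof (cases "lprod (map val R) = \<one>")
    case True
    then have "W = [] @ R @ V \<and> R \<noteq> [] \<and> (\<forall>l\<in>set R. ty l = c) \<and> lprod (map val R) = \<one> \<and>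
            ([] \<noteq> ([]::'c list) \<longrightarrow> ty (last []) \<noteq> c) \<and> (V \<noteq> [] \<longrightarrow> ty (hd V) \<noteq> c)"
      using WRV Rne mono hdV by simp
    then show ?thesis by blast
  next
    case False
    show ?thesis
    proof (cases "V = []")
      case True
      then have "[lprod (map val R)] \<noteq> [] \<and> alternating (ty (hd W)) [lprod (map val R)] \<and>
           lprod [lprod (map val R)] = lprod (map val W)"
        using False inR pW clR c_def by simp
      then show ?thesis by blast
    next
      case Vne: False
      have "length V < length W" using Rne WRV by auto
      moreover have "\<forall>l\<in>set V. val l \<in> fac (ty l)" using "1.prems"(2) WRV by auto
      ultimately consider
        (a) U S U' d where "V = U @ S @ U'" "S \<noteq> []" "\<forall>l\<in>set S. ty l = d" "lprod (map val S) = \<one>"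
            "U \<noteq> [] \<longrightarrow> ty (last U) \<noteq> d" "U' \<noteq> [] \<longrightarrow> ty (hd U') \<noteq> d"
        | (b) vs where "vs \<noteq> []" "alternating (ty (hd V)) vs" "lprod vs = lprod (map val V)"
        using "1.IH"[rule_format, of V] Vne by blast
      then show ?thesis
      proof cases
        case a
        have "ty (last (R @ U)) \<noteq> d"
        proof (cases "U = []")
          case True
          then have "ty (hd V) = d" using a(1,2,3) by simp
          then show ?thesis using True lastR hdV[OF Vne] by auto
        qed (use a in simp)
        then have "W = (R @ U) @ S @ U' \<and> S \<noteq> [] \<and> (\<forall>l\<in>set S. ty l = d) \<and> lprod (map val S) = \<one> \<and>
            (R @ U \<noteq> [] \<longrightarrow> ty (last (R @ U)) \<noteq> d) \<and> (U' \<noteq> [] \<longrightarrow> ty (hd U') \<noteq> d)"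
          using a WRV by simp
        then show ?thesis by blast
      next
        case b
        then have "lprod (map val R) # vs \<noteq> [] \<and> alternating (ty (hd W)) (lprod (map val R) # vs) \<and>
           lprod (lprod (map val R) # vs) = lprod (map val W)"
          using hdV[OF Vne] inR False pW c_def by simp
        then show ?thesis by blast
      qed
    qed
  qed
qed

lemma rotate_to_boundary:
  assumes "\<not> monochrome ty W"
  shows "\<exists>n. ty (hd (rotate n W)) \<noteq> (ty (last (rotate n W)) :: bool)"
proof (cases "ty (hd W) = ty (last W)")
  case True
  define c where "c = ty (hd W)"
  define U where "U = takeWhile (\<lambda>l. ty l = c) W"
  define V where "V = dropWhile (\<lambda>l. ty l = c) W"
  have W: "W = U @ V" by (simp add: U_def V_def)
  have mono: "\<forall>l\<in>set U. ty l = c" unfolding U_def using set_takeWhileD by fast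
  have "V \<noteq> []" using assms by (force simp: V_def monochrome_def)
  then have hV: "ty (hd V) \<noteq> c" using hd_dropWhile[of "\<lambda>l. ty l = c" W] by (simp add: V_def)
  have "W \<noteq> []" using assms by (auto simp: monochrome_def)
  then have "U \<noteq> []" by (cases W) (auto simp: U_def c_def)
  then have "ty (last U) = c" using mono by simp
  moreover have "rotate (length U) W = V @ U" by (simp add: W rotate_append)
  ultimately have "ty (hd (rotate (length U) W)) \<noteq> ty (last (rotate (length U) W))"
    using \<open>V \<noteq> []\<close> \<open>U \<noteq> []\<close> hV by simp
  then show ?thesis by blast
next
  case False
  then have "ty (hd (rotate 0 W)) \<noteq> ty (last (rotate 0 W))" by simp
  then show ?thesis by blast
qed

text \<open>In a trivial word some maximal run has product \<open>1\<close>, by the normal form theorem. The word is first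
  rotated to begin at a change of factor, so that no run of the cyclic word is cut in two; hence the
  run is surrounded by letters of the other factor also cyclically.\<close>

lemma cyclic_trivial_run:
  assumes "\<not> monochrome ty W" "\<forall>l\<in>set W. val l \<in> fac (ty l)" "lprod (map val W) = \<one>"
  obtains n R V c where "rotate n W = R @ V" "R \<noteq> []" "V \<noteq> []" "\<forall>l\<in>set R. ty l = c"
    "lprod (map val R) = \<one>" "ty (hd V) \<noteq> c" "ty (last V) \<noteq> c"
proof -
  obtain m where m: "ty (hd (rotate m W)) \<noteq> ty (last (rotate m W))"
    using rotate_to_boundary[OF assms(1)] by blast
  define X where "X = rotate m W"
  have sX: "set X = set W" by (simp add: X_def)
  have Xne: "X \<noteq> []" using assms(1) sX by (auto simp: monochrome_def)
  have "set (map val W) \<subseteq> carrier G" using assms(2) fac_closed by auto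
  then have pX: "lprod (map val X) = \<one>"
    using assms(3) by (simp add: X_def rotate_map[symmetric] lprod_rotate)
  have "\<not> (\<exists>vs. vs \<noteq> [] \<and> alternating (ty (hd X)) vs \<and> lprod vs = lprod (map val X))"
    using normal_form pX by auto
  then obtain U R U' c where X: "X = U @ R @ U'" "R \<noteq> []" "\<forall>l\<in>set R. ty l = c" "lprod (map val R) = \<one>"
            "U \<noteq> [] \<longrightarrow> ty (last U) \<noteq> c" "U' \<noteq> [] \<longrightarrow> ty (hd U') \<noteq> c"
    using trivial_run_or_alternating[of X val ty] Xne assms(2)[folded sX] by blast
  have r: "rotate (length U) X = R @ U' @ U" by (simp add: X rotate_append)
  have lR: "ty (last R) = c" "ty (hd R) = c" using X(2,3) by auto
  have ne: "U' @ U \<noteq> []"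
  proof
    assume "U' @ U = []"
    then have "set W = set R" using X(1) sX by simp
    then show False using assms(1) X(3) by (auto simp: monochrome_def)
  qed
  have h: "ty (hd (U' @ U)) \<noteq> c"
  proof (cases "U' = []")
    case True
    then have "hd X = hd U" "last X = last R" using ne X(1,2) by auto
    then show ?thesis using m lR True by (simp add: X_def)
  qed (use X in simp)
  have l: "ty (last (U' @ U)) \<noteq> c"
  proof (cases "U = []")
    case True
    then have "hd X = hd R" "last X = last U'" using ne X(1,2) by auto
    then show ?thesis using m True lR by (simp add: X_def)
  qed (use X in simp)
  show ?thesis
    by (rule that[of "length U + m" R "U' @ U" c]) (use r X(2-4) ne h l in \<open>simp_all add: X_def rotate_rotate\<close>)
qed

end

section \<open>Decomposition of a trivial cyclic word into blocks\<close>

context free_product begin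

text \<open>Delete a trivial run, close up the gap and repeat until only letters of one factor are left.
  The deleted runs are the blocks. Each deletion removes two changes of factor and yields one block,
  which gives the count at the end.

  The condition on \<open>z\<close>, \<open>y\<close>, \<open>c\<close>, \<open>d\<close> is what remains of the planarity of the picture: if \<open>y\<close> follows \<open>z\<close> in
  a block, then the letter \<open>c\<close> before \<open>y\<close> in \<open>W\<close> is followed in a block by the letter \<open>d\<close> after \<open>z\<close> in
  \<open>W\<close>. When \<open>c\<close> and \<open>d\<close> belong to the other factor, the blocks of one factor are thus reflected in
  those of the other.\<close>

lemma block_decomposition:
  assumes "W \<noteq> []" "distinct W" "\<forall>l\<in>set W. val l \<in> fac (ty l)" "lprod (map val W) = \<one>"
  shows "\<exists>Bs. distinct (concat Bs) \<and> set (concat Bs) = set W \<and>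
     (\<forall>B\<in>set Bs. B \<noteq> [] \<and> monochrome ty B \<and> lprod (map val B) = \<one>) \<and>
     (\<forall>z y c d. (z, y) \<in> next_in Bs \<longrightarrow> (c, y) \<in> cyc W \<longrightarrow> (z, d) \<in> cyc W \<longrightarrow> (c, d) \<in> next_in Bs) \<and>
     (\<forall>z y. (z, y) \<in> cyc W \<longrightarrow> ty z = ty y \<longrightarrow> (z, y) \<in> next_in Bs) \<and>
     2 * length Bs = crossings ty W + 2"
  using assms
proof (induction W rule: length_induct)
  case (1 W)
  show ?case
  proof (cases "monochrome ty W")
    case True
    have n: "next_in [W] = cyc W" by (simp add: next_in_def)
    have "filter (\<lambda>(z, y). ty z \<noteq> ty y) (cyclic_pairs W) = []"
      using True cyc_in_set[of _ _ W] unfolding monochrome_def by (simp add: filter_empty_conv case_prod_unfold) (metis prod.collapse)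
    then have c: "crossings ty W = 0" by (simp add: crossings_def)
    show ?thesis
    proof (rule exI[of _ "[W]"], intro conjI allI impI)
      fix z y c d assume "(z, y) \<in> next_in [W]" "(c, y) \<in> cyc W" "(z, d) \<in> cyc W"
      then show "(c, d) \<in> next_in [W]"
        using n cyc_functional cyc_injective "1.prems"(2) by metis
    qed (use True n c "1.prems" in auto)
  next
    case False
    then obtain n R V c where RV: "rotate n W = R @ V" "R \<noteq> []" "V \<noteq> []" "\<forall>l\<in>set R. ty l = c"
      "lprod (map val R) = \<one>" "ty (hd V) \<noteq> c" "ty (last V) \<noteq> c"
      using cyclic_trivial_run[OF False "1.prems"(3,4)] by blast
    have mR: "monochrome ty R" unfolding monochrome_def using RV(4) by blast
    define X where "X = R @ V"
    have X: "cyc X = cyc W" "crossings ty X = crossings ty W" "set X = set W" "distinct X"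
      using "1.prems"(2) by (simp_all add: X_def RV(1)[symmetric])
    have cl: "set (map val X) \<subseteq> carrier G" using "1.prems"(3) fac_closed X(3) by auto
    have "lprod (map val X) = \<one>"
      using "1.prems"(3,4) fac_closed unfolding X_def RV(1)[symmetric]
      by (subst rotate_map[symmetric], subst lprod_rotate) auto
    then have pV: "lprod (map val V) = \<one>" using RV(5) cl by (auto simp: X_def)
    have dV: "distinct V" "distinct R" "set R \<inter> set V = {}" using X(4) by (auto simp: X_def)
    have "length V < length W" by (metis RV(1,2) add_less_same_cancel2 length_append length_greater_0_conv length_rotate less_add_same_cancel2)
    moreover have "\<forall>l\<in>set V. val l \<in> fac (ty l)" using "1.prems"(3) X(3) by (auto simp: X_def)
    ultimately obtain Bs where Bs: "distinct (concat Bs)" "set (concat Bs) = set V"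
      "\<forall>B\<in>set Bs. B \<noteq> [] \<and> monochrome ty B \<and> lprod (map val B) = \<one>"
      "\<And>z y c d. (z, y) \<in> next_in Bs \<Longrightarrow> (c, y) \<in> cyc V \<Longrightarrow> (z, d) \<in> cyc V \<Longrightarrow> (c, d) \<in> next_in Bs"
      "\<And>z y. (z, y) \<in> cyc V \<Longrightarrow> ty z = ty y \<Longrightarrow> (z, y) \<in> next_in Bs"
      "2 * length Bs = crossings ty V + 2"
      using "1.IH"[rule_format, of V] RV(3) dV(1) pV by blast
    have n: "next_in (R # Bs) = cyc R \<union> next_in Bs" by (simp add: next_in_def)
    have cX: "cyc X = set (adjacent_pairs R) \<union> {(last R, hd V)} \<union> set (adjacent_pairs V) \<union> {(last V, hd R)}"
      using RV(2,3) by (auto simp: X_def cyclic_pairs_append)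
    have cR: "cyc R = set (adjacent_pairs R) \<union> {(last R, hd R)}"
      and cV: "cyc V = set (adjacent_pairs V) \<union> {(last V, hd V)}"
      using RV(2,3) by (auto simp: cyclic_pairs_def)
    have hdtl: "ty (hd V) = ty (last V)" using RV(6,7) by auto
    have lVhV: "(last V, hd V) \<in> next_in Bs" using Bs(5)[of "last V" "hd V"] hdtl cV by auto
    have inR: "last R \<in> set R" "hd R \<in> set R" and inV: "last V \<in> set V" "hd V \<in> set V"
      using RV(2,3) by auto
    have apR: "z \<in> set R \<and> y \<in> set R" if "(z, y) \<in> set (adjacent_pairs R)" for z y
      using that cR cyc_in_set[of z y R] by auto
    have apV: "z \<in> set V \<and> y \<in> set V" if "(z, y) \<in> set (adjacent_pairs V)" for z y
      using that cV cyc_in_set[of z y V] by auto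
    have nV: "z \<in> set V \<and> y \<in> set V" if "(z, y) \<in> next_in Bs" for z y
      using that next_in_set Bs(2) by metis
    \<comment> \<open>Compared with \<open>V\<close>, the two ends of \<open>R\<close> are the critical places; there the condition pairs the step
      from the last letter of \<open>R\<close> to its first with the step of the blocks of \<open>V\<close> across the gap.\<close>
    have K: "(e, d) \<in> next_in (R # Bs)" if zy: "(z, y) \<in> next_in (R # Bs)" and ey: "(e, y) \<in> cyc X"
      and zd: "(z, d) \<in> cyc X" for z y e d
    proof (cases "(z, y) \<in> cyc R")
      case True
      show ?thesis
      proof (cases "(z, y) \<in> set (adjacent_pairs R)")
        case True
        then have "(z, y) \<in> cyc X" using cX by auto
        then have "e = z" "d = y" using ey zd cyc_injective cyc_functional X(4) by metis+
        then show ?thesis using n \<open>(z, y) \<in> cyc R\<close> by auto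
      next
        case False
        then have zy: "z = last R" "y = hd R" using True cR by auto
        have "(last V, hd R) \<in> cyc X" "(last R, hd V) \<in> cyc X" using cX by auto
        then have "e = last V" "d = hd V" using ey zd zy cyc_injective cyc_functional X(4) by metis+
        then show ?thesis using n lVhV by auto
      qed
    next
      case False
      then have zyB: "(z, y) \<in> next_in Bs" using zy n by auto
      show ?thesis
      proof (cases "z = last V")
        case True
        then have yV: "y = hd V" using zyB lVhV next_in_functional Bs(1) by metis
        have "(last V, hd R) \<in> cyc X" "(last R, hd V) \<in> cyc X" using cX by auto
        then have "d = hd R" "e = last R" using ey zd True yV cyc_injective cyc_functional X(4) by metis+
        then show ?thesis using n cR by auto
      next
        case zl: False
        have yh: "y \<noteq> hd V" using zl zyB lVhV next_in_injective Bs(1) by metis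
        have zyV: "z \<in> set V" "y \<in> set V" using nV zyB by auto
        have "(z, d) \<in> set (adjacent_pairs V)"
          using zd cX zl zyV(1) dV(3) apR inR by blast
        moreover have "(e, y) \<in> set (adjacent_pairs V)"
          using ey cX yh zyV(2) dV(3) apR inR by blast
        ultimately show ?thesis using Bs(4)[OF zyB] cV n by blast
      qed
    qed
    have T: "(z, y) \<in> next_in (R # Bs)" if zy: "(z, y) \<in> cyc X" "ty z = ty y" for z y
    proof -
      have "ty (last R) = c" "ty (hd R) = c" using RV(4) inR by auto
      then consider "(z, y) \<in> set (adjacent_pairs R)" | "(z, y) \<in> set (adjacent_pairs V)"
        using zy cX RV(6,7) by (metis Un_iff insertE empty_iff prod.inject)
      then show ?thesis using n cR cV Bs(5) zy(2) by cases auto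
    qed
    have tR: "ty (last R) = c" "ty (hd R) = c" using RV(4) inR by auto
    have "filter (\<lambda>(z, y). ty z \<noteq> ty y) (adjacent_pairs R) = []"
      using apR RV(4) by (fastforce simp: filter_empty_conv)
    then have "crossings ty X = crossings ty V + 2"
      using RV(2,3,6,7) tR hdtl
      by (simp add: crossings_def X_def cyclic_pairs_append[OF RV(2,3)] cyclic_pairs_def[of V])
    then have len: "2 * length (R # Bs) = crossings ty W + 2" using Bs(6) X(2) by simp
    show ?thesis
    proof (rule exI[of _ "R # Bs"], intro conjI)
      show "distinct (concat (R # Bs))" using Bs(1,2) dV by auto
      show "set (concat (R # Bs)) = set W" using Bs(2) X(3) by (auto simp: X_def)
      show "\<forall>B\<in>set (R # Bs). B \<noteq> [] \<and> monochrome ty B \<and> lprod (map val B) = \<one>"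
        using Bs(3) RV(2,5) mR by simp
      show "\<forall>z y c d. (z, y) \<in> next_in (R # Bs) \<longrightarrow> (c, y) \<in> cyc W \<longrightarrow> (z, d) \<in> cyc W \<longrightarrow> (c, d) \<in> next_in (R # Bs)"
        using K X(1) by blast
      show "\<forall>z y. (z, y) \<in> cyc W \<longrightarrow> ty z = ty y \<longrightarrow> (z, y) \<in> next_in (R # Bs)" using T X(1) by blast
      show "2 * length (R # Bs) = crossings ty W + 2" by (rule len)
    qed
  qed
qed

end

section \<open>Cancelling inverse pairs of letters\<close>

text \<open>The successor relation after the letters in \<open>R\<close> have been cancelled against their inverses: a walk
  along \<open>N\<close> that meets a cancelled letter \<open>d\<close> continues right after the inverse letter \<open>mu d\<close>.\<close>

inductive chain :: "('l \<times> 'l) set \<Rightarrow> 'l set \<Rightarrow> ('l \<Rightarrow> 'l) \<Rightarrow> 'l \<Rightarrow> 'l \<Rightarrow> bool"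
  for N R mu where
  base: "(l, t) \<in> N \<Longrightarrow> chain N R mu l t"
| step: "(l, d) \<in> N \<Longrightarrow> d \<in> R \<Longrightarrow> chain N R mu (mu d) t \<Longrightarrow> chain N R mu l t"

lemma chain2: "(l, d) \<in> N \<Longrightarrow> d \<in> R \<Longrightarrow> (mu d, t) \<in> N \<Longrightarrow> chain N R mu l t"
  by (auto intro: chain.intros)

lemma chain_append: "chain N R mu l d \<Longrightarrow> d \<in> R \<Longrightarrow> chain N R mu (mu d) t \<Longrightarrow> chain N R mu l t"
  by (induction rule: chain.induct) (auto intro: chain.intros)

lemma chain_mono: "chain N R mu l t \<Longrightarrow> R \<subseteq> R' \<Longrightarrow> chain N R' mu l t"
  by (induction rule: chain.induct) (auto intro: chain.intros)

lemma chain_compose: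
  assumes "chain N' R' mu l t" and "\<And>l t. (l, t) \<in> N' \<Longrightarrow> chain N R mu l t"
  shows "chain N (R \<union> R') mu l t"
  using assms(1)
proof (induction rule: chain.induct)
  case (base l t)
  then show ?case using assms(2) chain_mono[of N R mu l t "R \<union> R'"] by simp
next
  case (step l d t)
  have "chain N (R \<union> R') mu l d" using assms(2) step(1) chain_mono[of N R mu l d "R \<union> R'"] by simp
  then show ?case using step by (auto intro: chain_append)
qed

lemma chain_deterministic:
  assumes "chain N R mu l t" and "chain N R mu l t'" and "t \<notin> R" "t' \<notin> R"
    and f: "\<And>z y y'. (z, y) \<in> N \<Longrightarrow> (z, y') \<in> N \<Longrightarrow> y = y'"
  shows "t = t'"
  using assms(1-4)
proof (induction rule: chain.induct)
  case (base l t)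
  from base(2) show ?case
  proof (cases rule: chain.cases)
    case (step d')
    then have "d' = t" using f base.hyps by metis
    then show ?thesis using step(2) base(3) by simp
  qed (metis f base.hyps)
next
  case (step l d t)
  from step.prems(1) show ?case
  proof (cases rule: chain.cases)
    case base
    then have "d = t'" by (metis f step.hyps(1))
    then show ?thesis using step.hyps(2) step.prems(3) by simp
  next
    case (step d')
    then have "d' = d" by (metis f local.step.hyps(1))
    then show ?thesis using step(3) local.step.IH local.step.prems by simp
  qed
qed

lemma rotate_to_front:
  assumes "x \<in> set C"
  obtains n u where "rotate n C = x # u"
proof -
  obtain p q where "C = p @ x # q" using assms by (meson split_list)
  then have "rotate (length p) C = x # q @ p" by (simp add: rotate_append)
  then show ?thesis using that by blast
qed

lemma next_in_Cons: "next_in (C # Cs) = cyc C \<union> next_in Cs"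
  by (simp add: next_in_def)

lemma next_in_insert: "next_in (us @ C # vs) = cyc C \<union> next_in (us @ vs)"
  by (auto simp: next_in_def)

lemma monochrome_subset: "monochrome ty W \<Longrightarrow> set V \<subseteq> set W \<Longrightarrow> monochrome ty V"
  by (auto simp: monochrome_def)

lemma monochrome_append:
  "monochrome ty (x # u) \<Longrightarrow> monochrome ty (y # v) \<Longrightarrow> ty x = ty y \<Longrightarrow> monochrome ty (u @ v)"
  unfolding monochrome_def by (metis Un_iff list.set_intros(1,2) set_append)

context group begin

definition trivial_cycle :: "('l \<Rightarrow> 'a) \<Rightarrow> 'l list \<Rightarrow> bool" where
  "trivial_cycle val C \<longleftrightarrow> C \<noteq> [] \<and> lprod (map val C) = \<one>"

lemma trivial_cycle_rotate:
  assumes "\<And>l. val l \<in> carrier G"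
  shows "trivial_cycle val (rotate n C) \<longleftrightarrow> trivial_cycle val C"
  using assms unfolding trivial_cycle_def
  by (subst rotate_map[symmetric], subst lprod_rotate) auto

text \<open>Cancelling \<open>x\<close> against its inverse \<open>y\<close> cuts their cycle in two if they lie on the same cycle, and
  joins their cycles otherwise. Two cycles with trivial product are joined to a cycle with trivial
  product, so in either case at most one trivial cycle is lost. The joined cycle is nonempty since
  \<open>x\<close> has nontrivial value.\<close>

lemma glue_step:
  assumes d: "distinct (concat Cs)" and x: "x \<in> set (concat Cs)" and y: "y \<in> set (concat Cs)" and "x \<noteq> y"
    and val: "\<And>l. val l \<in> carrier G" and vy: "val y = inv (val x)" and vx: "val x \<noteq> \<one>"
    and mu: "mu x = y" "mu y = x" and ty: "ty x = ty y" and mono: "\<forall>C\<in>set Cs. monochrome ty C"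
  obtains Cs' where "distinct (concat Cs')" "set (concat Cs') = set (concat Cs) - {x, y}"
    "\<forall>C\<in>set Cs'. monochrome ty C"
    "\<And>l t. (l, t) \<in> next_in Cs' \<Longrightarrow> chain (next_in Cs) {x, y} mu l t"
    "length (filter (trivial_cycle val) Cs) \<le> length (filter (trivial_cycle val) Cs') + 1"
proof -
  obtain us C vs where Cs: "Cs = us @ C # vs" "x \<in> set C" using x by (metis set_concat UN_iff split_list)
  obtain n u where u: "rotate n C = x # u" using rotate_to_front[OF Cs(2)] .
  have sC: "set C = insert x (set u)" using u by (metis list.simps(15) set_rotate)
  have dC: "distinct (x # u)" using d Cs u by (metis distinct_append distinct_rotate concat_append concat.simps(2))
  have cC: "cyc C = cyc (x # u)" using u cyc_rotate by metis
  have mC: "monochrome ty (x # u)" using monochrome_subset[of ty C "x # u"] mono Cs sC by simp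
  define rest where "rest = us @ vs"
  have N: "next_in Cs = cyc (x # u) \<union> next_in rest" using Cs cC by (simp add: next_in_insert rest_def)
  have tC: "trivial_cycle val C = trivial_cycle val (x # u)" using trivial_cycle_rotate[of val n C] val u by simp
  have dr: "distinct (concat rest)" "set (concat rest) \<inter> insert x (set u) = {}"
    using d Cs sC by (auto simp: rest_def)
  have sCs: "set (concat Cs) = insert x (set u) \<union> set (concat rest)" using Cs sC by (auto simp: rest_def)
  have lC: "length (filter (trivial_cycle val) Cs)
      = (if trivial_cycle val (x # u) then 1 else 0) + length (filter (trivial_cycle val) rest)"
    using tC by (simp add: Cs rest_def)
  have mrest: "\<forall>C\<in>set rest. monochrome ty C" using mono Cs by (auto simp: rest_def)
  have lift: "chain (next_in Cs) {x, y} mu l t" if "(l, t) \<in> next_in rest" for l t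
    using that N by (auto intro: chain.base)
  show ?thesis
  proof (cases "y \<in> set u")
    case True
    then obtain v w where vw: "u = v @ y # w" by (meson split_list)
    have N1: "cyc (x # u) = set (adjacent_pairs (x # v)) \<union> {(last (x # v), y)} \<union> set (adjacent_pairs (y # w)) \<union> {(last (y # w), x)}"
      using cyclic_pairs_append[of "x # v" "y # w"] by (auto simp: vw)
    show ?thesis
    proof (rule that[of "v # w # rest"])
      show "distinct (concat (v # w # rest))" using dC dr by (auto simp: vw)
      show "set (concat (v # w # rest)) = set (concat Cs) - {x, y}"
        using sCs dC dr by (auto simp: vw)
      show "\<forall>C\<in>set (v # w # rest). monochrome ty C"
        using mrest monochrome_subset[OF mC, of v] monochrome_subset[OF mC, of w] by (auto simp: vw)
      show "length (filter (trivial_cycle val) Cs) \<le> length (filter (trivial_cycle val) (v # w # rest)) + 1"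
        using lC by auto
      fix l t assume "(l, t) \<in> next_in (v # w # rest)"
      then consider "(l, t) \<in> cyc v" | "(l, t) \<in> cyc w" | "(l, t) \<in> next_in rest"
        by (auto simp: next_in_Cons)
      then show "chain (next_in Cs) {x, y} mu l t"
      proof cases
        case 1
        then have "v \<noteq> []" by auto
        then have a: "set (adjacent_pairs v) \<subseteq> next_in Cs" "(x, hd v) \<in> next_in Cs" "(last v, y) \<in> next_in Cs"
          using N N1 by (auto simp: adjacent_pairs_Cons)
        from 1 consider "(l, t) \<in> set (adjacent_pairs v)" | "l = last v" "t = hd v"
          by (auto simp: cyclic_pairs_def split: if_splits)
        then show ?thesis
        proof cases
          case 2
          show ?thesis by (rule chain2[of _ y]) (use a mu 2 in simp_all)
        qed (use a in \<open>auto intro: chain.base\<close>)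
      next
        case 2
        then have "w \<noteq> []" by auto
        then have a: "set (adjacent_pairs w) \<subseteq> next_in Cs" "(y, hd w) \<in> next_in Cs" "(last w, x) \<in> next_in Cs"
          using N N1 by (auto simp: adjacent_pairs_Cons)
        from 2 consider "(l, t) \<in> set (adjacent_pairs w)" | "l = last w" "t = hd w"
          by (auto simp: cyclic_pairs_def split: if_splits)
        then show ?thesis
        proof cases
          case 2
          show ?thesis by (rule chain2[of _ x]) (use a mu 2 in simp_all)
        qed (use a in \<open>auto intro: chain.base\<close>)
      qed (rule lift)
    qed
  next
    case False
    then have yr: "y \<in> set (concat rest)" using y sCs \<open>x \<noteq> y\<close> by auto
    then obtain us' D vs' where D: "rest = us' @ D # vs'" "y \<in> set D" by (metis set_concat UN_iff split_list)
    obtain m v where v: "rotate m D = y # v" using rotate_to_front[OF D(2)] .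
    have sD: "set D = insert y (set v)" using v by (metis list.simps(15) set_rotate)
    have dD: "distinct (y # v)" using dr(1) D v by (metis distinct_append distinct_rotate concat_append concat.simps(2))
    have cD: "cyc D = cyc (y # v)" using v cyc_rotate by metis
    have mD: "monochrome ty (y # v)" using monochrome_subset[of ty D "y # v"] mrest D sD by simp
    define rest' where "rest' = us' @ vs'"
    have N': "next_in rest = cyc (y # v) \<union> next_in rest'" using D cD by (simp add: next_in_insert rest'_def)
    have tD: "trivial_cycle val D = trivial_cycle val (y # v)" using trivial_cycle_rotate[of val m D] val v by simp
    have dr': "distinct (concat rest')" "set (concat rest') \<inter> insert y (set v) = {}"
      using dr(1) D sD by (auto simp: rest'_def)
    have sr: "set (concat rest) = insert y (set v) \<union> set (concat rest')" using D sD by (auto simp: rest'_def)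
    have lD: "length (filter (trivial_cycle val) rest)
        = (if trivial_cycle val (y # v) then 1 else 0) + length (filter (trivial_cycle val) rest')"
      using tD by (simp add: D rest'_def)
    have both: "trivial_cycle val (u @ v)" if "trivial_cycle val (x # u)" "trivial_cycle val (y # v)"
    proof -
      have c: "lprod (map val u) \<in> carrier G" "lprod (map val v) \<in> carrier G"
        using val by (auto intro!: lprod_closed)
      have 1: "val x \<otimes> lprod (map val u) = \<one>" "inv (val x) \<otimes> lprod (map val v) = \<one>"
        using that vy by (auto simp: trivial_cycle_def)
      have "lprod (map val u) = inv (val x)" using 1(1) c val by (metis inv_comm inv_equality)
      moreover have "lprod (map val v) = val x" using 1(2) c val
        by (metis inv_closed inv_comm inv_equality inv_inv)
      moreover have "u \<noteq> []" using 1(1) vx val by auto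
      moreover have "lprod (map val (u @ v)) = lprod (map val u) \<otimes> lprod (map val v)"
        unfolding map_append using val by (intro lprod_append) auto
      ultimately show ?thesis using val by (simp add: trivial_cycle_def)
    qed
    have Nx: "u = [] \<Longrightarrow> (x, x) \<in> next_in Cs"
      "u \<noteq> [] \<Longrightarrow> (x, hd u) \<in> next_in Cs \<and> (last u, x) \<in> next_in Cs \<and> set (adjacent_pairs u) \<subseteq> next_in Cs"
      using N by (auto simp: cyclic_pairs_def adjacent_pairs_Cons)
    have Ny: "v = [] \<Longrightarrow> (y, y) \<in> next_in Cs"
      "v \<noteq> [] \<Longrightarrow> (y, hd v) \<in> next_in Cs \<and> (last v, y) \<in> next_in Cs \<and> set (adjacent_pairs v) \<subseteq> next_in Cs"
      using N N' by (auto simp: cyclic_pairs_def adjacent_pairs_Cons)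
    show ?thesis
    proof (rule that[of "(u @ v) # rest'"])
      show "distinct (concat ((u @ v) # rest'))"
        using dC dr dr' dD sr by auto
      show "set (concat ((u @ v) # rest')) = set (concat Cs) - {x, y}"
        using sCs sr dC dD dr dr' False by auto
      show "\<forall>C\<in>set ((u @ v) # rest'). monochrome ty C"
        using mrest D monochrome_append[OF mC mD ty] by (auto simp: rest'_def)
      show "length (filter (trivial_cycle val) Cs) \<le> length (filter (trivial_cycle val) ((u @ v) # rest')) + 1"
        using lC lD both by auto
      fix l t assume "(l, t) \<in> next_in ((u @ v) # rest')"
      then consider "(l, t) \<in> cyc (u @ v)" | "(l, t) \<in> next_in rest'" by (auto simp: next_in_Cons)
      then show "chain (next_in Cs) {x, y} mu l t"
      proof cases
        case 1
        show ?thesis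
        proof (cases "u = []")
          case ue: True
          then have ve: "v \<noteq> []" using 1 by auto
          from 1 ue ve consider "(l, t) \<in> set (adjacent_pairs v)" | "l = last v" "t = hd v"
            by (auto simp: cyclic_pairs_def)
          then show ?thesis
          proof cases
            case 2
            have c3: "chain (next_in Cs) {x, y} mu x (hd v)"
              by (rule chain2[of _ x]) (use Nx(1)[OF ue] Ny(2)[OF ve] mu in simp_all)
            show ?thesis by (rule chain.step[of _ y]) (use 2 Ny(2)[OF ve] mu c3 in simp_all)
          qed (use Ny(2)[OF ve] in \<open>auto intro: chain.base\<close>)
        next
          case une: False
          show ?thesis
          proof (cases "v = []")
            case ve: True
            from 1 une ve consider "(l, t) \<in> set (adjacent_pairs u)" | "l = last u" "t = hd u"
              by (auto simp: cyclic_pairs_def)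
            then show ?thesis
            proof cases
              case 2
              have c3: "chain (next_in Cs) {x, y} mu y (hd u)"
                by (rule chain2[of _ y]) (use Ny(1)[OF ve] Nx(2)[OF une] mu in simp_all)
              show ?thesis by (rule chain.step[of _ x]) (use 2 Nx(2)[OF une] mu c3 in simp_all)
            qed (use Nx(2)[OF une] in \<open>auto intro: chain.base\<close>)
          next
            case vne: False
            from 1 consider "(l, t) \<in> set (adjacent_pairs u) \<union> set (adjacent_pairs v)"
              | "l = last u" "t = hd v" | "l = last v" "t = hd u"
              using cyclic_pairs_append[OF une vne] by auto
            then show ?thesis
            proof cases
              case 1
              then show ?thesis using Nx(2)[OF une] Ny(2)[OF vne] by (auto intro: chain.base)
            next
              case 2
              show ?thesis
                by (rule chain2[of _ x]) (use 2 Nx(2)[OF une] Ny(2)[OF vne] mu in simp_all)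
            next
              case 3
              show ?thesis
                by (rule chain2[of _ y]) (use 3 Nx(2)[OF une] Ny(2)[OF vne] mu in simp_all)
            qed
          qed
        qed
      next
        case 2
        then show ?thesis using N' by (intro lift) auto
      qed
    qed
  qed
qed

lemma glue_all:
  assumes "distinct (concat Bs)" "\<And>l. val l \<in> carrier G" "\<forall>B\<in>set Bs. monochrome ty B"
    and "distinct ts" "set ts \<union> mu ` set ts \<subseteq> set (concat Bs)" "inj_on mu (set ts)"
    and "\<And>t. t \<in> set ts \<Longrightarrow> mu t \<notin> set ts \<and> mu (mu t) = t \<and> ty (mu t) = ty t \<and>
           val (mu t) = inv (val t) \<and> val t \<noteq> \<one>"
  shows "\<exists>Cs. distinct (concat Cs) \<and> set (concat Cs) = set (concat Bs) - (set ts \<union> mu ` set ts) \<and>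
    (\<forall>C\<in>set Cs. monochrome ty C) \<and>
    (\<forall>l t. (l, t) \<in> next_in Cs \<longrightarrow> chain (next_in Bs) (set ts \<union> mu ` set ts) mu l t) \<and>
    length (filter (trivial_cycle val) Bs) \<le> length (filter (trivial_cycle val) Cs) + length ts"
  using assms(4-7)
proof (induction ts)
  case Nil
  then show ?case using assms(1,3) by (intro exI[of _ Bs]) (auto intro: chain.base)
next
  case (Cons x ts)
  have "distinct ts" "set ts \<union> mu ` set ts \<subseteq> set (concat Bs)" "inj_on mu (set ts)"
    using Cons.prems by auto
  moreover have "mu t \<notin> set ts \<and> mu (mu t) = t \<and> ty (mu t) = ty t \<and> val (mu t) = inv (val t) \<and> val t \<noteq> \<one>"
    if "t \<in> set ts" for t using Cons.prems(4)[of t] that by auto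
  ultimately obtain Cs where Cs: "distinct (concat Cs)"
    "set (concat Cs) = set (concat Bs) - (set ts \<union> mu ` set ts)" "\<forall>C\<in>set Cs. monochrome ty C"
    "\<And>l t. (l, t) \<in> next_in Cs \<Longrightarrow> chain (next_in Bs) (set ts \<union> mu ` set ts) mu l t"
    "length (filter (trivial_cycle val) Bs) \<le> length (filter (trivial_cycle val) Cs) + length ts"
    using Cons.IH by blast
  have p: "mu x \<notin> set (x # ts) \<and> mu (mu x) = x \<and> ty (mu x) = ty x \<and> val (mu x) = inv (val x) \<and> val x \<noteq> \<one>"
    using Cons.prems(4)[of x] by simp
  have p3: "val (mu x) = inv (val x) \<and> val x \<noteq> \<one>" and p1: "mu (mu x) = x" "ty (mu x) = ty x" using p by auto
  have xm: "x \<notin> mu ` set ts"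
  proof
    assume "x \<in> mu ` set ts"
    then obtain t where "t \<in> set ts" "x = mu t" by auto
    then show False using Cons.prems(4)[of t] by auto
  qed
  have mx: "mu x \<notin> mu ` set ts" using Cons.prems(1,3) by (auto simp: inj_on_def)
  have m: "x \<in> set (concat Cs)" "mu x \<in> set (concat Cs)" "x \<noteq> mu x"
    using Cs(2) Cons.prems(1,2) p xm mx by auto
  obtain Cs' where Cs': "distinct (concat Cs')" "set (concat Cs') = set (concat Cs) - {x, mu x}"
    "\<forall>C\<in>set Cs'. monochrome ty C"
    "\<And>l t. (l, t) \<in> next_in Cs' \<Longrightarrow> chain (next_in Cs) {x, mu x} mu l t"
    "length (filter (trivial_cycle val) Cs) \<le> length (filter (trivial_cycle val) Cs') + 1"
    using glue_step[OF Cs(1) m(1,2,3) assms(2) conjunct1[OF p3] conjunct2[OF p3] refl p1(1) p1(2)[symmetric] Cs(3)] by blast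
  have R: "set ts \<union> mu ` set ts \<union> {x, mu x} = set (x # ts) \<union> mu ` set (x # ts)" by auto
  have ch: "chain (next_in Bs) (set (x # ts) \<union> mu ` set (x # ts)) mu l t" if "(l, t) \<in> next_in Cs'" for l t
    using chain_compose[OF Cs'(4)[OF that] Cs(4)] unfolding R .
  show ?case
  proof (intro exI[of _ Cs'] conjI allI impI)
    show "set (concat Cs') = set (concat Bs) - (set (x # ts) \<union> mu ` set (x # ts))"
      unfolding Cs'(2) Cs(2) R[symmetric] by blast
    show "length (filter (trivial_cycle val) Bs) \<le> length (filter (trivial_cycle val) Cs') + length (x # ts)"
      using Cs'(5) Cs(5) by simp
  qed (fact Cs'(1) Cs'(3) ch)+
qed

end

section \<open>Changes of factor and ascents\<close>

lemma adjacent_pairs_append_subset: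
  "set (adjacent_pairs u) \<union> set (adjacent_pairs v) \<subseteq> set (adjacent_pairs (u @ v))"
  by (cases "u = []"; cases "v = []") (auto simp: adjacent_pairs_append)

lemma adjacent_pairs_concat:
  "B \<in> set Bs \<Longrightarrow> set (adjacent_pairs B) \<subseteq> set (adjacent_pairs (concat Bs))"
  by (induction Bs) (use adjacent_pairs_append_subset in fastforce)+

lemma adjacent_pairs_cyc: "set (adjacent_pairs W) \<subseteq> cyc W"
  by (auto simp: cyclic_pairs_def)

lemma successor_of_last:
  assumes "distinct (concat Bs)" "\<forall>B\<in>set Bs. B \<noteq> []" "B \<in> set Bs" "(last B, t) \<in> cyc (concat Bs)"
  shows "\<exists>B'\<in>set Bs. t = hd B'"
proof -
  obtain us vs where Bs: "Bs = us @ B # vs" using assms(3) by (meson split_list)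
  define D where "D = concat (vs @ us)"
  have r: "rotate (length (concat us)) (concat Bs) = B @ D"
    by (simp add: Bs D_def rotate_append)
  have Bne: "B \<noteq> []" using assms by auto
  have c: "cyc (concat Bs) = cyc (B @ D)" by (metis r cyc_rotate)
  show ?thesis
  proof (cases "vs @ us")
    case Nil
    then have "(last B, hd B) \<in> cyc (concat Bs)" using c Bne by (simp add: D_def cyclic_pairs_def)
    then have "t = hd B" using cyc_functional assms(1,4) by metis
    then show ?thesis using assms(3) by blast
  next
    case (Cons C Cs)
    then have C: "C \<in> set Bs" "C \<noteq> []" using assms(2) unfolding Bs
      by (metis Un_iff list.set_intros set_append UnCI set_ConsD)+
    have "D \<noteq> []" "hd D = hd C" using Cons C(2) by (auto simp: D_def)
    then have "(last B, hd C) \<in> cyc (concat Bs)" using c cyclic_pairs_append[OF Bne, of D] by auto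
    then have "t = hd C" using cyc_functional assms(1,4) by metis
    then show ?thesis using C by blast
  qed
qed

definition adjacent_crossings :: "('l \<Rightarrow> bool) \<Rightarrow> 'l list \<Rightarrow> nat" where
  "adjacent_crossings ty W = length (filter (\<lambda>(z, y). ty z \<noteq> ty y) (adjacent_pairs W))"

lemma adjacent_crossings_le: "adjacent_crossings ty W \<le> crossings ty W"
  by (simp add: adjacent_crossings_def crossings_def cyclic_pairs_def)

lemma adjacent_crossings_append:
  assumes "u \<noteq> []" "v \<noteq> []"
  shows "adjacent_crossings ty (u @ v) = adjacent_crossings ty u + adjacent_crossings ty v
     + (if ty (last u) \<noteq> ty (hd v) then 1 else 0)"
  using assms by (simp add: adjacent_crossings_def adjacent_pairs_append)

lemma adjacent_crossings_concat:
  "(\<Sum>B\<leftarrow>Bs. adjacent_crossings ty B) \<le> adjacent_crossings ty (concat Bs)"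
proof (induction Bs)
  case (Cons B Bs)
  have "adjacent_crossings ty B + adjacent_crossings ty (concat Bs) \<le> adjacent_crossings ty (B @ concat Bs)"
  proof (cases "B = [] \<or> concat Bs = []")
    case True
    then show ?thesis by (elim disjE; simp only: append_Nil append_Nil2) (simp_all add: adjacent_crossings_def)
  next
    case False
    then show ?thesis using adjacent_crossings_append[of B "concat Bs" ty] by linarith
  qed
  then show ?case using Cons by simp
qed simp

lemma adjacent_crossings_upt:
  assumes "\<And>i. ty (f i) = even (i::nat)"
  shows "adjacent_crossings ty (map f [0..<m]) = m - 1"
proof (induction m)
  case (Suc m)
  show ?case
  proof (cases "m = 0")
    case False
    have "adjacent_crossings ty (map f [0..<m] @ [f m]) = adjacent_crossings ty (map f [0..<m])
      + adjacent_crossings ty [f m] + 1"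
      using False assms by (subst adjacent_crossings_append) (auto simp: last_map)
    then show ?thesis using Suc False by (simp add: adjacent_crossings_def)
  qed (simp add: adjacent_crossings_def)
qed (simp add: adjacent_crossings_def)

lemma adjacent_crossings_rev: "adjacent_crossings ty (rev W) = adjacent_crossings ty W"
proof (induction W)
  case (Cons x W)
  show ?case
  proof (cases "W = []")
    case False
    then show ?thesis
      using adjacent_crossings_append[of "rev W" "[x]" ty] adjacent_crossings_append[of "[x]" W ty] Cons
      by (auto simp: last_rev)
  qed simp
qed simp

text \<open>A cycle that never ascends cannot have descended, since it returns to its starting point.\<close>

lemma descending_cycle_constant:
  fixes idx :: "'l \<Rightarrow> nat"
  assumes "\<forall>(z, y)\<in>cyc C. idx y \<le> idx z" "z \<in> set C"
  shows "idx z = idx (hd C)"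
proof -
  have a: "idx (last D) \<le> idx z \<and> idx z \<le> idx (hd D)"
    if "\<forall>(z, y)\<in>set (adjacent_pairs D). idx y \<le> idx z" "z \<in> set D" for D z
    using that
  proof (induction D arbitrary: z)
    case (Cons x D)
    show ?case
    proof (cases "D = []")
      case False
      then have ap: "adjacent_pairs (x # D) = (x, hd D) # adjacent_pairs D" by (rule adjacent_pairs_Cons)
      then have h: "idx (hd D) \<le> idx x" using Cons.prems(1) by simp
      have IH: "idx (last D) \<le> idx z' \<and> idx z' \<le> idx (hd D)" if "z' \<in> set D" for z'
        using Cons.IH[of z'] Cons.prems(1) that unfolding ap by simp
      have "idx (last D) \<le> idx (hd D)" using IH[of "hd D"] False by simp
      moreover have "z = x \<or> z \<in> set D" using Cons.prems(2) by auto
      ultimately show ?thesis using h IH[of z] False by auto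
    qed (use Cons in auto)
  qed simp
  have Cne: "C \<noteq> []" using assms by auto
  have "\<forall>(z, y)\<in>set (adjacent_pairs C). idx y \<le> idx z" using assms(1) adjacent_pairs_cyc by blast
  then have "idx (last C) \<le> idx z" "idx z \<le> idx (hd C)" using a[of C z] assms(2) by auto
  moreover have "idx (hd C) \<le> idx (last C)" using assms(1) Cne by (auto simp: cyclic_pairs_def)
  ultimately show ?thesis by simp
qed

lemma chain_type:
  assumes "chain N R mu l t" "\<And>z y. (z, y) \<in> N \<Longrightarrow> ty z = ty y" "\<And>l. ty (mu l) = ty l"
  shows "ty l = (ty t :: bool)"
  using assms(1) by (induction rule: chain.induct) (use assms(2,3) in metis)+

text \<open>The reflection property of the blocks survives the cancellation. The chain \<open>s \<rightarrow> t\<close> runs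
  through letters of the first factor; its mirror image runs through their neighbours in the second
  factor in the opposite direction, from the letter before \<open>t\<close> to the letter after \<open>s\<close>. The assumption
  \<open>mirror\<close> says that a letter of the second factor which follows a cancelled letter of the first factor
  is cancelled as well, and that the two inverses occur in the opposite order. It reflects the fact
  that a conjugator and its inverse are read in opposite directions.\<close>

lemma chain_duality:
  assumes "chain N R mu s t" "ty s" "(c, t) \<in> cyc W" "\<not> ty c" "(s, d) \<in> cyc W"
    and K: "\<And>z y c d. (z, y) \<in> N \<Longrightarrow> (c, y) \<in> cyc W \<Longrightarrow> (z, d) \<in> cyc W \<Longrightarrow> (c, d) \<in> N"
    and tyN: "\<And>z y. (z, y) \<in> N \<Longrightarrow> ty z = ty y" and tymu: "\<And>l. ty (mu l) = ty l"
    and R: "\<And>l. l \<in> R \<Longrightarrow> mu (mu l) = l \<and> mu l \<in> R \<and> l \<in> set W"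
    and mirror: "\<And>z d. z \<in> R \<Longrightarrow> (z, d) \<in> cyc W \<Longrightarrow> ty z \<Longrightarrow> \<not> ty d \<Longrightarrow> d \<in> R \<and> (mu d, mu z) \<in> cyc W"
  shows "chain N R mu c d"
  using assms(1-5)
proof (induction arbitrary: d rule: chain.induct)
  case (base s t)
  then have "(c, d) \<in> N" using K by blast
  then show ?case by (rule chain.base)
next
  case (step s y t)
  have y: "mu (mu y) = y" "mu y \<in> R" "mu y \<in> set W" using R step.hyps(2) by blast+
  obtain d' where d': "(mu y, d') \<in> cyc W" using cyc_successor_exists[OF y(3)] by blast
  have tyy: "ty (mu y)" using tyN[OF step.hyps(1)] tymu step.prems(1) by metis
  have ch: "chain N R mu c d'" using step.IH[OF tyy step.prems(2,3) d'] .
  then have "\<not> ty d'" using chain_type[where ty = ty, OF ch tyN tymu] step.prems(3) by blast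
  then have m: "d' \<in> R" "(mu d', y) \<in> cyc W" using mirror[OF y(2) d' tyy] y(1) by auto
  \<comment> \<open>The first step of the given chain becomes the last step of its mirror image.\<close>
  have "(mu d', d) \<in> N" using K[OF step.hyps(1) m(2) step.prems(4)] .
  then show ?case using chain_append[OF ch m(1)] chain.base by metis
qed

lemma distinct_nonempty_cycles: "distinct (concat Cs) \<Longrightarrow> distinct (filter (\<lambda>C. C \<noteq> [] \<and> P C) Cs)"
proof (induction Cs)
  case (Cons C Cs)
  have "C \<notin> set Cs" if "C \<noteq> []"
  proof -
    have "hd C \<in> set C" using that by simp
    then show ?thesis using Cons.prems by auto
  qed
  then show ?case using Cons by auto
qed simp

text \<open>Letters of a product of conjugates \<open>x w x\<^sup>-\<close>, the first argument being the number of the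
  conjugate: \<open>Opening r q\<close> and \<open>Closing r q\<close> stand for the letter of \<open>x\<close> at position \<open>q\<close> and for its
  inverse, and \<open>Base r p\<close> for the letter of \<open>w\<close> at position \<open>p\<close>.\<close>

datatype letter = Base nat nat | Opening nat nat | Closing nat nat

fun mirror :: "letter \<Rightarrow> letter" where
  "mirror (Base r p) = Base r p"
| "mirror (Opening r q) = Closing r q"
| "mirror (Closing r q) = Opening r q"

fun position :: "letter \<Rightarrow> nat" where
  "position (Base r p) = p"
| "position (Opening r q) = q"
| "position (Closing r q) = q"

text \<open>Both \<open>w\<close> and the conjugators are alternating lists that begin in the first factor.\<close>

definition in_first :: "letter \<Rightarrow> bool" where "in_first l = even (position l)"

lemma in_first_simps [simp]:
  "in_first (Base r p) = even p" "in_first (Opening r p) = even p" "in_first (Closing r p) = even p"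
  "in_first (mirror l) = in_first l" "mirror (mirror l) = l"
  by (cases l; simp add: in_first_def)+

definition conjugate_letters :: "nat \<Rightarrow> nat \<Rightarrow> nat \<Rightarrow> letter list" where
  "conjugate_letters l m r = map (Opening r) [0..<l] @ map (Base r) [0..<m] @ map (Closing r) (rev [0..<l])"

lemma adjacent_pairs_map: "adjacent_pairs (map f xs) = map (\<lambda>(x, y). (f x, f y)) (adjacent_pairs xs)"
  by (induction xs rule: adjacent_pairs.induct) auto

lemma adjacent_pairs_upt: "Suc q < l \<Longrightarrow> (q, Suc q) \<in> set (adjacent_pairs [0..<l])"
proof (induction l)
  case (Suc l)
  show ?case
  proof (cases "Suc q < l")
    case True
    then show ?thesis using Suc adjacent_pairs_append_subset[of "[0..<l]" "[l]"] by auto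
  next
    case False
    then have "l = Suc q" using Suc by simp
    then show ?thesis using adjacent_pairs_append[of "[0..<l]" "[l]"] by simp
  qed
qed simp

lemma adjacent_pairs_rev: "(x, y) \<in> set (adjacent_pairs W) \<Longrightarrow> (y, x) \<in> set (adjacent_pairs (rev W))"
proof (induction W rule: adjacent_pairs.induct)
  case (1 a b zs)
  have "set (adjacent_pairs (rev (b # zs) @ [a])) = set (adjacent_pairs (rev (b # zs))) \<union> {(b, a)}"
    using adjacent_pairs_append[of "rev (b # zs)" "[a]"] by auto
  then show ?case using 1 by auto
qed auto

lemma conjugate_letters_adjacent:
  assumes "0 < l" "0 < m"
  shows "Suc q < l \<Longrightarrow> (Opening r q, Opening r (Suc q)) \<in> set (adjacent_pairs (conjugate_letters l m r))"
    and "Suc q < l \<Longrightarrow> (Closing r (Suc q), Closing r q) \<in> set (adjacent_pairs (conjugate_letters l m r))"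
    and "Suc q < m \<Longrightarrow> (Base r q, Base r (Suc q)) \<in> set (adjacent_pairs (conjugate_letters l m r))"
    and "(Opening r (l - 1), Base r 0) \<in> set (adjacent_pairs (conjugate_letters l m r))"
    and "adjacent_crossings in_first (conjugate_letters l m r) = 2 * (l - 1) + m - 1 +
       (if even l then 1 else 0) + (if even m = odd l then 1 else 0)"
proof -
  let ?a = "map (Opening r) [0..<l]" and ?b = "map (Base r) [0..<m]" and ?c = "map (Closing r) (rev [0..<l])"
  have ne: "?a \<noteq> []" "?b \<noteq> []" "?c \<noteq> []" using assms by auto
  have b: "?b @ ?c \<noteq> []" using ne by simp
  have eq: "adjacent_pairs (conjugate_letters l m r) = adjacent_pairs ?a @ (last ?a, hd (?b @ ?c)) #
      adjacent_pairs ?b @ (last ?b, hd ?c) # adjacent_pairs ?c"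
    unfolding conjugate_letters_def adjacent_pairs_append[OF ne(1) b] adjacent_pairs_append[OF ne(2,3)] ..
  show "Suc q < l \<Longrightarrow> (Opening r q, Opening r (Suc q)) \<in> set (adjacent_pairs (conjugate_letters l m r))"
    unfolding eq using adjacent_pairs_upt[of q l] by (force simp: adjacent_pairs_map)
  show "Suc q < l \<Longrightarrow> (Closing r (Suc q), Closing r q) \<in> set (adjacent_pairs (conjugate_letters l m r))"
    unfolding eq using adjacent_pairs_rev[OF adjacent_pairs_upt[of q l]]
    by (force simp: adjacent_pairs_map)
  show "Suc q < m \<Longrightarrow> (Base r q, Base r (Suc q)) \<in> set (adjacent_pairs (conjugate_letters l m r))"
    unfolding eq using adjacent_pairs_upt[of q m] by (force simp: adjacent_pairs_map)
  have la: "last ?a = Opening r (l - 1)" "hd ?b = Base r 0" "hd (?b @ ?c) = Base r 0"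
    "last ?b = Base r (m - 1)" "hd ?c = Closing r (l - 1)"
    using assms by (auto simp: last_map hd_map hd_append hd_rev)
  show "(Opening r (l - 1), Base r 0) \<in> set (adjacent_pairs (conjugate_letters l m r))"
    unfolding eq la by simp
  have "adjacent_crossings in_first ?c = adjacent_crossings in_first (rev ?c)"
    by (rule adjacent_crossings_rev[symmetric])
  also have "\<dots> = l - 1" using adjacent_crossings_upt[of in_first "Closing r" l] by (simp add: rev_map)
  finally have c: "adjacent_crossings in_first ?c = l - 1" .
  have odd: "even (l - 1) = odd l" "even (m - 1) = odd m" using assms by auto
  show "adjacent_crossings in_first (conjugate_letters l m r) = 2 * (l - 1) + m - 1 +
       (if even l then 1 else 0) + (if even m = odd l then 1 else 0)"
    unfolding conjugate_letters_def adjacent_crossings_append[OF ne(1) b] adjacent_crossings_append[OF ne(2,3)] la c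
      adjacent_crossings_upt[of in_first "Opening r", OF in_first_simps(2)]
      adjacent_crossings_upt[of in_first "Base r", OF in_first_simps(1)] in_first_simps odd
    using assms by auto
qed

section \<open>Products of conjugates of a cyclically reduced word\<close>

context group begin

lemma lprod_concat:
  "\<forall>L\<in>set Ls. set L \<subseteq> carrier G \<Longrightarrow> lprod (concat Ls) = lprod (map lprod Ls)"
proof (induction Ls)
  case (Cons L Ls)
  then have "set L \<subseteq> carrier G" "set (concat Ls) \<subseteq> carrier G" by auto
  then show ?case using Cons by simp
qed simp

lemma lprod_replicate: "v \<in> carrier G \<Longrightarrow> lprod (replicate m v) = v [^] m"
  by (induction m) (simp_all only: replicate.simps lprod_simps nat_pow_Suc2 nat_pow_0)

end

context free_product begin

lemma alternating_nth:
  "alternating t vs \<Longrightarrow> i < length vs \<Longrightarrow> vs ! i \<noteq> \<one> \<and> vs ! i \<in> fac (t = even i)"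
proof (induction vs arbitrary: t i)
  case (Cons v vs)
  show ?case
  proof (cases i)
    case (Suc j)
    then have "vs ! j \<noteq> \<one> \<and> vs ! j \<in> fac ((\<not> t) = even j)" using Cons.IH[of "\<not> t" j] Cons.prems by simp
    moreover have "((\<not> t) = even j) = (t = even i)" using Suc by auto
    ultimately show ?thesis using Suc by simp
  qed (use Cons in simp)
qed simp

text \<open>The heart of the matter, by counting. If the product were trivial, its blocks would leave more
  than \<open>k (n - 1)\<close> trivial cycles on the letters of the \<open>k\<close> copies of \<open>w\<close> once the conjugators have been
  cancelled. Every one of them ascends somewhere, as torsion-freeness excludes cycles that repeat one
  letter. The ascents can be charged injectively to the \<open>n - 1\<close> junctions inside the copies of \<open>w\<close> at
  which the second factor is followed by the first, of which there are only \<open>k (n - 1)\<close>.\<close>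

lemma product_of_conjugates_nontrivial:
  assumes tf: "\<And>v m. v \<in> A \<union> B \<Longrightarrow> 1 \<le> (m::nat) \<Longrightarrow> v [^] m = \<one> \<Longrightarrow> v = \<one>"
    and ws: "alternating True ws" "length ws = 2 * n" "1 \<le> n"
    and X: "\<And>r. r < k \<Longrightarrow> X r \<noteq> [] \<and> alternating True (X r)" and k: "1 \<le> k"
  shows "lprod (map (\<lambda>r. lprod (X r) \<otimes> lprod ws \<otimes> inv (lprod (X r))) [0..<k]) \<noteq> \<one>"
proof
  assume triv: "lprod (map (\<lambda>r. lprod (X r) \<otimes> lprod ws \<otimes> inv (lprod (X r))) [0..<k]) = \<one>"
  define op where "op r q = (if r < k \<and> q < length (X r) then X r ! q else \<one>)" for r q
  define val where "val l = (case l of Base r p \<Rightarrow> if p < 2 * n then ws ! p else \<one>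
      | Opening r q \<Rightarrow> op r q | Closing r q \<Rightarrow> inv (op r q))" for l
  define len where "len r = length (X r)" for r
  define L where "L r = conjugate_letters (len r) (2 * n) r" for r
  define W where "W = concat (map L [0..<k])"
  have cX: "set (X r) \<subseteq> carrier G" if "r < k" for r using X[OF that] alternating_closed by blast
  have cw: "set ws \<subseteq> carrier G" using ws(1) alternating_closed by blast
  have len: "0 < len r" if "r < k" for r using X[OF that] by (simp add: len_def)
  have wsn: "ws ! p \<noteq> \<one> \<and> ws ! p \<in> fac (even p)" if "p < 2 * n" for p
    using alternating_nth[OF ws(1)] ws(2) that by simp
  have opn: "op r q \<noteq> \<one> \<and> op r q \<in> fac (even q)" if "r < k" "q < len r" for r q
    using alternating_nth[of True "X r" q] X[OF that(1)] that by (simp add: op_def len_def)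
  have op_carrier: "op r q \<in> carrier G" for r q
    using opn[of r q] fac_closed by (cases "r < k \<and> q < len r") (auto simp: op_def len_def)
  have wsc: "ws ! p \<in> carrier G" if "p < 2 * n" for p using wsn[OF that] fac_closed by blast
  have val_carrier: "val l \<in> carrier G" for l
    using op_carrier wsc by (cases l) (auto simp: val_def)
  have setL: "set (L r) = Opening r ` {0..<len r} \<union> Base r ` {0..<2 * n} \<union> Closing r ` {0..<len r}" for r
    by (auto simp: L_def conjugate_letters_def)
  have setW: "set W = (\<Union>r\<in>{0..<k}. set (L r))" by (simp add: W_def)
  have Lne: "L r \<noteq> []" if "r < k" for r using len[OF that] by (simp add: L_def conjugate_letters_def)
  have dL: "distinct (L r)" for r
    by (auto simp: L_def conjugate_letters_def distinct_map inj_on_def)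
  have dW: "distinct W"
  proof -
    have "distinct (concat (map L [0..<j]))" for j
    proof (induction j)
      case (Suc j)
      then show ?case using dL[of j] by (auto simp: setL)
    qed simp
    then show ?thesis by (simp add: W_def)
  qed
  have valfac: "\<forall>l\<in>set W. val l \<in> fac (in_first l)"
  proof
    fix l assume "l \<in> set W"
    then obtain r where r: "r < k" "l \<in> set (L r)" using setW by auto
    then consider q where "l = Opening r q" "q < len r" | p where "l = Base r p" "p < 2 * n"
      | q where "l = Closing r q" "q < len r" using setL by auto
    then show "val l \<in> fac (in_first l)"
      using opn[OF r(1)] wsn subgroup.m_inv_closed[OF subgroup_fac] by cases (auto simp: val_def)
  qed
  have valL: "lprod (map val (L r)) = lprod (X r) \<otimes> lprod ws \<otimes> inv (lprod (X r))" if "r < k" for r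
  proof -
    have 1: "map (\<lambda>q. val (Opening r q)) [0..<len r] = X r"
      using that by (intro nth_equalityI) (auto simp: val_def op_def len_def)
    have 2: "map (\<lambda>q. val (Base r q)) [0..<2 * n] = ws"
      using ws(2) by (intro nth_equalityI) (auto simp: val_def)
    have "map (\<lambda>q. val (Closing r q)) [0..<len r] = map (\<lambda>v. inv v) (X r)"
      using that by (intro nth_equalityI) (auto simp: val_def op_def len_def)
    then have 3: "map (\<lambda>q. val (Closing r q)) (rev [0..<len r]) = rev (map (\<lambda>v. inv v) (X r))"
      by (simp add: rev_map[symmetric])
    have 4: "map val (L r) = X r @ ws @ rev (map (\<lambda>v. inv v) (X r))"
      using 1 2 3 by (simp add: L_def conjugate_letters_def comp_def)
    have ci: "set (rev (map (\<lambda>v. inv v) (X r))) \<subseteq> carrier G" using cX[OF that] by auto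
    have "lprod (map val (L r)) = lprod (X r) \<otimes> (lprod ws \<otimes> lprod (rev (map (\<lambda>v. inv v) (X r))))"
      unfolding 4 using lprod_append cX[OF that] cw ci by (metis Un_subset_iff set_append)
    also have "\<dots> = lprod (X r) \<otimes> (lprod ws \<otimes> inv (lprod (X r)))"
      by (simp only: lprod_rev_inv[OF cX[OF that]])
    finally show ?thesis using cX[OF that] cw by (simp add: m_assoc)
  qed
  have "lprod (map val W) = lprod (map (\<lambda>r. lprod (map val (L r))) [0..<k])"
    unfolding W_def map_concat map_map
    by (subst lprod_concat) (use val_carrier in \<open>auto simp: comp_def\<close>)
  also have "map (\<lambda>r. lprod (map val (L r))) [0..<k]
      = map (\<lambda>r. lprod (X r) \<otimes> lprod ws \<otimes> inv (lprod (X r))) [0..<k]"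
    using valL by (intro map_cong) auto
  finally have pW: "lprod (map val W) = \<one>" using triv by simp
  have Wne: "W \<noteq> []" using k Lne[of 0] by (auto simp: W_def)
  obtain Bs where Bs: "distinct (concat Bs)" "set (concat Bs) = set W"
    "\<forall>B\<in>set Bs. B \<noteq> [] \<and> monochrome in_first B \<and> lprod (map val B) = \<one>"
    "\<And>z y c d. (z, y) \<in> next_in Bs \<Longrightarrow> (c, y) \<in> cyc W \<Longrightarrow> (z, d) \<in> cyc W \<Longrightarrow> (c, d) \<in> next_in Bs"
    "2 * length Bs = crossings in_first W + 2"
    using block_decomposition[OF Wne dW valfac pW] by blast
  \<comment> \<open>Inside each conjugate the factor changes at least \<open>2 * len r + 2 * (n - 1)\<close> times. Of the
    two transitions from the conjugator to \<open>w\<close> and from \<open>w\<close> to the inverse of the conjugator, exactly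
    one changes the factor, depending on the parity of \<open>len r\<close>.\<close>
  define S where "S = (\<Sum>r\<leftarrow>[0..<k]. len r)"
  have "(\<Sum>r\<leftarrow>[0..<k]. 2 * len r + 2 * (n - 1)) \<le> (\<Sum>r\<leftarrow>[0..<k]. adjacent_crossings in_first (L r))"
  proof (rule sum_list_mono)
    fix r assume "r \<in> set [0..<k]"
    then have "0 < len r" using len by simp
    then show "2 * len r + 2 * (n - 1) \<le> adjacent_crossings in_first (L r)"
      using conjugate_letters_adjacent(5)[of "len r" "2 * n" r] ws(3) by (auto simp: L_def)
  qed
  also have "\<dots> \<le> crossings in_first W"
    using adjacent_crossings_concat[of in_first "map L [0..<k]"] adjacent_crossings_le[of in_first W]
    by (simp add: W_def comp_def)
  also have "(\<Sum>r\<leftarrow>[0..<k]. 2 * len r + 2 * (n - 1)) = 2 * S + 2 * (k * (n - 1))"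
    by (simp add: S_def sum_list_addf sum_list_const_mult sum_list_triv)
  finally have lenBs: "S + k * (n - 1) + 1 \<le> length Bs" using Bs(5) by simp

  \<comment> \<open>Cancelling the conjugators takes \<open>S\<close> steps, each of which costs at most one trivial cycle.\<close>
  define ts where "ts = concat (map (\<lambda>r. map (Opening r) [0..<len r]) [0..<k])"
  have sts: "set ts = {Opening r q | r q. r < k \<and> q < len r}" by (auto simp: ts_def)
  have mts: "mirror ` set ts = {Closing r q | r q. r < k \<and> q < len r}"
    unfolding sts by (auto intro!: image_eqI)
  have lts: "length ts = S" by (simp add: ts_def S_def length_concat comp_def)
  define R where "R = set ts \<union> mirror ` set ts"
  have Rin: "R \<subseteq> set W" unfolding R_def mts sts setW setL by auto
  have dts: "distinct ts"
  proof -
    have "distinct (concat (map (\<lambda>r. map (Opening r) [0..<len r]) [0..<j]))" for j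
      by (induction j) (auto simp: distinct_map inj_on_def)
    then show ?thesis by (simp add: ts_def)
  qed
  have "\<exists>Cs. distinct (concat Cs) \<and> set (concat Cs) = set (concat Bs) - (set ts \<union> mirror ` set ts) \<and>
    (\<forall>C\<in>set Cs. monochrome in_first C) \<and>
    (\<forall>l t. (l, t) \<in> next_in Cs \<longrightarrow> chain (next_in Bs) (set ts \<union> mirror ` set ts) mirror l t) \<and>
    length (filter (trivial_cycle val) Bs) \<le> length (filter (trivial_cycle val) Cs) + length ts"
  proof (rule glue_all[OF Bs(1) val_carrier])
    show "\<forall>B\<in>set Bs. monochrome in_first B" using Bs(3) by blast
    show "inj_on mirror (set ts)" by (metis inj_onI in_first_simps(5))
    show "set ts \<union> mirror ` set ts \<subseteq> set (concat Bs)" using Rin Bs(2) by (simp add: R_def)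
    fix t assume "t \<in> set ts"
    then obtain r q where "t = Opening r q" "r < k" "q < len r" using sts by auto
    then show "mirror t \<notin> set ts \<and> mirror (mirror t) = t \<and> in_first (mirror t) = in_first t \<and>
           val (mirror t) = inv (val t) \<and> val t \<noteq> \<one>"
      using opn[of r q] by (auto simp: sts val_def)
  qed (rule dts)
  then obtain Cs where Cs: "distinct (concat Cs)" "set (concat Cs) = set W - R"
    "\<forall>C\<in>set Cs. monochrome in_first C"
    "\<And>l t. (l, t) \<in> next_in Cs \<Longrightarrow> chain (next_in Bs) R mirror l t"
    "length (filter (trivial_cycle val) Bs) \<le> length (filter (trivial_cycle val) Cs) + length ts"
    unfolding R_def Bs(2) by blast
  have "filter (trivial_cycle val) Bs = Bs"
    using Bs(3) by (intro filter_True) (auto simp: trivial_cycle_def)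
  then have many: "k * (n - 1) < length (filter (trivial_cycle val) Cs)"
    using lenBs Cs(5) lts by simp
  define T where "T = set (filter (trivial_cycle val) Cs)"
  have cardT: "card T = length (filter (trivial_cycle val) Cs)"
    unfolding T_def trivial_cycle_def[abs_def] by (intro distinct_card distinct_nonempty_cycles Cs(1))
  have base: "\<exists>r p. l = Base r p \<and> r < k \<and> p < 2 * n" if "l \<in> set (concat Cs)" for l
  proof -
    have l: "l \<in> set W" "l \<notin> R" using that Cs(2) by auto
    then obtain r where r: "r < k" "l \<in> set (L r)" using setW by auto
    show ?thesis
    proof (cases l)
      case (Base r' p)
      then show ?thesis using r setL by auto
    next
      case (Opening r' q)
      then have "l \<in> set ts" using r setL sts by auto
      then show ?thesis using l(2) by (simp add: R_def)
    next
      case (Closing r' q)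
      then have "l \<in> mirror ` set ts" using r setL mts by auto
      then show ?thesis using l(2) by (simp add: R_def)
    qed
  qed
  have notR: "l \<notin> R" if "l \<in> set (concat Cs)" for l using that Cs(2) by auto

  \<comment> \<open>The two letters \<open>w ! (2 * i)\<close> and \<open>w ! (2 * i + 1)\<close> share the index \<open>i\<close>.\<close>
  define idx where "idx l = position l div 2" for l
  have ascent: "\<exists>z y. (z, y) \<in> cyc C \<and> idx z < idx y" if "C \<in> T" for C
  proof (rule ccontr)
    assume no: "\<not> (\<exists>z y. (z, y) \<in> cyc C \<and> idx z < idx y)"
    have C: "C \<in> set Cs" "C \<noteq> []" "lprod (map val C) = \<one>" using that by (auto simp: T_def trivial_cycle_def)
    have hC: "hd C \<in> set (concat Cs)" unfolding set_concat using C(1,2) hd_in_set by blast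
    obtain r p where rp: "hd C = Base r p" "p < 2 * n" using base[OF hC] by blast
    have "\<forall>(z, y)\<in>cyc C. idx y \<le> idx z" using no by (auto simp: not_less)
    then have const: "idx z = idx (hd C)" if "z \<in> set C" for z
      using descending_cycle_constant[of C idx z] that by blast
    have vc: "val z = val (hd C)" if z: "z \<in> set C" for z
    proof -
      have "z \<in> set (concat Cs)" using z C(1) by auto
      then obtain r' p' where z': "z = Base r' p'" "p' < 2 * n" using base by blast
      have "monochrome in_first C" using Cs(3) C(1) by blast
      then have "in_first z = in_first (hd C)" using z C(2) unfolding monochrome_def by (meson hd_in_set)
      then have "even p' = even p" using z' rp by simp
      moreover have "p' div 2 = p div 2" using const[OF z] z' rp by (simp add: idx_def)
      ultimately have "p' = p" by (metis even_two_times_div_two odd_two_times_div_two_succ)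
      then show ?thesis using z' rp by (simp add: val_def)
    qed
    have "map val C = map (\<lambda>z. val (hd C)) C" by (rule map_cong[OF refl vc])
    then have mr: "map val C = replicate (length C) (val (hd C))" by (simp only: map_replicate_const)
    have "val (hd C) [^] length C = \<one>"
      using C(3) unfolding mr lprod_replicate[OF val_carrier] .
    moreover have "val (hd C) \<in> A \<union> B" "val (hd C) \<noteq> \<one>"
      using wsn[OF rp(2)] rp by (simp_all add: val_def fac_def split: if_splits)
    moreover have "1 \<le> length C" using C(2) by (simp add: Suc_le_eq)
    ultimately show False using tf[of "val (hd C)" "length C"] by blast
  qed
  then have "\<forall>C\<in>T. \<exists>e. e \<in> cyc C \<and> idx (fst e) < idx (snd e)" by (metis fst_conv snd_conv)
  then obtain e where e: "\<forall>C\<in>T. e C \<in> cyc C \<and> idx (fst (e C)) < idx (snd (e C))"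
    using bchoice[of T "\<lambda>C e. e \<in> cyc C \<and> idx (fst e) < idx (snd e)"] by blast
  define src where "src C = fst (e C)" for C
  define dst where "dst C = snd (e C)" for C
  have sd: "(src C, dst C) \<in> cyc C \<and> idx (src C) < idx (dst C)" if "C \<in> T" for C
    using e that by (simp add: src_def dst_def)
  \<comment> \<open>Junction \<open>j\<close> lies between positions \<open>2 * j - 1\<close> and \<open>2 * j\<close>. An ascent in the first factor is
    charged to the junction before the letter where it ends, and an ascent in the second factor to
    the junction after the letter where it starts. Only letters of the form \<open>Base r p\<close> occur; the
    last case is a default.\<close>
  define junction where "junction C =
     (case (if in_first (dst C) then dst C else src C) of
        Base r p \<Rightarrow> (r, if in_first (dst C) then p div 2 else Suc (p div 2)) | _ \<Rightarrow> (0, 0))" for C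
  have TC: "C \<in> set Cs" if "C \<in> T" for C using that by (auto simp: T_def)
  have mem: "src C \<in> set C" "dst C \<in> set C" "src C \<in> set (concat Cs)" "dst C \<in> set (concat Cs)"
    "in_first (src C) = in_first (dst C)" "(src C, dst C) \<in> next_in Cs" if "C \<in> T" for C
  proof -
    show 1: "src C \<in> set C" "dst C \<in> set C" using sd[OF that] cyc_in_set[of "src C" "dst C" C] by blast+
    then show "src C \<in> set (concat Cs)" "dst C \<in> set (concat Cs)" using TC[OF that] by auto
    show "in_first (src C) = in_first (dst C)" using 1 Cs(3) TC[OF that] unfolding monochrome_def by blast
    show "(src C, dst C) \<in> next_in Cs" using sd[OF that] TC[OF that] by (auto simp: next_in_def)
  qed
  have junction_first: "\<exists>r j. dst C = Base r (2 * j) \<and> junction C = (r, j) \<and> r < k \<and> j < n"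
    if CT: "C \<in> T" and ty: "in_first (dst C)" for C
  proof -
    obtain r p where rp: "dst C = Base r p" "r < k" "p < 2 * n" using base mem(4)[OF CT] by blast
    then obtain j where "p = 2 * j" using ty by auto
    then show ?thesis using rp ty by (auto simp: junction_def)
  qed
  have junction_second: "\<exists>r j. src C = Base r (Suc (2 * j)) \<and> junction C = (r, Suc j) \<and> r < k"
    if CT: "C \<in> T" and ty: "\<not> in_first (dst C)" for C
  proof -
    obtain r p where rp: "src C = Base r p" "r < k" "p < 2 * n" using base mem(3)[OF CT] by blast
    then have "odd p" using ty mem(5)[OF CT] by simp
    then obtain j where "p = Suc (2 * j)" by (metis oddE Suc_eq_plus1)
    then show ?thesis using rp ty by (auto simp: junction_def)
  qed
  have same: "C = C'" if "C \<in> T" "C' \<in> T" "z \<in> set C" "z \<in> set C'" for C C' z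
    using distinct_concat_same[OF Cs(1)] TC that by metis
  have tyN: "in_first z = in_first y" if zy: "(z, y) \<in> next_in Bs" for z y
  proof -
    obtain B' where "B' \<in> set Bs" "(z, y) \<in> cyc B'" using zy by (auto simp: next_in_def)
    then show ?thesis using Bs(3) cyc_in_set unfolding monochrome_def by metis
  qed
  have inW: "set (adjacent_pairs (L r)) \<subseteq> cyc W" if "r < k" for r
    using adjacent_pairs_concat[of "L r" "map L [0..<k]"] adjacent_pairs_cyc[of W] that
    by (auto simp: W_def)
  have consecutive:
    "Suc q < len r \<Longrightarrow> (Opening r q, Opening r (Suc q)) \<in> cyc W"
    "Suc q < len r \<Longrightarrow> (Closing r (Suc q), Closing r q) \<in> cyc W"
    "Suc q < 2 * n \<Longrightarrow> (Base r q, Base r (Suc q)) \<in> cyc W"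
    "(Opening r (len r - 1), Base r 0) \<in> cyc W" if "r < k" for r q
    using conjugate_letters_adjacent(1-4)[of "len r" "2 * n"] inW[OF that, unfolded L_def] len[OF that] ws(3)
    by auto
  have Rset: "R = {Opening r q | r q. r < k \<and> q < len r} \<union> {Closing r q | r q. r < k \<and> q < len r}"
    unfolding R_def mts by (simp only: sts)
  have RW: "mirror (mirror l) = l \<and> mirror l \<in> R \<and> l \<in> set W" if "l \<in> R" for l
    using that Rin by (auto simp: R_def)
  have mir: "d \<in> R \<and> (mirror d, mirror z) \<in> cyc W"
    if z: "z \<in> R" and zd: "(z, d) \<in> cyc W" and ty: "in_first z" "\<not> in_first d" for z d
  proof -
    consider r q where "z = Opening r q" "r < k" "q < len r" | r q where "z = Closing r q" "r < k" "q < len r"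
      using z unfolding Rset by blast
    then show ?thesis
    proof cases
      case 1
      show ?thesis
      proof (cases "Suc q < len r")
        case True
        note c = consecutive(1,2)[OF 1(2) True]
        have "d = Opening r (Suc q)" using cyc_functional[OF dW] zd 1(1) c(1) by metis
        moreover from this have "d \<in> set ts" using 1(2) True by (auto simp: sts)
        ultimately show ?thesis using 1(1) c(2) by (auto simp: R_def)
      next
        case False
        then have "q = len r - 1" using 1(3) by simp
        then have "(Opening r q, Base r 0) \<in> cyc W" using consecutive(4)[OF 1(2)] by simp
        then have "d = Base r 0" using cyc_functional[OF dW] zd 1(1) by metis
        then show ?thesis using ty by simp
      qed
    next
      case 2
      show ?thesis
      proof (cases q)
        case (Suc q')
        note c = consecutive(1,2)[OF 2(2), of q']
        have "d = Closing r q'" using cyc_functional[OF dW] zd 2(1,3) c(2) Suc by metis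
        moreover from this have "d \<in> mirror ` set ts" using 2(2,3) Suc unfolding mts by auto
        ultimately show ?thesis using 2(1,3) c(1) Suc by (auto simp: R_def)
      next
        case 0
        have "L r \<in> set (map L [0..<k])" using 2(2) by simp
        moreover have "last (L r) = z" using 2 0 by (simp add: L_def conjugate_letters_def last_map last_rev)
        ultimately obtain B' where "B' \<in> set (map L [0..<k])" "d = hd B'"
          using successor_of_last[of "map L [0..<k]" "L r" d] dW Lne zd by (auto simp: W_def)
        then obtain r' where "r' < k" "d = hd (L r')" by auto
        then have "d = Opening r' 0" using len[of r'] by (simp add: L_def conjugate_letters_def hd_append hd_map)
        then show ?thesis using ty by simp
      qed
    qed
  qed
  \<comment> \<open>If an ascent in the first factor ends right after a junction, then by duality the cycle through
    the letter right before the junction descends or stays level there.\<close>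
  have mixed: False if T: "C \<in> T" "C' \<in> T" and ty: "in_first (dst C)" "\<not> in_first (dst C')"
    and eq: "junction C = junction C'" for C C'
  proof -
    obtain r j where d: "dst C = Base r (2 * j)" "junction C = (r, j)" "r < k" "j < n"
      using junction_first T(1) ty(1) by blast
    obtain r' i' where s: "src C' = Base r' (Suc (2 * i'))" "junction C' = (r', Suc i')"
      using junction_second T(2) ty(2) by blast
    have j: "j = Suc i'" "r' = r" using d s eq by auto
    obtain r0 p where src: "src C = Base r0 p" "r0 < k" "p < 2 * n" using base mem(3)[OF T(1)] by blast
    then have "even p" using mem(5)[OF T(1)] ty(1) by simp
    then obtain i where p: "p = 2 * i" by auto
    have 1: "(src C', dst C) \<in> cyc W"
      using consecutive(3)[OF d(3), of "Suc (2 * i')"] d(4) s(1) d(1) j by simp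
    have 2: "(src C, Base r0 (Suc (2 * i))) \<in> cyc W"
      using consecutive(3)[OF src(2), of "2 * i"] src p by auto
    have ch: "chain (next_in Bs) R mirror (src C) (dst C)" using Cs(4) mem(6)[OF T(1)] by blast
    have t: "in_first (src C)" "\<not> in_first (src C')" using mem(5)[OF T(1)] mem(5)[OF T(2)] ty by simp_all
    have "chain (next_in Bs) R mirror (src C') (Base r0 (Suc (2 * i)))"
      by (rule chain_duality[where ty = in_first and W = W, OF ch t(1) 1 t(2) 2 Bs(4) tyN in_first_simps(4) RW mir])
    moreover have "chain (next_in Bs) R mirror (src C') (dst C')" using Cs(4) mem(6)[OF T(2)] by blast
    moreover have "Base r0 (Suc (2 * i)) \<notin> R" unfolding Rset by auto
    moreover have "dst C' \<notin> R" using notR mem(4)[OF T(2)] by blast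
    ultimately have "dst C' = Base r0 (Suc (2 * i))"
      using chain_deterministic[of "next_in Bs" R mirror "src C'"] next_in_functional[OF Bs(1)] by blast
    then have "i' < i" using sd[OF T(2)] s(1) by (simp add: idx_def)
    moreover have "i < j" using sd[OF T(1)] d(1) src(1) p by (simp add: idx_def)
    ultimately show False using j(1) by simp
  qed
  have inj: "inj_on junction T"
  proof (rule inj_onI)
    fix C C' assume T: "C \<in> T" "C' \<in> T" and eq: "junction C = junction C'"
    consider "in_first (dst C)" "in_first (dst C')" | "\<not> in_first (dst C)" "\<not> in_first (dst C')"
      using mixed[OF T _ _ eq] mixed[OF T(2,1) _ _ eq[symmetric]] by blast
    then show "C = C'"
    proof cases
      case 1
      obtain r j where 3: "dst C = Base r (2 * j)" "junction C = (r, j)" using junction_first[OF T(1) 1(1)] by blast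
      obtain r' j' where 4: "dst C' = Base r' (2 * j')" "junction C' = (r', j')" using junction_first[OF T(2) 1(2)] by blast
      have "dst C = dst C'" using 3 4 eq by simp
      then show ?thesis using same[OF T mem(2)[OF T(1)]] mem(2)[OF T(2)] by simp
    next
      case 2
      obtain r j where 3: "src C = Base r (Suc (2 * j))" "junction C = (r, Suc j)" using junction_second[OF T(1) 2(1)] by blast
      obtain r' j' where 4: "src C' = Base r' (Suc (2 * j'))" "junction C' = (r', Suc j')" using junction_second[OF T(2) 2(2)] by blast
      have "src C = src C'" using 3 4 eq by simp
      then show ?thesis using same[OF T mem(1)[OF T(1)]] mem(1)[OF T(2)] by simp
    qed
  qed
  have "junction ` T \<subseteq> {0..<k} \<times> {1..<n}"
  proof
    fix J assume "J \<in> junction ` T"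
    then obtain C where C: "C \<in> T" "J = junction C" by blast
    show "J \<in> {0..<k} \<times> {1..<n}"
    proof (cases "in_first (dst C)")
      case True
      then obtain r j where rj: "dst C = Base r (2 * j)" "junction C = (r, j)" "r < k" "j < n"
        using junction_first[OF C(1)] by blast
      then have "idx (src C) < j" using sd[OF C(1)] by (simp add: idx_def)
      then show ?thesis using rj C(2) by auto
    next
      case False
      then obtain r j where rj: "src C = Base r (Suc (2 * j))" "junction C = (r, Suc j)" "r < k"
        using junction_second[OF C(1)] by blast
      obtain r' p where p: "dst C = Base r' p" "p < 2 * n" using base mem(4)[OF C(1)] by blast
      have "j < p div 2" using sd[OF C(1)] rj p by (simp add: idx_def)
      then have "Suc j < n" using p(2) by simp
      then show ?thesis using rj C(2) by auto
    qed
  qed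
  then have "card (junction ` T) \<le> card ({0..<k} \<times> {1..<n})" by (intro card_mono) auto
  also have "\<dots> = k * (n - 1)" by (simp add: card_cartesian_product)
  finally have "card T \<le> k * (n - 1)" using card_image[OF inj] by simp
  then show False using many cardT by simp
qed

end

section \<open>Generalized torsion in a free product\<close>

context group begin

lemma lprod_conjugates:
  assumes "set vs \<subseteq> carrier G" "a \<in> carrier G"
  shows "lprod (map (\<lambda>v. a \<otimes> v \<otimes> inv a) vs) = a \<otimes> lprod vs \<otimes> inv a"
  using assms(1)
proof (induction vs)
  case (Cons v vs)
  have c: "v \<in> carrier G" "lprod vs \<in> carrier G" using Cons.prems by auto
  have "inv a \<otimes> (a \<otimes> (lprod vs \<otimes> inv a)) = lprod vs \<otimes> inv a"
    using c assms(2) by (simp add: m_assoc[symmetric])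
  then show ?case using Cons c assms(2) by (simp add: m_assoc)
qed (use assms in simp)

end

context free_product begin

lemma A_closed: "v \<in> A \<Longrightarrow> v \<in> carrier G"
  by (rule subgroup.mem_carrier[OF A])

lemma B_closed: "v \<in> B \<Longrightarrow> v \<in> carrier G"
  by (rule subgroup.mem_carrier[OF B])

lemma alternating_mult:
  assumes a: "a \<in> fac c" and alt: "alternating t vs"
  shows "\<exists>t' vs'. alternating t' vs' \<and> lprod vs' = a \<otimes> lprod vs"
proof (cases "a = \<one>")
  case True
  then show ?thesis using alt alternating_closed[OF alt] by auto
next
  case an: False
  note ac = fac_closed[OF a]
  show ?thesis
  proof (cases "vs = [] \<or> t \<noteq> c")
    case True
    then have "alternating c (a # vs) \<and> lprod (a # vs) = a \<otimes> lprod vs" using a an alt by auto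
    then show ?thesis by blast
  next
    case False
    then obtain v vs' where vs: "vs = v # vs'" "t = c" by (cases vs) auto
    then have v: "v \<in> fac c" "alternating (\<not> c) vs'" using alt by auto
    have cl: "v \<in> carrier G" "lprod vs' \<in> carrier G" using fac_closed[OF v(1)] alternating_closed[OF v(2)] by auto
    have p: "a \<otimes> lprod vs = (a \<otimes> v) \<otimes> lprod vs'" using vs cl ac by (simp add: m_assoc)
    show ?thesis
    proof (cases "a \<otimes> v = \<one>")
      case True
      then show ?thesis using p v(2) cl by auto
    next
      case False
      then have "alternating c ((a \<otimes> v) # vs') \<and> lprod ((a \<otimes> v) # vs') = a \<otimes> lprod vs"
        using v p subgroup.m_closed[OF subgroup_fac a v(1)] by simp
      then show ?thesis by blast
    qed
  qed
qed

lemma alternating_mult_list: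
  assumes "alternating s us" "alternating t vs"
  shows "\<exists>t' vs'. alternating t' vs' \<and> lprod vs' = lprod us \<otimes> lprod vs"
  using assms(1)
proof (induction us arbitrary: s)
  case Nil
  then show ?case using assms(2) alternating_closed[OF assms(2)] by auto
next
  case (Cons u us)
  then have u: "u \<in> fac s" "alternating (\<not> s) us" by auto
  obtain t' vs' where v: "alternating t' vs'" "lprod vs' = lprod us \<otimes> lprod vs" using Cons.IH[OF u(2)] by blast
  obtain t2 vs2 where "alternating t2 vs2" "lprod vs2 = u \<otimes> lprod vs'" using alternating_mult[OF u(1) v(1)] by blast
  moreover have "u \<otimes> lprod vs' = lprod (u # us) \<otimes> lprod vs"
    using v(2) fac_closed[OF u(1)] alternating_closed[OF u(2)] alternating_closed[OF assms(2)] by (simp add: m_assoc)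
  ultimately show ?case by auto
qed

lemma alternating_representation:
  assumes "g \<in> carrier G"
  shows "\<exists>t vs. alternating t vs \<and> lprod vs = g"
proof -
  have single: "\<exists>t vs. alternating t vs \<and> lprod vs = h" if "h \<in> fac c" for h c
    using alternating_mult[OF that, of True "[]"] fac_closed[OF that] by simp
  have "g \<in> generate G (A \<union> B)" using assms generated by simp
  then show ?thesis
  proof (induction rule: generate.induct)
    case one
    have "alternating True []" "lprod [] = \<one>" by simp_all
    then show ?case by blast
  next
    case (incl h)
    then have "h \<in> fac True \<or> h \<in> fac False" by (simp add: fac_def)
    then show ?case using single by blast
  next
    case (inv h)
    then have "h \<in> fac True \<or> h \<in> fac False" by (simp add: fac_def)
    then have "inv h \<in> fac True \<or> inv h \<in> fac False" using subgroup.m_inv_closed[OF subgroup_fac] by blast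
    then show ?case using single by blast
  next
    case (eng h1 h2)
    then show ?case using alternating_mult_list by metis
  qed
qed

lemma alternating_snoc:
  "alternating t (vs @ [v]) \<longleftrightarrow> alternating t vs \<and> v \<in> fac (t = even (length vs)) \<and> v \<noteq> \<one>"
proof (induction vs arbitrary: t)
  case (Cons x vs)
  have e: "((\<not> t) = even (length vs)) = (t = even (length (x # vs)))" by auto
  show ?case using Cons.IH[of "\<not> t"] unfolding e by auto
qed simp

text \<open>Conjugating by the last letter merges it with the first one while both lie in the same factor,
  and makes the list shorter. A list whose ends lie in different factors is cyclically reduced, and
  one more conjugation makes it begin in \<open>A\<close>.\<close>

lemma cyclic_reduction_aux:
  assumes "alternating t vs"
  shows "\<exists>c\<in>carrier G. (\<exists>a\<in>A \<union> B. lprod vs = c \<otimes> a \<otimes> inv c) \<or>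
    (\<exists>ws n. alternating True ws \<and> length ws = 2 * n \<and> 1 \<le> n \<and> lprod vs = c \<otimes> lprod ws \<otimes> inv c)"
  using assms
proof (induction vs arbitrary: t rule: length_induct)
  case (1 vs)
  note alt = "1.prems"
  show ?case
  proof (cases vs)
    case Nil
    have "\<one> \<in> A" using A subgroup.one_closed by blast
    then show ?thesis using Nil by (intro bexI[of _ \<one>] disjI1) auto
  next
    case (Cons v vs')
    then have v: "v \<in> fac t" "v \<noteq> \<one>" "alternating (\<not> t) vs'" using alt by auto
    have vc: "v \<in> carrier G" and v'c: "set vs' \<subseteq> carrier G"
      using fac_closed[OF v(1)] alternating_closed[OF v(3)] by auto
    show ?thesis
    proof (cases vs' rule: rev_cases)
      case Nil
      have "v \<in> A \<union> B" using v(1) by (auto simp: fac_def split: if_splits)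
      then show ?thesis using Cons Nil vc by (intro bexI[of _ \<one>] disjI1 bexI[of _ v]) auto
    next
      case (snoc us u)
      show ?thesis
      proof (cases "even (length vs)")
        case True
        have len: "length vs = 2 * (length vs div 2)" "1 \<le> length vs div 2"
          using True Cons snoc by auto
        show ?thesis
        proof (cases t)
          case True
          then show ?thesis using alt len alternating_closed[OF alt]
            by (intro bexI[of _ \<one>] disjI2 exI[of _ vs] exI[of _ "length vs div 2"]) auto
        next
          case False
          have "even (length vs') = False" using True Cons by simp
          then have "alternating True (vs' @ [v])" using v False by (simp add: alternating_snoc)
          moreover have "length (vs' @ [v]) = 2 * (length vs div 2)" using len(1) Cons by simp
          moreover have "lprod vs = v \<otimes> lprod (vs' @ [v]) \<otimes> inv v"
            using Cons vc v'c by (simp add: m_assoc)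
          ultimately show ?thesis using len(2) vc
            by (intro bexI[of _ v] disjI2 exI[of _ "vs' @ [v]"] exI[of _ "length vs div 2"]) auto
        qed
      next
        case False
        then have evn: "odd (length us)" using Cons snoc by simp
        have u: "alternating (\<not> t) us" "u \<in> fac ((\<not> t) = even (length us))" "u \<noteq> \<one>"
          using v(3) snoc by (auto simp: alternating_snoc)
        have ut: "u \<in> fac t" using u(2) evn by simp
        have uc: "u \<in> carrier G" "set us \<subseteq> carrier G" using fac_closed[OF ut] alternating_closed[OF u(1)] by auto
        have lu: "lprod us \<in> carrier G" using uc by simp
        have p: "lprod vs = inv u \<otimes> ((u \<otimes> v) \<otimes> lprod us) \<otimes> inv (inv u)"
        proof -
          have "lprod vs = v \<otimes> (lprod us \<otimes> u)" using Cons snoc uc vc by simp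
          also have "\<dots> = (inv u \<otimes> u) \<otimes> (v \<otimes> (lprod us \<otimes> u))" using uc vc by simp
          also have "\<dots> = inv u \<otimes> ((u \<otimes> v) \<otimes> lprod us) \<otimes> u"
            using uc vc lu by (simp only: m_assoc m_closed inv_closed)
          finally show ?thesis using uc by simp
        qed
        define ys where "ys = (if u \<otimes> v = \<one> then us else (u \<otimes> v) # us)"
        have ys: "alternating (if u \<otimes> v = \<one> then \<not> t else t) ys"
          using u subgroup.m_closed[OF subgroup_fac ut v(1)] by (simp add: ys_def)
        have "length ys < length vs" using Cons snoc by (simp add: ys_def)
        then have "\<exists>c\<in>carrier G. (\<exists>a\<in>A \<union> B. lprod ys = c \<otimes> a \<otimes> inv c) \<or>
            (\<exists>ws n. alternating True ws \<and> length ws = 2 * n \<and> 1 \<le> n \<and> lprod ys = c \<otimes> lprod ws \<otimes> inv c)"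
          using "1.IH" ys by blast
        then obtain c where c: "c \<in> carrier G" and
          alt2: "(\<exists>a\<in>A \<union> B. lprod ys = c \<otimes> a \<otimes> inv c) \<or>
            (\<exists>ws n. alternating True ws \<and> length ws = 2 * n \<and> 1 \<le> n \<and> lprod ys = c \<otimes> lprod ws \<otimes> inv c)"
          by blast
        define d where "d = inv u \<otimes> c"
        have dc: "d \<in> carrier G" using uc c by (simp add: d_def)
        have "lprod ys = (u \<otimes> v) \<otimes> lprod us" using uc vc by (auto simp: ys_def)
        then have pv: "lprod vs = inv u \<otimes> lprod ys \<otimes> inv (inv u)" using p by simp
        have conj: "inv u \<otimes> (c \<otimes> x \<otimes> inv c) \<otimes> inv (inv u) = d \<otimes> x \<otimes> inv d"
          if "x \<in> carrier G" for x using that c uc by (simp add: m_assoc inv_mult_group d_def)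
        from alt2 show ?thesis
        proof
          assume "\<exists>a\<in>A \<union> B. lprod ys = c \<otimes> a \<otimes> inv c"
          then obtain a where a: "a \<in> A \<union> B" "lprod ys = c \<otimes> a \<otimes> inv c" by blast
          have "a \<in> carrier G" using a(1) A_closed B_closed by blast
          then have "lprod vs = d \<otimes> a \<otimes> inv d" using pv conj a(2) by simp
          then show ?thesis using dc a(1) by blast
        next
          assume "\<exists>ws n. alternating True ws \<and> length ws = 2 * n \<and> 1 \<le> n \<and> lprod ys = c \<otimes> lprod ws \<otimes> inv c"
          then obtain ws n where ws: "alternating True ws" "length ws = 2 * n" "1 \<le> n"
            "lprod ys = c \<otimes> lprod ws \<otimes> inv c" by blast
          have "lprod ws \<in> carrier G" using alternating_closed[OF ws(1)] by simp
          then have "lprod vs = d \<otimes> lprod ws \<otimes> inv d" using pv conj ws(4) by simp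
          then show ?thesis using dc ws by blast
        qed
      qed
    qed
  qed
qed

lemma cyclic_reduction:
  assumes "g \<in> carrier G"
  obtains c a where "c \<in> carrier G" "a \<in> A \<union> B" "g = c \<otimes> a \<otimes> inv c"
  | c ws n where "c \<in> carrier G" "alternating True ws" "length ws = 2 * n" "1 \<le> n" "g = c \<otimes> lprod ws \<otimes> inv c"
proof -
  obtain t vs where "alternating t vs" "lprod vs = g" using alternating_representation[OF assms] by blast
  then obtain c where c: "c \<in> carrier G" and
    d: "(\<exists>a\<in>A \<union> B. g = c \<otimes> a \<otimes> inv c) \<or>
      (\<exists>ws n. alternating True ws \<and> length ws = 2 * n \<and> 1 \<le> n \<and> g = c \<otimes> lprod ws \<otimes> inv c)"
    using cyclic_reduction_aux[of t vs] by blast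
  from d show thesis
  proof
    assume "\<exists>a\<in>A \<union> B. g = c \<otimes> a \<otimes> inv c"
    then show thesis using c that(1) by blast
  next
    assume "\<exists>ws n. alternating True ws \<and> length ws = 2 * n \<and> 1 \<le> n \<and> g = c \<otimes> lprod ws \<otimes> inv c"
    then show thesis using c that(2) by blast
  qed
qed

text \<open>An element not conjugate into a factor is conjugate to a cyclically reduced \<open>ws\<close>. It remains to
  arrange that all conjugators are nonempty and begin in \<open>A\<close>. Conjugating the whole relation by some
  \<open>a \<in> A\<close> achieves this, provided that \<open>a\<close> does not cancel any of the finitely many first letters.\<close>

theorem generalized_torsion_conjugate_into_factor:
  assumes tf: "\<And>v m. v \<in> A \<union> B \<Longrightarrow> 1 \<le> (m::nat) \<Longrightarrow> v [^] m = \<one> \<Longrightarrow> v = \<one>"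
    and g: "g \<in> carrier G" and xs: "xs \<noteq> []" "set xs \<subseteq> carrier G"
    and triv: "lprod (map (\<lambda>x. x \<otimes> g \<otimes> inv x) xs) = \<one>"
  obtains c a where "c \<in> carrier G" "a \<in> A \<union> B" "g = c \<otimes> a \<otimes> inv c"
proof (rule cyclic_reduction[OF g])
  fix c ws n
  assume c: "c \<in> carrier G" and ws: "alternating True ws" "length ws = 2 * n" "1 \<le> n"
    and gc: "g = c \<otimes> lprod ws \<otimes> inv c"
  define k where "k = length xs"
  have wc: "lprod ws \<in> carrier G" using alternating_closed[OF ws(1)] by simp
  have xc: "xs ! r \<otimes> c \<in> carrier G" if "r < k" for r
    using that xs c by (metis k_def m_closed nth_mem subsetD)
  then have "\<forall>r. \<exists>tv. r < k \<longrightarrow> alternating (fst tv) (snd tv) \<and> lprod (snd tv) = xs ! r \<otimes> c"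
    using alternating_representation by (metis fst_conv snd_conv)
  then obtain tv where tv: "\<And>r. r < k \<Longrightarrow> alternating (fst (tv r)) (snd (tv r)) \<and> lprod (snd (tv r)) = xs ! r \<otimes> c"
    by metis
  \<comment> \<open>The powers of a nontrivial \<open>b \<in> A\<close> are distinct because \<open>A\<close> is torsion-free, so one of them is a
    suitable \<open>a\<close>.\<close>
  obtain b where b: "b \<in> A" "b \<noteq> \<one>"
    using alternating_nth[OF ws(1), of 0] ws(2,3) by (auto simp: fac_def)
  have bc: "b \<in> carrier G" using b(1) A_closed by blast
  have bpow: "b [^] (m::nat) \<in> A" for m
    by (induction m) (use b A in \<open>auto simp: subgroup.one_closed subgroup.m_closed\<close>)
  have inj: "inj (\<lambda>m::nat. b [^] Suc m)"
  proof -
    have "False" if "m < m'" "b [^] Suc m = b [^] Suc m'" for m m' :: nat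
    proof -
      have "b [^] Suc m \<otimes> b [^] (m' - m) = b [^] Suc m'"
        using bc that(1) by (subst nat_pow_mult) auto
      then have "b [^] Suc m \<otimes> b [^] (m' - m) = b [^] Suc m \<otimes> \<one>"
        using that(2) bc by (simp del: nat_pow_Suc)
      then have "b [^] (m' - m) = \<one>" using bc by (simp del: nat_pow_Suc)
      moreover have "1 \<le> m' - m" "b \<in> A \<union> B" using b that(1) by auto
      ultimately show False using tf b(2) by blast
    qed
    then show ?thesis by (intro injI) (metis linorder_neqE_nat)
  qed
  define bad where "bad = (\<lambda>r. inv (hd (snd (tv r)))) ` {0..<k}"
  have "\<not> range (\<lambda>m::nat. b [^] Suc m) \<subseteq> bad"
  proof
    assume "range (\<lambda>m::nat. b [^] Suc m) \<subseteq> bad"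
    moreover have "finite bad" by (simp add: bad_def)
    ultimately have "finite (range (\<lambda>m::nat. b [^] Suc m))" by (rule finite_subset)
    then show False using finite_imageD[OF _ inj] infinite_UNIV_nat by blast
  qed
  then obtain m :: nat where m: "b [^] Suc m \<notin> bad" by auto
  define a where "a = b [^] Suc m"
  have a: "a \<in> A" "a \<noteq> \<one>"
  proof -
    show "a \<in> A" using bpow[of "Suc m"] by (simp only: a_def)
    show "a \<noteq> \<one>" unfolding a_def using tf[of b "Suc m"] b by (metis UnI1 le_add1 plus_1_eq_Suc)
  qed
  have ac: "a \<in> carrier G" using a(1) A_closed by blast
  have "\<exists>X. X \<noteq> [] \<and> alternating True X \<and> lprod X = a \<otimes> (xs ! r \<otimes> c)" if r: "r < k" for r
  proof -
    define t vs where "t = fst (tv r)" and "vs = snd (tv r)"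
    have vs: "alternating t vs" "lprod vs = xs ! r \<otimes> c" using tv[OF r] by (auto simp: t_def vs_def)
    show ?thesis
    proof (cases "vs = [] \<or> \<not> t")
      case True
      then have "alternating True (a # vs)" using a vs by (auto simp: fac_def)
      then show ?thesis using vs by (intro exI[of _ "a # vs"]) simp
    next
      case False
      then obtain v vs' where v: "vs = v # vs'" "t" by (cases vs) auto
      then have v': "v \<in> A" "alternating False vs'" using vs(1) by (auto simp: fac_def)
      have vc: "v \<in> carrier G" "set vs' \<subseteq> carrier G"
        using A_closed[OF v'(1)] alternating_closed[OF v'(2)] by simp_all
      have "inv v \<in> bad" using r v(1) by (auto simp: bad_def vs_def intro!: image_eqI[of _ _ r])
      then have "a \<noteq> inv v" using m a_def by auto
      then have "a \<otimes> v \<noteq> \<one>" using ac vc(1) inv_equality by auto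
      then have "alternating True ((a \<otimes> v) # vs')"
        using v' a(1) A by (simp add: fac_def subgroup.m_closed)
      moreover have "lprod ((a \<otimes> v) # vs') = a \<otimes> (xs ! r \<otimes> c)"
        using vs(2) v(1) vc ac by (simp add: m_assoc)
      ultimately show ?thesis by blast
    qed
  qed
  then obtain X where X: "\<And>r. r < k \<Longrightarrow> X r \<noteq> [] \<and> alternating True (X r) \<and> lprod (X r) = a \<otimes> (xs ! r \<otimes> c)"
    by metis
  have "lprod (X r) \<otimes> lprod ws \<otimes> inv (lprod (X r)) = a \<otimes> (xs ! r \<otimes> g \<otimes> inv (xs ! r)) \<otimes> inv a" if "r < k" for r
  proof -
    have "xs ! r \<in> carrier G" using that xs by (auto simp: k_def)
    then show ?thesis using X[OF that] ac c wc gc by (simp add: m_assoc inv_mult_group)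
  qed
  then have "map (\<lambda>r. lprod (X r) \<otimes> lprod ws \<otimes> inv (lprod (X r))) [0..<k]
      = map (\<lambda>v. a \<otimes> v \<otimes> inv a) (map (\<lambda>x. x \<otimes> g \<otimes> inv x) xs)"
    by (intro nth_equalityI) (auto simp: k_def)
  moreover have "lprod (map (\<lambda>v. a \<otimes> v \<otimes> inv a) (map (\<lambda>x. x \<otimes> g \<otimes> inv x) xs)) = \<one>"
    by (subst lprod_conjugates) (use xs g ac triv in auto)
  ultimately have eq1: "lprod (map (\<lambda>r. lprod (X r) \<otimes> lprod ws \<otimes> inv (lprod (X r))) [0..<k]) = \<one>"
    by simp
  have k1: "1 \<le> k" using xs(1) by (simp add: k_def Suc_le_eq)
  have X': "X r \<noteq> [] \<and> alternating True (X r)" if "r < k" for r using X[OF that] by simp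
  have "lprod (map (\<lambda>r. lprod (X r) \<otimes> lprod ws \<otimes> inv (lprod (X r))) [0..<k]) \<noteq> \<one>"
    by (rule product_of_conjugates_nontrivial[OF _ ws X' k1]) (use tf in blast)+
  then show thesis using eq1 by simp
qed (rule that)

end

section \<open>Free products recognized by their action on reduced words\<close>

locale two_groups =
  fixes K :: "bool \<Rightarrow> ('x, 'm) monoid_scheme"
  assumes K: "\<And>t. group (K t)"
begin

fun reduced :: "(bool \<times> 'x) list \<Rightarrow> bool" where
  "reduced [] = True"
| "reduced ((t, k) # w) = (k \<in> carrier (K t) \<and> k \<noteq> \<one>\<^bsub>K t\<^esub> \<and> (w = [] \<or> fst (hd w) \<noteq> t) \<and> reduced w)"

fun act :: "bool \<Rightarrow> 'x \<Rightarrow> (bool \<times> 'x) list \<Rightarrow> (bool \<times> 'x) list" where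
  "act t k [] = (if k = \<one>\<^bsub>K t\<^esub> then [] else [(t, k)])"
| "act t k ((s, h) # w) =
     (if s = t then (if k \<otimes>\<^bsub>K t\<^esub> h = \<one>\<^bsub>K t\<^esub> then w else (t, k \<otimes>\<^bsub>K t\<^esub> h) # w)
      else if k = \<one>\<^bsub>K t\<^esub> then (s, h) # w else (t, k) # (s, h) # w)"

lemma act_reduced:
  assumes "reduced w" "k \<in> carrier (K t)"
  shows "reduced (act t k w)"
proof -
  interpret group "K t" by (rule K)
  show ?thesis using assms by (cases w rule: reduced.cases) auto
qed

lemma act_one:
  assumes "reduced w"
  shows "act t \<one>\<^bsub>K t\<^esub> w = w"
proof -
  interpret group "K t" by (rule K)
  show ?thesis
  proof (cases w)
    case (Cons x w')
    obtain s h where x: "x = (s, h)" by fastforce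
    show ?thesis
    proof (cases "s = t")
      case True
      then have "h \<in> carrier (K t)" "h \<noteq> \<one>\<^bsub>K t\<^esub>" using assms Cons x by auto
      then show ?thesis using Cons x True by simp
    qed (use Cons x in simp)
  qed simp
qed

lemma act_mult:
  assumes "reduced w" "k \<in> carrier (K t)" "l \<in> carrier (K t)"
  shows "act t (k \<otimes>\<^bsub>K t\<^esub> l) w = act t k (act t l w)"
proof -
  interpret group "K t" by (rule K)
  have other: "act t k v = (if k = \<one>\<^bsub>K t\<^esub> then v else (t, k) # v)" if "v = [] \<or> fst (hd v) \<noteq> t" for k v
    using that by (cases v rule: reduced.cases) auto
  show ?thesis
  proof (cases "w = [] \<or> fst (hd w) \<noteq> t")
    case True
    have "act t k ((t, l) # w) = (if k \<otimes>\<^bsub>K t\<^esub> l = \<one>\<^bsub>K t\<^esub> then w else (t, k \<otimes>\<^bsub>K t\<^esub> l) # w)" by simp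
    then show ?thesis using other[OF True] assms by (cases "l = \<one>\<^bsub>K t\<^esub>") auto
  next
    case False
    then obtain h w' where w: "w = (t, h) # w'" by (cases w) auto
    then have h: "h \<in> carrier (K t)" "h \<noteq> \<one>\<^bsub>K t\<^esub>" "w' = [] \<or> fst (hd w') \<noteq> t" using assms(1) by auto
    have a: "k \<otimes>\<^bsub>K t\<^esub> l \<otimes>\<^bsub>K t\<^esub> h = k \<otimes>\<^bsub>K t\<^esub> (l \<otimes>\<^bsub>K t\<^esub> h)" using h assms by (simp add: m_assoc)
    show ?thesis
    proof (cases "l \<otimes>\<^bsub>K t\<^esub> h = \<one>\<^bsub>K t\<^esub>")
      case True
      then show ?thesis using w a other[OF h(3), of k] assms(2) by simp
    next
      case False
      then show ?thesis using w a by simp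
    qed
  qed
qed

text \<open>The elements of \<open>BijGroup\<close> are extensional functions, hence the restriction.\<close>

definition action :: "bool \<Rightarrow> 'x \<Rightarrow> (bool \<times> 'x) list \<Rightarrow> (bool \<times> 'x) list" where
  "action t k = restrict (act t k) (Collect reduced)"

lemma action_Bij:
  assumes k: "k \<in> carrier (K t)"
  shows "action t k \<in> Bij (Collect reduced)"
proof -
  interpret group "K t" by (rule K)
  have inverse: "act t (inv\<^bsub>K t\<^esub> k) (act t k w) = w" "act t k (act t (inv\<^bsub>K t\<^esub> k) w) = w" if "reduced w" for w
    using act_mult[OF that, of "inv\<^bsub>K t\<^esub> k" t k] act_mult[OF that, of k t "inv\<^bsub>K t\<^esub> k"] k act_one[OF that] by simp_all
  have "bij_betw (act t k) (Collect reduced) (Collect reduced)"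
    by (rule bij_betw_byWitness[where f' = "act t (inv\<^bsub>K t\<^esub> k)"])
       (use inverse act_reduced k in auto)
  then show ?thesis by (simp add: Bij_def action_def bij_betw_restrict_eq)
qed

lemma action_hom: "action t \<in> hom (K t) (BijGroup (Collect reduced))"
proof (rule homI)
  fix k assume "k \<in> carrier (K t)"
  then show "action t k \<in> carrier (BijGroup (Collect reduced))" by (simp add: BijGroup_def action_Bij)
next
  fix k l assume kl: "k \<in> carrier (K t)" "l \<in> carrier (K t)"
  have "action t (k \<otimes>\<^bsub>K t\<^esub> l) = compose (Collect reduced) (action t k) (action t l)"
  proof
    fix w show "action t (k \<otimes>\<^bsub>K t\<^esub> l) w = compose (Collect reduced) (action t k) (action t l) w"
      using kl act_mult[of w k t l] act_reduced[of w l t] by (simp add: action_def compose_def)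
  qed
  then show "action t (k \<otimes>\<^bsub>K t\<^esub> l) = action t k \<otimes>\<^bsub>BijGroup (Collect reduced)\<^esub> action t l"
    using kl by (simp add: BijGroup_def action_Bij)
qed

lemma BijGroup_mult_apply:
  assumes "x \<in> carrier (BijGroup S)" "y \<in> carrier (BijGroup S)" "w \<in> S"
  shows "(x \<otimes>\<^bsub>BijGroup S\<^esub> y) w = x (y w)"
  using assms by (simp add: BijGroup_def compose_def)

text \<open>Van der Waerden's device. If \<open>G\<close> acts on the reduced words compatibly with left multiplication by
  the two groups, then a product of an alternating list, applied to the empty word, spells out that
  list. So it is not the identity, and \<open>k\<close> can be recovered from \<open>j t k\<close>.\<close>

lemma free_product_from_action:
  fixes G :: "('g, 'n) monoid_scheme"
  assumes G: "group G" and j: "\<And>t. j t \<in> hom (K t) G"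
    and gen: "generate G (j True ` carrier (K True) \<union> j False ` carrier (K False)) = carrier G"
    and theta: "\<theta> \<in> hom G (BijGroup (Collect reduced))"
    and theta_j: "\<And>t k. k \<in> carrier (K t) \<Longrightarrow> \<theta> (j t k) = action t k"
  shows "free_product G (j True ` carrier (K True)) (j False ` carrier (K False))"
    and "inj_on (j t) (carrier (K t))"
proof -
  interpret G: group G by (rule G)
  have sub: "subgroup (j t ` carrier (K t)) G" for t
  proof -
    interpret h: group_hom "K t" G "j t" using K G j by (simp add: group_hom_def group_hom_axioms_def)
    show ?thesis by (rule h.img_is_subgroup)
  qed
  interpret P: internal_free_product G "j True ` carrier (K True)" "j False ` carrier (K False)"
    by (intro internal_free_product.intro internal_free_product_axioms.intro G sub gen)
  have fac: "P.fac t = j t ` carrier (K t)" for t by (auto simp: P.fac_def)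
  have j_one: "j t \<one>\<^bsub>K t\<^esub> = \<one>\<^bsub>G\<^esub>" for t using hom_one[OF j K G] .
  have one: "\<theta> \<one>\<^bsub>G\<^esub> [] = []"
    using theta_j[of "\<one>\<^bsub>K True\<^esub>" True] j_one group.is_monoid[OF K] act_one[of "[]" True]
    by (simp add: action_def monoid.one_closed)
  have head: "reduced (\<theta> (G.lprod vs) []) \<and> (vs \<noteq> [] \<longrightarrow> \<theta> (G.lprod vs) [] \<noteq> []) \<and>
      (\<theta> (G.lprod vs) [] \<noteq> [] \<longrightarrow> fst (hd (\<theta> (G.lprod vs) [])) = t)" if "P.alternating t vs" for t vs
    using that
  proof (induction vs arbitrary: t)
    case Nil
    then show ?case using one by simp
  next
    case (Cons v vs)
    then obtain k where k: "v = j t k" "k \<in> carrier (K t)" using fac by auto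
    have alt: "P.alternating (\<not> t) vs" and vn: "v \<noteq> \<one>\<^bsub>G\<^esub>" using Cons.prems by auto
    have kn: "k \<noteq> \<one>\<^bsub>K t\<^esub>" using vn k(1) j_one by auto
    define w where "w = \<theta> (G.lprod vs) []"
    have w: "reduced w" "w = [] \<or> fst (hd w) \<noteq> t" using Cons.IH[OF alt] by (auto simp: w_def)
    have "set vs \<subseteq> carrier G" if "P.alternating s vs" for s vs
      using that by (induction vs arbitrary: s) (use fac hom_in_carrier[OF j] in auto)
    then have c: "G.lprod vs \<in> carrier G" using alt by auto
    have vc: "v \<in> carrier G" using k hom_in_carrier[OF j] by simp
    have "\<theta> (G.lprod (v # vs)) [] = (\<theta> v \<otimes>\<^bsub>BijGroup (Collect reduced)\<^esub> \<theta> (G.lprod vs)) []"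
      using hom_mult[OF theta vc c] by simp
    also have "\<dots> = \<theta> v w"
      unfolding w_def by (rule BijGroup_mult_apply) (use hom_in_carrier[OF theta] vc c in auto)
    also have "\<dots> = act t k w" using theta_j[OF k(2)] k(1) w(1) by (simp add: action_def)
    also have "\<dots> = (t, k) # w" using w(2) kn by (cases w rule: reduced.cases) auto
    finally show ?case using w k kn by simp
  qed
  show "free_product G (j True ` carrier (K True)) (j False ` carrier (K False))"
  proof unfold_locales
    fix t vs assume "P.alternating t vs" "vs \<noteq> []"
    then have "\<theta> (G.lprod vs) [] \<noteq> []" using head by blast
    then show "G.lprod vs \<noteq> \<one>\<^bsub>G\<^esub>" using one by auto
  qed
  show "inj_on (j t) (carrier (K t))"
  proof (rule inj_onI)
    fix k l assume kl: "k \<in> carrier (K t)" "l \<in> carrier (K t)" "j t k = j t l"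
    then have "action t k [] = action t l []" using theta_j by metis
    then show "k = l" by (auto simp: action_def split: if_splits)
  qed
qed

end

section \<open>Path homotopies\<close>

abbreviation unit_interval :: "real topology" where
  "unit_interval \<equiv> top_of_set {0..1}"

definition path_from_to :: "'a topology \<Rightarrow> 'a \<Rightarrow> 'a \<Rightarrow> (real \<Rightarrow> 'a) \<Rightarrow> bool" where
  "path_from_to X u v \<gamma> \<longleftrightarrow> pathin X \<gamma> \<and> \<gamma> 0 = u \<and> \<gamma> 1 = v"

definition path_homotopic :: "'a topology \<Rightarrow> 'a \<Rightarrow> 'a \<Rightarrow> (real \<Rightarrow> 'a) \<Rightarrow> (real \<Rightarrow> 'a) \<Rightarrow> bool" where
  "path_homotopic X u v = homotopic_with (\<lambda>r. r 0 = u \<and> r 1 = v) unit_interval X"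

lemma path_homotopic_refl: "path_from_to X u v \<gamma> \<Longrightarrow> path_homotopic X u v \<gamma> \<gamma>"
  by (simp add: path_homotopic_def path_from_to_def pathin_def)

lemma path_homotopic_sym: "path_homotopic X u v \<gamma> \<delta> \<Longrightarrow> path_homotopic X u v \<delta> \<gamma>"
  by (simp add: path_homotopic_def homotopic_with_sym)

lemma path_homotopic_trans:
  "path_homotopic X u v \<gamma> \<delta> \<Longrightarrow> path_homotopic X u v \<delta> \<epsilon> \<Longrightarrow> path_homotopic X u v \<gamma> \<epsilon>"
  unfolding path_homotopic_def by (rule homotopic_with_trans)

lemma path_homotopic_imp_path:
  assumes "path_homotopic X u v \<gamma> \<delta>"
  shows "path_from_to X u v \<gamma>" "path_from_to X u v \<delta>"
  using homotopic_with_imp_continuous_maps[OF assms[unfolded path_homotopic_def]]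
    homotopic_with_imp_property[OF assms[unfolded path_homotopic_def]]
  by (auto simp: path_from_to_def pathin_def)

lemma path_homotopic_eq_on:
  assumes "path_from_to X u v \<gamma>" "\<And>t. 0 \<le> t \<Longrightarrow> t \<le> 1 \<Longrightarrow> \<gamma> t = \<delta> t"
  shows "path_homotopic X u v \<gamma> \<delta>"
  unfolding path_homotopic_def
  using assms(1) assms(2)[of 0] assms(2)[of 1] assms(2)
  by (intro homotopic_with_equal) (auto simp: path_from_to_def pathin_def)

lemma path_from_to_map:
  "continuous_map X Y f \<Longrightarrow> path_from_to X u v \<gamma> \<Longrightarrow> path_from_to Y (f u) (f v) (f \<circ> \<gamma>)"
  by (auto simp: path_from_to_def pathin_def intro: continuous_map_compose)

lemma path_homotopic_map:
  "continuous_map X Y f \<Longrightarrow> path_homotopic X u v \<gamma> \<delta> \<Longrightarrow> path_homotopic Y (f u) (f v) (f \<circ> \<gamma>) (f \<circ> \<delta>)"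
  unfolding path_homotopic_def
  by (erule homotopic_with_compose_continuous_map_left) auto

lemma path_from_to_subtopology:
  "path_from_to (subtopology X S) u v \<gamma> \<longleftrightarrow> path_from_to X u v \<gamma> \<and> \<gamma> ` {0..1} \<subseteq> S"
  by (auto simp: path_from_to_def pathin_subtopology image_subset_iff)

lemma path_homotopic_subtopology:
  assumes "path_homotopic (subtopology X S) u v \<gamma> \<delta>"
  shows "path_homotopic X u v \<gamma> \<delta>"
  using path_homotopic_map[of "subtopology X S" X id, OF _ assms] by simp

lemma path_homotopic_subtopology_mono:
  assumes "path_homotopic (subtopology X S) u v \<gamma> \<delta>" "S \<subseteq> T"
  shows "path_homotopic (subtopology X T) u v \<gamma> \<delta>"
proof -
  have "continuous_map (subtopology X S) (subtopology X T) id"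
    using assms(2) by (auto simp: continuous_map_in_subtopology)
  then show ?thesis using path_homotopic_map[OF _ assms(1)] by fastforce
qed

lemma path_homotopic_of_homotopic_paths:
  assumes "homotopic_paths S p q" "continuous_map (top_of_set S) X f"
  shows "path_homotopic X (f (pathstart p)) (f (pathfinish p)) (f \<circ> p) (f \<circ> q)"
  using path_homotopic_map[OF assms(2), of "pathstart p" "pathfinish p" p q] assms(1)
  by (simp add: path_homotopic_def homotopic_paths_def pathstart_def pathfinish_def)

lemma path_homotopic_convex:
  fixes C :: "'e::real_normed_vector set"
  assumes "convex C" "continuous_map (top_of_set C) X f"
    and "continuous_on {0..1} p" "continuous_on {0..1} q" "p ` {0..1} \<subseteq> C" "q ` {0..1} \<subseteq> C"
    and "p 0 = q 0" "p 1 = q 1"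
  shows "path_homotopic X (f (p 0)) (f (p 1)) (f \<circ> p) (f \<circ> q)"
proof -
  have "homotopic_paths C p q"
  proof (rule homotopic_paths_linear)
    fix t :: real assume "t \<in> {0..1}"
    then show "closed_segment (p t) (q t) \<subseteq> C"
      using assms by (intro closed_segment_subset) auto
  qed (use assms in \<open>auto simp: path_def pathstart_def pathfinish_def\<close>)
  then show ?thesis using path_homotopic_of_homotopic_paths[OF _ assms(2), of p q]
    by (simp add: pathstart_def pathfinish_def)
qed

text \<open>The groupoid laws for concatenation up to homotopy are instances: in each case both sides are
  one path composed with two maps of the unit interval, which is convex.\<close>

lemma path_homotopic_reparametrization:
  assumes "pathin X \<gamma>" "continuous_on {0..1} f" "continuous_on {0..1} g"
    and "f ` {0..1} \<subseteq> {0..1}" "g ` {0..1} \<subseteq> {0..1}" "f 0 = g 0" "f 1 = g 1"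
  shows "path_homotopic X (\<gamma> (f 0)) (\<gamma> (f 1)) (\<gamma> \<circ> f) (\<gamma> \<circ> g)"
  using assms by (intro path_homotopic_convex[of "{0..1}"]) (auto simp: pathin_def)

subsection \<open>Operations on paths\<close>

lemma path_from_to_const: "u \<in> topspace X \<Longrightarrow> path_from_to X u u (\<lambda>_. u)"
  by (simp add: path_from_to_def pathin_const)

lemma path_from_to_topspace:
  "path_from_to X u v \<gamma> \<Longrightarrow> u \<in> topspace X \<and> v \<in> topspace X"
  unfolding path_from_to_def pathin_def
  by (metis atLeastAtMost_iff continuous_map_funspace funcset_mem order_refl topspace_euclidean_subtopology zero_le_one)

lemma homotopic_concat:
  assumes "path_homotopic X u v \<gamma> \<gamma>'" "path_homotopic X v w \<delta> \<delta>'"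
  shows "path_homotopic X u w (path_concat \<gamma> \<delta>) (path_concat \<gamma>' \<delta>')"
proof -
  let ?J = "prod_topology unit_interval unit_interval"
  obtain h where h: "continuous_map ?J X h" "\<And>x. h (0, x) = \<gamma> x" "\<And>x. h (1, x) = \<gamma>' x"
    "\<And>t. t \<in> {0..1} \<Longrightarrow> h (t, 0) = u \<and> h (t, 1) = v"
    using assms(1) unfolding path_homotopic_def homotopic_with_def by auto
  obtain k where k: "continuous_map ?J X k" "\<And>x. k (0, x) = \<delta> x" "\<And>x. k (1, x) = \<delta>' x"
    "\<And>t. t \<in> {0..1} \<Longrightarrow> k (t, 0) = v \<and> k (t, 1) = w"
    using assms(2) unfolding path_homotopic_def homotopic_with_def by auto
  define K where "K = (\<lambda>z. if snd z \<le> 1 / 2 then h (fst z, 2 * snd z) else k (fst z, 2 * snd z - 1))"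
  have J: "?J = top_of_set ({0..1} \<times> {0..1})" by (simp add: subtopology_Times)
  have "continuous_map ?J X K"
    unfolding K_def
  proof (rule continuous_map_cases_le)
    show "continuous_map ?J euclideanreal snd" "continuous_map ?J euclideanreal (\<lambda>x. 1 / 2)"
      unfolding J by (auto intro!: continuous_intros)
    have c1: "continuous_map (subtopology ?J {z \<in> topspace ?J. snd z \<le> 1 / 2}) ?J (\<lambda>z. (fst z, 2 * snd z))"
      unfolding J by (auto simp: subtopology_subtopology intro!: continuous_intros)
    show "continuous_map (subtopology ?J {z \<in> topspace ?J. snd z \<le> 1 / 2}) X (\<lambda>z. h (fst z, 2 * snd z))"
      using continuous_map_compose[OF c1 h(1)] by (simp add: comp_def)
    have c2: "continuous_map (subtopology ?J {z \<in> topspace ?J. 1 / 2 \<le> snd z}) ?J (\<lambda>z. (fst z, 2 * snd z - 1))"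
      unfolding J by (auto simp: subtopology_subtopology intro!: continuous_intros)
    show "continuous_map (subtopology ?J {z \<in> topspace ?J. 1 / 2 \<le> snd z}) X (\<lambda>z. k (fst z, 2 * snd z - 1))"
      using continuous_map_compose[OF c2 k(1)] by (simp add: comp_def)
    fix z assume z: "z \<in> topspace ?J" "snd z = 1 / 2"
    then have "fst z \<in> {0..1}" by auto
    then show "h (fst z, 2 * snd z) = k (fst z, 2 * snd z - 1)"
      using h(4)[of "fst z"] k(4)[of "fst z"] unfolding z(2) by simp
  qed
  then show ?thesis
    unfolding path_homotopic_def homotopic_with_def
    by (intro exI[of _ K]) (use h k in \<open>auto simp: K_def path_concat_def\<close>)
qed

lemma path_from_to_concat:
  "path_from_to X u v \<gamma> \<Longrightarrow> path_from_to X v w \<delta> \<Longrightarrow> path_from_to X u w (path_concat \<gamma> \<delta>)"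
  by (rule path_homotopic_imp_path(1)[OF homotopic_concat[OF path_homotopic_refl path_homotopic_refl]])

lemma path_from_to_reverse:
  assumes "path_from_to X u v \<gamma>"
  shows "path_from_to X v u (path_reverse \<gamma>)"
proof -
  have "continuous_map unit_interval unit_interval (\<lambda>t. 1 - t)" by (auto intro!: continuous_intros)
  then have "continuous_map unit_interval X (\<gamma> \<circ> (\<lambda>t. 1 - t))"
    by (rule continuous_map_compose) (use assms in \<open>simp add: path_from_to_def pathin_def\<close>)
  then show ?thesis using assms by (simp add: path_from_to_def pathin_def path_reverse_def comp_def)
qed

lemma homotopic_reverse:
  assumes "path_homotopic X u v \<gamma> \<delta>"
  shows "path_homotopic X v u (path_reverse \<gamma>) (path_reverse \<delta>)"
proof -
  have "continuous_map unit_interval unit_interval (\<lambda>t. 1 - t)" by (auto intro!: continuous_intros)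
  then have "homotopic_with (\<lambda>r. r 0 = v \<and> r 1 = u) unit_interval X (\<gamma> \<circ> (\<lambda>t. 1 - t)) (\<delta> \<circ> (\<lambda>t. 1 - t))"
    using assms unfolding path_homotopic_def
    by (intro homotopic_with_compose_continuous_map_right[where p = "\<lambda>r. r 0 = u \<and> r 1 = v"]) auto
  then show ?thesis by (simp add: path_homotopic_def path_reverse_def comp_def)
qed

lemma path_reverse_reverse [simp]: "path_reverse (path_reverse \<gamma>) = \<gamma>"
  by (simp add: path_reverse_def)

lemma homotopic_assoc:
  assumes "path_from_to X u v a" "path_from_to X v w b" "path_from_to X w z c"
  shows "path_homotopic X u z (path_concat (path_concat a b) c) (path_concat a (path_concat b c))"
proof -
  let ?r = "path_concat a (path_concat b c)"
  define f where "f t = min (min (2 * t) (t + 1 / 4)) ((t + 1) / 2)" for t :: real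
  have r: "path_from_to X u z ?r" using assms by (blast intro: path_from_to_concat)
  have l: "path_from_to X u z (path_concat (path_concat a b) c)" using assms by (blast intro: path_from_to_concat)
  have "path_homotopic X u z (path_concat (path_concat a b) c) (?r \<circ> f)"
  proof (rule path_homotopic_eq_on[OF l])
    fix t :: real assume t: "0 \<le> t" "t \<le> 1"
    consider "t \<le> 1 / 4" | "1 / 4 < t" "t \<le> 1 / 2" | "1 / 2 < t" by linarith
    then show "path_concat (path_concat a b) c t = (?r \<circ> f) t"
    proof cases
      case 1
      then have "f t = 2 * t" using t by (auto simp: f_def min_def)
      then show ?thesis using 1 t by (simp add: path_concat_def)
    next
      case 2
      then have "f t = t + 1 / 4" using t by (auto simp: f_def min_def)
      then show ?thesis using 2 t by (simp add: path_concat_def algebra_simps)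
    next
      case 3
      then have f: "f t = (t + 1) / 2" using t by (auto simp: f_def min_def field_simps)
      show ?thesis using 3 t unfolding comp_apply f
        by (simp add: path_concat_def field_simps)
    qed
  qed
  moreover have "path_homotopic X (?r (f 0)) (?r (f 1)) (?r \<circ> f) (?r \<circ> (\<lambda>t. t))"
    using r by (intro path_homotopic_reparametrization)
      (auto simp: path_from_to_def f_def min_le_iff_disj intro!: continuous_intros)
  moreover have "f 0 = 0" "f 1 = 1" by (auto simp: f_def)
  ultimately show ?thesis using r path_homotopic_trans by (auto simp: path_from_to_def comp_def)
qed

lemma homotopic_unit_left:
  assumes "path_from_to X u v \<gamma>"
  shows "path_homotopic X u v (path_concat (\<lambda>_. u) \<gamma>) \<gamma>"
proof -
  define f where "f t = max 0 (2 * t - 1)" for t :: real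
  have l: "path_from_to X u v (path_concat (\<lambda>_. u) \<gamma>)"
    using assms path_from_to_topspace path_from_to_const path_from_to_concat by metis
  have "path_homotopic X u v (path_concat (\<lambda>_. u) \<gamma>) (\<gamma> \<circ> f)"
  proof (rule path_homotopic_eq_on[OF l])
    fix t :: real assume "0 \<le> t" "t \<le> 1"
    consider "t < 1 / 2" | "t = 1 / 2" | "1 / 2 < t" by linarith
    then show "path_concat (\<lambda>_. u) \<gamma> t = (\<gamma> \<circ> f) t"
      using assms by cases (auto simp: path_concat_def f_def path_from_to_def)
  qed
  moreover have "path_homotopic X (\<gamma> (f 0)) (\<gamma> (f 1)) (\<gamma> \<circ> f) (\<gamma> \<circ> (\<lambda>t. t))"
    using assms by (intro path_homotopic_reparametrization)
      (auto simp: path_from_to_def f_def intro!: continuous_intros)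
  moreover have "f 0 = 0" "f 1 = 1" by (auto simp: f_def)
  ultimately show ?thesis using assms path_homotopic_trans by (auto simp: path_from_to_def comp_def)
qed

lemma homotopic_unit_right:
  assumes "path_from_to X u v \<gamma>"
  shows "path_homotopic X u v (path_concat \<gamma> (\<lambda>_. v)) \<gamma>"
proof -
  define f where "f t = min 1 (2 * t)" for t :: real
  have l: "path_from_to X u v (path_concat \<gamma> (\<lambda>_. v))"
    using assms path_from_to_topspace path_from_to_const path_from_to_concat by metis
  have "path_homotopic X u v (path_concat \<gamma> (\<lambda>_. v)) (\<gamma> \<circ> f)"
  proof (rule path_homotopic_eq_on[OF l])
    fix t :: real assume "0 \<le> t" "t \<le> 1"
    consider "t < 1 / 2" | "t = 1 / 2" | "1 / 2 < t" by linarith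
    then show "path_concat \<gamma> (\<lambda>_. v) t = (\<gamma> \<circ> f) t"
    proof cases
      case 2
      show ?thesis unfolding 2 using assms by (simp add: path_concat_def f_def path_from_to_def)
    qed (use assms in \<open>auto simp: path_concat_def f_def path_from_to_def\<close>)
  qed
  moreover have "path_homotopic X (\<gamma> (f 0)) (\<gamma> (f 1)) (\<gamma> \<circ> f) (\<gamma> \<circ> (\<lambda>t. t))"
    using assms by (intro path_homotopic_reparametrization)
      (auto simp: path_from_to_def f_def intro!: continuous_intros)
  moreover have "f 0 = 0" "f 1 = 1" by (auto simp: f_def)
  ultimately show ?thesis using assms path_homotopic_trans by (auto simp: path_from_to_def comp_def)
qed

lemma homotopic_inverse_right:
  assumes "path_from_to X u v \<gamma>"
  shows "path_homotopic X u u (path_concat \<gamma> (path_reverse \<gamma>)) (\<lambda>_. u)"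
proof -
  define f where "f t = min (2 * t) (2 - 2 * t)" for t :: real
  have l: "path_from_to X u u (path_concat \<gamma> (path_reverse \<gamma>))"
    using assms path_from_to_reverse path_from_to_concat by metis
  have "path_homotopic X u u (path_concat \<gamma> (path_reverse \<gamma>)) (\<gamma> \<circ> f)"
    by (rule path_homotopic_eq_on[OF l])
       (auto simp: path_concat_def f_def path_reverse_def min_def)
  moreover have "path_homotopic X (\<gamma> (f 0)) (\<gamma> (f 1)) (\<gamma> \<circ> f) (\<gamma> \<circ> (\<lambda>t. 0))"
    using assms by (intro path_homotopic_reparametrization)
      (auto simp: path_from_to_def f_def intro!: continuous_intros)
  moreover have "f 0 = 0" "f 1 = 0" by (auto simp: f_def)
  ultimately show ?thesis using assms path_homotopic_trans by (auto simp: path_from_to_def comp_def)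
qed

lemma homotopic_inverse_left:
  assumes "path_from_to X u v \<gamma>"
  shows "path_homotopic X v v (path_concat (path_reverse \<gamma>) \<gamma>) (\<lambda>_. v)"
  using homotopic_inverse_right[OF path_from_to_reverse[OF assms]] by simp

lemma comp_path_concat: "f \<circ> path_concat a b = path_concat (f \<circ> a) (f \<circ> b)"
  by (auto simp: path_concat_def)

lemma comp_path_reverse: "f \<circ> path_reverse a = path_reverse (f \<circ> a)"
  by (auto simp: path_reverse_def)

lemma image_path_concat_subset: "path_concat a b ` {0..1} \<subseteq> a ` {0..1} \<union> b ` {0..1}"
  by (auto simp: path_concat_def)

text \<open>The path \<open>\<gamma>\<close> is carried over to new end points along \<open>\<alpha>\<close> and \<open>\<beta>\<close>. For \<open>\<alpha> = \<beta>\<close> this is the usual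
  change of base point; different ends are needed to turn arbitrary paths into loops.\<close>

definition twist :: "(real \<Rightarrow> 'a) \<Rightarrow> (real \<Rightarrow> 'a) \<Rightarrow> (real \<Rightarrow> 'a) \<Rightarrow> real \<Rightarrow> 'a" where
  "twist \<alpha> \<gamma> \<beta> = path_concat \<alpha> (path_concat \<gamma> (path_reverse \<beta>))"

lemma path_from_to_twist:
  "path_from_to X p u \<alpha> \<Longrightarrow> path_from_to X u v \<gamma> \<Longrightarrow> path_from_to X q v \<beta> \<Longrightarrow>
   path_from_to X p q (twist \<alpha> \<gamma> \<beta>)"
  unfolding twist_def by (intro path_from_to_concat path_from_to_reverse)

lemma homotopic_twist:
  "path_homotopic X p u \<alpha> \<alpha>' \<Longrightarrow> path_homotopic X u v \<gamma> \<gamma>' \<Longrightarrow> path_homotopic X q v \<beta> \<beta>' \<Longrightarrow>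
   path_homotopic X p q (twist \<alpha> \<gamma> \<beta>) (twist \<alpha>' \<gamma>' \<beta>')"
  unfolding twist_def by (intro homotopic_concat homotopic_reverse)

lemma comp_twist: "f \<circ> twist a b c = twist (f \<circ> a) (f \<circ> b) (f \<circ> c)"
  by (simp add: twist_def comp_path_concat comp_path_reverse)

lemma homotopic_cancel_left:
  assumes "path_from_to X u v \<beta>" "path_from_to X v w \<delta>"
  shows "path_homotopic X v w (path_concat (path_reverse \<beta>) (path_concat \<beta> \<delta>)) \<delta>"
proof -
  note rb = path_from_to_reverse[OF assms(1)]
  have "path_homotopic X v w (path_concat (path_reverse \<beta>) (path_concat \<beta> \<delta>))
     (path_concat (path_concat (path_reverse \<beta>) \<beta>) \<delta>)"
    by (rule path_homotopic_sym[OF homotopic_assoc[OF rb assms]])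
  moreover have "path_homotopic X v w (path_concat (path_concat (path_reverse \<beta>) \<beta>) \<delta>) (path_concat (\<lambda>_. v) \<delta>)"
    by (intro homotopic_concat[OF homotopic_inverse_left[OF assms(1)]] path_homotopic_refl assms(2))
  ultimately show ?thesis using homotopic_unit_left[OF assms(2)] path_homotopic_trans by metis
qed

lemma twist_mult:
  assumes a: "path_from_to X p u \<alpha>" and g: "path_from_to X u v \<gamma>" and b: "path_from_to X q v \<beta>"
    and d: "path_from_to X v w \<delta>" and k: "path_from_to X r w \<kappa>"
  shows "path_homotopic X p r (path_concat (twist \<alpha> \<gamma> \<beta>) (twist \<beta> \<delta> \<kappa>)) (twist \<alpha> (path_concat \<gamma> \<delta>) \<kappa>)"
proof -
  note rb = path_from_to_reverse[OF b] and rk = path_from_to_reverse[OF k]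
  note dk = path_from_to_concat[OF d rk]
  note bdk = path_from_to_concat[OF b dk]
  note gb = path_from_to_concat[OF g rb]
  note refl = path_homotopic_refl
  have "path_homotopic X p r (path_concat (twist \<alpha> \<gamma> \<beta>) (twist \<beta> \<delta> \<kappa>))
      (path_concat \<alpha> (path_concat (path_concat \<gamma> (path_reverse \<beta>)) (twist \<beta> \<delta> \<kappa>)))"
    unfolding twist_def by (rule homotopic_assoc[OF a gb bdk])
  moreover have "path_homotopic X p r \<dots>
      (path_concat \<alpha> (path_concat \<gamma> (path_concat (path_reverse \<beta>) (twist \<beta> \<delta> \<kappa>))))"
    unfolding twist_def by (rule homotopic_concat[OF refl[OF a] homotopic_assoc[OF g rb bdk]])
  moreover have "path_homotopic X p r \<dots> (path_concat \<alpha> (path_concat \<gamma> (path_concat \<delta> (path_reverse \<kappa>))))"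
    unfolding twist_def
    by (rule homotopic_concat[OF refl[OF a] homotopic_concat[OF refl[OF g] homotopic_cancel_left[OF b dk]]])
  moreover have "path_homotopic X p r \<dots> (twist \<alpha> (path_concat \<gamma> \<delta>) \<kappa>)"
    unfolding twist_def
    by (rule homotopic_concat[OF refl[OF a] path_homotopic_sym[OF homotopic_assoc[OF g d rk]]])
  ultimately show ?thesis by (meson path_homotopic_trans)
qed

lemma twist_twist:
  assumes a: "path_from_to X p u \<alpha>" and b: "path_from_to X u v \<beta>" and g: "path_from_to X v v' \<gamma>"
    and b': "path_from_to X u' v' \<beta>'" and a': "path_from_to X p' u' \<alpha>'"
  shows "path_homotopic X p p' (twist \<alpha> (twist \<beta> \<gamma> \<beta>') \<alpha>')
    (twist (path_concat \<alpha> \<beta>) \<gamma> (path_concat \<alpha>' \<beta>'))"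
proof -
  note ra = path_from_to_reverse[OF a'] and rb = path_from_to_reverse[OF b']
  note grb = path_from_to_concat[OF g rb]
  note ab = path_from_to_concat[OF a' b']
  note rab = path_from_to_concat[OF rb ra]
  note refl = path_homotopic_refl
  have rev: "path_homotopic X v' p' (path_concat (path_reverse \<beta>') (path_reverse \<alpha>')) (path_reverse (path_concat \<alpha>' \<beta>'))"
    by (rule path_homotopic_eq_on[OF rab])
       (use a' b' in \<open>auto simp: path_concat_def path_reverse_def path_from_to_def algebra_simps field_simps\<close>)
  have "path_homotopic X p p' (twist \<alpha> (twist \<beta> \<gamma> \<beta>') \<alpha>')
     (path_concat \<alpha> (path_concat \<beta> (path_concat (path_concat \<gamma> (path_reverse \<beta>')) (path_reverse \<alpha>'))))"
    unfolding twist_def by (rule homotopic_concat[OF refl[OF a] homotopic_assoc[OF b grb ra]])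
  moreover have "path_homotopic X p p' \<dots>
     (path_concat \<alpha> (path_concat \<beta> (path_concat \<gamma> (path_concat (path_reverse \<beta>') (path_reverse \<alpha>')))))"
    by (rule homotopic_concat[OF refl[OF a] homotopic_concat[OF refl[OF b] homotopic_assoc[OF g rb ra]]])
  moreover have "path_homotopic X p p' \<dots>
     (path_concat \<alpha> (path_concat \<beta> (path_concat \<gamma> (path_reverse (path_concat \<alpha>' \<beta>')))))"
    by (rule homotopic_concat[OF refl[OF a] homotopic_concat[OF refl[OF b] homotopic_concat[OF refl[OF g] rev]]])
  moreover have "path_homotopic X p p' \<dots> (twist (path_concat \<alpha> \<beta>) \<gamma> (path_concat \<alpha>' \<beta>'))"
    unfolding twist_def
    by (rule path_homotopic_sym[OF homotopic_assoc[OF a b path_from_to_concat[OF g path_from_to_reverse[OF ab]]]])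
  ultimately show ?thesis by (meson path_homotopic_trans)
qed

lemma twist_const:
  assumes "path_from_to X u v \<gamma>"
  shows "path_homotopic X u v (twist (\<lambda>_. u) \<gamma> (\<lambda>_. v)) \<gamma>"
proof -
  have r: "path_reverse (\<lambda>_. v) = (\<lambda>_. v)" by (simp add: path_reverse_def)
  have c: "path_from_to X u v (path_concat \<gamma> (\<lambda>_. v))"
    using path_homotopic_imp_path(1)[OF homotopic_unit_right[OF assms]] .
  show ?thesis unfolding twist_def r
    using path_homotopic_trans[OF homotopic_unit_left[OF c] homotopic_unit_right[OF assms]] .
qed

section \<open>The fundamental group\<close>

lemma loop_class_alt: "loop_class X p \<gamma> = {\<delta>. path_homotopic X p p \<gamma> \<delta>}"
  by (simp add: loop_class_def path_homotopic_def)

lemma is_loop_alt: "is_loop X p \<gamma> \<longleftrightarrow> path_from_to X p p \<gamma>"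
  by (auto simp: is_loop_def path_from_to_def)

lemma loop_class_eqI: "path_homotopic X p p \<gamma> \<delta> \<Longrightarrow> loop_class X p \<gamma> = loop_class X p \<delta>"
  unfolding loop_class_alt by (blast intro: path_homotopic_sym path_homotopic_trans)

lemma loop_class_self: "path_from_to X p p \<gamma> \<Longrightarrow> \<gamma> \<in> loop_class X p \<gamma>"
  by (simp add: loop_class_alt path_homotopic_refl)

lemma fundamental_group_carrier:
  "c \<in> carrier (fundamental_group X p) \<longleftrightarrow> (\<exists>\<gamma>. path_from_to X p p \<gamma> \<and> c = loop_class X p \<gamma>)"
  by (auto simp: fundamental_group_def is_loop_alt)

lemma loop_class_carrier: "path_from_to X p p \<gamma> \<Longrightarrow> loop_class X p \<gamma> \<in> carrier (fundamental_group X p)"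
  by (auto simp: fundamental_group_carrier)

lemma fundamental_group_one: "\<one>\<^bsub>fundamental_group X p\<^esub> = loop_class X p (\<lambda>_. p)"
  by (simp add: fundamental_group_def)

lemma fundamental_group_mult:
  assumes "path_from_to X p p \<gamma>" "path_from_to X p p \<delta>"
  shows "loop_class X p \<gamma> \<otimes>\<^bsub>fundamental_group X p\<^esub> loop_class X p \<delta> = loop_class X p (path_concat \<gamma> \<delta>)"
proof -
  have "loop_class X p (path_concat \<gamma>' \<delta>') = loop_class X p (path_concat \<gamma> \<delta>)"
    if "\<gamma>' \<in> loop_class X p \<gamma>" "\<delta>' \<in> loop_class X p \<delta>" for \<gamma>' \<delta>'
    using that by (intro loop_class_eqI path_homotopic_sym[OF homotopic_concat]) (auto simp: loop_class_alt)
  then have "(\<Union>\<gamma>'\<in>loop_class X p \<gamma>. \<Union>\<delta>'\<in>loop_class X p \<delta>. loop_class X p (path_concat \<gamma>' \<delta>'))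
      = (\<Union>\<gamma>'\<in>loop_class X p \<gamma>. \<Union>\<delta>'\<in>loop_class X p \<delta>. loop_class X p (path_concat \<gamma> \<delta>))"
    by (intro SUP_cong refl) auto
  also have "\<dots> = loop_class X p (path_concat \<gamma> \<delta>)"
    using loop_class_self[OF assms(1)] loop_class_self[OF assms(2)] by blast
  finally show ?thesis by (simp add: fundamental_group_def)
qed

lemma group_fundamental_group:
  assumes "p \<in> topspace X"
  shows "group (fundamental_group X p)"
proof (rule groupI)
  let ?G = "fundamental_group X p"
  have c: "path_from_to X p p (\<lambda>_. p)" by (rule path_from_to_const[OF assms])
  show "\<one>\<^bsub>?G\<^esub> \<in> carrier ?G" using c by (auto simp: fundamental_group_one fundamental_group_carrier)
  fix x assume "x \<in> carrier ?G"
  then obtain a where a: "path_from_to X p p a" "x = loop_class X p a" by (auto simp: fundamental_group_carrier)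
  show "\<one>\<^bsub>?G\<^esub> \<otimes>\<^bsub>?G\<^esub> x = x"
    by (simp add: a(2) fundamental_group_one fundamental_group_mult[OF c a(1)] loop_class_eqI[OF homotopic_unit_left[OF a(1)]])
  have "loop_class X p (path_reverse a) \<otimes>\<^bsub>?G\<^esub> x = \<one>\<^bsub>?G\<^esub>"
    by (simp add: a(2) fundamental_group_one fundamental_group_mult[OF path_from_to_reverse[OF a(1)] a(1)]
        loop_class_eqI[OF homotopic_inverse_left[OF a(1)]])
  then show "\<exists>y\<in>carrier ?G. y \<otimes>\<^bsub>?G\<^esub> x = \<one>\<^bsub>?G\<^esub>"
    using loop_class_carrier[OF path_from_to_reverse[OF a(1)]] by blast
  fix y assume "y \<in> carrier ?G"
  then obtain b where b: "path_from_to X p p b" "y = loop_class X p b" by (auto simp: fundamental_group_carrier)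
  show "x \<otimes>\<^bsub>?G\<^esub> y \<in> carrier ?G"
    using loop_class_carrier[OF path_from_to_concat[OF a(1) b(1)]] by (simp add: a b fundamental_group_mult)
  fix z assume "z \<in> carrier ?G"
  then obtain d where d: "path_from_to X p p d" "z = loop_class X p d" by (auto simp: fundamental_group_carrier)
  show "x \<otimes>\<^bsub>?G\<^esub> y \<otimes>\<^bsub>?G\<^esub> z = x \<otimes>\<^bsub>?G\<^esub> (y \<otimes>\<^bsub>?G\<^esub> z)"
    unfolding a(2) b(2) d(2) fundamental_group_mult[OF a(1) b(1)] fundamental_group_mult[OF b(1) d(1)]
      fundamental_group_mult[OF path_from_to_concat[OF a(1) b(1)] d(1)]
      fundamental_group_mult[OF a(1) path_from_to_concat[OF b(1) d(1)]]
    by (rule loop_class_eqI[OF homotopic_assoc[OF a(1) b(1) d(1)]])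
qed

definition representative :: "(real \<Rightarrow> 'a) set \<Rightarrow> real \<Rightarrow> 'a" where
  "representative c = (SOME \<gamma>. \<gamma> \<in> c)"

lemma representative_homotopic:
  assumes "path_from_to X p p \<gamma>"
  shows "path_homotopic X p p \<gamma> (representative (loop_class X p \<gamma>))"
  using someI[of "\<lambda>\<delta>. \<delta> \<in> loop_class X p \<gamma>", OF loop_class_self[OF assms]]
  by (simp add: representative_def loop_class_alt)

lemma representative_carrier:
  assumes "c \<in> carrier (fundamental_group X p)"
  shows "path_from_to X p p (representative c)" "loop_class X p (representative c) = c"
proof -
  obtain \<gamma> where g: "path_from_to X p p \<gamma>" "c = loop_class X p \<gamma>"
    using assms by (auto simp: fundamental_group_carrier)
  have h: "path_homotopic X p p \<gamma> (representative c)" using representative_homotopic[OF g(1)] g(2) by simp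
  show "path_from_to X p p (representative c)" using path_homotopic_imp_path(2)[OF h] .
  show "loop_class X p (representative c) = c" using loop_class_eqI[OF h] g(2) by simp
qed

text \<open>Homomorphisms out of the fundamental group are given by homotopy invariant, multiplicative
  functions of loops. Induced maps, changes of base point and the homomorphism of the theorem of Seifert
  and van Kampen are obtained in this way.\<close>

lemma hom_of_loop_functional:
  assumes cl: "\<And>\<gamma>. path_from_to X p p \<gamma> \<Longrightarrow> F \<gamma> \<in> carrier H"
    and inv: "\<And>\<gamma> \<delta>. path_homotopic X p p \<gamma> \<delta> \<Longrightarrow> F \<gamma> = F \<delta>"
    and mult: "\<And>\<gamma> \<delta>. path_from_to X p p \<gamma> \<Longrightarrow> path_from_to X p p \<delta> \<Longrightarrow> F (path_concat \<gamma> \<delta>) = F \<gamma> \<otimes>\<^bsub>H\<^esub> F \<delta>"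
  shows "(\<lambda>c. F (representative c)) \<in> hom (fundamental_group X p) H"
    and "path_from_to X p p \<gamma> \<Longrightarrow> F (representative (loop_class X p \<gamma>)) = F \<gamma>"
proof -
  show val: "F (representative (loop_class X p \<gamma>)) = F \<gamma>" if "path_from_to X p p \<gamma>" for \<gamma>
    using inv[OF representative_homotopic[OF that]] by simp
  show "(\<lambda>c. F (representative c)) \<in> hom (fundamental_group X p) H"
  proof (rule homI)
    fix c assume "c \<in> carrier (fundamental_group X p)"
    then show "F (representative c) \<in> carrier H" using cl[OF representative_carrier(1)] by simp
  next
    fix c d assume "c \<in> carrier (fundamental_group X p)" "d \<in> carrier (fundamental_group X p)"
    then obtain \<gamma> \<delta> where "path_from_to X p p \<gamma>" "c = loop_class X p \<gamma>" "path_from_to X p p \<delta>" "d = loop_class X p \<delta>"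
      by (auto simp: fundamental_group_carrier)
    then show "F (representative (c \<otimes>\<^bsub>fundamental_group X p\<^esub> d)) = F (representative c) \<otimes>\<^bsub>H\<^esub> F (representative d)"
      by (simp add: fundamental_group_mult val path_from_to_concat mult)
  qed
qed

definition induced_map :: "'b topology \<Rightarrow> 'b \<Rightarrow> ('a \<Rightarrow> 'b) \<Rightarrow> (real \<Rightarrow> 'a) set \<Rightarrow> (real \<Rightarrow> 'b) set" where
  "induced_map Y q f c = loop_class Y q (f \<circ> representative c)"

lemma induced_map:
  assumes f: "continuous_map X Y f" and q: "f p = q"
  shows "induced_map Y q f \<in> hom (fundamental_group X p) (fundamental_group Y q)"
    and "path_from_to X p p \<gamma> \<Longrightarrow> induced_map Y q f (loop_class X p \<gamma>) = loop_class Y q (f \<circ> \<gamma>)"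
proof -
  have 1: "loop_class Y q (f \<circ> \<gamma>) \<in> carrier (fundamental_group Y q)" if "path_from_to X p p \<gamma>" for \<gamma>
    using path_from_to_map[OF f that] q loop_class_carrier by auto
  have 2: "loop_class Y q (f \<circ> \<gamma>) = loop_class Y q (f \<circ> \<delta>)" if "path_homotopic X p p \<gamma> \<delta>" for \<gamma> \<delta>
    using loop_class_eqI[OF path_homotopic_map[OF f that]] q by simp
  have 3: "loop_class Y q (f \<circ> path_concat \<gamma> \<delta>) =
     loop_class Y q (f \<circ> \<gamma>) \<otimes>\<^bsub>fundamental_group Y q\<^esub> loop_class Y q (f \<circ> \<delta>)"
    if "path_from_to X p p \<gamma>" "path_from_to X p p \<delta>" for \<gamma> \<delta>
    using fundamental_group_mult[OF path_from_to_map[OF f that(1)] path_from_to_map[OF f that(2)]] q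
    by (simp add: comp_path_concat)
  show "induced_map Y q f \<in> hom (fundamental_group X p) (fundamental_group Y q)"
    using hom_of_loop_functional(1)[of X p "\<lambda>\<gamma>. loop_class Y q (f \<circ> \<gamma>)", OF 1 2 3]
    unfolding induced_map_def[abs_def] .
  show "path_from_to X p p \<gamma> \<Longrightarrow> induced_map Y q f (loop_class X p \<gamma>) = loop_class Y q (f \<circ> \<gamma>)"
    using hom_of_loop_functional(2)[of X p "\<lambda>\<gamma>. loop_class Y q (f \<circ> \<gamma>)", OF 1 2 3]
    unfolding induced_map_def .
qed

definition base_change :: "'a topology \<Rightarrow> 'a \<Rightarrow> (real \<Rightarrow> 'a) \<Rightarrow> (real \<Rightarrow> 'a) set \<Rightarrow> (real \<Rightarrow> 'a) set" where
  "base_change X p \<omega> c = loop_class X p (twist \<omega> (representative c) \<omega>)"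

lemma base_change:
  assumes w: "path_from_to X p q \<omega>"
  shows "base_change X p \<omega> \<in> hom (fundamental_group X q) (fundamental_group X p)"
    and "path_from_to X q q \<gamma> \<Longrightarrow> base_change X p \<omega> (loop_class X q \<gamma>) = loop_class X p (twist \<omega> \<gamma> \<omega>)"
proof -
  have 1: "loop_class X p (twist \<omega> \<gamma> \<omega>) \<in> carrier (fundamental_group X p)" if "path_from_to X q q \<gamma>" for \<gamma>
    by (rule loop_class_carrier[OF path_from_to_twist[OF w that w]])
  have 2: "loop_class X p (twist \<omega> \<gamma> \<omega>) = loop_class X p (twist \<omega> \<delta> \<omega>)" if "path_homotopic X q q \<gamma> \<delta>" for \<gamma> \<delta>
    by (rule loop_class_eqI[OF homotopic_twist[OF path_homotopic_refl[OF w] that path_homotopic_refl[OF w]]])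
  have 3: "loop_class X p (twist \<omega> (path_concat \<gamma> \<delta>) \<omega>) =
     loop_class X p (twist \<omega> \<gamma> \<omega>) \<otimes>\<^bsub>fundamental_group X p\<^esub> loop_class X p (twist \<omega> \<delta> \<omega>)"
    if "path_from_to X q q \<gamma>" "path_from_to X q q \<delta>" for \<gamma> \<delta>
    using fundamental_group_mult[OF path_from_to_twist[OF w that(1) w] path_from_to_twist[OF w that(2) w]]
      loop_class_eqI[OF twist_mult[OF w that(1) w that(2) w]] by simp
  show "base_change X p \<omega> \<in> hom (fundamental_group X q) (fundamental_group X p)"
    using hom_of_loop_functional(1)[of X q "\<lambda>\<gamma>. loop_class X p (twist \<omega> \<gamma> \<omega>)", OF 1 2 3]
    unfolding base_change_def[abs_def] .
  show "path_from_to X q q \<gamma> \<Longrightarrow> base_change X p \<omega> (loop_class X q \<gamma>) = loop_class X p (twist \<omega> \<gamma> \<omega>)"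
    using hom_of_loop_functional(2)[of X q "\<lambda>\<gamma>. loop_class X p (twist \<omega> \<gamma> \<omega>)", OF 1 2 3]
    unfolding base_change_def .
qed

lemma base_change_compose:
  assumes w: "path_from_to X p q \<omega>" and v: "path_from_to X q r \<nu>" and c: "c \<in> carrier (fundamental_group X r)"
  shows "base_change X p \<omega> (base_change X q \<nu> c) = base_change X p (path_concat \<omega> \<nu>) c"
proof -
  obtain \<gamma> where g: "path_from_to X r r \<gamma>" "c = loop_class X r \<gamma>" using c by (auto simp: fundamental_group_carrier)
  show ?thesis unfolding g(2) base_change(2)[OF v g(1)] base_change(2)[OF w path_from_to_twist[OF v g(1) v]]
      base_change(2)[OF path_from_to_concat[OF w v] g(1)]
    by (rule loop_class_eqI[OF twist_twist[OF w v g(1) v w]])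
qed

lemma base_change_loop:
  assumes "path_from_to X p p \<omega>" "c \<in> carrier (fundamental_group X p)"
  shows "base_change X p \<omega> c = loop_class X p \<omega> \<otimes>\<^bsub>fundamental_group X p\<^esub> c \<otimes>\<^bsub>fundamental_group X p\<^esub> inv\<^bsub>fundamental_group X p\<^esub> (loop_class X p \<omega>)"
proof -
  let ?G = "fundamental_group X p"
  have p: "p \<in> topspace X" using path_from_to_topspace[OF assms(1)] by simp
  interpret group ?G by (rule group_fundamental_group[OF p])
  obtain \<gamma> where g: "path_from_to X p p \<gamma>" "c = loop_class X p \<gamma>" using assms(2) by (auto simp: fundamental_group_carrier)
  note rw = path_from_to_reverse[OF assms(1)]
  have "loop_class X p (path_reverse \<omega>) \<otimes>\<^bsub>?G\<^esub> loop_class X p \<omega> = \<one>\<^bsub>?G\<^esub>"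
    by (simp add: fundamental_group_one fundamental_group_mult[OF rw assms(1)]
        loop_class_eqI[OF homotopic_inverse_left[OF assms(1)]])
  then have i: "inv\<^bsub>?G\<^esub> (loop_class X p \<omega>) = loop_class X p (path_reverse \<omega>)"
    by (rule inv_equality[OF _ loop_class_carrier[OF assms(1)] loop_class_carrier[OF rw]])
  show ?thesis
    unfolding i g(2) base_change(2)[OF assms(1) g(1)] twist_def
    using loop_class_carrier[OF rw] loop_class_carrier[OF assms(1)] loop_class_carrier[OF g(1)]
    by (simp add: m_assoc fundamental_group_mult[OF g(1) rw] fundamental_group_mult[OF assms(1) path_from_to_concat[OF g(1) rw]])
qed

lemma base_change_homotopic:
  assumes "path_homotopic X p q \<omega> \<omega>'" "c \<in> carrier (fundamental_group X q)"
  shows "base_change X p \<omega> c = base_change X p \<omega>' c"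
proof -
  obtain \<gamma> where g: "path_from_to X q q \<gamma>" "c = loop_class X q \<gamma>" using assms(2) by (auto simp: fundamental_group_carrier)
  show ?thesis unfolding g(2) base_change(2)[OF path_homotopic_imp_path(1)[OF assms(1)] g(1)]
      base_change(2)[OF path_homotopic_imp_path(2)[OF assms(1)] g(1)]
    by (rule loop_class_eqI[OF homotopic_twist[OF assms(1) path_homotopic_refl[OF g(1)] assms(1)]])
qed

lemma base_change_const:
  assumes c: "c \<in> carrier (fundamental_group X p)"
  shows "base_change X p (\<lambda>_. p) c = c"
proof -
  obtain \<gamma> where g: "path_from_to X p p \<gamma>" "c = loop_class X p \<gamma>" using c by (auto simp: fundamental_group_carrier)
  have "path_from_to X p p (\<lambda>_. p)" by (rule path_from_to_const) (use path_from_to_topspace[OF g(1)] in simp)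
  then show ?thesis unfolding g(2)
    using base_change(2)[OF _ g(1)] loop_class_eqI[OF twist_const[OF g(1)]] by simp
qed

lemma base_change_inverse:
  assumes w: "path_from_to X p q \<omega>" and c: "c \<in> carrier (fundamental_group X q)"
  shows "base_change X q (path_reverse \<omega>) (base_change X p \<omega> c) = c"
  using base_change_compose[OF path_from_to_reverse[OF w] w c]
    base_change_homotopic[OF homotopic_inverse_left[OF w] c] base_change_const[OF c] by simp

lemma base_change_bij:
  assumes w: "path_from_to X p q \<omega>"
  shows "bij_betw (base_change X p \<omega>) (carrier (fundamental_group X q)) (carrier (fundamental_group X p))"
proof (rule bij_betw_byWitness[where f' = "base_change X q (path_reverse \<omega>)"])
  note rw = path_from_to_reverse[OF w]
  show "base_change X p \<omega> ` carrier (fundamental_group X q) \<subseteq> carrier (fundamental_group X p)"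
    using base_change(1)[OF w] by (auto simp: hom_def)
  show "base_change X q (path_reverse \<omega>) ` carrier (fundamental_group X p) \<subseteq> carrier (fundamental_group X q)"
    using base_change(1)[OF rw] by (auto simp: hom_def)
  show "\<forall>c\<in>carrier (fundamental_group X q). base_change X q (path_reverse \<omega>) (base_change X p \<omega> c) = c"
    using base_change_inverse[OF w] by blast
  show "\<forall>c\<in>carrier (fundamental_group X p). base_change X p \<omega> (base_change X q (path_reverse \<omega>) c) = c"
    using base_change_inverse[OF rw] by simp
qed

section \<open>Local-to-global principle for functionals on paths\<close>

definition segment :: "(real \<Rightarrow> 'a) \<Rightarrow> real \<Rightarrow> real \<Rightarrow> real \<Rightarrow> 'a" where
  "segment \<gamma> s t = (\<lambda>r. \<gamma> (s + (t - s) * r))"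

lemma affine_in_interval:
  fixes s t r :: real
  assumes "s \<le> t" "0 \<le> r" "r \<le> 1"
  shows "s \<le> s + (t - s) * r" "s + (t - s) * r \<le> t"
proof -
  have "(t - s) * r \<le> (t - s) * 1" using assms by (intro mult_left_mono) auto
  then show "s + (t - s) * r \<le> t" by simp
  show "s \<le> s + (t - s) * r" using assms by simp
qed

lemma segment_image: "s \<le> t \<Longrightarrow> segment \<gamma> s t ` {0..1} \<subseteq> \<gamma> ` {s..t}"
  using affine_in_interval[of s t] by (fastforce simp: segment_def)

lemma path_concat_joinpaths: "path_concat a b = a +++ b"
  by (simp add: path_concat_def joinpaths_def)

lemma (in group) lprod_upt_Suc:
  assumes "\<And>i. i \<le> n \<Longrightarrow> f i \<in> carrier G"
  shows "lprod (map f [0..<Suc n]) = lprod (map f [0..<n]) \<otimes> f n"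
proof -
  have "lprod (map f [0..<Suc n]) = lprod (map f [0..<n] @ [f n])" by simp
  also have "\<dots> = lprod (map f [0..<n]) \<otimes> lprod [f n]" using assms by (intro lprod_append) auto
  finally show ?thesis using assms[of n] by simp
qed

lemma (in group) lprod_blocks:
  assumes "\<And>i. f i \<in> carrier G"
  shows "lprod (map f [0..<N * M]) = lprod (map (\<lambda>i. lprod (map (\<lambda>j. f (i * M + j)) [0..<M])) [0..<N])"
proof (induction N)
  case (Suc N)
  have "[0..<Suc N * M] = [0..<N * M] @ map (\<lambda>j. N * M + j) [0..<M]"
    using upt_add_eq_append[of 0 "N * M" M] map_add_upt[of "N * M" M] by (simp add: add.commute)
  then have "map f [0..<Suc N * M] = map f [0..<N * M] @ map (\<lambda>j. f (N * M + j)) [0..<M]"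
    by (simp only: map_append map_map comp_def)
  then have "lprod (map f [0..<Suc N * M]) = lprod (map f [0..<N * M] @ map (\<lambda>j. f (N * M + j)) [0..<M])"
    by (rule arg_cong)
  also have "\<dots> = lprod (map f [0..<N * M]) \<otimes> lprod (map (\<lambda>j. f (N * M + j)) [0..<M])"
    using assms by (intro lprod_append) auto
  also have "\<dots> = lprod (map (\<lambda>i. lprod (map (\<lambda>j. f (i * M + j)) [0..<M])) [0..<Suc N])"
    unfolding Suc.IH by (rule lprod_upt_Suc[symmetric]) (use assms in \<open>auto intro!: lprod_closed\<close>)
  finally show ?case .
qed simp

text \<open>A functional of paths, multiplicative and homotopy invariant, that is defined for the paths inside
  each of two open sets and unambiguous on their intersection, extends to all paths: cut a path into
  pieces that lie in one of the two sets and multiply the values. This is the theorem of Seifert and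
  van Kampen for the fundamental groupoid.\<close>

locale path_functional = group H for H :: "('h, 'n) monoid_scheme" (structure) +
  fixes Z :: "'a topology" and U :: "bool \<Rightarrow> 'a set" and F :: "bool \<Rightarrow> (real \<Rightarrow> 'a) \<Rightarrow> 'h"
  assumes open_U: "\<And>t. openin Z (U t)" and cover: "topspace Z = U True \<union> U False"
    and F_closed: "\<And>t u v \<gamma>. path_from_to (subtopology Z (U t)) u v \<gamma> \<Longrightarrow> F t \<gamma> \<in> carrier H"
    and F_homotopic: "\<And>t u v \<gamma> \<delta>. path_homotopic (subtopology Z (U t)) u v \<gamma> \<delta> \<Longrightarrow> F t \<gamma> = F t \<delta>"
    and F_concat: "\<And>t u v w \<gamma> \<delta>. path_from_to (subtopology Z (U t)) u v \<gamma> \<Longrightarrow>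
       path_from_to (subtopology Z (U t)) v w \<delta> \<Longrightarrow> F t (path_concat \<gamma> \<delta>) = F t \<gamma> \<otimes> F t \<delta>"
    and F_agree: "\<And>u v \<gamma>. path_from_to (subtopology Z (U True \<inter> U False)) u v \<gamma> \<Longrightarrow> F True \<gamma> = F False \<gamma>"
begin

text \<open>For a path inside both open sets the choice is immaterial by \<open>F_agree\<close>; the value is meaningful only
  if the path lies in one of them.\<close>

definition small :: "(real \<Rightarrow> 'a) \<Rightarrow> 'h" where
  "small \<gamma> = (if \<gamma> ` {0..1} \<subseteq> U True then F True \<gamma> else F False \<gamma>)"

lemma small_eq:
  assumes "path_from_to (subtopology Z (U t)) u v \<gamma>"
  shows "small \<gamma> = F t \<gamma>"
proof (cases "t \<or> \<not> \<gamma> ` {0..1} \<subseteq> U True")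
  case True
  then show ?thesis using assms by (cases t) (auto simp: small_def path_from_to_subtopology)
next
  case False
  then have "path_from_to (subtopology Z (U True \<inter> U False)) u v \<gamma>"
    using assms by (simp add: path_from_to_subtopology)
  then show ?thesis using F_agree False by (simp add: small_def)
qed

lemma segment_path:
  assumes "pathin Z \<gamma>" "0 \<le> s" "s \<le> t" "t \<le> 1" "\<gamma> ` {s..t} \<subseteq> U b"
  shows "path_from_to (subtopology Z (U b)) (\<gamma> s) (\<gamma> t) (segment \<gamma> s t)"
proof -
  have "continuous_map unit_interval unit_interval (\<lambda>r. s + (t - s) * r)"
    using affine_in_interval[OF assms(3)] assms(2,4) by (auto intro!: continuous_intros) (smt (verit))+
  then have "pathin Z (segment \<gamma> s t)"
    using continuous_map_compose[of unit_interval unit_interval _ Z \<gamma>] assms(1)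
    by (auto simp: pathin_def segment_def comp_def)
  then show ?thesis
    unfolding path_from_to_subtopology using segment_image[OF assms(3), of \<gamma>] assms(5)
    by (simp add: path_from_to_def segment_def)
qed

lemma small_segment_closed:
  assumes "pathin Z \<gamma>" "0 \<le> s" "s \<le> t" "t \<le> 1" "\<gamma> ` {s..t} \<subseteq> U b"
  shows "small (segment \<gamma> s t) \<in> carrier H"
  using small_eq[OF segment_path[OF assms]] F_closed[OF segment_path[OF assms]] by simp

lemma small_segment_mult:
  assumes g: "pathin Z \<gamma>" and st: "0 \<le> s" "s \<le> t" "t \<le> u" "u \<le> 1" and im: "\<gamma> ` {s..u} \<subseteq> U b"
  shows "small (segment \<gamma> s t) \<otimes> small (segment \<gamma> t u) = small (segment \<gamma> s u)"
proof -
  let ?S = "subtopology Z (U b)"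
  have im': "\<gamma> ` {s..t} \<subseteq> U b" "\<gamma> ` {t..u} \<subseteq> U b" using im st by auto
  have p1: "path_from_to ?S (\<gamma> s) (\<gamma> t) (segment \<gamma> s t)" using segment_path g st im' by simp
  have p2: "path_from_to ?S (\<gamma> t) (\<gamma> u) (segment \<gamma> t u)" using segment_path g st im' by simp
  have p3: "path_from_to ?S (\<gamma> s) (\<gamma> u) (segment \<gamma> s u)" using segment_path g st im by simp
  define q where "q r = s + (t - s) * min 1 (2 * r) + (u - t) * max 0 (2 * r - 1)" for r :: real
  have q_in: "s \<le> q r \<and> q r \<le> u" if r: "0 \<le> r" "r \<le> 1" for r
  proof -
    define a b where "a = min 1 (2 * r)" and "b = max 0 (2 * r - 1)"
    have ab: "0 \<le> a" "a \<le> 1" "0 \<le> b" "b \<le> 1" using r by (auto simp: a_def b_def)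
    have 1: "0 \<le> (t - s) * a" "0 \<le> (u - t) * b" using st ab by (auto intro!: mult_nonneg_nonneg)
    have 2: "(t - s) * a \<le> (t - s) * 1" "(u - t) * b \<le> (u - t) * 1"
      using st ab by (intro mult_left_mono; simp)+
    have "q r = s + (t - s) * a + (u - t) * b" by (simp add: q_def a_def b_def)
    then show ?thesis using 1 2 by simp
  qed
  have "continuous_map (top_of_set {s..u}) Z \<gamma>"
    using continuous_map_from_subtopology[of unit_interval Z \<gamma> "{s..u}"] g st
    by (simp add: pathin_def subtopology_subtopology Int_absorb1)
  then have c: "continuous_map (top_of_set {s..u}) ?S \<gamma>" using im by (simp add: continuous_map_in_subtopology image_subset_iff_funcset)
  have "path_homotopic ?S (\<gamma> (q 0)) (\<gamma> (q 1)) (\<gamma> \<circ> q) (\<gamma> \<circ> (\<lambda>r. s + (u - s) * r))"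
  proof (rule path_homotopic_convex[OF _ c])
    show "q ` {0..1} \<subseteq> {s..u}" using q_in by auto
    show "(\<lambda>r. s + (u - s) * r) ` {0..1} \<subseteq> {s..u}" using affine_in_interval[of s u] st by auto
  qed (auto simp: q_def intro!: continuous_intros)
  moreover have "path_homotopic ?S (\<gamma> s) (\<gamma> u) (path_concat (segment \<gamma> s t) (segment \<gamma> t u)) (\<gamma> \<circ> q)"
  proof (rule path_homotopic_eq_on[OF path_from_to_concat[OF p1 p2]])
    fix r :: real
    have "min 1 (2 * r) = 2 * r \<and> max 0 (2 * r - 1) = 0" if "r \<le> 1 / 2" using that by auto
    moreover have "min 1 (2 * r) = 1 \<and> max 0 (2 * r - 1) = 2 * r - 1" if "\<not> r \<le> 1 / 2" using that by auto
    ultimately show "path_concat (segment \<gamma> s t) (segment \<gamma> t u) r = (\<gamma> \<circ> q) r"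
      by (cases "r \<le> 1 / 2") (simp_all add: path_concat_def segment_def q_def)
  qed
  moreover have "q 0 = s" "q 1 = u" by (auto simp: q_def)
  moreover have "\<gamma> \<circ> (\<lambda>r. s + (u - s) * r) = segment \<gamma> s u" by (auto simp: segment_def)
  ultimately have "path_homotopic ?S (\<gamma> s) (\<gamma> u) (path_concat (segment \<gamma> s t) (segment \<gamma> t u)) (segment \<gamma> s u)"
    by (metis path_homotopic_trans)
  then have "F b (path_concat (segment \<gamma> s t) (segment \<gamma> t u)) = F b (segment \<gamma> s u)" by (rule F_homotopic)
  then show ?thesis using F_concat[OF p1 p2] small_eq[OF p1] small_eq[OF p2] small_eq[OF p3] by simp
qed

definition partition_product :: "(real \<Rightarrow> 'a) \<Rightarrow> nat \<Rightarrow> 'h" where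
  "partition_product \<gamma> N = lprod (map (\<lambda>i. small (segment \<gamma> (real i / N) (real (Suc i) / N))) [0..<N])"

definition subordinate :: "(real \<Rightarrow> 'a) \<Rightarrow> nat \<Rightarrow> bool" where
  "subordinate \<gamma> N \<longleftrightarrow> 1 \<le> N \<and> (\<forall>i<N. \<exists>b. \<gamma> ` {real i / N..real (Suc i) / N} \<subseteq> U b)"

lemma small_segments_prod:
  assumes g: "pathin Z \<gamma>" and "0 \<le> a" "0 \<le> d" "a + real M * d \<le> 1" "\<gamma> ` {a..a + real M * d} \<subseteq> U b" "1 \<le> M"
  shows "lprod (map (\<lambda>j. small (segment \<gamma> (a + real j * d) (a + real (Suc j) * d))) [0..<M])
     = small (segment \<gamma> a (a + real M * d))"
  using assms(6,4,5)
proof (induction M rule: nat_induct_at_least)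
  case base
  have "small (segment \<gamma> a (a + d)) \<in> carrier H"
    using small_segment_closed[OF g assms(2), of "a + d" b] base assms(3) by simp
  then show ?case by simp
next
  case (Suc M)
  have le: "a + real M * d \<le> a + real (Suc M) * d" "a \<le> a + real M * d" using assms(3) by (auto simp: algebra_simps)
  have sub: "\<gamma> ` {a..a + real M * d} \<subseteq> U b" "\<gamma> ` {a + real M * d..a + real (Suc M) * d} \<subseteq> U b"
    using Suc.prems(2) le by auto
  have IH: "lprod (map (\<lambda>j. small (segment \<gamma> (a + real j * d) (a + real (Suc j) * d))) [0..<M])
     = small (segment \<gamma> a (a + real M * d))"
    using Suc.IH le Suc.prems sub by linarith
  have cl: "small (segment \<gamma> (a + real j * d) (a + real (Suc j) * d)) \<in> carrier H" if "j < Suc M" for j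
  proof (rule small_segment_closed[OF g])
    have "real (Suc j) * d \<le> real (Suc M) * d" using that assms(3) by (intro mult_right_mono) auto
    then show "a + real (Suc j) * d \<le> 1" using Suc.prems(1) by linarith
    then have "{a + real j * d..a + real (Suc j) * d} \<subseteq> {a..a + real (Suc M) * d}"
      using \<open>real (Suc j) * d \<le> real (Suc M) * d\<close> assms(3) by (auto intro: order_trans[of a "a + real j * d"])
    then show "\<gamma> ` {a + real j * d..a + real (Suc j) * d} \<subseteq> U b" using Suc.prems(2) by blast
  qed (use assms(2,3) in \<open>auto simp: algebra_simps\<close>)
  have "lprod (map (\<lambda>j. small (segment \<gamma> (a + real j * d) (a + real (Suc j) * d))) [0..<Suc M])
     = small (segment \<gamma> a (a + real M * d)) \<otimes> small (segment \<gamma> (a + real M * d) (a + real (Suc M) * d))"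
    unfolding upt_Suc_append[OF le0] map_append using cl IH
    by (subst lprod_append) auto
  also have "\<dots> = small (segment \<gamma> a (a + real (Suc M) * d))"
    using small_segment_mult[OF g assms(2) le(2,1) Suc.prems(1,2)] .
  finally show ?case .
qed

lemma partition_closed:
  assumes "pathin Z \<gamma>" "subordinate \<gamma> N" "i < N"
  shows "small (segment \<gamma> (real i / N) (real (Suc i) / N)) \<in> carrier H"
proof -
  obtain b where "\<gamma> ` {real i / N..real (Suc i) / N} \<subseteq> U b" using assms(2,3) by (auto simp: subordinate_def)
  then show ?thesis using assms by (intro small_segment_closed) (auto simp: field_simps)
qed

lemma partition_product_closed:
  "pathin Z \<gamma> \<Longrightarrow> subordinate \<gamma> N \<Longrightarrow> partition_product \<gamma> N \<in> carrier H"
  unfolding partition_product_def using partition_closed by (intro lprod_closed) auto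

lemma partition_refine:
  assumes g: "pathin Z \<gamma>" and f: "subordinate \<gamma> N" and M: "1 \<le> M"
  shows "subordinate \<gamma> (N * M)" "partition_product \<gamma> (N * M) = partition_product \<gamma> N"
proof -
  have N: "1 \<le> N" using f by (simp add: subordinate_def)
  have pos: "(0::real) < real N" "(0::real) < real M" using N M by auto
  have e1: "real (i * M + j) / real (N * M) = real i / N + real j * (1 / real (N * M))" for i j
    using pos by (simp add: field_simps)
  have e2: "real (Suc i) / N = real i / N + real M * (1 / real (N * M))" for i
    using pos by (simp add: field_simps)
  have e3: "real (Suc (i * M + j)) / real (N * M) = real i / N + real (Suc j) * (1 / real (N * M))" for i j
    using e1[of i "Suc j"] by simp
  show "subordinate \<gamma> (N * M)"
    unfolding subordinate_def
  proof (intro conjI allI impI)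
    show "1 \<le> N * M" using N M by simp
    fix l assume l: "l < N * M"
    define i j where "i = l div M" and "j = l mod M"
    have ij: "l = i * M + j" "i < N" "j < M" using l M by (auto simp: i_def j_def less_mult_imp_div_less)
    obtain b where b: "\<gamma> ` {real i / N..real (Suc i) / N} \<subseteq> U b" using f ij(2) by (auto simp: subordinate_def)
    have "real (Suc j) * (1 / real (N * M)) \<le> real M * (1 / real (N * M))"
      using ij(3) by (intro mult_right_mono) auto
    then have "real (Suc l) / real (N * M) \<le> real (Suc i) / N"
      unfolding ij(1) e3 e2 by linarith
    moreover have "real i / N \<le> real l / real (N * M)" unfolding ij(1) e1 by simp
    ultimately have "{real l / real (N * M)..real (Suc l) / real (N * M)} \<subseteq> {real i / N..real (Suc i) / N}" by auto
    then show "\<exists>b. \<gamma> ` {real l / real (N * M)..real (Suc l) / real (N * M)} \<subseteq> U b" using b by blast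
  qed
  define f where "f l = (if l < N * M then small (segment \<gamma> (real l / real (N * M)) (real (Suc l) / real (N * M))) else \<one>)" for l :: nat
  have fc: "f l \<in> carrier H" for l using partition_closed[OF g \<open>subordinate \<gamma> (N * M)\<close>] by (simp add: f_def)
  have "partition_product \<gamma> (N * M) = lprod (map f [0..<N * M])"
    unfolding partition_product_def by (intro arg_cong[of _ _ lprod] map_cong) (auto simp: f_def)
  also have "\<dots> = lprod (map (\<lambda>i. lprod (map (\<lambda>j. f (i * M + j)) [0..<M])) [0..<N])"
    by (rule lprod_blocks[OF fc])
  also have "\<dots> = partition_product \<gamma> N"
    unfolding partition_product_def
  proof (intro arg_cong[where f = lprod] map_cong refl)
    fix i assume "i \<in> set [0..<N]"
    then have i: "i < N" by simp
    obtain b where b: "\<gamma> ` {real i / N..real (Suc i) / N} \<subseteq> U b" using f i by (auto simp: subordinate_def)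
    have m: "map (\<lambda>j. f (i * M + j)) [0..<M] = map (\<lambda>j. small (segment \<gamma> (real i / N + real j * (1 / real (N * M)))
        (real i / N + real (Suc j) * (1 / real (N * M))))) [0..<M]"
    proof (intro map_cong refl)
      fix j assume "j \<in> set [0..<M]"
      then have "i * M + j < Suc i * M" by simp
      also have "\<dots> \<le> N * M" using i by (intro mult_le_mono1) simp
      finally show "f (i * M + j) = small (segment \<gamma> (real i / N + real j * (1 / real (N * M)))
        (real i / N + real (Suc j) * (1 / real (N * M))))" by (simp only: f_def e1 e3 if_True)
    qed
    have "lprod (map (\<lambda>j. f (i * M + j)) [0..<M]) = small (segment \<gamma> (real i / N) (real i / N + real M * (1 / real (N * M))))"
      unfolding m
    proof (rule small_segments_prod[OF g])
      have "real (Suc i) / N \<le> 1" using i by simp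
      then show "real i / N + real M * (1 / real (N * M)) \<le> 1" unfolding e2 .
      show "\<gamma> ` {real i / N..real i / N + real M * (1 / real (N * M))} \<subseteq> U b" using b unfolding e2 .
    qed (use M in auto)
    then show "lprod (map (\<lambda>j. f (i * M + j)) [0..<M]) = small (segment \<gamma> (real i / N) (real (Suc i) / N))"
      unfolding e2 .
  qed
  finally show "partition_product \<gamma> (N * M) = partition_product \<gamma> N" .
qed

text \<open>Any two subdivisions have a common refinement.\<close>

lemma partition_product_unique:
  assumes "pathin Z \<gamma>" "subordinate \<gamma> N" "subordinate \<gamma> M"
  shows "partition_product \<gamma> N = partition_product \<gamma> M"
  using partition_refine(2)[OF assms(1,2), of M] partition_refine(2)[OF assms(1,3), of N] assms(2,3)
  by (simp add: subordinate_def mult.commute)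

text \<open>A Lebesgue number for the cover of the square by the preimages of the two open sets.\<close>

lemma square_subdivision:
  assumes K: "continuous_map (top_of_set ({0..1::real} \<times> {0..1::real})) Z K"
  obtains N :: nat where "1 \<le> N"
    "\<And>i j. i < N \<Longrightarrow> j < N \<Longrightarrow> \<exists>b. K ` ({real i / N..real (Suc i) / N} \<times> {real j / N..real (Suc j) / N}) \<subseteq> U b"
proof -
  let ?S = "{0..1::real} \<times> {0..1::real}"
  have "\<exists>G. open G \<and> {x \<in> ?S. K x \<in> U b} = ?S \<inter> G" for b
    using openin_continuous_map_preimage[OF K open_U[of b]] by (auto simp: openin_open)
  then obtain G where G: "\<And>b. open (G b)" "\<And>b. {x \<in> ?S. K x \<in> U b} = ?S \<inter> G b" by metis
  have KS: "K x \<in> topspace Z" if "x \<in> ?S" for x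
    using continuous_map_funspace[OF K] that by (auto simp: Pi_iff)
  have "?S \<subseteq> \<Union>(range G)"
  proof
    fix x assume x: "x \<in> ?S"
    then obtain b where "K x \<in> U b" using KS cover by blast
    then have "x \<in> ?S \<inter> G b" using x G(2)[of b] by blast
    then show "x \<in> \<Union>(range G)" by blast
  qed
  moreover have "compact ?S" by (intro compact_Times) auto
  ultimately obtain e where e: "0 < e" "\<And>x. x \<in> ?S \<Longrightarrow> \<exists>B\<in>range G. ball x e \<subseteq> B"
    using Heine_Borel_lemma[of ?S "range G"] G(1) by blast
  obtain N :: nat where N: "2 / e < real N" using reals_Archimedean2 by blast
  have N1: "1 \<le> N" using N e(1) by (cases N) (auto simp: field_simps)
  have N2: "2 / real N < e" using N e(1) N1 by (simp add: field_simps)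
  show thesis
  proof (rule that[OF N1])
    fix i j assume ij: "i < N" "j < N"
    let ?x = "(real i / N, real j / N)"
    have "?x \<in> ?S" using ij by auto
    then obtain b where b: "ball ?x e \<subseteq> G b" using e(2) by blast
    have "K y \<in> U b" if y: "y \<in> {real i / N..real (Suc i) / N} \<times> {real j / N..real (Suc j) / N}" for y
    proof -
      obtain y1 y2 where y12: "y = (y1, y2)" by fastforce
      have s: "real (Suc i) / N = real i / N + 1 / N" "real (Suc j) / N = real j / N + 1 / N"
        by (auto simp: field_simps add_divide_distrib)
      have d1: "\<bar>real i / N - y1\<bar> \<le> 1 / N" and d2: "\<bar>real j / N - y2\<bar> \<le> 1 / N"
        using y unfolding y12 s by auto
      have "dist ?x y = sqrt ((real i / N - y1)\<^sup>2 + (real j / N - y2)\<^sup>2)"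
        by (simp add: y12 dist_Pair_Pair dist_real_def)
      also have "\<dots> \<le> \<bar>real i / N - y1\<bar> + \<bar>real j / N - y2\<bar>" by (rule sqrt_sum_squares_le_sum_abs)
      also have "\<dots> \<le> 2 / N" using d1 d2 by simp
      finally have "y \<in> ball ?x e" using N2 by simp
      then have "y \<in> G b" using b by blast
      moreover have "y \<in> ?S"
      proof -
        have "real (Suc i) / N \<le> 1" "real (Suc j) / N \<le> 1" "0 \<le> real i / N" "0 \<le> real j / N" using ij by auto
        then show ?thesis using y unfolding y12 mem_Times_iff fst_conv snd_conv atLeastAtMost_iff by linarith
      qed
      ultimately show ?thesis using G(2)[of b] by blast
    qed
    then show "\<exists>b. K ` ({real i / N..real (Suc i) / N} \<times> {real j / N..real (Suc j) / N}) \<subseteq> U b" by blast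
  qed
qed

end

context path_functional begin

definition globalized :: "(real \<Rightarrow> 'a) \<Rightarrow> 'h" where
  "globalized \<gamma> = partition_product \<gamma> (SOME N. subordinate \<gamma> N)"

lemma subordinate_exists:
  assumes "pathin Z \<gamma>"
  shows "\<exists>N. subordinate \<gamma> N"
proof -
  have "continuous_map (prod_topology unit_interval unit_interval) Z (\<gamma> \<circ> snd)"
    using assms by (intro continuous_map_compose[OF continuous_map_snd]) (simp add: pathin_def)
  then have K: "continuous_map (top_of_set ({0..1::real} \<times> {0..1::real})) Z (\<gamma> \<circ> snd)"
    by (simp add: subtopology_Times)
  obtain N :: nat where N: "1 \<le> N"
    "\<And>i j. i < N \<Longrightarrow> j < N \<Longrightarrow> \<exists>b. (\<gamma> \<circ> snd) ` ({real i / N..real (Suc i) / N} \<times> {real j / N..real (Suc j) / N}) \<subseteq> U b"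
    using square_subdivision[OF K] by blast
  have "\<exists>b. \<gamma> ` {real j / N..real (Suc j) / N} \<subseteq> U b" if j: "j < N" for j
  proof -
    obtain b where "(\<gamma> \<circ> snd) ` ({real j / N..real (Suc j) / N} \<times> {real j / N..real (Suc j) / N}) \<subseteq> U b"
      using N(2)[OF j j] by blast
    then show ?thesis by fastforce
  qed
  then show ?thesis using N(1) by (auto simp: subordinate_def)
qed

lemma globalized_eq:
  assumes "pathin Z \<gamma>" "subordinate \<gamma> N"
  shows "globalized \<gamma> = partition_product \<gamma> N"
  unfolding globalized_def using partition_product_unique[OF assms(1) _ assms(2)] assms(2) by (metis someI)

lemma globalized_closed: "pathin Z \<gamma> \<Longrightarrow> globalized \<gamma> \<in> carrier H"
  using subordinate_exists globalized_eq partition_product_closed by metis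

lemma globalized_small:
  assumes "path_from_to (subtopology Z (U t)) u v \<gamma>"
  shows "globalized \<gamma> = F t \<gamma>"
proof -
  have p: "pathin Z \<gamma>" and im: "\<gamma> ` {0..1} \<subseteq> U t"
    using assms unfolding path_from_to_subtopology by (auto simp: path_from_to_def)
  have "subordinate \<gamma> 1" using im by (auto simp: subordinate_def)
  moreover have "segment \<gamma> 0 1 = \<gamma>" by (simp add: segment_def)
  ultimately show ?thesis
    using globalized_eq[OF p, of 1] small_eq[OF assms] F_closed[OF assms] by (simp add: partition_product_def)
qed

lemma small_const:
  assumes "u \<in> topspace Z"
  shows "small (\<lambda>_. u) = \<one>"
proof -
  obtain t where t: "u \<in> U t" using assms cover by blast
  have "path_from_to Z u u (\<lambda>_. u)" by (rule path_from_to_const[OF assms])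
  then have p: "path_from_to (subtopology Z (U t)) u u (\<lambda>_. u)" using t by (auto simp: path_from_to_subtopology)
  have "path_concat (\<lambda>_. u) (\<lambda>_. u) = (\<lambda>_. u)" by (auto simp: path_concat_def)
  then have "F t (\<lambda>_. u) \<otimes> F t (\<lambda>_. u) = F t (\<lambda>_. u)" using F_concat[OF p p] by simp
  then have "F t (\<lambda>_. u) = \<one>" using F_closed[OF p] by simp
  then show ?thesis using small_eq[OF p] by simp
qed

text \<open>The two ways around a rectangle are homotopic in the rectangle, which is convex.\<close>

lemma small_square:
  assumes K: "continuous_map (top_of_set ({0..1::real} \<times> {0..1::real})) Z K"
    and q: "0 \<le> s" "s \<le> s'" "s' \<le> 1" "0 \<le> x" "x \<le> x'" "x' \<le> 1"
    and im: "K ` ({s..s'} \<times> {x..x'}) \<subseteq> U b"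
  shows "small (segment (\<lambda>y. K (s, y)) x x') \<otimes> small (segment (\<lambda>y. K (y, x')) s s')
       = small (segment (\<lambda>y. K (y, x)) s s') \<otimes> small (segment (\<lambda>y. K (s', y)) x x')"
    and "small (segment (\<lambda>y. K (s, y)) x x') \<in> carrier H" "small (segment (\<lambda>y. K (y, x)) s s') \<in> carrier H"
    "small (segment (\<lambda>y. K (s', y)) x x') \<in> carrier H" "small (segment (\<lambda>y. K (y, x')) s s') \<in> carrier H"
proof -
  let ?C = "{s..s'} \<times> {x..x'}" and ?S = "subtopology Z (U b)"
  have "continuous_map (top_of_set ?C) Z K"
    using continuous_map_from_subtopology[OF K, of ?C] q
    by (simp add: subtopology_subtopology Int_absorb1 Times_subset_cancel2 Sigma_mono)
  then have c: "continuous_map (top_of_set ?C) ?S K"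
    using im by (simp add: continuous_map_in_subtopology image_subset_iff_funcset)
  have conv: "convex ?C" by (intro convex_Times) auto
  define h where "h y r = (y, x + (x' - x) * r)" for y r :: real
  define v where "v y r = (s + (s' - s) * r, y)" for y r :: real
  have hv: "path (h y)" "path (v y)" for y by (auto simp: path_def h_def v_def intro!: continuous_intros)
  have hC: "h y ` {0..1} \<subseteq> ?C" if "y \<in> {s..s'}" for y
    using that affine_in_interval[of x x'] q by (auto simp: h_def)
  have vC: "v y ` {0..1} \<subseteq> ?C" if "y \<in> {x..x'}" for y
    using that affine_in_interval[of s s'] q by (auto simp: v_def)
  have Kh: "segment (\<lambda>z. K (y, z)) x x' = K \<circ> h y" and Kv: "segment (\<lambda>z. K (z, y)) s s' = K \<circ> v y" for y
    by (auto simp: segment_def h_def v_def)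
  have ends: "h y 0 = (y, x)" "h y 1 = (y, x')" "v y 0 = (s, y)" "v y 1 = (s', y)" for y by (auto simp: h_def v_def)
  have pC: "path_from_to ?S (K (p 0)) (K (p 1)) (K \<circ> p)" if "path p" "p ` {0..1} \<subseteq> ?C" for p
    using path_homotopic_imp_path(1)[OF path_homotopic_convex[OF conv c, of p p]] that by (simp add: path_def)
  have P: "path_from_to ?S (K (s, x)) (K (s, x')) (K \<circ> h s)" "path_from_to ?S (K (s', x)) (K (s', x')) (K \<circ> h s')"
    "path_from_to ?S (K (s, x)) (K (s', x)) (K \<circ> v x)" "path_from_to ?S (K (s, x')) (K (s', x')) (K \<circ> v x')"
    using pC[of "h s"] pC[of "h s'"] pC[of "v x"] pC[of "v x'"] hv hC vC q by (simp_all add: ends)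
  have im2: "(a +++ b) ` {0..1} \<subseteq> ?C" if "a ` {0..1} \<subseteq> ?C" "b ` {0..1} \<subseteq> ?C" for a b :: "real \<Rightarrow> real \<times> real"
    using image_path_concat_subset[of a b] that unfolding path_concat_joinpaths by blast
  have j: "path (h s +++ v x')" "path (v x +++ h s')"
    using hv by (auto intro!: path_join_imp simp: pathstart_def pathfinish_def ends)
  have e: "(h s +++ v x') 0 = (s, x)" "(h s +++ v x') 1 = (s', x')" "(v x +++ h s') 0 = (s, x)" "(v x +++ h s') 1 = (s', x')"
    by (auto simp: joinpaths_def ends)
  have "path_homotopic ?S (K ((h s +++ v x') 0)) (K ((h s +++ v x') 1)) (K \<circ> (h s +++ v x')) (K \<circ> (v x +++ h s'))"
    by (rule path_homotopic_convex[OF conv c]) (use j e im2 hC vC q in \<open>auto simp: path_def\<close>)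
  then have "F b (path_concat (K \<circ> h s) (K \<circ> v x')) = F b (path_concat (K \<circ> v x) (K \<circ> h s'))"
    unfolding path_concat_joinpaths[symmetric] comp_path_concat by (rule F_homotopic)
  then show "small (segment (\<lambda>y. K (s, y)) x x') \<otimes> small (segment (\<lambda>y. K (y, x')) s s')
       = small (segment (\<lambda>y. K (y, x)) s s') \<otimes> small (segment (\<lambda>y. K (s', y)) x x')"
    unfolding Kh Kv small_eq[OF P(1)] small_eq[OF P(2)] small_eq[OF P(3)] small_eq[OF P(4)]
      F_concat[OF P(1,4)] F_concat[OF P(3,2)] .
  show "small (segment (\<lambda>y. K (s, y)) x x') \<in> carrier H" "small (segment (\<lambda>y. K (y, x)) s s') \<in> carrier H"
    "small (segment (\<lambda>y. K (s', y)) x x') \<in> carrier H" "small (segment (\<lambda>y. K (y, x')) s s') \<in> carrier H"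
    unfolding Kh Kv small_eq[OF P(1)] small_eq[OF P(2)] small_eq[OF P(3)] small_eq[OF P(4)]
    using F_closed P by blast+
qed

text \<open>Subdivide the square of the homotopy so that each cell maps into one of the two open sets. Two
  consecutive rows have the same value: moving across the cells of a row one after the other changes
  the product only by the vertical sides at the two ends, where the homotopy is constant.\<close>

lemma globalized_homotopic:
  assumes "path_homotopic Z u v \<gamma> \<delta>"
  shows "globalized \<gamma> = globalized \<delta>"
proof -
  obtain K where K0: "continuous_map (prod_topology unit_interval unit_interval) Z K"
    and K: "\<And>x. K (0, x) = \<gamma> x" "\<And>x. K (1, x) = \<delta> x" "\<And>t. t \<in> {0..1} \<Longrightarrow> K (t, 0) = u \<and> K (t, 1) = v"
    using assms unfolding path_homotopic_def homotopic_with_def by auto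
  have Kc: "continuous_map (top_of_set ({0..1} \<times> {0..1})) Z K" using K0 by (simp add: subtopology_Times)
  obtain N :: nat where N: "1 \<le> N"
    "\<And>i j. i < N \<Longrightarrow> j < N \<Longrightarrow> \<exists>b. K ` ({real i / N..real (Suc i) / N} \<times> {real j / N..real (Suc j) / N}) \<subseteq> U b"
    using square_subdivision[OF Kc] by blast
  define row where "row j = (\<lambda>x. K (real j / N, x))" for j :: nat
  define col where "col j i = small (segment (\<lambda>y. K (y, real i / N)) (real j / N) (real (Suc j) / N))" for j i :: nat
  define cell where "cell j i = small (segment (row j) (real i / N) (real (Suc i) / N))" for j i :: nat
  have step: "partition_product (row j) N = partition_product (row (Suc j)) N" if j: "j < N" for j
  proof -
    have sq: "cell j i \<otimes> col j (Suc i) = col j i \<otimes> cell (Suc j) i" "cell j i \<in> carrier H" "col j i \<in> carrier H"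
       "cell (Suc j) i \<in> carrier H" "col j (Suc i) \<in> carrier H" if i: "i < N" for i
    proof -
      obtain b where b: "K ` ({real j / N..real (Suc j) / N} \<times> {real i / N..real (Suc i) / N}) \<subseteq> U b"
        using N(2)[OF j i] by blast
      have le: "0 \<le> real j / N" "real j / N \<le> real (Suc j) / N" "real (Suc j) / N \<le> 1"
        "0 \<le> real i / N" "real i / N \<le> real (Suc i) / N" "real (Suc i) / N \<le> 1"
        using i j by (auto simp: divide_right_mono)
      note sm = small_square[OF Kc le b]
      show "cell j i \<otimes> col j (Suc i) = col j i \<otimes> cell (Suc j) i" "cell j i \<in> carrier H" "col j i \<in> carrier H"
       "cell (Suc j) i \<in> carrier H" "col j (Suc i) \<in> carrier H"
        using sm unfolding cell_def col_def row_def by blast+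
    qed
    have c0: "col j 0 = \<one>" and cN: "col j N = \<one>"
    proof -
      have le: "real j / N \<le> real (Suc j) / N" "real (Suc j) / N \<le> 1" "0 \<le> real j / N" using j by (auto simp: divide_right_mono)
      have uv: "u \<in> topspace Z" "v \<in> topspace Z" using path_from_to_topspace[OF path_homotopic_imp_path(1)[OF assms]] by auto
      have "K (y, 0) = u \<and> K (y, 1) = v" if "real j / N \<le> y" "y \<le> real (Suc j) / N" for y
        using K(3)[of y] that le by auto
      then have const: "segment (\<lambda>y. K (y, real 0 / N)) (real j / N) (real (Suc j) / N) r = u"
          "segment (\<lambda>y. K (y, real N / N)) (real j / N) (real (Suc j) / N) r = v" if "0 \<le> r" "r \<le> 1" for r
        using affine_in_interval[OF le(1) that] N(1) by (simp_all add: segment_def)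
      have eqon: "small a = \<one>" if aw: "\<And>r. 0 \<le> r \<Longrightarrow> r \<le> 1 \<Longrightarrow> a r = w" and wZ: "w \<in> topspace Z" for a w
      proof -
        obtain t where t: "w \<in> U t" using wZ cover by blast
        have "path_from_to Z w w (\<lambda>_. w)" by (rule path_from_to_const[OF wZ])
        then have p: "path_from_to (subtopology Z (U t)) w w (\<lambda>_. w)" using t by (auto simp: path_from_to_subtopology)
        have h: "path_homotopic (subtopology Z (U t)) w w (\<lambda>_. w) a"
          by (rule path_homotopic_eq_on[OF p]) (use aw in simp)
        show ?thesis using F_homotopic[OF h] small_eq[OF p] small_eq[OF path_homotopic_imp_path(2)[OF h]]
          small_const[OF wZ] by simp
      qed
      show "col j 0 = \<one>" "col j N = \<one>"
        unfolding col_def by (rule eqon[OF const(1) uv(1)], assumption+) (rule eqon[OF const(2) uv(2)], assumption+)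
    qed
    have tele: "m \<le> N \<Longrightarrow> lprod (map (cell j) [0..<m]) \<otimes> col j m = col j 0 \<otimes> lprod (map (cell (Suc j)) [0..<m])" for m
    proof (induction m)
      case 0
      then show ?case using c0 by simp
    next
      case (Suc m)
      then have m: "m < N" by simp
      have A: "lprod (map (cell j) [0..<m]) \<in> carrier H" "lprod (map (cell (Suc j)) [0..<m]) \<in> carrier H"
        using sq m by (auto intro!: lprod_closed)
      have "lprod (map (cell j) [0..<Suc m]) \<otimes> col j (Suc m)
          = (lprod (map (cell j) [0..<m]) \<otimes> cell j m) \<otimes> col j (Suc m)"
        by (subst lprod_upt_Suc) (use sq m in auto)
      also have "\<dots> = lprod (map (cell j) [0..<m]) \<otimes> (cell j m \<otimes> col j (Suc m))" using A sq[OF m] by (simp add: m_assoc)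
      also have "\<dots> = lprod (map (cell j) [0..<m]) \<otimes> (col j m \<otimes> cell (Suc j) m)" using sq(1)[OF m] by simp
      also have "\<dots> = (lprod (map (cell j) [0..<m]) \<otimes> col j m) \<otimes> cell (Suc j) m" using A sq[OF m] by (simp add: m_assoc)
      also have "\<dots> = (col j 0 \<otimes> lprod (map (cell (Suc j)) [0..<m])) \<otimes> cell (Suc j) m" using Suc by simp
      also have "\<dots> = col j 0 \<otimes> (lprod (map (cell (Suc j)) [0..<m]) \<otimes> cell (Suc j) m)" using A sq[OF m] c0 by (simp add: m_assoc)
      also have "\<dots> = col j 0 \<otimes> lprod (map (cell (Suc j)) [0..<Suc m])"
        by (subst lprod_upt_Suc[of m "cell (Suc j)"]) (use sq m in auto)
      finally show ?case .
    qed
    have B: "lprod (map (cell j) [0..<N]) \<in> carrier H" "lprod (map (cell (Suc j)) [0..<N]) \<in> carrier H"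
      using sq by (auto intro!: lprod_closed)
    show ?thesis using tele[of N] c0 cN B unfolding partition_product_def cell_def[symmetric] by simp
  qed
  have all: "j \<le> N \<Longrightarrow> partition_product (row 0) N = partition_product (row j) N" for j
    by (induction j) (use step in auto)
  have row: "row 0 = \<gamma>" "row N = \<delta>" using K N(1) by (auto simp: row_def)
  have "subordinate (row j) N" if "j = 0 \<or> j = N" for j
    unfolding subordinate_def
  proof (intro conjI allI impI)
    fix i assume i: "i < N"
    define j' where "j' = (if j = 0 then 0 else N - 1)"
    have j': "j' < N" "real j / N \<in> {real j' / N..real (Suc j') / N}"
      using that N(1) by (auto simp: j'_def divide_right_mono)
    obtain b where b: "K ` ({real j' / N..real (Suc j') / N} \<times> {real i / N..real (Suc i) / N}) \<subseteq> U b"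
      using N(2)[OF j'(1) i] by blast
    have "K (real j / N, y) \<in> U b" if "y \<in> {real i / N..real (Suc i) / N}" for y
      using b j'(2) that by blast
    then show "\<exists>b. row j ` {real i / N..real (Suc i) / N} \<subseteq> U b" unfolding row_def by blast
  qed (rule N(1))
  then have "subordinate \<gamma> N" "subordinate \<delta> N" using row by metis+
  moreover have "pathin Z \<gamma>" "pathin Z \<delta>"
    using path_homotopic_imp_path[OF assms] by (auto simp: path_from_to_def)
  ultimately show ?thesis using globalized_eq all[of N] row by simp
qed

lemma small_eq_on:
  assumes "path_from_to (subtopology Z (U t)) u v a" "\<And>r. 0 \<le> r \<Longrightarrow> r \<le> 1 \<Longrightarrow> a r = b r"
  shows "small a = small b"
proof -
  have h: "path_homotopic (subtopology Z (U t)) u v a b" by (rule path_homotopic_eq_on[OF assms])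
  show ?thesis using F_homotopic[OF h] small_eq[OF assms(1)] small_eq[OF path_homotopic_imp_path(2)[OF h]] by simp
qed

text \<open>If both paths are divided into \<open>N\<close> parts, then the concatenation is divided into \<open>2 * N\<close> parts.\<close>

lemma globalized_concat:
  assumes g: "path_from_to Z u v \<gamma>" and d: "path_from_to Z v w \<delta>"
  shows "globalized (path_concat \<gamma> \<delta>) = globalized \<gamma> \<otimes> globalized \<delta>"
proof -
  have p: "pathin Z \<gamma>" "pathin Z \<delta>" "pathin Z (path_concat \<gamma> \<delta>)"
    using g d path_from_to_concat[OF g d] by (auto simp: path_from_to_def)
  obtain N1 N2 where N12: "subordinate \<gamma> N1" "subordinate \<delta> N2" using subordinate_exists p by metis
  define N where "N = N1 * N2"
  have N: "subordinate \<gamma> N" "subordinate \<delta> N" "1 \<le> N"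
    using partition_refine(1)[OF p(1) N12(1), of N2] partition_refine(1)[OF p(2) N12(2), of N1] N12
    by (auto simp: N_def subordinate_def mult.commute)
  let ?c = "path_concat \<gamma> \<delta>"
  have N0: "0 < real N" using N(3) by simp
  have half: "2 * y \<le> 1 \<Longrightarrow> y \<le> 1 / 2" "0 \<le> 2 * y - 1 \<Longrightarrow> 1 / 2 \<le> y" for y :: real by simp_all
  have first: "?c y = \<gamma> (2 * y)" if "y \<le> 1 / 2" for y using that by (simp add: path_concat_def)
  have second: "?c y = \<delta> (2 * y - 1)" if "1 / 2 \<le> y" for y
  proof (cases "y = 1 / 2")
    case True
    show ?thesis unfolding True using g d by (simp add: path_concat_def path_from_to_def)
  qed (use that in \<open>simp add: path_concat_def\<close>)
  have im1: "?c ` {real i / real (2 * N)..real (Suc i) / real (2 * N)} \<subseteq> \<gamma> ` {real i / N..real (Suc i) / N}" if i: "i < N" for i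
  proof -
    have "?c y \<in> \<gamma> ` {real i / N..real (Suc i) / N}" if y: "real i / real (2 * N) \<le> y" "y \<le> real (Suc i) / real (2 * N)" for y
    proof -
      have "real (Suc i) / real (2 * N) \<le> 1 / 2" using i N0 by (simp add: field_simps)
      then have "?c y = \<gamma> (2 * y)" using y by (intro first) linarith
      moreover have "2 * y \<in> {real i / N..real (Suc i) / N}" using y N0 by (auto simp: field_simps)
      ultimately show ?thesis by simp
    qed
    then show ?thesis by auto
  qed
  have im2: "?c ` {real (N + i) / real (2 * N)..real (Suc (N + i)) / real (2 * N)} \<subseteq> \<delta> ` {real i / N..real (Suc i) / N}" if i: "i < N" for i
  proof -
    have "?c y \<in> \<delta> ` {real i / N..real (Suc i) / N}" if y: "real (N + i) / real (2 * N) \<le> y" "y \<le> real (Suc (N + i)) / real (2 * N)" for y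
    proof -
      have "1 / 2 \<le> real (N + i) / real (2 * N)" using N0 by (simp add: field_simps)
      then have "?c y = \<delta> (2 * y - 1)" using y by (intro second) linarith
      moreover have "2 * y - 1 \<in> {real i / N..real (Suc i) / N}" using y N0 by (auto simp: field_simps)
      ultimately show ?thesis by simp
    qed
    then show ?thesis by auto
  qed
  have sub: "subordinate ?c (2 * N)"
    unfolding subordinate_def
  proof (intro conjI allI impI)
    fix l assume l: "l < 2 * N"
    show "\<exists>b. ?c ` {real l / real (2 * N)..real (Suc l) / real (2 * N)} \<subseteq> U b"
    proof (cases "l < N")
      case True
      then obtain b where "\<gamma> ` {real l / N..real (Suc l) / N} \<subseteq> U b" using N(1) unfolding subordinate_def by blast
      then show ?thesis using im1[OF True] by blast
    next
      case False
      then obtain i where i: "l = N + i" "i < N" using l by (metis add_less_cancel_left le_Suc_ex linorder_not_less mult_2)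
      then obtain b where "\<delta> ` {real i / N..real (Suc i) / N} \<subseteq> U b" using N(2) unfolding subordinate_def by blast
      then show ?thesis using im2[OF i(2)] unfolding i(1) by blast
    qed
  qed (use N(3) in simp)
  have s1: "small (segment ?c (real i / real (2 * N)) (real (Suc i) / real (2 * N))) = small (segment \<gamma> (real i / N) (real (Suc i) / N))"
    if i: "i < N" for i
  proof -
    obtain b where b: "\<gamma> ` {real i / N..real (Suc i) / N} \<subseteq> U b" using N(1) i unfolding subordinate_def by blast
    have le: "0 \<le> real i / N" "real i / N \<le> real (Suc i) / N" "real (Suc i) / N \<le> 1" using i by (auto simp: divide_right_mono)
    show ?thesis
    proof (rule small_eq_on[symmetric, OF segment_path[OF p(1) le b]])
      fix r :: real assume r: "0 \<le> r" "r \<le> 1"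
      have e: "2 * (real i / real (2 * N) + (real (Suc i) / real (2 * N) - real i / real (2 * N)) * r) = real i / N + (real (Suc i) / N - real i / N) * r"
        using N0 by (simp add: field_simps)
      have "real i / N + (real (Suc i) / N - real i / N) * r \<le> 1" using affine_in_interval(2)[OF le(2) r] le(3) by linarith
      then have "real i / real (2 * N) + (real (Suc i) / real (2 * N) - real i / real (2 * N)) * r \<le> 1 / 2"
        unfolding e[symmetric] by (rule half(1))
      from first[OF this] show "segment \<gamma> (real i / N) (real (Suc i) / N) r = segment ?c (real i / real (2 * N)) (real (Suc i) / real (2 * N)) r"
        unfolding segment_def e by (rule sym)
    qed
  qed
  have s2: "small (segment ?c (real (N + i) / real (2 * N)) (real (Suc (N + i)) / real (2 * N))) = small (segment \<delta> (real i / N) (real (Suc i) / N))"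
    if i: "i < N" for i
  proof -
    obtain b where b: "\<delta> ` {real i / N..real (Suc i) / N} \<subseteq> U b" using N(2) i unfolding subordinate_def by blast
    have le: "0 \<le> real i / N" "real i / N \<le> real (Suc i) / N" "real (Suc i) / N \<le> 1" using i by (auto simp: divide_right_mono)
    show ?thesis
    proof (rule small_eq_on[symmetric, OF segment_path[OF p(2) le b]])
      fix r :: real assume r: "0 \<le> r" "r \<le> 1"
      have e: "2 * (real (N + i) / real (2 * N) + (real (Suc (N + i)) / real (2 * N) - real (N + i) / real (2 * N)) * r) - 1 = real i / N + (real (Suc i) / N - real i / N) * r"
        using N0 by (simp add: field_simps)
      have "0 \<le> real i / N + (real (Suc i) / N - real i / N) * r" using affine_in_interval(1)[OF le(2) r] le(1) by linarith
      then have "1 / 2 \<le> real (N + i) / real (2 * N) + (real (Suc (N + i)) / real (2 * N) - real (N + i) / real (2 * N)) * r"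
        unfolding e[symmetric] by (rule half(2))
      from second[OF this] show "segment \<delta> (real i / N) (real (Suc i) / N) r = segment ?c (real (N + i) / real (2 * N)) (real (Suc (N + i)) / real (2 * N)) r"
        unfolding segment_def e by (rule sym)
    qed
  qed
  let ?f = "\<lambda>i. small (segment ?c (real i / real (2 * N)) (real (Suc i) / real (2 * N)))"
  have up: "[0..<2 * N] = [0..<N] @ map (\<lambda>i. N + i) [0..<N]"
    using upt_add_eq_append[of 0 N N] map_add_upt[of N N] by (simp add: mult_2 add.commute)
  have m1: "map ?f [0..<N] = map (\<lambda>i. small (segment \<gamma> (real i / N) (real (Suc i) / N))) [0..<N]"
    using s1 by (intro map_cong refl) auto
  have m2: "map ?f (map (\<lambda>i. N + i) [0..<N]) = map (\<lambda>i. small (segment \<delta> (real i / N) (real (Suc i) / N))) [0..<N]"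
    unfolding map_map comp_def using s2 by (intro map_cong refl) auto
  have "globalized ?c = lprod (map ?f [0..<N] @ map ?f (map (\<lambda>i. N + i) [0..<N]))"
    unfolding globalized_eq[OF p(3) sub] partition_product_def up map_append ..
  also have "\<dots> = partition_product \<gamma> N \<otimes> partition_product \<delta> N"
    unfolding m1 m2 partition_product_def
    by (rule lprod_append) (use partition_closed[OF p(1) N(1)] partition_closed[OF p(2) N(2)] in auto)
  finally show ?thesis using globalized_eq p N by simp
qed

lemma globalized_eq_functional:
  assumes G: "\<And>u v \<gamma>. path_from_to Z u v \<gamma> \<Longrightarrow> G \<gamma> \<in> carrier H"
    "\<And>u v \<gamma> \<delta>. path_homotopic Z u v \<gamma> \<delta> \<Longrightarrow> G \<gamma> = G \<delta>"
    "\<And>u v w \<gamma> \<delta>. path_from_to Z u v \<gamma> \<Longrightarrow> path_from_to Z v w \<delta> \<Longrightarrow> G (path_concat \<gamma> \<delta>) = G \<gamma> \<otimes> G \<delta>"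
    and agree: "\<And>t u v \<gamma>. path_from_to (subtopology Z (U t)) u v \<gamma> \<Longrightarrow> F t \<gamma> = G \<gamma>"
    and g: "path_from_to Z u v \<gamma>"
  shows "globalized \<gamma> = G \<gamma>"
proof -
  interpret G: path_functional H Z "\<lambda>_. topspace Z" "\<lambda>_. G"
    by unfold_locales (use G in auto)
  have p: "pathin Z \<gamma>" using g by (simp add: path_from_to_def)
  obtain N where N: "subordinate \<gamma> N" using subordinate_exists[OF p] by blast
  have im: "\<gamma> ` {0..1} \<subseteq> topspace Z" using p by (auto simp: pathin_def continuous_map_def Pi_iff)
  have GN: "G.subordinate \<gamma> N" unfolding G.subordinate_def
  proof (intro conjI allI impI)
    show "1 \<le> N" using N by (simp add: subordinate_def)
    fix i assume i: "i < N"
    have "real (Suc i) / N \<le> 1" "0 \<le> real i / N" using i by auto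
    then have "{real i / N..real (Suc i) / N} \<subseteq> {0..1}" by auto
    then show "\<exists>b::bool. \<gamma> ` {real i / N..real (Suc i) / N} \<subseteq> topspace Z" using im by blast
  qed
  have "small (segment \<gamma> (real i / N) (real (Suc i) / N)) = G.small (segment \<gamma> (real i / N) (real (Suc i) / N))"
    if i: "i < N" for i
  proof -
    obtain b where b: "\<gamma> ` {real i / N..real (Suc i) / N} \<subseteq> U b" using N i unfolding subordinate_def by blast
    have le: "0 \<le> real i / N" "real i / N \<le> real (Suc i) / N" "real (Suc i) / N \<le> 1" using i by (auto simp: divide_right_mono)
    show ?thesis
      using small_eq[OF segment_path[OF p le b]] agree[OF segment_path[OF p le b]] by (simp add: G.small_def)
  qed
  then have "partition_product \<gamma> N = G.partition_product \<gamma> N"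
    unfolding partition_product_def G.partition_product_def by (intro arg_cong[where f = lprod] map_cong refl) auto
  then have "globalized \<gamma> = G.globalized \<gamma>" using globalized_eq[OF p N] G.globalized_eq[OF p GN] by simp
  also have "\<dots> = G \<gamma>" using G.globalized_small[where u = u and v = v and \<gamma> = \<gamma>] g by simp
  finally show ?thesis .
qed

lemma globalized_in_generate:
  assumes S: "\<And>t u v \<gamma>. path_from_to (subtopology Z (U t)) u v \<gamma> \<Longrightarrow> F t \<gamma> \<in> S" and p: "pathin Z \<gamma>"
  shows "globalized \<gamma> \<in> generate H S"
proof -
  obtain N where N: "subordinate \<gamma> N" using subordinate_exists[OF p] by blast
  have "small (segment \<gamma> (real i / N) (real (Suc i) / N)) \<in> S" if i: "i < N" for i
  proof -
    obtain b where b: "\<gamma> ` {real i / N..real (Suc i) / N} \<subseteq> U b" using N i unfolding subordinate_def by blast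
    have le: "0 \<le> real i / N" "real i / N \<le> real (Suc i) / N" "real (Suc i) / N \<le> 1" using i by (auto simp: divide_right_mono)
    show ?thesis using small_eq[OF segment_path[OF p le b]] S[OF segment_path[OF p le b]] by simp
  qed
  then have s: "set (map (\<lambda>i. small (segment \<gamma> (real i / N) (real (Suc i) / N))) [0..<N]) \<subseteq> S" by auto
  have "lprod vs \<in> generate H S" if "set vs \<subseteq> S" for vs
    using that by (induction vs) (auto intro: generate.intros)
  then show ?thesis using globalized_eq[OF p N] s unfolding partition_product_def by metis
qed

end

section \<open>The Seifert--van Kampen theorem for a simply connected intersection\<close>

locale simply_connected_cover =
  fixes Z :: "'a topology" and U :: "bool \<Rightarrow> 'a set" and b :: 'a
  assumes open_U: "\<And>t. openin Z (U t)" and cover: "topspace Z = U True \<union> U False"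
    and base: "b \<in> U True \<inter> U False"
    and connected: "\<And>t q. q \<in> U t \<Longrightarrow> \<exists>c. path_from_to (subtopology Z (U t)) b q c"
    and connected_inter: "\<And>q. q \<in> U True \<inter> U False \<Longrightarrow> \<exists>c. path_from_to (subtopology Z (U True \<inter> U False)) b q c"
    and simply_connected_inter: "\<And>\<gamma>. path_from_to (subtopology Z (U True \<inter> U False)) b b \<gamma> \<Longrightarrow>
      path_homotopic (subtopology Z (U True \<inter> U False)) b b \<gamma> (\<lambda>_. b)"
begin

lemma connecting_paths:
  obtains c where "c b = (\<lambda>_. b)" "\<And>t q. q \<in> U t \<Longrightarrow> path_from_to (subtopology Z (U t)) b q (c q)"
    "\<And>q. q \<in> U True \<inter> U False \<Longrightarrow> path_from_to (subtopology Z (U True \<inter> U False)) b q (c q)"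
proof -
  let ?W = "U True \<inter> U False"
  have bZ: "b \<in> topspace Z" using base cover by blast
  have cb: "path_from_to (subtopology Z ?W) b b (\<lambda>_. b)"
    unfolding path_from_to_subtopology using path_from_to_const[OF bZ] base by auto
  have "\<exists>d. (q = b \<longrightarrow> d = (\<lambda>_. b)) \<and> (\<forall>t. q \<in> U t \<longrightarrow> path_from_to (subtopology Z (U t)) b q d) \<and>
      (q \<in> ?W \<longrightarrow> path_from_to (subtopology Z ?W) b q d)" for q
  proof -
    have weaken: "\<forall>t. q \<in> U t \<longrightarrow> path_from_to (subtopology Z (U t)) b q d" if "path_from_to (subtopology Z ?W) b q d" for d
    proof (intro allI impI)
      fix t show "path_from_to (subtopology Z (U t)) b q d"
        using that unfolding path_from_to_subtopology by (cases t) auto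
    qed
    show ?thesis
    proof (cases "q \<in> ?W")
      case True
      then obtain d where d: "path_from_to (subtopology Z ?W) b q d" using connected_inter by blast
      show ?thesis
      proof (cases "q = b")
        case True
        then show ?thesis using cb weaken by blast
      qed (use d weaken in blast)
    next
      case False
      then have "q \<noteq> b" using base by blast
      show ?thesis
      proof (cases "\<exists>t. q \<in> U t")
        case True
        then obtain t where t: "q \<in> U t" by blast
        then obtain d where d: "path_from_to (subtopology Z (U t)) b q d" using connected by blast
        have "t' = t" if "q \<in> U t'" for t' using that t False by (cases t; cases t') auto
        then show ?thesis using d False \<open>q \<noteq> b\<close> by blast
      qed (use \<open>q \<noteq> b\<close> False in blast)
    qed
  qed
  then obtain c where c: "\<And>q. (q = b \<longrightarrow> c q = (\<lambda>_. b)) \<and> (\<forall>t. q \<in> U t \<longrightarrow> path_from_to (subtopology Z (U t)) b q (c q)) \<and>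
      (q \<in> ?W \<longrightarrow> path_from_to (subtopology Z ?W) b q (c q))" by metis
  show thesis by (rule that[of c]) (use c in blast)+
qed

text \<open>Choose paths \<open>c q\<close> from the base point to all points \<open>q\<close>, inside the intersection whenever \<open>q\<close> lies
  there. They turn paths \<open>\<gamma>\<close> inside \<open>U t\<close> into loops, to which \<open>\<phi> t\<close> applies. On the intersection both
  \<open>\<phi> True\<close> and \<open>\<phi> False\<close> give \<open>1\<close>, since the loops are contractible there; so the functionals agree.\<close>

theorem van_kampen_hom:
  assumes H: "group H"
    and phi: "\<And>t. \<phi> t \<in> hom (fundamental_group (subtopology Z (U t)) b) H"
  obtains f where "f \<in> hom (fundamental_group Z b) H"
    "\<forall>t \<gamma>. path_from_to (subtopology Z (U t)) b b \<gamma> \<longrightarrow>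
        f (loop_class Z b \<gamma>) = \<phi> t (loop_class (subtopology Z (U t)) b \<gamma>)"
proof -
  obtain c where c: "c b = (\<lambda>_. b)" "\<And>t q. q \<in> U t \<Longrightarrow> path_from_to (subtopology Z (U t)) b q (c q)"
    "\<And>q. q \<in> U True \<inter> U False \<Longrightarrow> path_from_to (subtopology Z (U True \<inter> U False)) b q (c q)"
    using connecting_paths by blast
  interpret H: group H by (rule H)
  let ?S = "\<lambda>t. subtopology Z (U t)" and ?W = "subtopology Z (U True \<inter> U False)"
  have bS: "b \<in> topspace (?S t)" for t using base cover by (cases t) auto
  have ends: "u \<in> U t" "v \<in> U t" if "path_from_to (?S t) u v \<gamma>" for t u v \<gamma>
    using path_from_to_topspace[OF that] by auto
  define F where "F t \<gamma> = \<phi> t (loop_class (?S t) b (twist (c (\<gamma> 0)) \<gamma> (c (\<gamma> 1))))" for t \<gamma>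
  have Feq: "F t \<gamma> = \<phi> t (loop_class (?S t) b (twist (c u) \<gamma> (c v)))"
    and Fpath: "path_from_to (?S t) b b (twist (c u) \<gamma> (c v))" if "path_from_to (?S t) u v \<gamma>" for t u v \<gamma>
  proof -
    show "F t \<gamma> = \<phi> t (loop_class (?S t) b (twist (c u) \<gamma> (c v)))" using that by (simp add: F_def path_from_to_def)
    show "path_from_to (?S t) b b (twist (c u) \<gamma> (c v))"
      by (rule path_from_to_twist[OF c(2)[OF ends(1)[OF that]] that c(2)[OF ends(2)[OF that]]])
  qed
  interpret path_functional H Z U F
  proof unfold_locales
    fix t show "openin Z (U t)" by (rule open_U)
    show "topspace Z = U True \<union> U False" by (rule cover)
    show "F t \<gamma> \<in> carrier H" if "path_from_to (?S t) u v \<gamma>" for u v \<gamma>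
      unfolding Feq[OF that] by (rule hom_in_carrier[OF phi loop_class_carrier[OF Fpath[OF that]]])
    show "F t \<gamma> = F t \<delta>" if h: "path_homotopic (?S t) u v \<gamma> \<delta>" for u v \<gamma> \<delta>
    proof -
      note g = path_homotopic_imp_path(1)[OF h] and d = path_homotopic_imp_path(2)[OF h]
      note cu = path_homotopic_refl[OF c(2)[OF ends(1)[OF g]]] and cv = path_homotopic_refl[OF c(2)[OF ends(2)[OF g]]]
      show ?thesis unfolding Feq[OF g] Feq[OF d] loop_class_eqI[OF homotopic_twist[OF cu h cv]] ..
    qed
    show "F t (path_concat \<gamma> \<delta>) = F t \<gamma> \<otimes>\<^bsub>H\<^esub> F t \<delta>"
      if g: "path_from_to (?S t) u v \<gamma>" and d: "path_from_to (?S t) v w \<delta>" for u v w \<gamma> \<delta>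
    proof -
      note cu = c(2)[OF ends(1)[OF g]] and cv = c(2)[OF ends(2)[OF g]] and cw = c(2)[OF ends(2)[OF d]]
      have "loop_class (?S t) b (twist (c u) (path_concat \<gamma> \<delta>) (c w)) =
        loop_class (?S t) b (twist (c u) \<gamma> (c v)) \<otimes>\<^bsub>fundamental_group (?S t) b\<^esub> loop_class (?S t) b (twist (c v) \<delta> (c w))"
        unfolding fundamental_group_mult[OF Fpath[OF g] Fpath[OF d]]
        by (rule loop_class_eqI[OF path_homotopic_sym[OF twist_mult[OF cu g cv d cw]]])
      then show ?thesis
        unfolding Feq[OF path_from_to_concat[OF g d]] Feq[OF g] Feq[OF d]
        using hom_mult[OF phi loop_class_carrier[OF Fpath[OF g]] loop_class_carrier[OF Fpath[OF d]]] by simp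
    qed
    show "F True \<gamma> = F False \<gamma>" if g: "path_from_to ?W u v \<gamma>" for u v \<gamma>
    proof -
      have uv: "u \<in> U True \<inter> U False" "v \<in> U True \<inter> U False" using path_from_to_topspace[OF g] by auto
      have "path_homotopic ?W b b (twist (c u) \<gamma> (c v)) (\<lambda>_. b)"
        by (rule simply_connected_inter[OF path_from_to_twist[OF c(3)[OF uv(1)] g c(3)[OF uv(2)]]])
      then have "path_homotopic (?S t) b b (twist (c u) \<gamma> (c v)) (\<lambda>_. b)" for t
        by (rule path_homotopic_subtopology_mono) (cases t; auto)
      then have "loop_class (?S t) b (twist (c u) \<gamma> (c v)) = \<one>\<^bsub>fundamental_group (?S t) b\<^esub>" for t
        unfolding fundamental_group_one by (rule loop_class_eqI)
      moreover have "path_from_to (?S t) u v \<gamma>" for t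
        using g unfolding path_from_to_subtopology by (cases t) auto
      ultimately have "F t \<gamma> = \<one>\<^bsub>H\<^esub>" for t
        using Feq[of t u v \<gamma>] hom_one[OF phi group_fundamental_group[OF bS] H] by simp
      then show ?thesis by simp
    qed
  qed
  show thesis
  proof (rule that)
    have 1: "globalized \<gamma> \<in> carrier H" if "path_from_to Z b b \<gamma>" for \<gamma> using globalized_closed that by (simp add: path_from_to_def)
    show "(\<lambda>c. globalized (representative c)) \<in> hom (fundamental_group Z b) H"
      by (rule hom_of_loop_functional(1)[OF 1 globalized_homotopic globalized_concat])
    show "\<forall>t \<gamma>. path_from_to (?S t) b b \<gamma> \<longrightarrow>
        globalized (representative (loop_class Z b \<gamma>)) = \<phi> t (loop_class (?S t) b \<gamma>)"
    proof (intro allI impI)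
      fix t \<gamma> assume g: "path_from_to (?S t) b b \<gamma>"
      then have gZ: "path_from_to Z b b \<gamma>" by (simp add: path_from_to_subtopology)
      have "globalized (representative (loop_class Z b \<gamma>)) = globalized \<gamma>"
        by (rule hom_of_loop_functional(2)[OF 1 globalized_homotopic globalized_concat gZ])
      also have "\<dots> = \<phi> t (loop_class (?S t) b (twist (\<lambda>_. b) \<gamma> (\<lambda>_. b)))"
        unfolding globalized_small[OF g] Feq[OF g] c(1) ..
      also have "\<dots> = \<phi> t (loop_class (?S t) b \<gamma>)" unfolding loop_class_eqI[OF twist_const[OF g]] ..
      finally show "globalized (representative (loop_class Z b \<gamma>)) = \<phi> t (loop_class (?S t) b \<gamma>)" .
    qed
  qed
qed

text \<open>The same construction with the class of the loop in \<open>Z\<close> itself as value: the class of a loop is the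
  product of the classes that belong to the pieces of a subdivision.\<close>

theorem van_kampen_generate:
  "generate (fundamental_group Z b) (\<Union>t. {loop_class Z b \<gamma> | \<gamma>. path_from_to (subtopology Z (U t)) b b \<gamma>})
     = carrier (fundamental_group Z b)" (is "generate ?G ?S = _")
proof -
  obtain c where c: "c b = (\<lambda>_. b)" "\<And>t q. q \<in> U t \<Longrightarrow> path_from_to (subtopology Z (U t)) b q (c q)"
    "\<And>q. q \<in> U True \<inter> U False \<Longrightarrow> path_from_to (subtopology Z (U True \<inter> U False)) b q (c q)"
    using connecting_paths by blast
  have bZ: "b \<in> topspace Z" using base cover by blast
  interpret G: group ?G by (rule group_fundamental_group[OF bZ])
  have cZ: "path_from_to Z b q (c q)" if q: "q \<in> topspace Z" for q
  proof -
    have *: "path_from_to Z b q (c q)" if "q \<in> U t" for t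
      using c(2)[OF that] by (simp add: path_from_to_subtopology)
    have "q \<in> U True \<or> q \<in> U False" using q cover by simp
    then show ?thesis using *[of True] *[of False] by satx
  qed
  define F where "F \<gamma> = loop_class Z b (twist (c (\<gamma> 0)) \<gamma> (c (\<gamma> 1)))" for \<gamma>
  have Feq: "F \<gamma> = loop_class Z b (twist (c u) \<gamma> (c v))"
    and Fpath: "path_from_to Z b b (twist (c u) \<gamma> (c v))" if "path_from_to Z u v \<gamma>" for u v \<gamma>
  proof -
    show "F \<gamma> = loop_class Z b (twist (c u) \<gamma> (c v))" using that by (simp add: F_def path_from_to_def)
    show "path_from_to Z b b (twist (c u) \<gamma> (c v))"
      by (rule path_from_to_twist[OF cZ that cZ]) (use path_from_to_topspace[OF that] in simp_all)
  qed
  have F1: "F \<gamma> \<in> carrier ?G" if "path_from_to Z u v \<gamma>" for u v \<gamma>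
    unfolding Feq[OF that] by (rule loop_class_carrier[OF Fpath[OF that]])
  have F2: "F \<gamma> = F \<delta>" if h: "path_homotopic Z u v \<gamma> \<delta>" for u v \<gamma> \<delta>
  proof -
    note g = path_homotopic_imp_path(1)[OF h] and d = path_homotopic_imp_path(2)[OF h]
    have uv: "u \<in> topspace Z" "v \<in> topspace Z" using path_from_to_topspace[OF g] by auto
    show ?thesis unfolding Feq[OF g] Feq[OF d]
      by (rule loop_class_eqI[OF homotopic_twist[OF path_homotopic_refl[OF cZ[OF uv(1)]] h path_homotopic_refl[OF cZ[OF uv(2)]]]])
  qed
  have F3: "F (path_concat \<gamma> \<delta>) = F \<gamma> \<otimes>\<^bsub>?G\<^esub> F \<delta>" if g: "path_from_to Z u v \<gamma>" and d: "path_from_to Z v w \<delta>" for u v w \<gamma> \<delta>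
  proof -
    have uv: "u \<in> topspace Z" "v \<in> topspace Z" "w \<in> topspace Z"
      using path_from_to_topspace[OF g] path_from_to_topspace[OF d] by auto
    show ?thesis unfolding Feq[OF path_from_to_concat[OF g d]] Feq[OF g] Feq[OF d] fundamental_group_mult[OF Fpath[OF g] Fpath[OF d]]
      by (rule loop_class_eqI[OF path_homotopic_sym[OF twist_mult[OF cZ[OF uv(1)] g cZ[OF uv(2)] d cZ[OF uv(3)]]]])
  qed
  have loc: "path_from_to Z u v \<gamma>" if "path_from_to (subtopology Z (U t)) u v \<gamma>" for t u v \<gamma>
    using that by (simp add: path_from_to_subtopology)
  interpret path_functional ?G Z U "\<lambda>_. F"
  proof unfold_locales
    show "F \<gamma> = F \<delta>" if "path_homotopic (subtopology Z (U t)) u v \<gamma> \<delta>" for t u v \<gamma> \<delta>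
      by (rule F2[OF path_homotopic_subtopology[OF that]])
  qed (use open_U cover F1[OF loc] F3[OF loc loc] in auto)
  have inS: "F \<gamma> \<in> ?S" if g: "path_from_to (subtopology Z (U t)) u v \<gamma>" for t u v \<gamma>
  proof -
    have uv: "u \<in> U t" "v \<in> U t" using path_from_to_topspace[OF g] by auto
    have "path_from_to (subtopology Z (U t)) b b (twist (c u) \<gamma> (c v))"
      by (rule path_from_to_twist[OF c(2)[OF uv(1)] g c(2)[OF uv(2)]])
    then show ?thesis unfolding Feq[OF loc[OF g]] by blast
  qed
  have "x \<in> generate ?G ?S" if x: "x \<in> carrier ?G" for x
  proof -
    obtain \<gamma> where g: "path_from_to Z b b \<gamma>" "x = loop_class Z b \<gamma>" using x by (auto simp: fundamental_group_carrier)
    have "globalized \<gamma> = F \<gamma>" by (rule globalized_eq_functional[OF F1 F2 F3 refl g(1)])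
    also have "\<dots> = x" unfolding Feq[OF g(1)] c(1) g(2) by (rule loop_class_eqI[OF twist_const[OF g(1)]])
    finally have "globalized \<gamma> = x" .
    moreover have "globalized \<gamma> \<in> generate ?G ?S"
      by (rule globalized_in_generate[OF inS]) (use g(1) in \<open>simp_all add: path_from_to_def\<close>)
    ultimately show ?thesis by simp
  qed
  moreover have "?S \<subseteq> carrier ?G"
  proof
    fix x assume "x \<in> ?S"
    then obtain t \<gamma> where "path_from_to (subtopology Z (U t)) b b \<gamma>" "x = loop_class Z b \<gamma>" by blast
    then show "x \<in> carrier ?G" using loop_class_carrier[OF loc] by simp
  qed
  ultimately show ?thesis using G.generate_incl by blast
qed

end

section \<open>Gluing two spaces along punctured balls\<close>

lemma simply_connected_transport:
  fixes A :: "'e::real_normed_vector set"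
  assumes sc: "simply_connected A" and hm: "homeomorphic_maps (top_of_set A) (subtopology Z W) k k'"
    and W: "W \<subseteq> topspace Z" and b: "b \<in> W"
  shows "q \<in> W \<Longrightarrow> \<exists>c. path_from_to (subtopology Z W) b q c"
    and "path_from_to (subtopology Z W) b b \<gamma> \<Longrightarrow> path_homotopic (subtopology Z W) b b \<gamma> (\<lambda>_. b)"
proof -
  let ?S = "subtopology Z W"
  have k: "continuous_map (top_of_set A) ?S k" and k': "continuous_map ?S (top_of_set A) k'"
    and kk': "\<And>q. q \<in> W \<Longrightarrow> k (k' q) = q"
    using hm W by (auto simp: homeomorphic_maps_def)
  have inA: "k' q \<in> A" if "q \<in> W" for q using continuous_map_funspace[OF k'] that W by auto
  show "\<exists>c. path_from_to ?S b q c" if q: "q \<in> W"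
  proof -
    have "path_connected A" using sc simply_connected_imp_path_connected by blast
    then obtain p where p: "path p" "path_image p \<subseteq> A" "pathstart p = k' b" "pathfinish p = k' q"
      using inA[OF b] inA[OF q] unfolding path_connected_def by blast
    have "path_from_to (top_of_set A) (k' b) (k' q) p"
      using p unfolding path_from_to_def by (auto simp: path_def path_image_def pathstart_def pathfinish_def pathin_def continuous_map_in_subtopology)
    from path_from_to_map[OF k this] show ?thesis using kk' b q by auto
  qed
  show "path_homotopic ?S b b \<gamma> (\<lambda>_. b)" if g: "path_from_to ?S b b \<gamma>"
  proof -
    have kg: "path_from_to (top_of_set A) (k' b) (k' b) (k' \<circ> \<gamma>)" by (rule path_from_to_map[OF k' g])
    have im: "\<gamma> ` {0..1} \<subseteq> W" using g by (simp add: path_from_to_subtopology)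
    have "path (k' \<circ> \<gamma>)" "path_image (k' \<circ> \<gamma>) \<subseteq> A" "pathstart (k' \<circ> \<gamma>) = k' b" "pathfinish (k' \<circ> \<gamma>) = k' b"
      using kg by (auto simp: path_from_to_def pathin_def path_def path_image_def pathstart_def pathfinish_def continuous_map_in_subtopology)
    then have "homotopic_paths A (k' \<circ> \<gamma>) (linepath (k' b) (k' b))"
      using sc unfolding simply_connected_eq_contractible_path by metis
    from path_homotopic_of_homotopic_paths[OF this k]
    have "path_homotopic ?S b b (k \<circ> (k' \<circ> \<gamma>)) (k \<circ> linepath (k' b) (k' b))"
      using \<open>pathstart (k' \<circ> \<gamma>) = k' b\<close> \<open>pathfinish (k' \<circ> \<gamma>) = k' b\<close> kk'[OF b] by simp
    moreover have "k \<circ> linepath (k' b) (k' b) = (\<lambda>_. b)" using kk'[OF b] by (auto simp: linepath_refl)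
    moreover have "path_homotopic ?S b b \<gamma> (k \<circ> (k' \<circ> \<gamma>))"
    proof (rule path_homotopic_eq_on[OF g])
      fix t :: real assume "0 \<le> t" "t \<le> 1"
      then have "\<gamma> t \<in> W" using im by auto
      then show "\<gamma> t = (k \<circ> (k' \<circ> \<gamma>)) t" using kk' by simp
    qed
    ultimately show ?thesis using path_homotopic_trans by metis
  qed
qed

text \<open>Inversion in the unit sphere exchanges the inside and the outside of the ball and fixes the
  sphere, so it matches the gluing of two summands along the sphere.\<close>

definition inversion :: "real^3 \<Rightarrow> real^3" where
  "inversion v = (1 / (norm v)\<^sup>2) *\<^sub>R v"

lemma inversion:
  assumes "v \<noteq> 0"
  shows "inversion v \<noteq> 0" "norm (inversion v) = 1 / norm v" "inversion (inversion v) = v"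
proof -
  have n: "norm v \<noteq> 0" using assms by simp
  show 1: "norm (inversion v) = 1 / norm v" using n by (simp add: inversion_def power2_eq_square)
  show "inversion v \<noteq> 0" using assms by (simp add: inversion_def)
  have "inversion (inversion v) = (1 / (norm (inversion v))\<^sup>2) *\<^sub>R inversion v" by (rule inversion_def)
  also have "\<dots> = v" unfolding 1 using n by (simp add: inversion_def power_divide)
  finally show "inversion (inversion v) = v" .
qed

lemma inversion_sphere: "norm v = 1 \<Longrightarrow> inversion v = v"
  by (simp add: inversion_def)

lemma continuous_on_inversion: "continuous_on (- {0}) inversion"
  unfolding inversion_def by (intro continuous_intros) auto

text \<open>The connected sum in a form that is symmetric in the two summands \<open>S True\<close> and \<open>S False\<close>. The set
  \<open>D t\<close> is the summand minus the open ball, and \<open>h t\<close> its structure map into \<open>X\<close>.\<close>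

locale gluing =
  fixes X :: "'a topology" and S :: "bool \<Rightarrow> 'a topology" and e :: "bool \<Rightarrow> real^3 \<Rightarrow> 'a" and h :: "bool \<Rightarrow> 'a \<Rightarrow> 'a"
    and D :: "bool \<Rightarrow> 'a set"
  assumes D_def: "\<And>t. D t = topspace (S t) - e t ` ball 0 1"
    and Hausdorff: "\<And>t. Hausdorff_space (S t)"
    and conn: "\<And>t. connected_space (S t)"
    and lpc: "\<And>t. locally_path_connected_space (S t)"
    and e_embedding: "\<And>t. embedding_map euclidean (S t) (e t)"
    and e_open: "\<And>t. openin (S t) (range (e t))"
    and openin_X: "\<And>Q. Q \<subseteq> topspace X \<Longrightarrow>
       openin X Q \<longleftrightarrow> (\<forall>t. openin (subtopology (S t) (D t)) {z \<in> D t. h t z \<in> Q})"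
    and cover_X: "topspace X = h True ` D True \<union> h False ` D False"
    and h_inj: "\<And>t. inj_on (h t) (D t)"
    and h_glue: "\<And>t y z. y \<in> D t \<Longrightarrow> z \<in> D (\<not> t) \<Longrightarrow>
       h t y = h (\<not> t) z \<longleftrightarrow> (\<exists>s\<in>sphere 0 1. y = e t s \<and> z = e (\<not> t) s)"
begin

definition e_inv :: "bool \<Rightarrow> 'a \<Rightarrow> real^3" where "e_inv t = inv_into UNIV (e t)"

lemma e_homeo: "homeomorphic_map euclidean (subtopology (S t) (range (e t))) (e t)"
  using e_embedding[of t] by (simp add: embedding_map_def)

lemma e_inj: "inj (e t)"
  using homeomorphic_imp_injective_map[OF e_homeo[of t]] by simp

lemma e_inv_e [simp]: "e_inv t (e t v) = v"
  by (simp add: e_inv_def e_inj)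

lemma e_eq_iff [simp]: "e t v = e t w \<longleftrightarrow> v = w"
  using e_inj by (auto simp: inj_def)

lemma e_maps: "homeomorphic_maps euclidean (subtopology (S t) (range (e t))) (e t) (e_inv t)"
proof -
  obtain g where g: "homeomorphic_maps euclidean (subtopology (S t) (range (e t))) (e t) g"
    using e_homeo[of t] homeomorphic_map_maps by blast
  then have cg: "continuous_map (subtopology (S t) (range (e t))) euclidean g" and ge: "\<And>v. g (e t v) = v"
    by (auto simp: homeomorphic_maps_def)
  from cg have "continuous_map (subtopology (S t) (range (e t))) euclidean (e_inv t)"
    by (rule continuous_map_eq) (auto simp: ge)
  then show ?thesis using g by (auto simp: homeomorphic_maps_def)
qed

lemma e_continuous: "continuous_map euclidean (S t) (e t)"
  using e_maps[of t] by (simp add: homeomorphic_maps_def continuous_map_in_subtopology)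

lemma e_in [simp]: "e t v \<in> topspace (S t)"
  using continuous_map_funspace[OF e_continuous[of t]] by auto

lemma e_open_map: "open V \<Longrightarrow> openin (S t) (e t ` V)"
proof -
  assume "open V"
  then have "openin (subtopology (S t) (range (e t))) (e t ` V)"
    using homeomorphic_imp_open_map[OF e_homeo[of t]] by (simp add: open_map_def)
  then show ?thesis using openin_open_subtopology[OF e_open] by blast
qed

lemma e_in_D: "e t v \<in> D t \<longleftrightarrow> 1 \<le> norm v"
  by (auto simp: D_def image_iff)

lemma not_in_D: "q \<in> topspace (S t) \<Longrightarrow> q \<notin> D t \<Longrightarrow> \<exists>v. q = e t v \<and> norm v < 1"
  by (auto simp: D_def)

definition punctured :: "bool \<Rightarrow> 'a set" where "punctured t = topspace (S t) - {e t 0}"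

lemma D_punctured: "D t \<subseteq> punctured t"
  by (auto simp: D_def punctured_def)

lemma punctured_open: "openin (S t) (punctured t)"
proof -
  have "closedin (S t) {e t 0}" using closedin_Hausdorff_singleton[OF Hausdorff, of "e t 0" t] by simp
  then show ?thesis by (simp add: punctured_def openin_diff)
qed

lemma e_punctured: "e t v \<in> punctured t \<longleftrightarrow> v \<noteq> 0"
  by (auto simp: punctured_def)

text \<open>The structure map \<open>h t\<close> is extended across the neck, to all of the summand except for the centre of
  the ball: the punctured ball is sent to a collar of the sphere in the other summand. Unlike the sets
  \<open>h t ` D t\<close>, the images of these maps are open and overlap.\<close>

definition g :: "bool \<Rightarrow> 'a \<Rightarrow> 'a" where
  "g t q = (if q \<in> D t then h t q else h (\<not> t) (e (\<not> t) (inversion (e_inv t q))))"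

lemma g_D: "q \<in> D t \<Longrightarrow> g t q = h t q"
  by (simp add: g_def)

lemma inversion_D: "v \<noteq> 0 \<Longrightarrow> norm v \<le> 1 \<Longrightarrow> e t (inversion v) \<in> D t"
  by (simp add: e_in_D inversion)

lemma g_e_inner:
  assumes "v \<noteq> 0" "norm v \<le> 1"
  shows "g t (e t v) = h (\<not> t) (e (\<not> t) (inversion v))"
proof (cases "norm v = 1")
  case True
  have "h t (e t v) = h (\<not> t) (e (\<not> t) v)"
    using h_glue[of "e t v" t "e (\<not> t) v"] True by (auto simp: e_in_D)
  then show ?thesis using True by (simp add: g_def e_in_D inversion_sphere)
qed (use assms in \<open>simp add: g_def e_in_D\<close>)

lemma g_transition:
  assumes "v \<noteq> 0"
  shows "g t (e t v) = g (\<not> t) (e (\<not> t) (inversion v))"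
proof (cases "norm v \<le> 1")
  case True
  then show ?thesis using g_e_inner[OF assms True] g_D[OF inversion_D[OF assms True]] by simp
next
  case False
  have "norm (inversion v) \<le> 1" using False assms by (simp add: inversion)
  from g_e_inner[OF inversion(1)[OF assms] this, of "\<not> t"]
  show ?thesis using False assms by (simp add: inversion g_D e_in_D)
qed

lemma punctured_cases:
  assumes "q \<in> punctured t"
  obtains "q \<in> D t" | v where "q = e t v" "v \<noteq> 0" "norm v < 1"
  using assms not_in_D[of q t] by (auto simp: punctured_def)

lemma g_inj: "inj_on (g t) (punctured t)"
proof -
  have mixed: False if that: "q \<in> D t" "v \<noteq> 0" "norm v < 1" "g t q = g t (e t v)" for q v
  proof -
    have hq: "h t q = h (\<not> t) (e (\<not> t) (inversion v))" using that g_D g_e_inner[of v t] by simp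
    have "norm v \<le> 1" using that(3) by simp
    from h_glue[OF that(1) inversion_D[OF that(2) this, of "\<not> t"]] hq have "norm (inversion v) = 1" by auto
    then show False using that(2,3) by (simp add: inversion)
  qed
  show ?thesis
  proof (rule inj_onI)
    fix q q' assume q: "q \<in> punctured t" and q': "q' \<in> punctured t" and eq: "g t q = g t q'"
    from q show "q = q'"
    proof (cases rule: punctured_cases)
      case 1
      note qD = 1
      from q' show ?thesis
      proof (cases rule: punctured_cases)
        case 1
        then show ?thesis using qD eq h_inj[of t] by (simp add: g_D inj_on_def)
      next
        case (2 v)
        then show ?thesis using mixed[OF qD 2(2,3)] eq by simp
      qed
    next
      case (2 v)
      note qe = 2
      from q' show ?thesis
      proof (cases rule: punctured_cases)
        case 1
        then show ?thesis using mixed[OF 1 qe(2,3)] eq qe(1) by simp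
      next
        case (2 w)
        have "h (\<not> t) (e (\<not> t) (inversion v)) = h (\<not> t) (e (\<not> t) (inversion w))"
          using eq qe 2 g_e_inner[of v t] g_e_inner[of w t] by simp
        then have "e (\<not> t) (inversion v) = e (\<not> t) (inversion w)"
          by (rule inj_onD[OF h_inj[of "\<not> t"]]) (use inversion_D[of v "\<not> t"] inversion_D[of w "\<not> t"] qe 2 in simp_all)
        then have "inversion v = inversion w" by simp
        then have "v = w" using inversion(3) qe(2) 2(2) by metis
        then show ?thesis using qe 2 by simp
      qed
    qed
  qed
qed

lemma h_in: "q \<in> D t \<Longrightarrow> h t q \<in> topspace X"
  using cover_X by (cases t) auto

lemma g_in: "q \<in> punctured t \<Longrightarrow> g t q \<in> topspace X"
proof (erule punctured_cases)
  fix v assume "q = e t v" "v \<noteq> 0" "norm v < 1"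
  then show "g t q \<in> topspace X" using g_e_inner[of v t] h_in[OF inversion_D[of v "\<not> t"]] by simp
qed (simp add: g_D h_in)

text \<open>The image of an open set has to be pulled back to both pieces. In the piece \<open>D (\<not> t)\<close> it consists
  of the points outside the ball whose inversions lie in the given set.\<close>

lemma g_open_map:
  assumes "openin (S t) O'" "O' \<subseteq> punctured t"
  shows "openin X (g t ` O')"
proof -
  have sub: "g t ` O' \<subseteq> topspace X" using g_in assms(2) by auto
  have same: "{z \<in> D t. h t z \<in> g t ` O'} = D t \<inter> O'"
  proof -
    have "z \<in> O'" if "z \<in> D t" "q \<in> O'" "h t z = g t q" for z q
      using inj_onD[OF g_inj[of t], of z q] that assms(2) D_punctured[of t] by (auto simp: g_D)
    moreover have "h t z \<in> g t ` O'" if "z \<in> D t" "z \<in> O'" for z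
      using that g_D[of z t] by (metis imageI)
    ultimately show ?thesis by auto
  qed
  define N where "N = {u. u \<noteq> 0 \<and> e t (inversion u) \<in> O'}"
  have other: "{z \<in> D (\<not> t). h (\<not> t) z \<in> g t ` O'} = D (\<not> t) \<inter> e (\<not> t) ` N"
  proof (intro equalityI subsetI)
    fix z assume "z \<in> {z \<in> D (\<not> t). h (\<not> t) z \<in> g t ` O'}"
    then obtain q where z: "z \<in> D (\<not> t)" and q: "q \<in> O'" "h (\<not> t) z = g t q" by auto
    from q(1) assms(2) have "q \<in> punctured t" by auto
    then show "z \<in> D (\<not> t) \<inter> e (\<not> t) ` N"
    proof (cases rule: punctured_cases)
      case 1
      then obtain s where s: "s \<in> sphere 0 1" "q = e t s" "z = e (\<not> t) s"
        using h_glue[OF 1 z] q(2) g_D by auto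
      then have "s \<in> N" using q(1) by (auto simp: N_def inversion_sphere)
      then show ?thesis using s z by auto
    next
      case (2 v)
      then have "z = e (\<not> t) (inversion v)"
        using q(2) g_e_inner[of v t] inj_onD[OF h_inj[of "\<not> t"]] z inversion_D[of v "\<not> t"] by simp
      moreover have "inversion v \<in> N" using q(1) 2 by (simp add: N_def inversion)
      ultimately show ?thesis using z by auto
    qed
  next
    fix z assume "z \<in> D (\<not> t) \<inter> e (\<not> t) ` N"
    then obtain u where u: "z = e (\<not> t) u" "u \<noteq> 0" "e t (inversion u) \<in> O'" "z \<in> D (\<not> t)" by (auto simp: N_def)
    then have "1 \<le> norm u" by (simp add: e_in_D)
    then have "g t (e t (inversion u)) = h (\<not> t) z"
      using g_e_inner[of "inversion u" t] u(1,2) by (simp add: inversion)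
    then show "z \<in> {z \<in> D (\<not> t). h (\<not> t) z \<in> g t ` O'}" using u(3,4) by (metis (mono_tags, lifting) imageI mem_Collect_eq)
  qed
  have "open N"
  proof -
    have "continuous_map (top_of_set (- {0})) (S t) (e t \<circ> inversion)"
      by (rule continuous_map_compose[OF _ e_continuous]) (simp add: continuous_on_inversion)
    then have "openin (top_of_set (- {0})) {u \<in> - {0}. (e t \<circ> inversion) u \<in> O'}"
      using openin_continuous_map_preimage[OF _ assms(1)] by fastforce
    then have "open {u \<in> - {0}. (e t \<circ> inversion) u \<in> O'}"
      using openin_open_eq[of "- {0 :: real^3}"] by auto
    then show ?thesis by (simp add: N_def)
  qed
  then have "openin (subtopology (S (\<not> t)) (D (\<not> t))) (D (\<not> t) \<inter> e (\<not> t) ` N)"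
    using openin_subtopology_Int2[OF e_open_map] by blast
  moreover have "openin (subtopology (S t) (D t)) (D t \<inter> O')"
    using openin_subtopology_Int2[OF assms(1)] by blast
  ultimately have *: "openin (subtopology (S t) (D t)) {z \<in> D t. h t z \<in> g t ` O'}"
    "openin (subtopology (S (\<not> t)) (D (\<not> t))) {z \<in> D (\<not> t). h (\<not> t) z \<in> g t ` O'}"
    unfolding same other by simp_all
  have "\<forall>s. openin (subtopology (S s) (D s)) {z \<in> D s. h s z \<in> g t ` O'}"
  proof
    fix s
    have "s = t \<or> s = (\<not> t)" by auto
    then show "openin (subtopology (S s) (D s)) {z \<in> D s. h s z \<in> g t ` O'}" using * by (elim disjE) simp_all
  qed
  then show ?thesis using openin_X[OF sub] by blast
qed

lemma D_subset: "D t \<subseteq> topspace (S t)"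
  by (auto simp: D_def)

lemma h_continuous: "continuous_map (subtopology (S t) (D t)) X (h t)"
  unfolding continuous_map_def
proof (intro conjI allI impI)
  show "h t \<in> topspace (subtopology (S t) (D t)) \<rightarrow> topspace X" using h_in by auto
  fix O' assume O: "openin X O'"
  then have "openin (subtopology (S t) (D t)) {z \<in> D t. h t z \<in> O'}" using openin_X openin_subset by blast
  moreover have "topspace (subtopology (S t) (D t)) = D t" using D_subset by auto
  ultimately show "openin (subtopology (S t) (D t)) {x \<in> topspace (subtopology (S t) (D t)). h t x \<in> O'}" by simp
qed

lemma cball_closed: "closedin (S t) (e t ` cball 0 r)"
  by (rule compactin_imp_closedin[OF Hausdorff image_compactin[OF _ e_continuous]]) auto

lemma D_closed: "closedin (S t) (D t)"
  unfolding D_def by (intro closedin_diff e_open_map closedin_topspace) auto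

lemma g_continuous: "continuous_map (subtopology (S t) (punctured t)) X (g t)"
proof -
  let ?P = "subtopology (S t) (punctured t)"
  define T where "T i = (if i then D t else e t ` cball 0 1 \<inter> punctured t)" for i :: bool
  define f where "f i = (if i then h t else h (\<not> t) \<circ> (e (\<not> t) \<circ> (inversion \<circ> e_inv t)))" for i :: bool
  have tP: "topspace ?P = punctured t" by (auto simp: punctured_def)
  have TP: "T i \<subseteq> punctured t" for i using D_punctured by (auto simp: T_def)
  show ?thesis
  proof (rule pasting_lemma_closed[of "UNIV :: bool set" _ T _ f])
    fix i :: bool
    show "closedin ?P (T i)"
      using closedin_subtopology_Int_closed[OF D_closed[of t], of "punctured t"]
        closedin_subtopology_Int_closed[OF cball_closed[of t 1], of "punctured t"] Int_absorb1[OF D_punctured[of t]]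
      by (cases i) (simp_all add: T_def Int_commute)
    have sub: "subtopology ?P (T i) = subtopology (S t) (T i)" using TP by (simp add: subtopology_subtopology Int_absorb1)
    show "continuous_map (subtopology ?P (T i)) X (f i)"
    proof (cases i)
      case True
      then show ?thesis unfolding sub using h_continuous by (simp add: T_def f_def)
    next
      case False
      have c1: "continuous_map (subtopology (S t) (T i)) (top_of_set {v. v \<noteq> 0 \<and> norm v \<le> 1}) (e_inv t)"
      proof -
        have "T i \<subseteq> range (e t)" using False by (auto simp: T_def)
        then have "continuous_map (subtopology (S t) (T i)) euclidean (e_inv t)"
          using e_maps[of t] continuous_map_from_subtopology_mono by (fastforce simp: homeomorphic_maps_def)
        moreover have "e_inv t ` T i \<subseteq> {v. v \<noteq> 0 \<and> norm v \<le> 1}" using False by (auto simp: T_def e_punctured)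
        ultimately show ?thesis by (auto simp: continuous_map_in_subtopology)
      qed
      have c2: "continuous_map (top_of_set {v. v \<noteq> 0 \<and> norm v \<le> 1}) (top_of_set {v. 1 \<le> norm v}) inversion"
        using continuous_on_subset[OF continuous_on_inversion, of "{v. v \<noteq> 0 \<and> norm v \<le> 1}"]
        by (auto simp: continuous_map_in_subtopology inversion)
      have c3: "continuous_map (top_of_set {v. 1 \<le> norm v}) (subtopology (S (\<not> t)) (D (\<not> t))) (e (\<not> t))"
        using continuous_map_from_subtopology[OF e_continuous, of "{v. 1 \<le> norm v}" "\<not> t"]
        by (auto simp: continuous_map_in_subtopology e_in_D)
      have "continuous_map (subtopology (S t) (T i)) X (h (\<not> t) \<circ> (e (\<not> t) \<circ> (inversion \<circ> e_inv t)))"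
        by (rule continuous_map_compose[OF continuous_map_compose[OF continuous_map_compose[OF c1 c2] c3] h_continuous])
      then show ?thesis unfolding sub f_def using False by simp
    qed
  next
    have inner: "g t q = h (\<not> t) (e (\<not> t) (inversion (e_inv t q)))" if "q \<in> T False" for q
      using that by (auto simp: T_def e_punctured g_e_inner)
    fix i j q assume q: "q \<in> topspace ?P \<inter> T i \<inter> T j"
    have "f i q = g t q" if "q \<in> T i" for i
      using that inner g_D[of q t] by (cases i) (auto simp: f_def T_def)
    then show "f i q = f j q" using q by auto
  next
    fix q assume "q \<in> topspace ?P"
    then have "q \<in> punctured t" using tP by simp
    then show "\<exists>j. j \<in> UNIV \<and> q \<in> T j \<and> g t q = f j q"
    proof (cases rule: punctured_cases)
      case 1
      then show ?thesis by (intro exI[of _ True]) (simp add: T_def f_def g_D)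
    next
      case (2 v)
      then show ?thesis by (intro exI[of _ False]) (auto simp: T_def f_def g_e_inner e_punctured)
    qed
  qed simp
qed

definition V :: "bool \<Rightarrow> 'a set" where "V t = g t ` punctured t"

definition g_inv :: "bool \<Rightarrow> 'a \<Rightarrow> 'a" where "g_inv t = inv_into (punctured t) (g t)"

lemma g_inv_g: "q \<in> punctured t \<Longrightarrow> g_inv t (g t q) = q"
  by (simp add: g_inv_def g_inj)

lemma g_maps: "homeomorphic_maps (subtopology (S t) (punctured t)) (subtopology X (V t)) (g t) (g_inv t)"
proof -
  let ?P = "subtopology (S t) (punctured t)"
  have tP: "topspace ?P = punctured t" by (auto simp: punctured_def)
  have "open_map ?P X (g t)"
    unfolding open_map_def
  proof (intro allI impI)
    fix O' assume "openin ?P O'"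
    then have "openin (S t) O'" "O' \<subseteq> punctured t" using openin_open_subtopology[OF punctured_open] by auto
    then show "openin X (g t ` O')" by (rule g_open_map)
  qed
  then have "embedding_map ?P X (g t)"
    by (intro injective_open_imp_embedding_map g_continuous) (use tP g_inj in auto)
  then have "homeomorphic_map ?P (subtopology X (V t)) (g t)" unfolding embedding_map_def V_def tP .
  then obtain k where k: "homeomorphic_maps ?P (subtopology X (V t)) (g t) k" using homeomorphic_map_maps by blast
  have tV: "topspace (subtopology X (V t)) = V t" using g_in by (auto simp: V_def)
  have kg: "k (g t r) = r" if "r \<in> punctured t" for r
    using k that unfolding homeomorphic_maps_def tP by simp
  have kq: "k q = g_inv t q" if "q \<in> V t" for q
    using that by (auto simp: V_def kg g_inv_g)
  have ck: "continuous_map (subtopology X (V t)) ?P k" using k unfolding homeomorphic_maps_def by (elim conjE)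
  have "continuous_map (subtopology X (V t)) ?P (g_inv t)"
    by (rule continuous_map_eq[OF ck]) (simp only: tV kq)
  moreover have "continuous_map ?P (subtopology X (V t)) (g t)" using k unfolding homeomorphic_maps_def by (elim conjE)
  moreover have "g t (g_inv t q) = q" if "q \<in> V t" for q using that by (auto simp: V_def g_inv_g)
  ultimately show ?thesis unfolding homeomorphic_maps_def tP tV using g_inv_g by simp
qed

lemma V_open: "openin X (V t)"
  unfolding V_def by (rule g_open_map[OF punctured_open]) simp

lemma V_cover: "topspace X = V True \<union> V False"
proof -
  have "h t ` D t \<subseteq> V t" for t
  proof
    fix x assume "x \<in> h t ` D t"
    then obtain q where "q \<in> D t" "x = g t q" using g_D by (metis imageE)
    then show "x \<in> V t" using D_punctured by (auto simp: V_def)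
  qed
  moreover have "V t \<subseteq> topspace X" for t using g_in by (auto simp: V_def)
  ultimately show ?thesis using cover_X by blast
qed

lemma V_inter: "V True \<inter> V False = g t ` e t ` (- {0})"
proof -
  have 1: "g s ` e s ` (- {0}) \<subseteq> V True \<inter> V False" for s
  proof
    fix x assume "x \<in> g s ` e s ` (- {0})"
    then obtain v where v: "v \<noteq> 0" "x = g s (e s v)" by auto
    then have "x = g (\<not> s) (e (\<not> s) (inversion v))" using g_transition by simp
    then have "x \<in> V s" "x \<in> V (\<not> s)" unfolding V_def
      using v(2) e_punctured[of s v] e_punctured[of "\<not> s" "inversion v"] v(1) inversion(1)[OF v(1)]
      by (metis imageI)+
    then show "x \<in> V True \<inter> V False" by (cases s) auto
  qed
  have 2: "x \<in> g s ` e s ` (- {0})" if xs: "x \<in> V s" and xn: "x \<in> V (\<not> s)" for x s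
  proof -
    obtain q where q: "q \<in> punctured s" "x = g s q" using xs by (auto simp: V_def)
    obtain q' where q': "q' \<in> punctured (\<not> s)" "x = g (\<not> s) q'" using xn by (auto simp: V_def)
    from q(1) show ?thesis
    proof (cases rule: punctured_cases)
      case 1
      note qD = 1
      from q'(1) show ?thesis
      proof (cases rule: punctured_cases)
        case 1
        then obtain u where "u \<in> sphere 0 1" "q = e s u"
          using h_glue[OF qD 1] q(2) q'(2) g_D[OF qD] g_D[OF 1] by auto
        moreover from this have "u \<noteq> 0" by auto
        ultimately show ?thesis using q(2) by blast
      next
        case (2 v)
        then have "x = g s (e s (inversion v))" using q'(2) g_transition[of v "\<not> s"] by simp
        then show ?thesis using inversion(1)[OF 2(2)] by auto
      qed
    next
      case (2 v)
      then show ?thesis using q(2) by auto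
    qed
  qed
  show ?thesis
  proof
    show "V True \<inter> V False \<subseteq> g t ` e t ` (- {0})" using 2[of _ t] by (cases t) auto
    show "g t ` e t ` (- {0}) \<subseteq> V True \<inter> V False" by (rule 1)
  qed
qed

end

section \<open>Generalized torsion under homomorphisms\<close>

lemma conjugate_product_hom:
  assumes G: "group G" and H: "group H" and f: "f \<in> hom G H" and g: "g \<in> carrier G" and xs: "set xs \<subseteq> carrier G"
  shows "conjugate_product G g xs \<in> carrier G"
    and "f (conjugate_product G g xs) = conjugate_product H (f g) (map f xs)"
proof -
  interpret G: group G by (rule G)
  interpret H: group H by (rule H)
  interpret f: group_hom G H f by unfold_locales (rule f)
  have "conjugate_product G g xs \<in> carrier G \<and> f (conjugate_product G g xs) = conjugate_product H (f g) (map f xs)"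
    using xs
  proof (induction xs)
    case Nil
    then show ?case by (simp add: conjugate_product_def)
  next
    case (Cons x xs)
    then have x: "x \<in> carrier G" and IH: "conjugate_product G g xs \<in> carrier G"
      "f (conjugate_product G g xs) = conjugate_product H (f g) (map f xs)" by auto
    have s: "conjugate_product K k (y # ys) = (y \<otimes>\<^bsub>K\<^esub> k \<otimes>\<^bsub>K\<^esub> inv\<^bsub>K\<^esub> y) \<otimes>\<^bsub>K\<^esub> conjugate_product K k ys"
      for K :: "('k, 'n) monoid_scheme" and k y ys
      by (simp add: conjugate_product_def)
    show ?case unfolding list.map s using x g IH by (simp add: s)
  qed
  then show "conjugate_product G g xs \<in> carrier G"
    and "f (conjugate_product G g xs) = conjugate_product H (f g) (map f xs)" by auto
qed

lemma generalized_torsion_hom: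
  assumes "group G" "group H" "f \<in> hom G H" "generalized_torsion G g" "f g \<noteq> \<one>\<^bsub>H\<^esub>"
  shows "generalized_torsion H (f g)"
proof -
  obtain xs where g: "g \<in> carrier G" and xs: "xs \<noteq> []" "set xs \<subseteq> carrier G" "conjugate_product G g xs = \<one>\<^bsub>G\<^esub>"
    using assms(4) by (auto simp: generalized_torsion_def)
  have "conjugate_product H (f g) (map f xs) = f \<one>\<^bsub>G\<^esub>"
    using conjugate_product_hom(2)[OF assms(1-3) g xs(2)] xs(3) by simp
  also have "\<dots> = \<one>\<^bsub>H\<^esub>" by (rule hom_one[OF assms(3,1,2)])
  finally have "conjugate_product H (f g) (map f xs) = \<one>\<^bsub>H\<^esub>" .
  moreover have "f x \<in> carrier H" if "x \<in> carrier G" for x using assms(3) that by (rule hom_in_carrier)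
  ultimately show ?thesis unfolding generalized_torsion_def using xs g assms(5)
    by (intro conjI exI[of _ "map f xs"]) auto
qed

lemma generalized_torsion_inj_hom:
  assumes "group G" "group H" "f \<in> hom G H" "inj_on f (carrier G)" "generalized_torsion G g"
  shows "generalized_torsion H (f g)"
proof (rule generalized_torsion_hom[OF assms(1-3,5)])
  have g: "g \<in> carrier G" "g \<noteq> \<one>\<^bsub>G\<^esub>" using assms(5) by (auto simp: generalized_torsion_def)
  have 1: "\<one>\<^bsub>G\<^esub> \<in> carrier G" using assms(1) group.is_monoid monoid.one_closed by blast
  show "f g \<noteq> \<one>\<^bsub>H\<^esub>"
    using inj_onD[OF assms(4) _ g(1) 1] g(2) hom_one[OF assms(3,1,2)] by auto
qed

lemma (in group) conjugation_hom:
  assumes c: "c \<in> carrier G"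
  shows "(\<lambda>x. inv c \<otimes> x \<otimes> c) \<in> hom G G"
proof (rule homI)
  fix x y assume x: "x \<in> carrier G" and y: "y \<in> carrier G"
  have "c \<otimes> (inv c \<otimes> (y \<otimes> c)) = y \<otimes> c" using c y by (simp add: m_assoc[symmetric])
  then show "inv c \<otimes> (x \<otimes> y) \<otimes> c = (inv c \<otimes> x \<otimes> c) \<otimes> (inv c \<otimes> y \<otimes> c)"
    using c x y by (simp add: m_assoc)
qed (use c in auto)

lemma (in group) generalized_torsion_conjugate:
  assumes c: "c \<in> carrier G" and a: "a \<in> carrier G" and g: "generalized_torsion G (c \<otimes> a \<otimes> inv c)"
  shows "generalized_torsion G a"
proof -
  have e: "inv c \<otimes> (c \<otimes> a \<otimes> inv c) \<otimes> c = a" using c a by (simp add: m_assoc inv_solve_left')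
  have "a \<noteq> \<one>" using g c by (auto simp: generalized_torsion_def)
  then show ?thesis
    using generalized_torsion_hom[OF is_group is_group conjugation_hom[OF c] g] unfolding e by blast
qed

lemma torsion_free_inj_hom:
  assumes "group G" "group H" "f \<in> hom G H" "inj_on f (carrier G)" "torsion_free H"
  shows "torsion_free G"
  unfolding torsion_free_def
proof (intro ballI allI impI)
  fix x and k :: nat assume x: "x \<in> carrier G" and k: "1 \<le> k \<and> x [^]\<^bsub>G\<^esub> k = \<one>\<^bsub>G\<^esub>"
  interpret f: group_hom G H f by (intro group_hom.intro group_hom_axioms.intro assms)
  have "f x [^]\<^bsub>H\<^esub> k = \<one>\<^bsub>H\<^esub>" using f.hom_nat_pow[OF x, of k] k by simp
  then have "f x = f \<one>\<^bsub>G\<^esub>" using assms(5) k f.hom_closed[OF x] by (auto simp: torsion_free_def)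
  then show "x = \<one>\<^bsub>G\<^esub>" using inj_onD[OF assms(4) _ x] by simp
qed

lemma conjugate_product_power:
  assumes G: "group G" and g: "g \<in> carrier G"
  shows "conjugate_product G g (replicate k \<one>\<^bsub>G\<^esub>) = g [^]\<^bsub>G\<^esub> k"
proof -
  interpret group G by (rule G)
  show ?thesis
  proof (induction k)
    case (Suc k)
    then show ?case using g nat_pow_Suc2[OF g, of k] by (simp add: conjugate_product_def)
  qed (simp add: conjugate_product_def)
qed

lemma torsion_generalized_torsion:
  assumes G: "group G" and "\<not> torsion_free G"
  obtains g k where "generalized_torsion G g" "1 \<le> k" "g [^]\<^bsub>G\<^esub> (k::nat) = \<one>\<^bsub>G\<^esub>"
proof -
  interpret group G by (rule G)
  obtain g and k :: nat where g: "g \<in> carrier G" "1 \<le> k" "g [^]\<^bsub>G\<^esub> k = \<one>\<^bsub>G\<^esub>" "g \<noteq> \<one>\<^bsub>G\<^esub>"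
    using assms(2) by (auto simp: torsion_free_def)
  have "generalized_torsion G g" unfolding generalized_torsion_def
    using g conjugate_product_power[OF G g(1), of k] by (intro conjI exI[of _ "replicate k \<one>\<^bsub>G\<^esub>"]) auto
  then show thesis using that g by blast
qed

section \<open>The fundamental group of a connected sum is a free product\<close>

lemma homeomorphic_maps_restrict:
  assumes fg: "homeomorphic_maps (subtopology X A) (subtopology Y B) f g" and C: "C \<subseteq> A" "C \<subseteq> topspace X"
  shows "homeomorphic_maps (subtopology X C) (subtopology Y (f ` C)) f g"
proof -
  have fC: "f ` C \<subseteq> B" using fg C unfolding homeomorphic_maps_def continuous_map_in_subtopology by auto
  have "f ` C \<subseteq> topspace Y" using fg C unfolding homeomorphic_maps_def continuous_map_def by auto
  then have "homeomorphic_maps (subtopology (subtopology X A) C) (subtopology (subtopology Y B) (f ` C)) f g"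
    using fC C by (intro homeomorphic_maps_subtopologies[OF fg]) auto
  then show ?thesis using C(1) fC by (simp add: subtopology_subtopology Int_absorb1)
qed

lemma simply_connected_punctured_space: "simply_connected (- {0 :: real^3})"
  by (rule simply_connected_punctured_universe) simp

context gluing
begin

text \<open>Any point of the unit sphere will do; its images in \<open>X\<close> from both sides agree.\<close>

definition base :: "bool \<Rightarrow> 'a" where "base t = e t (axis 1 1)"

lemma base_D: "base t \<in> D t"
  by (simp add: base_def e_in_D)

lemma base_punctured: "base t \<in> punctured t"
  using base_D D_punctured by blast

lemma base_S: "base t \<in> topspace (S t)"
  by (simp add: base_def)

definition base_X :: 'a where "base_X = g True (base True)"

lemma g_base: "g t (base t) = base_X"
proof -
  have "g t (base t) = g (\<not> t) (base (\<not> t))" for t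
    using g_transition[of "axis 1 1" t] by (simp add: base_def inversion_sphere)
  from this[of True] show ?thesis by (cases t) (simp_all add: base_X_def)
qed

lemma g_inv_base: "g_inv t base_X = base t"
  using g_inv_g[OF base_punctured] g_base by metis

lemma e_punctured_maps:
  "homeomorphic_maps (top_of_set (- {0})) (subtopology (S t) (e t ` (- {0}))) (e t) (e_inv t)"
proof -
  have "homeomorphic_maps (subtopology euclidean UNIV) (subtopology (S t) (range (e t))) (e t) (e_inv t)"
    using e_maps[of t] by simp
  then show ?thesis by (rule homeomorphic_maps_restrict) auto
qed

lemma neck: "punctured t \<inter> range (e t) = e t ` (- {0})"
  by (auto simp: punctured_def)

text \<open>The path component of the base point in the punctured summand contains the punctured ball. Together
  with the ball it is open, and so is the rest, as the summand is locally path connected. The rest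
  is empty because the summand is connected.\<close>

lemma punctured_path_connected:
  assumes q: "q \<in> punctured t"
  shows "\<exists>c. path_from_to (subtopology (S t) (punctured t)) (base t) q c"
proof -
  let ?P = "subtopology (S t) (punctured t)"
  have tP: "topspace ?P = punctured t" by (auto simp: punctured_def)
  have l: "locally_path_connected_space ?P" by (rule locally_path_connected_space_open_subset[OF lpc punctured_open])
  define C where "C = Collect (path_component_of ?P (base t))"
  have openP: "openin (S t) W" if "openin ?P W" for W
    using that openin_open_subtopology[OF punctured_open] by auto
  have C: "openin (S t) C" unfolding C_def
    by (rule openP[OF openin_path_component_of_locally_path_connected_space[OF l]])
  have CP: "C \<subseteq> punctured t" unfolding C_def using path_component_of_subset_topspace[of ?P "base t"] tP by simp
  have comp: "openin (S t) (punctured t - C)"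
  proof (rule openP, subst openin_subopen, intro ballI)
    fix y assume y: "y \<in> punctured t - C"
    let ?Y = "Collect (path_component_of ?P y)"
    have "y \<in> ?Y" using y tP path_component_of_refl[of ?P y] by simp
    moreover have "?Y \<subseteq> punctured t - C"
    proof
      fix z assume z: "z \<in> ?Y"
      then have "z \<in> punctured t" using path_component_of_subset_topspace[of ?P y] tP by blast
      moreover have "z \<notin> C"
      proof
        assume "z \<in> C"
        then have "path_component_of ?P (base t) y"
          using z path_component_of_trans path_component_of_sym unfolding C_def mem_Collect_eq by metis
        then show False using y by (simp add: C_def)
      qed
      ultimately show "z \<in> punctured t - C" by blast
    qed
    ultimately show "\<exists>T. openin ?P T \<and> y \<in> T \<and> T \<subseteq> punctured t - C"
      using openin_path_component_of_locally_path_connected_space[OF l, of y] by blast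
  qed
  have neck_C: "e t v \<in> C" if "v \<noteq> 0" for v
  proof -
    have "base t \<in> e t ` (- {0})" by (auto simp: base_def axis_eq_0_iff)
    moreover have "e t v \<in> e t ` (- {0})" using that by simp
    moreover have "e t ` (- {0}) \<subseteq> topspace (S t)" by auto
    ultimately obtain c where "path_from_to (subtopology (S t) (e t ` (- {0}))) (base t) (e t v) c"
      using simply_connected_transport(1)[OF simply_connected_punctured_space e_punctured_maps] by blast
    then have "path_from_to ?P (base t) (e t v) c" unfolding path_from_to_subtopology neck[symmetric] by blast
    then show ?thesis unfolding C_def path_component_of_def path_from_to_def by blast
  qed
  have "openin (S t) (C \<union> range (e t))" using C e_open by blast
  moreover have "(C \<union> range (e t)) \<inter> (punctured t - C) = {}"
  proof -
    have "e t v \<in> C" if "e t v \<in> punctured t" for v using that neck_C e_punctured by blast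
    then show ?thesis by auto
  qed
  moreover have "topspace (S t) \<subseteq> (C \<union> range (e t)) \<union> (punctured t - C)" by (auto simp: punctured_def)
  moreover have "C \<union> range (e t) \<noteq> {}" by blast
  ultimately have "punctured t - C = {}" using conn[of t] comp unfolding connected_space_def by blast
  then have "q \<in> C" using q by blast
  then show ?thesis unfolding C_def path_component_of_def path_from_to_def by blast
qed

text \<open>The summand is itself covered by two open sets with simply connected intersection: the punctured
  summand and the ball that contains the puncture.\<close>

definition cap :: "bool \<Rightarrow> bool \<Rightarrow> 'a set" where "cap t i = (if i then punctured t else range (e t))"

lemma cap_simps [simp]: "cap t True = punctured t" "cap t False = range (e t)"
  by (simp_all add: cap_def)

lemma range_maps: "homeomorphic_maps (top_of_set UNIV) (subtopology (S t) (range (e t))) (e t) (e_inv t)"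
  using e_maps[of t] by simp

lemma simply_connected_space: "simply_connected (UNIV :: (real^3) set)"
  by (rule convex_imp_simply_connected) simp

lemma summand_cover: "simply_connected_cover (S t) (cap t) (base t)"
proof
  have W: "e t ` (- {0}) \<subseteq> topspace (S t)" and b: "base t \<in> e t ` (- {0})"
    by (auto simp: base_def axis_eq_0_iff)
  note tr = simply_connected_transport[OF simply_connected_punctured_space e_punctured_maps W b]
  show "openin (S t) (cap t i)" for i by (cases i) (simp_all add: punctured_open e_open)
  show "topspace (S t) = cap t True \<union> cap t False" by (auto simp: punctured_def)
  show "base t \<in> cap t True \<inter> cap t False" using base_punctured by (simp add: base_def)
  show "\<exists>c. path_from_to (subtopology (S t) (cap t i)) (base t) q c" if "q \<in> cap t i" for i q
  proof (cases i)
    case True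
    then show ?thesis using punctured_path_connected that by simp
  next
    case False
    have "range (e t) \<subseteq> topspace (S t)" "base t \<in> range (e t)" by (auto simp: base_def)
    from simply_connected_transport(1)[OF simply_connected_space range_maps this] show ?thesis
      using that False by simp
  qed
  show "\<exists>c. path_from_to (subtopology (S t) (cap t True \<inter> cap t False)) (base t) q c"
    if "q \<in> cap t True \<inter> cap t False" for q
    using tr(1) that unfolding cap_simps neck .
  show "path_homotopic (subtopology (S t) (cap t True \<inter> cap t False)) (base t) (base t) \<gamma> (\<lambda>_. base t)"
    if "path_from_to (subtopology (S t) (cap t True \<inter> cap t False)) (base t) (base t) \<gamma>" for \<gamma>
    using tr(2) that unfolding cap_simps neck .
qed

lemma V_subset: "V t \<subseteq> topspace X"
  by (rule openin_subset[OF V_open])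

lemma base_X_V: "base_X \<in> V t"
  unfolding V_def g_base[of t, symmetric] using base_punctured by blast

lemma sum_cover: "simply_connected_cover X V base_X"
proof
  let ?W = "e True ` (- {0})"
  have "?W \<subseteq> punctured True" "?W \<subseteq> topspace (S True)" by (auto simp: e_punctured)
  from homeomorphic_maps_compose[OF conjI[OF e_punctured_maps homeomorphic_maps_restrict[OF g_maps this]]]
  have hm: "homeomorphic_maps (top_of_set (- {0})) (subtopology X (g True ` ?W)) (g True \<circ> e True) (e_inv True \<circ> g_inv True)" .
  have I: "V True \<inter> V False = g True ` ?W" by (rule V_inter)
  have W: "g True ` ?W \<subseteq> topspace X" unfolding I[symmetric] using V_subset by blast
  have b: "base_X \<in> g True ` ?W" unfolding I[symmetric] using base_X_V by blast
  note tr = simply_connected_transport[OF simply_connected_punctured_space hm W b]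
  show "openin X (V t)" for t by (rule V_open)
  show "topspace X = V True \<union> V False" by (rule V_cover)
  show "base_X \<in> V True \<inter> V False" using base_X_V by blast
  show "\<exists>c. path_from_to (subtopology X (V t)) base_X q c" if q: "q \<in> V t" for t q
  proof -
    obtain r where r: "r \<in> punctured t" "q = g t r" using q by (auto simp: V_def)
    obtain c where c: "path_from_to (subtopology (S t) (punctured t)) (base t) r c"
      using punctured_path_connected[OF r(1)] by blast
    have "continuous_map (subtopology (S t) (punctured t)) (subtopology X (V t)) (g t)"
      using g_maps[of t] by (simp add: homeomorphic_maps_def)
    from path_from_to_map[OF this c] show ?thesis unfolding g_base r(2) by blast
  qed
  show "\<exists>c. path_from_to (subtopology X (V True \<inter> V False)) base_X q c" if "q \<in> V True \<inter> V False" for q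
    using tr(1) that unfolding I .
  show "path_homotopic (subtopology X (V True \<inter> V False)) base_X base_X \<gamma> (\<lambda>_. base_X)"
    if "path_from_to (subtopology X (V True \<inter> V False)) base_X base_X \<gamma>" for \<gamma>
    using tr(2) that unfolding I .
qed

abbreviation K :: "bool \<Rightarrow> (real \<Rightarrow> 'a) set monoid" where "K t \<equiv> fundamental_group (S t) (base t)"

abbreviation GX :: "(real \<Rightarrow> 'a) set monoid" where "GX \<equiv> fundamental_group X base_X"

lemma base_X_in: "base_X \<in> topspace X"
  using base_X_V V_subset by blast

lemma group_K: "group (K t)"
  by (rule group_fundamental_group[OF base_S])

lemma group_GX: "group GX"
  by (rule group_fundamental_group[OF base_X_in])

lemma trivial_hom: "group G \<Longrightarrow> group H \<Longrightarrow> (\<lambda>_. \<one>\<^bsub>H\<^esub>) \<in> hom G H"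
  by (intro homI) (simp_all add: group.is_monoid monoid.one_closed monoid.r_one)

text \<open>The map \<open>g t\<close> is defined only off the puncture. It still induces a map on the fundamental group
  of the whole summand, because the ball that is added back is simply connected.\<close>

lemma summand_inclusion_exists:
  "\<exists>f. f \<in> hom (K t) GX \<and> (\<forall>\<gamma>. path_from_to (subtopology (S t) (punctured t)) (base t) (base t) \<gamma> \<longrightarrow>
      f (loop_class (S t) (base t) \<gamma>) = loop_class X base_X (g t \<circ> \<gamma>))"
proof -
  interpret simply_connected_cover "S t" "cap t" "base t" by (rule summand_cover)
  define \<phi> where "\<phi> i = (if i then induced_map X base_X (g t) else (\<lambda>_. \<one>\<^bsub>GX\<^esub>))" for i
  have hom: "\<phi> i \<in> hom (fundamental_group (subtopology (S t) (cap t i)) (base t)) GX" for i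
  proof (cases i)
    case True
    then show ?thesis unfolding \<phi>_def by (simp add: induced_map(1)[where f = "g t", OF g_continuous g_base])
  next
    case False
    have "group (fundamental_group (subtopology (S t) (range (e t))) (base t))"
      by (rule group_fundamental_group) (simp add: base_def)
    then show ?thesis unfolding \<phi>_def using trivial_hom[OF _ group_GX] False by simp
  qed
  obtain f where f: "f \<in> hom (K t) GX"
    and v: "\<forall>i \<gamma>. path_from_to (subtopology (S t) (cap t i)) (base t) (base t) \<gamma> \<longrightarrow>
        f (loop_class (S t) (base t) \<gamma>) = \<phi> i (loop_class (subtopology (S t) (cap t i)) (base t) \<gamma>)"
    by (rule van_kampen_hom[of GX \<phi>, OF group_GX hom])
  show ?thesis
  proof (intro exI conjI allI impI)
    show "f \<in> hom (K t) GX" by (rule f)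
    fix \<gamma> assume a: "path_from_to (subtopology (S t) (punctured t)) (base t) (base t) \<gamma>"
    show "f (loop_class (S t) (base t) \<gamma>) = loop_class X base_X (g t \<circ> \<gamma>)"
      using v[rule_format, of True \<gamma>] a induced_map(2)[where f = "g t", OF g_continuous g_base a] by (simp add: \<phi>_def)
  qed
qed

definition summand_inclusion :: "bool \<Rightarrow> (real \<Rightarrow> 'a) set \<Rightarrow> (real \<Rightarrow> 'a) set" where
  "summand_inclusion t = (SOME f. f \<in> hom (K t) GX \<and>
     (\<forall>\<gamma>. path_from_to (subtopology (S t) (punctured t)) (base t) (base t) \<gamma> \<longrightarrow>
        f (loop_class (S t) (base t) \<gamma>) = loop_class X base_X (g t \<circ> \<gamma>)))"

lemma summand_inclusion:
  shows "summand_inclusion t \<in> hom (K t) GX"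
    and "path_from_to (subtopology (S t) (punctured t)) (base t) (base t) \<gamma> \<Longrightarrow>
      summand_inclusion t (loop_class (S t) (base t) \<gamma>) = loop_class X base_X (g t \<circ> \<gamma>)"
  using someI_ex[OF summand_inclusion_exists[of t]] unfolding summand_inclusion_def[symmetric] by blast+

lemma punctured_representative:
  assumes c: "c \<in> carrier (K t)"
  obtains \<gamma> where "path_from_to (subtopology (S t) (punctured t)) (base t) (base t) \<gamma>" "c = loop_class (S t) (base t) \<gamma>"
proof -
  interpret simply_connected_cover "S t" "cap t" "base t" by (rule summand_cover)
  let ?P = "subtopology (S t) (punctured t)" and ?R = "subtopology (S t) (range (e t))"
  let ?f = "induced_map (S t) (base t) id"
  have GP: "group (fundamental_group ?P (base t))"
    by (rule group_fundamental_group) (use base_punctured base_S in simp)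
  have cm: "continuous_map ?P (S t) id" by simp
  note f = induced_map[where f = id, OF cm id_apply]
  interpret f: group_hom "fundamental_group ?P (base t)" "K t" ?f
    by (intro group_hom.intro group_hom_axioms.intro GP group_K f(1))
  let ?H = "?f ` carrier (fundamental_group ?P (base t))"
  have H: "subgroup ?H (K t)" by (rule f.img_is_subgroup)
  have triv: "loop_class (S t) (base t) \<gamma> \<in> ?H" if g: "path_from_to ?R (base t) (base t) \<gamma>" for \<gamma>
  proof -
    have "range (e t) \<subseteq> topspace (S t)" "base t \<in> range (e t)" by (auto simp: base_def)
    from simply_connected_transport(2)[OF simply_connected_space range_maps this g]
    have "path_homotopic (S t) (base t) (base t) \<gamma> (\<lambda>_. base t)" by (rule path_homotopic_subtopology)
    then have "loop_class (S t) (base t) \<gamma> = \<one>\<^bsub>K t\<^esub>" unfolding fundamental_group_one by (rule loop_class_eqI)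
    then show ?thesis using subgroup.one_closed[OF H] by simp
  qed
  have main: "loop_class (S t) (base t) \<gamma> \<in> ?H" if g: "path_from_to ?P (base t) (base t) \<gamma>" for \<gamma>
    using f(2)[OF g] loop_class_carrier[OF g] by (metis id_comp imageI)
  have "generate (K t) (\<Union>i. {loop_class (S t) (base t) \<gamma> | \<gamma>. path_from_to (subtopology (S t) (cap t i)) (base t) (base t) \<gamma>}) \<subseteq> ?H"
  proof (rule group.generate_subgroup_incl[OF group_K _ H], safe)
    fix i \<gamma> assume a: "path_from_to (subtopology (S t) (cap t i)) (base t) (base t) \<gamma>"
    show "loop_class (S t) (base t) \<gamma> \<in> ?H" using a triv main by (cases i) simp_all
  qed
  then have "c \<in> ?H" using van_kampen_generate c by blast
  then obtain d where "d \<in> carrier (fundamental_group ?P (base t))" and d: "c = ?f d" by blast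
  then obtain \<gamma> where "path_from_to ?P (base t) (base t) \<gamma>" "d = loop_class ?P (base t) \<gamma>"
    unfolding fundamental_group_carrier by blast
  then show thesis using that[of \<gamma>] f(2) d by (simp only: id_comp)
qed

text \<open>The universal property of the free product: on \<open>V t\<close>, which is a copy of the punctured summand, the
  homomorphism is \<open>\<psi> t\<close> after the inverse of \<open>g t\<close>.\<close>

lemma extend_homs:
  assumes H: "group H" and psi: "\<And>t. \<psi> t \<in> hom (K t) H"
  obtains f where "f \<in> hom GX H" "\<forall>t. \<forall>c\<in>carrier (K t). f (summand_inclusion t c) = \<psi> t c"
proof -
  interpret simply_connected_cover X V base_X by (rule sum_cover)
  define \<phi> where "\<phi> t = \<psi> t \<circ> induced_map (S t) (base t) (g_inv t)" for t
  have ci: "continuous_map (subtopology X (V t)) (S t) (g_inv t)" for t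
    using g_maps[of t] by (simp add: homeomorphic_maps_def continuous_map_in_subtopology)
  have hom: "\<phi> t \<in> hom (fundamental_group (subtopology X (V t)) base_X) H" for t
    unfolding \<phi>_def by (rule hom_compose[OF induced_map(1)[where f = "g_inv t", OF ci g_inv_base] psi])
  obtain f where f: "f \<in> hom GX H"
    and v: "\<forall>t \<gamma>. path_from_to (subtopology X (V t)) base_X base_X \<gamma> \<longrightarrow>
        f (loop_class X base_X \<gamma>) = \<phi> t (loop_class (subtopology X (V t)) base_X \<gamma>)"
    by (rule van_kampen_hom[of H \<phi>, OF H hom])
  show thesis
  proof (rule that[OF f], intro allI ballI)
    fix t c assume "c \<in> carrier (K t)"
    then obtain \<gamma> where g: "path_from_to (subtopology (S t) (punctured t)) (base t) (base t) \<gamma>" "c = loop_class (S t) (base t) \<gamma>"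
      by (rule punctured_representative)
    have gc: "continuous_map (subtopology (S t) (punctured t)) (subtopology X (V t)) (g t)"
      using g_maps[of t] by (simp add: homeomorphic_maps_def)
    have gg: "path_from_to (subtopology X (V t)) base_X base_X (g t \<circ> \<gamma>)"
      using path_from_to_map[OF gc g(1)] unfolding g_base .
    have im: "\<gamma> ` {0..1} \<subseteq> punctured t" "path_from_to (S t) (base t) (base t) \<gamma>"
      using g(1) by (auto simp: path_from_to_subtopology)
    have "path_homotopic (S t) (base t) (base t) \<gamma> (g_inv t \<circ> (g t \<circ> \<gamma>))"
    proof (rule path_homotopic_eq_on[OF im(2)])
      fix s :: real assume "0 \<le> s" "s \<le> 1"
      then have "\<gamma> s \<in> punctured t" using im(1) by auto
      then show "\<gamma> s = (g_inv t \<circ> (g t \<circ> \<gamma>)) s" by (simp add: g_inv_g)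
    qed
    then have eq: "loop_class (S t) (base t) (g_inv t \<circ> (g t \<circ> \<gamma>)) = c" unfolding g(2) by (rule loop_class_eqI[symmetric])
    show "f (summand_inclusion t c) = \<psi> t c"
      using v[rule_format, OF gg] induced_map(2)[where f = "g_inv t", OF ci g_inv_base gg] eq summand_inclusion(2)[OF g(1)] g(2)
      by (simp add: \<phi>_def)
  qed
qed

lemma summand_inclusion_generate:
  "generate GX (summand_inclusion True ` carrier (K True) \<union> summand_inclusion False ` carrier (K False)) = carrier GX"
    (is "generate _ ?A = _")
proof -
  interpret simply_connected_cover X V base_X by (rule sum_cover)
  have "loop_class X base_X \<gamma> \<in> summand_inclusion t ` carrier (K t)"
    if a: "path_from_to (subtopology X (V t)) base_X base_X \<gamma>" for t \<gamma>
  proof -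
    have ci: "continuous_map (subtopology X (V t)) (subtopology (S t) (punctured t)) (g_inv t)"
      and gi: "\<And>q. q \<in> V t \<Longrightarrow> g t (g_inv t q) = q"
      using g_maps[of t] V_subset[of t] by (auto simp: homeomorphic_maps_def)
    have p: "path_from_to (subtopology (S t) (punctured t)) (base t) (base t) (g_inv t \<circ> \<gamma>)"
      using path_from_to_map[OF ci a] unfolding g_inv_base .
    have im: "\<gamma> ` {0..1} \<subseteq> V t" "path_from_to X base_X base_X \<gamma>" using a by (auto simp: path_from_to_subtopology)
    have "path_homotopic X base_X base_X \<gamma> (g t \<circ> (g_inv t \<circ> \<gamma>))"
    proof (rule path_homotopic_eq_on[OF im(2)])
      fix s :: real assume "0 \<le> s" "s \<le> 1"
      then have "\<gamma> s \<in> V t" using im(1) by auto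
      then show "\<gamma> s = (g t \<circ> (g_inv t \<circ> \<gamma>)) s" by (simp add: gi)
    qed
    then have eq: "loop_class X base_X \<gamma> = summand_inclusion t (loop_class (S t) (base t) (g_inv t \<circ> \<gamma>))"
      unfolding summand_inclusion(2)[OF p] by (rule loop_class_eqI)
    have p': "path_from_to (S t) (base t) (base t) (g_inv t \<circ> \<gamma>)" using p by (simp add: path_from_to_subtopology)
    show ?thesis unfolding eq by (rule imageI[OF loop_class_carrier[OF p']])
  qed
  then have each: "{loop_class X base_X \<gamma> | \<gamma>. path_from_to (subtopology X (V t)) base_X base_X \<gamma>} \<subseteq>
      summand_inclusion t ` carrier (K t)" for t
    by blast
  have sub: "(\<Union>t. {loop_class X base_X \<gamma> | \<gamma>. path_from_to (subtopology X (V t)) base_X base_X \<gamma>}) \<subseteq> ?A"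
  proof (rule UN_least)
    fix t
    show "{loop_class X base_X \<gamma> | \<gamma>. path_from_to (subtopology X (V t)) base_X base_X \<gamma>} \<subseteq> ?A"
      using each[of t] by (cases t) auto
  qed
  have "summand_inclusion t ` carrier (K t) \<subseteq> carrier GX" for t
    using hom_in_carrier[OF summand_inclusion(1)[of t]] by auto
  then have "?A \<subseteq> carrier GX" by (intro Un_least)
  then have "generate GX ?A \<subseteq> carrier GX" by (rule group.generate_incl[OF group_GX])
  moreover have "carrier GX \<subseteq> generate GX ?A" using group.mono_generate[OF group_GX sub] van_kampen_generate by simp
  ultimately show ?thesis by blast
qed

text \<open>The universal property, applied to the actions of the two groups on reduced words.\<close>

theorem fundamental_group_free_product:
  shows "free_product GX (summand_inclusion True ` carrier (K True)) (summand_inclusion False ` carrier (K False))"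
    and "inj_on (summand_inclusion t) (carrier (K t))"
proof -
  interpret two_groups K by (intro two_groups.intro group_K)
  obtain \<theta> where th: "\<theta> \<in> hom GX (BijGroup (Collect reduced))"
    "\<forall>t. \<forall>c\<in>carrier (K t). \<theta> (summand_inclusion t c) = action t c"
    by (rule extend_homs[of "BijGroup (Collect reduced)" action, OF group_BijGroup action_hom])
  note F = free_product_from_action[of GX summand_inclusion \<theta>, OF group_GX summand_inclusion(1) summand_inclusion_generate th(1) th(2)[rule_format]]
  show "free_product GX (summand_inclusion True ` carrier (K True)) (summand_inclusion False ` carrier (K False))" by (rule F(1))
  show "inj_on (summand_inclusion t) (carrier (K t))" by (rule F(2))
qed

text \<open>The conjugating elements of the generalized torsion element found in a summand come from the
  whole group. The retraction onto the summand, which is trivial on the other summand, replaces them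
  by elements of the summand.\<close>

theorem generalized_torsion_from_summand:
  assumes tf: "\<And>t. torsion_free (K t)" and x: "generalized_torsion GX x"
  obtains t k c where "generalized_torsion (K t) k" "c \<in> carrier GX"
    "x = c \<otimes>\<^bsub>GX\<^esub> summand_inclusion t k \<otimes>\<^bsub>GX\<^esub> inv\<^bsub>GX\<^esub> c"
proof -
  interpret F: free_product GX "summand_inclusion True ` carrier (K True)" "summand_inclusion False ` carrier (K False)"
    by (rule fundamental_group_free_product(1))
  obtain xs where xc: "x \<in> carrier GX" and xs: "xs \<noteq> []" "set xs \<subseteq> carrier GX" "conjugate_product GX x xs = \<one>\<^bsub>GX\<^esub>"
    using x by (auto simp: generalized_torsion_def)
  have "F.lprod (map (\<lambda>y. y \<otimes>\<^bsub>GX\<^esub> x \<otimes>\<^bsub>GX\<^esub> inv\<^bsub>GX\<^esub> y) xs) = conjugate_product GX x xs"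
    unfolding F.lprod_def conjugate_product_def by (simp add: foldr_map comp_def)
  then have lp: "F.lprod (map (\<lambda>y. y \<otimes>\<^bsub>GX\<^esub> x \<otimes>\<^bsub>GX\<^esub> inv\<^bsub>GX\<^esub> y) xs) = \<one>\<^bsub>GX\<^esub>" using xs(3) by simp
  have tfac: "v = \<one>\<^bsub>GX\<^esub>" if v: "v \<in> summand_inclusion t ` carrier (K t)" and m: "1 \<le> m" "v [^]\<^bsub>GX\<^esub> m = \<one>\<^bsub>GX\<^esub>" for v t and m :: nat
  proof -
    interpret h: group_hom "K t" GX "summand_inclusion t"
      by (intro group_hom.intro group_hom_axioms.intro group_K group_GX summand_inclusion(1))
    obtain k where k: "k \<in> carrier (K t)" "v = summand_inclusion t k" using v by blast
    have "summand_inclusion t (k [^]\<^bsub>K t\<^esub> m) = summand_inclusion t \<one>\<^bsub>K t\<^esub>" using h.hom_nat_pow[OF k(1), of m] k(2) m(2) by simp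
    then have "k [^]\<^bsub>K t\<^esub> m = \<one>\<^bsub>K t\<^esub>"
      by (rule inj_onD[OF fundamental_group_free_product(2)]) (use k(1) in simp_all)
    then have "k = \<one>\<^bsub>K t\<^esub>" using tf[of t] k(1) m(1) by (auto simp: torsion_free_def)
    then show ?thesis using k(2) by simp
  qed
  have tfac': "v = \<one>\<^bsub>GX\<^esub>" if "v \<in> summand_inclusion True ` carrier (K True) \<union> summand_inclusion False ` carrier (K False)"
    "1 \<le> m" "v [^]\<^bsub>GX\<^esub> m = \<one>\<^bsub>GX\<^esub>" for v and m :: nat
    using that tfac[of v True m] tfac[of v False m] by blast
  obtain c a where c: "c \<in> carrier GX" and a: "a \<in> summand_inclusion True ` carrier (K True) \<union> summand_inclusion False ` carrier (K False)"
    and xca: "x = c \<otimes>\<^bsub>GX\<^esub> a \<otimes>\<^bsub>GX\<^esub> inv\<^bsub>GX\<^esub> c"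
    by (rule F.generalized_torsion_conjugate_into_factor[OF tfac' xc xs(1,2) lp])
  from a obtain t k where k: "k \<in> carrier (K t)" "a = summand_inclusion t k" by blast
  have ac: "a \<in> carrier GX" unfolding k(2) by (rule hom_in_carrier[OF summand_inclusion(1) k(1)])
  have ga: "generalized_torsion GX a" by (rule F.generalized_torsion_conjugate[OF c ac]) (use x xca in simp)
  define \<psi> where "\<psi> s = (if s = t then (\<lambda>c. c) else (\<lambda>_. \<one>\<^bsub>K t\<^esub>))" for s
  have psi: "\<psi> s \<in> hom (K s) (K t)" for s
  proof (cases "s = t")
    case True
    then show ?thesis by (auto simp: \<psi>_def intro: homI)
  next
    case False
    then show ?thesis using trivial_hom[OF group_K group_K] by (simp add: \<psi>_def)
  qed
  obtain r where r: "r \<in> hom GX (K t)" "\<forall>s. \<forall>c\<in>carrier (K s). r (summand_inclusion s c) = \<psi> s c"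
    by (rule extend_homs[of "K t" \<psi>, OF group_K psi])
  have ra: "r a = k" using r(2)[rule_format, OF k(1)] k(2) by (simp add: \<psi>_def)
  have "k \<noteq> \<one>\<^bsub>K t\<^esub>"
  proof
    assume "k = \<one>\<^bsub>K t\<^esub>"
    then have "a = \<one>\<^bsub>GX\<^esub>" using k(2) hom_one[OF summand_inclusion(1) group_K group_GX] by simp
    then show False using ga by (simp add: generalized_torsion_def)
  qed
  then have "generalized_torsion (K t) k"
    using generalized_torsion_hom[OF group_GX group_K r(1) ga] unfolding ra by blast
  from that[OF this c] show thesis using xca k(2) by blast
qed

end

section \<open>The maps from the fundamental groups of the summands\<close>

lemma base_change_conjugate:
  assumes w: "path_from_to X p q \<omega>" and v: "path_from_to X p q \<nu>" and c: "c \<in> carrier (fundamental_group X q)"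
  shows "\<exists>l\<in>carrier (fundamental_group X p). base_change X p \<omega> c =
    l \<otimes>\<^bsub>fundamental_group X p\<^esub> base_change X p \<nu> c \<otimes>\<^bsub>fundamental_group X p\<^esub> inv\<^bsub>fundamental_group X p\<^esub> l"
proof -
  note rv = path_from_to_reverse[OF v]
  let ?l = "path_concat \<omega> (path_reverse \<nu>)"
  have l: "path_from_to X p p ?l" by (rule path_from_to_concat[OF w rv])
  have "path_homotopic X p q (path_concat ?l \<nu>) (path_concat \<omega> (path_concat (path_reverse \<nu>) \<nu>))"
    by (rule homotopic_assoc[OF w rv v])
  moreover have "path_homotopic X p q (path_concat \<omega> (path_concat (path_reverse \<nu>) \<nu>)) (path_concat \<omega> (\<lambda>_. q))"
    by (rule homotopic_concat[OF path_homotopic_refl[OF w] homotopic_inverse_left[OF v]])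
  ultimately have h: "path_homotopic X p q (path_concat ?l \<nu>) \<omega>"
    using path_homotopic_trans homotopic_unit_right[OF w] by metis
  have "base_change X p \<omega> c = base_change X p ?l (base_change X p \<nu> c)"
    unfolding base_change_compose[OF l v c] by (rule base_change_homotopic[OF path_homotopic_sym[OF h] c])
  also have "\<dots> = loop_class X p ?l \<otimes>\<^bsub>fundamental_group X p\<^esub> base_change X p \<nu> c \<otimes>\<^bsub>fundamental_group X p\<^esub> inv\<^bsub>fundamental_group X p\<^esub> loop_class X p ?l"
    by (rule base_change_loop[OF l hom_in_carrier[OF base_change(1)[OF v] c]])
  finally show ?thesis using loop_class_carrier[OF l] by blast
qed

text \<open>At time \<open>0\<close> the identity, at time \<open>1\<close> the radial projection to the unit sphere.\<close>

definition radial :: "real \<Rightarrow> real^3 \<Rightarrow> real^3" where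
  "radial s v = ((1 - s) + s / norm v) *\<^sub>R v"

lemma radial_simps: "radial 0 v = v" "norm v = 1 \<Longrightarrow> radial s v = v" "v \<noteq> 0 \<Longrightarrow> norm (radial 1 v) = 1"
  by (auto simp: radial_def)

lemma continuous_on_radial: "continuous_on (UNIV \<times> (- {0})) (\<lambda>z. radial (fst z) (snd z))"
  unfolding radial_def by (intro continuous_intros) auto

context gluing
begin

text \<open>The punctured summand is pushed out of the ball along its rays, with \<open>D t\<close> held fixed. So loops that
  avoid only the puncture can be moved into \<open>D t\<close>.\<close>

definition push :: "bool \<Rightarrow> real \<times> 'a \<Rightarrow> 'a" where
  "push t z = (if snd z \<in> D t then snd z else e t (radial (fst z) (e_inv t (snd z))))"

lemma push_continuous:
  "continuous_map (prod_topology (top_of_set {0..1::real}) (subtopology (S t) (punctured t))) (S t) (push t)"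
proof -
  let ?P = "subtopology (S t) (punctured t)"
  let ?Q = "prod_topology (top_of_set {0..1::real}) ?P"
  have tP: "topspace ?P = punctured t" by (auto simp: punctured_def)
  define C where "C i = (if i then D t else punctured t \<inter> e t ` cball 0 1)" for i :: bool
  define T where "T i = {z \<in> topspace ?Q. snd z \<in> C i}" for i :: bool
  define f where "f i = (if i then snd else e t \<circ> ((\<lambda>z. radial (fst z) (snd z)) \<circ> (\<lambda>z. (fst z, e_inv t (snd z)))))" for i :: bool
  have DP: "D t \<subseteq> punctured t" by (rule D_punctured)
  have inner: "push t z = f False z" if zT: "z \<in> T False" for z
  proof -
    obtain v where v: "snd z = e t v" "v \<noteq> 0" "norm v \<le> 1" using zT by (auto simp: T_def C_def e_punctured)
    show ?thesis
    proof (cases "norm v = 1")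
      case True
      then show ?thesis using v(1) by (simp add: push_def f_def e_in_D radial_simps)
    next
      case False
      then show ?thesis using v by (simp add: push_def f_def e_in_D)
    qed
  qed
  have outer: "push t z = f True z" if "z \<in> T True" for z
    using that by (simp add: push_def f_def T_def C_def)
  have both: "push t z = f i z" if "z \<in> T i" for z i
    using that inner outer by (cases i) simp_all
  show ?thesis
  proof (rule pasting_lemma_closed[of "UNIV :: bool set" _ T _ f])
    fix i :: bool
    have "closedin ?P (C i)"
      using closedin_subtopology_Int_closed[OF D_closed[of t], of "punctured t"]
        closedin_subtopology_Int_closed[OF cball_closed[of t 1], of "punctured t"] Int_absorb1[OF DP]
      by (cases i) (simp_all add: C_def Int_commute)
    then show "closedin ?Q (T i)" unfolding T_def by (rule closedin_continuous_map_preimage[OF continuous_map_snd])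
    have csnd: "continuous_map (subtopology ?Q (T i)) (S t) snd"
      using continuous_map_from_subtopology[OF continuous_map_snd[of "top_of_set {0..1::real}" ?P], of "T i"]
      by (simp add: continuous_map_in_subtopology)
    show "continuous_map (subtopology ?Q (T i)) (S t) (f i)"
    proof (cases i)
      case True
      then show ?thesis using csnd by (simp add: f_def)
    next
      case False
      have "snd ` T False \<subseteq> range (e t)" by (auto simp: T_def C_def)
      then have "continuous_map (subtopology ?Q (T False)) (subtopology (S t) (range (e t))) snd"
        using csnd False by (auto simp: continuous_map_in_subtopology)
      moreover have "continuous_map (subtopology (S t) (range (e t))) euclidean (e_inv t)"
        using e_maps[of t] by (simp add: homeomorphic_maps_def)
      ultimately have c1: "continuous_map (subtopology ?Q (T False)) euclidean (e_inv t \<circ> snd)"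
        by (rule continuous_map_compose)
      have c2: "continuous_map (subtopology ?Q (T False)) euclidean (fst :: real \<times> 'a \<Rightarrow> real)"
        using continuous_map_from_subtopology[OF continuous_map_fst[of "top_of_set {0..1::real}" ?P], of "T False"]
        by (simp add: continuous_map_in_subtopology)
      have "continuous_map (subtopology ?Q (T False)) (prod_topology euclidean euclidean) (\<lambda>z. (fst z, e_inv t (snd z)))"
        unfolding continuous_map_pairwise using c1 c2 by (simp add: comp_def)
      moreover have "(fst z, e_inv t (snd z)) \<in> UNIV \<times> (- {0})" if "z \<in> T False" for z
        using that by (auto simp: T_def C_def e_punctured)
      ultimately have c3: "continuous_map (subtopology ?Q (T False)) (top_of_set (UNIV \<times> (- {0}))) (\<lambda>z. (fst z, e_inv t (snd z)))"
        unfolding euclidean_product_topology by (auto simp: continuous_map_in_subtopology)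
      have c4: "continuous_map (top_of_set (UNIV \<times> (- {0}))) euclidean (\<lambda>z. radial (fst z) (snd z))"
        using continuous_on_radial by simp
      have "continuous_map (subtopology ?Q (T False)) (S t) (f False)"
        using continuous_map_compose[OF continuous_map_compose[OF c3 c4] e_continuous] by (simp add: f_def)
      then show ?thesis using False by simp
    qed
  next
    fix i j z assume "z \<in> topspace ?Q \<inter> T i \<inter> T j"
    then show "f i z = f j z" using both[of z i] both[of z j] by simp
  next
    fix z assume z: "z \<in> topspace ?Q"
    then have "snd z \<in> punctured t" unfolding topspace_prod_topology tP by (simp add: mem_Times_iff)
    then have "snd z \<in> C True \<or> snd z \<in> C False"
    proof (cases rule: punctured_cases)
      case 1
      then show ?thesis by (simp add: C_def)
    next
      case (2 v)
      then have "v \<in> cball 0 1" by simp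
      then show ?thesis using 2(1,2) e_punctured[of t v] by (simp add: C_def)
    qed
    then have "z \<in> T True \<or> z \<in> T False" using z by (simp add: T_def)
    then show "\<exists>j. j \<in> UNIV \<and> z \<in> T j \<and> push t z = f j z" using both by blast
  qed simp
qed

lemma push_in_D: "q \<in> punctured t \<Longrightarrow> push t (1, q) \<in> D t"
  by (erule punctured_cases) (auto simp: push_def e_in_D radial_simps)

lemma push_zero: "q \<in> punctured t \<Longrightarrow> push t (0, q) = q"
  by (erule punctured_cases) (auto simp: push_def radial_simps)

lemma push_path_homotopic:
  assumes y: "y \<in> D t" and d: "path_from_to (subtopology (S t) (punctured t)) y y \<delta>"
  shows "path_homotopic (S t) y y \<delta> (\<lambda>x. push t (1, \<delta> x))"
proof -
  have "homotopic_with (\<lambda>f. f y = y) (subtopology (S t) (punctured t)) (S t) (\<lambda>q. push t (0, q)) (\<lambda>q. push t (1, q))"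
    unfolding homotopic_with_def using push_continuous[of t] y by (intro exI[of _ "push t"]) (simp add: push_def)
  from homotopic_with_compose_continuous_map_right[OF this, of unit_interval \<delta> "\<lambda>r. r 0 = y \<and> r 1 = y"] d
  have h: "path_homotopic (S t) y y ((\<lambda>q. push t (0, q)) \<circ> \<delta>) ((\<lambda>q. push t (1, q)) \<circ> \<delta>)"
    unfolding path_homotopic_def path_from_to_def pathin_def by simp
  have "path_homotopic (S t) y y \<delta> ((\<lambda>q. push t (0, q)) \<circ> \<delta>)"
  proof (rule path_homotopic_eq_on)
    show "path_from_to (S t) y y \<delta>" using d by (simp add: path_from_to_subtopology)
    fix s :: real assume "0 \<le> s" "s \<le> 1"
    then have "\<delta> s \<in> punctured t" using d by (auto simp: path_from_to_subtopology)
    then show "\<delta> s = ((\<lambda>q. push t (0, q)) \<circ> \<delta>) s" by (simp add: push_zero)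
  qed
  from path_homotopic_trans[OF this h] show ?thesis by (simp add: comp_def)
qed

lemma D_representative:
  assumes y: "y \<in> D t" and c: "c \<in> carrier (fundamental_group (S t) y)"
  obtains \<gamma> where "path_from_to (S t) y y \<gamma>" "\<gamma> ` {0..1} \<subseteq> D t" "c = loop_class (S t) y \<gamma>"
proof -
  let ?P = "subtopology (S t) (punctured t)"
  obtain \<kappa> where k: "path_from_to ?P (base t) y \<kappa>" using punctured_path_connected y D_punctured by blast
  have kS: "path_from_to (S t) (base t) y \<kappa>" using k by (simp add: path_from_to_subtopology)
  have "base_change (S t) (base t) \<kappa> c \<in> carrier (K t)" by (rule hom_in_carrier[OF base_change(1)[OF kS] c])
  then obtain \<gamma> where g: "path_from_to ?P (base t) (base t) \<gamma>" "base_change (S t) (base t) \<kappa> c = loop_class (S t) (base t) \<gamma>"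
    by (rule punctured_representative)
  have gS: "path_from_to (S t) (base t) (base t) \<gamma>" using g(1) by (simp add: path_from_to_subtopology)
  let ?d = "twist (path_reverse \<kappa>) \<gamma> (path_reverse \<kappa>)"
  have d: "path_from_to ?P y y ?d" by (rule path_from_to_twist[OF path_from_to_reverse[OF k] g(1) path_from_to_reverse[OF k]])
  note h = push_path_homotopic[OF y d]
  have "c = base_change (S t) y (path_reverse \<kappa>) (base_change (S t) (base t) \<kappa> c)" by (rule base_change_inverse[OF kS c, symmetric])
  also have "\<dots> = loop_class (S t) y ?d" unfolding g(2) by (rule base_change(2)[OF path_from_to_reverse[OF kS] gS])
  also have "\<dots> = loop_class (S t) y (\<lambda>x. push t (1, ?d x))" by (rule loop_class_eqI[OF h])
  finally have "c = loop_class (S t) y (\<lambda>x. push t (1, ?d x))" .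
  moreover have "(\<lambda>x. push t (1, ?d x)) ` {0..1} \<subseteq> D t"
  proof
    fix z assume "z \<in> (\<lambda>x. push t (1, ?d x)) ` {0..1}"
    then obtain x where x: "x \<in> {0..1}" "z = push t (1, ?d x)" by blast
    have "?d x \<in> punctured t" using d x(1) unfolding path_from_to_subtopology by blast
    then show "z \<in> D t" unfolding x(2) by (rule push_in_D)
  qed
  ultimately show thesis using that path_homotopic_imp_path(2)[OF h] by blast
qed

text \<open>Both sides send the class of a loop \<open>\<gamma>\<close> in \<open>D t\<close> to the class of \<open>h t \<circ> \<gamma>\<close> connected to \<open>p\<close> by a
  path. The path \<open>\<omega>\<close> first follows \<open>\<alpha>\<close> and then the image of \<open>\<kappa>\<close> backwards, so that the two
  connecting paths are homotopic.\<close>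

lemma summand_map_eq:
  assumes y: "y \<in> D t" and \<alpha>: "path_from_to X p (h t y) \<alpha>"
  obtains \<omega> \<kappa> where "path_from_to X p base_X \<omega>" "path_from_to (S t) (base t) y \<kappa>"
    "\<forall>c\<in>carrier (fundamental_group (S t) y). summand_map X p (D t) (h t) \<alpha> c =
        base_change X p \<omega> (summand_inclusion t (base_change (S t) (base t) \<kappa> c))"
proof -
  let ?P = "subtopology (S t) (punctured t)"
  have yP: "y \<in> punctured t" using y D_punctured by blast
  obtain \<kappa> where k: "path_from_to ?P (base t) y \<kappa>" using punctured_path_connected[OF yP] by blast
  have kS: "path_from_to (S t) (base t) y \<kappa>" using k by (simp add: path_from_to_subtopology)
  have gk: "path_from_to X base_X (h t y) (g t \<circ> \<kappa>)"
    using path_from_to_map[OF g_continuous k] unfolding g_base g_D[OF y] .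
  define \<omega> where "\<omega> = path_concat \<alpha> (path_reverse (g t \<circ> \<kappa>))"
  have w: "path_from_to X p base_X \<omega>" unfolding \<omega>_def by (rule path_from_to_concat[OF \<alpha> path_from_to_reverse[OF gk]])
  have wk: "path_homotopic X p (h t y) (path_concat \<omega> (g t \<circ> \<kappa>)) \<alpha>"
  proof -
    have "path_homotopic X p (h t y) (path_concat \<omega> (g t \<circ> \<kappa>)) (path_concat \<alpha> (path_concat (path_reverse (g t \<circ> \<kappa>)) (g t \<circ> \<kappa>)))"
      unfolding \<omega>_def by (rule homotopic_assoc[OF \<alpha> path_from_to_reverse[OF gk] gk])
    moreover have "path_homotopic X p (h t y) (path_concat \<alpha> (path_concat (path_reverse (g t \<circ> \<kappa>)) (g t \<circ> \<kappa>))) (path_concat \<alpha> (\<lambda>_. h t y))"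
      by (rule homotopic_concat[OF path_homotopic_refl[OF \<alpha>] homotopic_inverse_left[OF gk]])
    ultimately show ?thesis using path_homotopic_trans homotopic_unit_right[OF \<alpha>] by metis
  qed
  have key: "loop_class X p (twist \<alpha> (h t \<circ> \<gamma>) \<alpha>) = base_change X p \<omega> (summand_inclusion t (base_change (S t) (base t) \<kappa> (loop_class (S t) y \<gamma>)))"
    if g: "path_from_to (S t) y y \<gamma>" "\<gamma> ` {0..1} \<subseteq> D t" for \<gamma>
  proof -
    have gP: "path_from_to ?P y y \<gamma>" using g D_punctured unfolding path_from_to_subtopology by blast
    have gg: "path_from_to X (h t y) (h t y) (g t \<circ> \<gamma>)"
      using path_from_to_map[OF g_continuous gP] unfolding g_D[OF y] .
    have tw: "path_from_to ?P (base t) (base t) (twist \<kappa> \<gamma> \<kappa>)" by (rule path_from_to_twist[OF k gP k])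
    have e1: "base_change (S t) (base t) \<kappa> (loop_class (S t) y \<gamma>) = loop_class (S t) (base t) (twist \<kappa> \<gamma> \<kappa>)"
      by (rule base_change(2)[OF kS g(1)])
    have e2: "summand_inclusion t (loop_class (S t) (base t) (twist \<kappa> \<gamma> \<kappa>)) =
        loop_class X base_X (twist (g t \<circ> \<kappa>) (g t \<circ> \<gamma>) (g t \<circ> \<kappa>))"
      unfolding summand_inclusion(2)[OF tw] comp_twist ..
    have e3: "base_change X p \<omega> (loop_class X base_X (twist (g t \<circ> \<kappa>) (g t \<circ> \<gamma>) (g t \<circ> \<kappa>))) =
        loop_class X p (twist \<omega> (twist (g t \<circ> \<kappa>) (g t \<circ> \<gamma>) (g t \<circ> \<kappa>)) \<omega>)"
      by (rule base_change(2)[OF w path_from_to_twist[OF gk gg gk]])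
    have "path_homotopic X p p (twist \<omega> (twist (g t \<circ> \<kappa>) (g t \<circ> \<gamma>) (g t \<circ> \<kappa>)) \<omega>)
        (twist (path_concat \<omega> (g t \<circ> \<kappa>)) (g t \<circ> \<gamma>) (path_concat \<omega> (g t \<circ> \<kappa>)))"
      by (rule twist_twist[OF w gk gg gk w])
    moreover have "path_homotopic X p p (twist (path_concat \<omega> (g t \<circ> \<kappa>)) (g t \<circ> \<gamma>) (path_concat \<omega> (g t \<circ> \<kappa>)))
        (twist \<alpha> (h t \<circ> \<gamma>) \<alpha>)"
    proof (rule homotopic_twist[OF wk _ wk], rule path_homotopic_eq_on[OF gg])
      fix s :: real assume "0 \<le> s" "s \<le> 1"
      then have "\<gamma> s \<in> D t" using g(2) by auto
      then show "(g t \<circ> \<gamma>) s = (h t \<circ> \<gamma>) s" by (simp add: g_D)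
    qed
    ultimately have "path_homotopic X p p (twist \<omega> (twist (g t \<circ> \<kappa>) (g t \<circ> \<gamma>) (g t \<circ> \<kappa>)) \<omega>) (twist \<alpha> (h t \<circ> \<gamma>) \<alpha>)"
      by (rule path_homotopic_trans)
    then show ?thesis unfolding e1 e2 e3 by (rule loop_class_eqI[symmetric])
  qed
  show thesis
  proof (rule that[OF w kS], rule ballI)
    fix c assume c: "c \<in> carrier (fundamental_group (S t) y)"
    let ?v = "base_change X p \<omega> (summand_inclusion t (base_change (S t) (base t) \<kappa> c))"
    have each: "loop_class X p (twist \<alpha> (h t \<circ> \<gamma>) \<alpha>) = ?v" if "\<gamma> \<in> c" "\<gamma> ` {0..1} \<subseteq> D t" for \<gamma>
    proof -
      obtain \<delta> where d: "path_from_to (S t) y y \<delta>" "c = loop_class (S t) y \<delta>" using c by (auto simp: fundamental_group_carrier)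
      have hd: "path_homotopic (S t) y y \<delta> \<gamma>" using that(1) d(2) by (simp add: loop_class_alt)
      have "c = loop_class (S t) y \<gamma>" unfolding d(2) by (rule loop_class_eqI[OF hd])
      then show ?thesis using key[OF path_homotopic_imp_path(2)[OF hd] that(2)] by simp
    qed
    obtain \<gamma> where g: "path_from_to (S t) y y \<gamma>" "\<gamma> ` {0..1} \<subseteq> D t" "c = loop_class (S t) y \<gamma>"
      by (rule D_representative[OF y c])
    have "\<gamma> \<in> {\<gamma> \<in> c. \<gamma> ` {0..1} \<subseteq> D t}" using g(2) loop_class_self[OF g(1)] g(3) by simp
    then have ne: "{\<gamma> \<in> c. \<gamma> ` {0..1} \<subseteq> D t} \<noteq> {}" by blast
    have "summand_map X p (D t) (h t) \<alpha> c = (\<Union>\<gamma>\<in>{\<gamma> \<in> c. \<gamma> ` {0..1} \<subseteq> D t}. ?v)"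
      unfolding summand_map_def by (rule SUP_cong[OF refl]) (use each in \<open>simp add: twist_def\<close>)
    also have "\<dots> = ?v" by (rule UN_constant_eq[OF \<open>\<gamma> \<in> {\<gamma> \<in> c. \<gamma> ` {0..1} \<subseteq> D t}\<close>]) simp
    finally show "summand_map X p (D t) (h t) \<alpha> c = ?v" .
  qed
qed

theorem summand_map_injective_hom:
  assumes y: "y \<in> D t" and \<alpha>: "path_from_to X p (h t y) \<alpha>"
  shows "summand_map X p (D t) (h t) \<alpha> \<in> hom (fundamental_group (S t) y) (fundamental_group X p)"
    and "inj_on (summand_map X p (D t) (h t) \<alpha>) (carrier (fundamental_group (S t) y))"
proof -
  let ?A = "fundamental_group (S t) y" and ?s = "summand_map X p (D t) (h t) \<alpha>"
  obtain \<omega> \<kappa> where w: "path_from_to X p base_X \<omega>" and k: "path_from_to (S t) (base t) y \<kappa>"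
    and eq: "\<forall>c\<in>carrier ?A. ?s c = base_change X p \<omega> (summand_inclusion t (base_change (S t) (base t) \<kappa> c))"
    by (rule summand_map_eq[OF y \<alpha>])
  define f where "f = base_change X p \<omega> \<circ> (summand_inclusion t \<circ> base_change (S t) (base t) \<kappa>)"
  have sf: "?s c = f c" if "c \<in> carrier ?A" for c using eq that by (simp add: f_def)
  have fh: "f \<in> hom ?A (fundamental_group X p)" unfolding f_def
    by (rule hom_compose[OF hom_compose[OF base_change(1)[OF k] summand_inclusion(1)] base_change(1)[OF w]])
  have kA: "base_change (S t) (base t) \<kappa> ` carrier ?A = carrier (K t)"
    and ki: "inj_on (base_change (S t) (base t) \<kappa>) (carrier ?A)"
    using base_change_bij[OF k] by (auto simp: bij_betw_def)
  have li: "inj_on (summand_inclusion t) (carrier (K t))" by (rule fundamental_group_free_product(2))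
  have lG: "summand_inclusion t ` carrier (K t) \<subseteq> carrier GX"
    using hom_in_carrier[OF summand_inclusion(1)[of t]] by (simp add: image_subset_iff)
  have "inj_on (base_change X p \<omega>) (carrier GX)" using base_change_bij[OF w] by (simp add: bij_betw_def)
  then have wi: "inj_on (base_change X p \<omega>) (summand_inclusion t ` carrier (K t))" using lG by (rule inj_on_subset)
  have i1: "inj_on (summand_inclusion t \<circ> base_change (S t) (base t) \<kappa>) (carrier ?A)"
    by (rule comp_inj_on[OF ki]) (simp add: kA li)
  have "(summand_inclusion t \<circ> base_change (S t) (base t) \<kappa>) ` carrier ?A = summand_inclusion t ` carrier (K t)"
    unfolding image_comp[symmetric] kA ..
  then have fi: "inj_on f (carrier ?A)" unfolding f_def using comp_inj_on[OF i1] wi by simp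
  have cl: "c \<otimes>\<^bsub>?A\<^esub> d \<in> carrier ?A" if "c \<in> carrier ?A" "d \<in> carrier ?A" for c d
    using group.subgroup_self[OF group_fundamental_group] subgroup.m_closed that path_from_to_topspace[OF k] by metis
  show "?s \<in> hom ?A (fundamental_group X p)"
  proof (rule homI)
    show "?s c \<in> carrier (fundamental_group X p)" if "c \<in> carrier ?A" for c
      unfolding sf[OF that] by (rule hom_in_carrier[OF fh that])
    show "?s (c \<otimes>\<^bsub>?A\<^esub> d) = ?s c \<otimes>\<^bsub>fundamental_group X p\<^esub> ?s d" if "c \<in> carrier ?A" "d \<in> carrier ?A" for c d
      unfolding sf[OF that(1)] sf[OF that(2)] sf[OF cl[OF that]] by (rule hom_mult[OF fh that])
  qed
  show "inj_on ?s (carrier ?A)" using inj_on_cong[of "carrier ?A" ?s f] sf fi by blast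
qed

text \<open>The statement about \<open>summand_inclusion\<close>, moved to arbitrary base points. The paths from \<open>p\<close> to the
  base point of the neck may differ for the two summands, which changes the result by a conjugation.\<close>

theorem generalized_torsion_from_summand_map:
  assumes y: "\<And>t. y t \<in> D t" and \<alpha>: "\<And>t. path_from_to X p (h t (y t)) (\<alpha> t)"
    and tf: "\<And>t. torsion_free (fundamental_group (S t) (y t))"
    and x: "generalized_torsion (fundamental_group X p) x"
  obtains t c where "generalized_torsion (fundamental_group (S t) (y t)) c"
    "conjugate_in (fundamental_group X p) x (summand_map X p (D t) (h t) (\<alpha> t) c)"
proof -
  let ?A = "\<lambda>t. fundamental_group (S t) (y t)" and ?s = "\<lambda>t. summand_map X p (D t) (h t) (\<alpha> t)"
  let ?G = "fundamental_group X p"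
  have "\<exists>\<omega> \<kappa>. path_from_to X p base_X \<omega> \<and> path_from_to (S t) (base t) (y t) \<kappa> \<and>
      (\<forall>c\<in>carrier (?A t). ?s t c = base_change X p \<omega> (summand_inclusion t (base_change (S t) (base t) \<kappa> c)))" for t
    by (rule summand_map_eq[OF y \<alpha>]) blast
  then obtain \<omega> \<kappa> where w: "\<And>t. path_from_to X p base_X (\<omega> t)" and k: "\<And>t. path_from_to (S t) (base t) (y t) (\<kappa> t)"
    and eq: "\<And>t. \<forall>c\<in>carrier (?A t). ?s t c = base_change X p (\<omega> t) (summand_inclusion t (base_change (S t) (base t) (\<kappa> t) c))"
    by metis
  have pX: "p \<in> topspace X" and yS: "y t \<in> topspace (S t)" for t
    using path_from_to_topspace[OF w] path_from_to_topspace[OF k[of t]] by auto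
  interpret G: group ?G by (rule group_fundamental_group[OF pX])
  have gA: "group (?A t)" for t by (rule group_fundamental_group[OF yS])
  note rk = path_from_to_reverse[OF k]
  have tfK: "torsion_free (K t)" for t
    by (rule torsion_free_inj_hom[OF group_K gA base_change(1)[OF rk] _ tf])
       (use base_change_bij[OF rk] in \<open>simp add: bij_betw_def\<close>)
  let ?w = "\<omega> True"
  have xc: "x \<in> carrier ?G" using x by (simp add: generalized_torsion_def)
  note rw = path_from_to_reverse[OF w[of True]]
  have "generalized_torsion GX (base_change X base_X (path_reverse ?w) x)"
    by (rule generalized_torsion_inj_hom[OF G.is_group group_GX base_change(1)[OF rw] _ x])
       (use base_change_bij[OF rw] in \<open>simp add: bij_betw_def\<close>)
  then obtain t d c where d: "generalized_torsion (K t) d" and c: "c \<in> carrier GX"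
    and xd: "base_change X base_X (path_reverse ?w) x = c \<otimes>\<^bsub>GX\<^esub> summand_inclusion t d \<otimes>\<^bsub>GX\<^esub> inv\<^bsub>GX\<^esub> c"
    by (rule generalized_torsion_from_summand[OF tfK])
  have dK: "d \<in> carrier (K t)" using d by (simp add: generalized_torsion_def)
  let ?z = "summand_inclusion t d"
  have zG: "?z \<in> carrier GX" by (rule hom_in_carrier[OF summand_inclusion(1) dK])
  interpret b: group_hom GX ?G "base_change X p ?w"
    by (intro group_hom.intro group_hom_axioms.intro group_GX G.is_group base_change(1)[OF w])
  interpret GX: group GX by (rule group_GX)
  define c' where "c' = base_change (S t) (y t) (path_reverse (\<kappa> t)) d"
  have c'A: "c' \<in> carrier (?A t)" unfolding c'_def by (rule hom_in_carrier[OF base_change(1)[OF rk] dK])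
  have c'g: "generalized_torsion (?A t) c'" unfolding c'_def
    by (rule generalized_torsion_inj_hom[OF group_K gA base_change(1)[OF rk] _ d])
       (use base_change_bij[OF rk] in \<open>simp add: bij_betw_def\<close>)
  have "base_change (S t) (base t) (\<kappa> t) c' = d"
    using base_change_inverse[OF rk dK] unfolding c'_def by simp
  then have sc: "?s t c' = base_change X p (\<omega> t) ?z" using eq c'A by simp
  have "x = base_change X p ?w (base_change X base_X (path_reverse ?w) x)"
    using base_change_inverse[OF rw xc] by simp
  also have "\<dots> = base_change X p ?w c \<otimes>\<^bsub>?G\<^esub> base_change X p ?w ?z \<otimes>\<^bsub>?G\<^esub> inv\<^bsub>?G\<^esub> base_change X p ?w c"
    unfolding xd using c zG by simp
  finally have x1: "x = base_change X p ?w c \<otimes>\<^bsub>?G\<^esub> base_change X p ?w ?z \<otimes>\<^bsub>?G\<^esub> inv\<^bsub>?G\<^esub> base_change X p ?w c" .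
  obtain l where l: "l \<in> carrier ?G" "base_change X p ?w ?z = l \<otimes>\<^bsub>?G\<^esub> base_change X p (\<omega> t) ?z \<otimes>\<^bsub>?G\<^esub> inv\<^bsub>?G\<^esub> l"
    using base_change_conjugate[OF w w zG] by blast
  let ?a = "base_change X p ?w c \<otimes>\<^bsub>?G\<^esub> l"
  have sG: "?s t c' \<in> carrier ?G" unfolding sc by (rule hom_in_carrier[OF base_change(1)[OF w] zG])
  have bc: "base_change X p ?w c \<in> carrier ?G" using c by simp
  have "x = ?a \<otimes>\<^bsub>?G\<^esub> ?s t c' \<otimes>\<^bsub>?G\<^esub> inv\<^bsub>?G\<^esub> ?a"
    unfolding x1 l(2) sc[symmetric] using bc l(1) sG by (simp add: G.m_assoc G.inv_mult_group)
  moreover have "?a \<in> carrier ?G" using bc l(1) by simp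
  ultimately have "conjugate_in ?G x (?s t c')" unfolding conjugate_in_def using xc sG by blast
  then show thesis using that[OF c'g] by blast
qed

end

section \<open>Connected sums of 3-manifolds\<close>

lemma locally_path_connected_space_top_of_set_convex:
  fixes H :: "'e::real_normed_vector set"
  assumes "convex H"
  shows "locally_path_connected_space (top_of_set H)"
  unfolding locally_path_connected_space
proof (intro allI impI, elim conjE)
  fix V x assume "openin (top_of_set H) V" "x \<in> V"
  then obtain u where u: "openin (top_of_set H) u" "path_connected u" "x \<in> u" "u \<subseteq> V"
    using convex_imp_locally_path_connected[OF assms] unfolding locally_path_connected by metis
  have uH: "u \<subseteq> H" using openin_subset[OF u(1)] by simp
  have "path_connected_space (top_of_set u)"
    unfolding path_connected_space_def
  proof (intro ballI)
    fix a b assume "a \<in> topspace (top_of_set u)" "b \<in> topspace (top_of_set u)"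
    then have "a \<in> u" "b \<in> u" by simp_all
    then obtain p where "path p" "path_image p \<subseteq> u" "pathstart p = a" "pathfinish p = b"
      using u(2) unfolding path_connected_def by blast
    then show "\<exists>g. pathin (top_of_set u) g \<and> g 0 = a \<and> g 1 = b"
      by (intro exI[of _ p]) (auto simp: pathin_def path_def path_image_def pathstart_def pathfinish_def continuous_map_in_subtopology)
  qed
  then have "path_connectedin (top_of_set H) u"
    using uH by (simp add: path_connectedin_def subtopology_subtopology Int_absorb1)
  then show "\<exists>U. openin (top_of_set H) U \<and> path_connectedin (top_of_set H) U \<and> x \<in> U \<and> U \<subseteq> V"
    using u by blast
qed

text \<open>Charts have values in relatively open subsets of a half space, which is convex.\<close>

lemma manifold3_locally_path_connected:
  assumes X: "manifold3 X"
  shows "locally_path_connected_space X"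
  unfolding locally_path_connected_space
proof (intro allI impI, elim conjE)
  fix W x assume W: "openin X W" "x \<in> W"
  let ?H = "{v :: real^3. v $ 1 \<ge> 0}"
  have "x \<in> topspace X" using W openin_subset by blast
  then obtain U V where U: "openin X U" "x \<in> U" and V: "openin (top_of_set ?H) V"
    and UV: "subtopology X U homeomorphic_space top_of_set V"
    using X unfolding manifold3_def by blast
  have "convex ?H" using convex_halfspace_ge[of 0 "axis 1 1 :: real^3"] by (simp add: inner_axis' )
  then have "locally_path_connected_space (subtopology (top_of_set ?H) V)"
    by (intro locally_path_connected_space_open_subset locally_path_connected_space_top_of_set_convex V)
  moreover have "subtopology (top_of_set ?H) V = top_of_set V"
    using openin_subset[OF V] by (simp add: subtopology_subtopology Int_absorb1)
  ultimately have l: "locally_path_connected_space (subtopology X U)"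
    using homeomorphic_locally_path_connected_space[OF UV] by simp
  have "openin (subtopology X U) (U \<inter> W)" by (rule openin_subtopology_Int2[OF W(1)])
  then obtain T where T: "openin (subtopology X U) T" "path_connectedin (subtopology X U) T" "x \<in> T" "T \<subseteq> U \<inter> W"
    using l U(2) W(2) unfolding locally_path_connected_space by blast
  then show "\<exists>T. openin X T \<and> path_connectedin X T \<and> x \<in> T \<and> T \<subseteq> W"
    using openin_open_subtopology[OF U(1)] by (auto simp: path_connectedin_subtopology)
qed

lemma connected_sum_gluing:
  assumes "connected_sum_via X Y P e1 e2 h1 h2"
  shows "gluing X (\<lambda>t. if t then Y else P) (\<lambda>t. if t then e1 else e2) (\<lambda>t. if t then h1 else h2)
    (\<lambda>t. if t then punctured_set Y e1 else punctured_set P e2)"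
proof -
  define S where "S t = (if t then Y else P)" for t
  define e where "e t = (if t then e1 else e2)" for t
  define h where "h t = (if t then h1 else h2)" for t
  define D where "D t = (if t then punctured_set Y e1 else punctured_set P e2)" for t
  have m: "compact_orientable_3manifold Y" "compact_orientable_3manifold P" and b: "tame_ball Y e1" "tame_ball P e2"
    and q: "quotient_map (sum_topology (\<lambda>b. if b then subtopology Y (punctured_set Y e1)
           else subtopology P (punctured_set P e2)) UNIV) X (\<lambda>(b, z). if b then h1 z else h2 z)"
    and inj: "inj_on h1 (punctured_set Y e1)" "inj_on h2 (punctured_set P e2)"
    and glue: "\<And>y z. y \<in> punctured_set Y e1 \<Longrightarrow> z \<in> punctured_set P e2 \<Longrightarrow>
        h1 y = h2 z \<longleftrightarrow> (\<exists>s\<in>sphere 0 1. y = e1 s \<and> z = e2 s)"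
    using assms unfolding connected_sum_via_def by auto
  have DS: "topspace (subtopology (S t) (D t)) = D t" for t
    by (cases t) (auto simp: S_def D_def punctured_set_def)
  let ?T = "sum_topology (\<lambda>t. subtopology (S t) (D t)) UNIV"
  have "(\<lambda>b. if b then subtopology Y (punctured_set Y e1) else subtopology P (punctured_set P e2)) = (\<lambda>t. subtopology (S t) (D t))"
    by (auto simp: S_def D_def)
  moreover have "(\<lambda>(b, z). if b then h1 z else h2 z) = (\<lambda>(b, z). h b z)" by (auto simp: h_def)
  ultimately have q': "quotient_map ?T X (\<lambda>(b, z). h b z)" using q by simp
  have tT: "topspace ?T = Sigma UNIV D" unfolding topspace_sum_topology using DS by (auto simp: comp_def)
  have man: "compact_orientable_3manifold (S t)" for t using m by (simp add: S_def)
  have "gluing X S e h D"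
  proof
    show "D t = topspace (S t) - e t ` ball 0 1" for t by (simp add: D_def S_def e_def punctured_set_def)
    show "Hausdorff_space (S t)" "connected_space (S t)" "locally_path_connected_space (S t)" for t
      using man[of t] manifold3_locally_path_connected
      by (auto simp: compact_orientable_3manifold_def manifold3_def)
    show "embedding_map euclidean (S t) (e t)" "openin (S t) (range (e t))" for t
      using b by (auto simp: tame_ball_def S_def e_def)
    show "openin X Q \<longleftrightarrow> (\<forall>t. openin (subtopology (S t) (D t)) {z \<in> D t. h t z \<in> Q})" if Q: "Q \<subseteq> topspace X" for Q
    proof -
      have "openin X Q \<longleftrightarrow> openin ?T {x \<in> topspace ?T. (case x of (b, z) \<Rightarrow> h b z) \<in> Q}"
        using q' Q unfolding quotient_map_def by blast
      also have "\<dots> \<longleftrightarrow> (\<forall>t. openin (subtopology (S t) (D t)) {z \<in> D t. h t z \<in> Q})"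
        unfolding openin_sum_topology tT using DS by (auto simp: comp_def)
      finally show ?thesis .
    qed
    have "topspace X = (\<lambda>(b, z). h b z) ` Sigma UNIV D" using q' unfolding quotient_map_def tT by simp
    also have "\<dots> = (\<Union>b. h b ` D b)" by force
    also have "\<dots> = h True ` D True \<union> h False ` D False" by (simp add: UNIV_bool Un_commute)
    finally show "topspace X = h True ` D True \<union> h False ` D False" .
    show "inj_on (h t) (D t)" for t using inj by (simp add: h_def D_def)
    show "h t y = h (\<not> t) z \<longleftrightarrow> (\<exists>s\<in>sphere 0 1. y = e t s \<and> z = e (\<not> t) s)"
      if "y \<in> D t" "z \<in> D (\<not> t)" for t y z
    proof (cases t)
      case True
      then show ?thesis using that glue[of y z] by (simp add: h_def D_def e_def)
    next
      case False
      then have "h1 z = h2 y \<longleftrightarrow> (\<exists>s\<in>sphere 0 1. z = e1 s \<and> y = e2 s)" using that glue[of z y] by (simp add: D_def)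
      then show ?thesis using False by (auto simp: h_def e_def)
    qed
  qed
  then show ?thesis unfolding S_def e_def h_def D_def .
qed

lemma conjugate_in_trans:
  assumes G: "group G" and "conjugate_in G x y" "conjugate_in G y z"
  shows "conjugate_in G x z"
proof -
  interpret group G by (rule G)
  obtain a b where ab: "a \<in> carrier G" "b \<in> carrier G" and c: "x \<in> carrier G" "z \<in> carrier G"
    and e: "x = a \<otimes>\<^bsub>G\<^esub> y \<otimes>\<^bsub>G\<^esub> inv\<^bsub>G\<^esub> a" "y = b \<otimes>\<^bsub>G\<^esub> z \<otimes>\<^bsub>G\<^esub> inv\<^bsub>G\<^esub> b"
    using assms(2,3) by (auto simp: conjugate_in_def)
  have "x = (a \<otimes>\<^bsub>G\<^esub> b) \<otimes>\<^bsub>G\<^esub> z \<otimes>\<^bsub>G\<^esub> inv\<^bsub>G\<^esub> (a \<otimes>\<^bsub>G\<^esub> b)"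
    unfolding e using ab c by (simp add: m_assoc inv_mult_group)
  moreover have "a \<otimes>\<^bsub>G\<^esub> b \<in> carrier G" using ab by simp
  ultimately show ?thesis unfolding conjugate_in_def using c by blast
qed

lemma conjugate_in_hom:
  assumes "group G" "group H" "f \<in> hom G H" and c: "conjugate_in G x y"
  shows "conjugate_in H (f x) (f y)"
proof -
  interpret group_hom G H f by (intro group_hom.intro group_hom_axioms.intro assms)
  obtain a where a: "a \<in> carrier G" "x \<in> carrier G" "y \<in> carrier G" "x = a \<otimes>\<^bsub>G\<^esub> y \<otimes>\<^bsub>G\<^esub> inv\<^bsub>G\<^esub> a"
    using c by (auto simp: conjugate_in_def)
  have "f x = f a \<otimes>\<^bsub>H\<^esub> f y \<otimes>\<^bsub>H\<^esub> inv\<^bsub>H\<^esub> f a" unfolding a(4) using a(1,3) by simp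
  then show ?thesis unfolding conjugate_in_def using a(1-3) by (intro conjI bexI[of _ "f a"]) simp_all
qed

lemma conjugate_in_refl:
  assumes "group G" "x \<in> carrier G"
  shows "conjugate_in G x x"
proof -
  interpret group G by (rule assms)
  show ?thesis unfolding conjugate_in_def using assms(2) by (intro conjI bexI[of _ "\<one>\<^bsub>G\<^esub>"]) simp_all
qed

text \<open>In the induction this rules out torsion in the fundamental group of a partial sum: a nontrivial
  torsion element would be conjugate to the image of a nontrivial torsion element of a summand.\<close>

lemma torsion_conjugate_into_image:
  assumes A: "group A" and G: "group G" and f: "f \<in> hom A G" and inj: "inj_on f (carrier A)"
    and tf: "torsion_free A" and a: "a \<in> carrier A" and c: "conjugate_in G g (f a)"
    and k: "1 \<le> k" "g [^]\<^bsub>G\<^esub> (k::nat) = \<one>\<^bsub>G\<^esub>"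
  shows "a = \<one>\<^bsub>A\<^esub>"
proof -
  interpret f: group_hom A G f by (intro group_hom.intro group_hom_axioms.intro A G f)
  obtain b where b: "b \<in> carrier G" "g = b \<otimes>\<^bsub>G\<^esub> f a \<otimes>\<^bsub>G\<^esub> inv\<^bsub>G\<^esub> b" and g: "g \<in> carrier G"
    using c by (auto simp: conjugate_in_def)
  let ?c = "\<lambda>x. inv\<^bsub>G\<^esub> b \<otimes>\<^bsub>G\<^esub> x \<otimes>\<^bsub>G\<^esub> b"
  interpret c: group_hom G G ?c by (intro group_hom.intro group_hom_axioms.intro G f.H.conjugation_hom b)
  have "?c g = f a" unfolding b(2) using b(1) a by (simp add: f.H.m_assoc f.H.inv_solve_left')
  then have "f a [^]\<^bsub>G\<^esub> k = \<one>\<^bsub>G\<^esub>" using c.hom_nat_pow[OF g, of k] k(2) c.hom_one by simp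
  then have "f (a [^]\<^bsub>A\<^esub> k) = f \<one>\<^bsub>A\<^esub>" using f.hom_nat_pow[OF a, of k] by simp
  then have "a [^]\<^bsub>A\<^esub> k = \<one>\<^bsub>A\<^esub>" by (rule inj_onD[OF inj]) (use a in simp_all)
  then show ?thesis using tf a k(1) by (auto simp: torsion_free_def)
qed

text \<open>For a single summand the map is an isomorphism, induced by the homeomorphism and followed by
  the change of base point along \<open>\<alpha>\<close>.\<close>

lemma summand_map_homeomorphism:
  assumes f: "homeomorphic_map P X f" and \<alpha>: "path_from_to X p (f x) \<alpha>" and x: "x \<in> topspace P"
  shows "summand_map X p (topspace P) f \<alpha> \<in> hom (fundamental_group P x) (fundamental_group X p)"
    and "inj_on (summand_map X p (topspace P) f \<alpha>) (carrier (fundamental_group P x))"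
    and "generalized_torsion (fundamental_group X p) g \<Longrightarrow>
      \<exists>c. generalized_torsion (fundamental_group P x) c \<and> summand_map X p (topspace P) f \<alpha> c = g"
proof -
  let ?A = "fundamental_group P x" and ?B = "fundamental_group X (f x)" and ?G = "fundamental_group X p"
  let ?s = "summand_map X p (topspace P) f \<alpha>"
  obtain f' where f': "homeomorphic_maps P X f f'" using f homeomorphic_map_maps by blast
  have cf: "continuous_map P X f" and cf': "continuous_map X P f'" and ff': "\<And>q. q \<in> topspace P \<Longrightarrow> f' (f q) = q"
    and f'f: "\<And>q. q \<in> topspace X \<Longrightarrow> f (f' q) = q"
    using f' by (auto simp: homeomorphic_maps_def)
  have pX: "p \<in> topspace X" "f x \<in> topspace X" using path_from_to_topspace[OF \<alpha>] by auto
  have gA: "group ?A" and gG: "group ?G" by (rule group_fundamental_group; fact)+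
  have gB: "group ?B" by (rule group_fundamental_group[OF pX(2)])
  note i1 = induced_map[where f = f, OF cf refl[of "f x"]]
  note i2 = induced_map[where f = f' and p = "f x" and q = x, OF cf' ff'[OF x]]
  note r\<alpha> = path_from_to_reverse[OF \<alpha>]
  define F where "F = base_change X p \<alpha> \<circ> induced_map X (f x) f"
  define F' where "F' = induced_map P x f' \<circ> base_change X (f x) (path_reverse \<alpha>)"
  have F: "F \<in> hom ?A ?G" unfolding F_def by (rule hom_compose[OF i1(1) base_change(1)[OF \<alpha>]])
  have F': "F' \<in> hom ?G ?A" unfolding F'_def by (rule hom_compose[OF base_change(1)[OF r\<alpha>] i2(1)])
  have roundtrip: "path_homotopic Z q q (k \<circ> (j \<circ> \<gamma>)) \<gamma>"
    if g: "path_from_to Z q q \<gamma>" and kj: "\<And>z. z \<in> topspace Z \<Longrightarrow> k (j z) = z" for Z :: "'c topology" and q \<gamma> and k :: "'d \<Rightarrow> 'c" and j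
  proof (rule path_homotopic_sym, rule path_homotopic_eq_on[OF g])
    fix s :: real assume s: "0 \<le> s" "s \<le> 1"
    have "path_from_to (subtopology Z (topspace Z)) q q \<gamma>" using g by simp
    then have "\<gamma> s \<in> topspace Z" using s unfolding path_from_to_subtopology by auto
    then show "\<gamma> s = (k \<circ> (j \<circ> \<gamma>)) s" using kj by simp
  qed
  have ii: "induced_map P x f' (induced_map X (f x) f c) = c" if c: "c \<in> carrier ?A" for c
  proof -
    obtain \<gamma> where g: "path_from_to P x x \<gamma>" "c = loop_class P x \<gamma>" using c by (auto simp: fundamental_group_carrier)
    show ?thesis unfolding g(2) i1(2)[OF g(1)] i2(2)[OF path_from_to_map[OF cf g(1)]]
      by (rule loop_class_eqI[OF roundtrip[OF g(1)]]) (rule ff')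
  qed
  have ii': "induced_map X (f x) f (induced_map P x f' c) = c" if c: "c \<in> carrier ?B" for c
  proof -
    obtain \<gamma> where g: "path_from_to X (f x) (f x) \<gamma>" "c = loop_class X (f x) \<gamma>" using c by (auto simp: fundamental_group_carrier)
    have "path_from_to P x x (f' \<circ> \<gamma>)" using path_from_to_map[OF cf' g(1)] ff'[OF x] by simp
    note e = i1(2)[OF this]
    show ?thesis unfolding g(2) i2(2)[OF g(1)] e
      by (rule loop_class_eqI[OF roundtrip[OF g(1)]]) (rule f'f)
  qed
  have F'F: "F' (F c) = c" if c: "c \<in> carrier ?A" for c
    using base_change_inverse[OF \<alpha> hom_in_carrier[OF i1(1) c]] ii[OF c] by (simp add: F_def F'_def)
  have FF': "F (F' c) = c" if c: "c \<in> carrier ?G" for c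
    using ii'[OF hom_in_carrier[OF base_change(1)[OF r\<alpha>] c]] base_change_inverse[OF r\<alpha> c] by (simp add: F_def F'_def)
  have sF: "?s c = F c" if c: "c \<in> carrier ?A" for c
  proof -
    have each: "loop_class X p (twist \<alpha> (f \<circ> \<gamma>) \<alpha>) = F c" if "\<gamma> \<in> c" for \<gamma>
    proof -
      obtain \<delta> where d: "path_from_to P x x \<delta>" "c = loop_class P x \<delta>" using c by (auto simp: fundamental_group_carrier)
      have hd: "path_homotopic P x x \<delta> \<gamma>" using that d(2) by (simp add: loop_class_alt)
      have e: "c = loop_class P x \<gamma>" unfolding d(2) by (rule loop_class_eqI[OF hd])
      note g = path_homotopic_imp_path(2)[OF hd]
      show ?thesis unfolding e F_def comp_apply i1(2)[OF g] base_change(2)[OF \<alpha> path_from_to_map[OF cf g]] ..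
    qed
    obtain \<gamma> where g: "path_from_to P x x \<gamma>" "c = loop_class P x \<gamma>" using c by (auto simp: fundamental_group_carrier)
    have "path_from_to (subtopology P (topspace P)) x x \<gamma>" using g(1) by simp
    then have mem: "\<gamma> \<in> {\<gamma> \<in> c. \<gamma> ` {0..1} \<subseteq> topspace P}"
      using loop_class_self[OF g(1)] g(2) unfolding path_from_to_subtopology by simp
    have "?s c = (\<Union>\<gamma>\<in>{\<gamma> \<in> c. \<gamma> ` {0..1} \<subseteq> topspace P}. F c)"
      unfolding summand_map_def by (rule SUP_cong[OF refl]) (use each in \<open>simp add: twist_def\<close>)
    also have "\<dots> = F c" by (rule UN_constant_eq[OF mem]) simp
    finally show ?thesis .
  qed
  have cl: "c \<otimes>\<^bsub>?A\<^esub> d \<in> carrier ?A" if "c \<in> carrier ?A" "d \<in> carrier ?A" for c d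
    using gA that by (simp add: group.is_monoid monoid.m_closed)
  show "?s \<in> hom ?A ?G"
  proof (rule homI)
    show "?s c \<in> carrier ?G" if "c \<in> carrier ?A" for c unfolding sF[OF that] by (rule hom_in_carrier[OF F that])
    show "?s (c \<otimes>\<^bsub>?A\<^esub> d) = ?s c \<otimes>\<^bsub>?G\<^esub> ?s d" if "c \<in> carrier ?A" "d \<in> carrier ?A" for c d
      unfolding sF[OF that(1)] sF[OF that(2)] sF[OF cl[OF that]] by (rule hom_mult[OF F that])
  qed
  show "inj_on ?s (carrier ?A)" by (rule inj_on_inverseI[of _ F']) (simp add: sF F'F)
  show "\<exists>c. generalized_torsion ?A c \<and> ?s c = g" if g: "generalized_torsion ?G g"
  proof (intro exI conjI)
    have gc: "g \<in> carrier ?G" using g by (simp add: generalized_torsion_def)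
    show "generalized_torsion ?A (F' g)"
      by (rule generalized_torsion_inj_hom[OF gG gA F' _ g]) (rule inj_on_inverseI[of _ F], rule FF')
    show "?s (F' g) = g" unfolding sF[OF hom_in_carrier[OF F' gc]] by (rule FF'[OF gc])
  qed
qed

section \<open>Prime decompositions\<close>

text \<open>The assertion about torsion-free summands, in the form in which it is carried through the
  iterated sum. The injectivity of the maps is included: it yields the torsion-freeness of the
  partial sums, which is needed to add the next summand.\<close>

definition detects_generalized_torsion ::
  "('a topology \<times> 'a) list \<Rightarrow> 'a topology \<Rightarrow> 'a \<Rightarrow> ((real \<Rightarrow> 'a) set \<Rightarrow> (real \<Rightarrow> 'a) set) list \<Rightarrow> bool" where
  "detects_generalized_torsion Ps M p \<iota>s \<longleftrightarrow>
     length \<iota>s = length Ps \<and> p \<in> topspace M \<and>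
     (\<forall>i<length Ps. let A = fundamental_group (fst (Ps ! i)) (snd (Ps ! i)) in
        snd (Ps ! i) \<in> topspace (fst (Ps ! i)) \<and>
        \<iota>s ! i \<in> hom A (fundamental_group M p) \<and> inj_on (\<iota>s ! i) (carrier A)) \<and>
     ((\<forall>i<length Ps. torsion_free (fundamental_group (fst (Ps ! i)) (snd (Ps ! i)))) \<longrightarrow>
      (\<forall>g. generalized_torsion (fundamental_group M p) g \<longrightarrow>
        (\<exists>i<length Ps. \<exists>c. generalized_torsion (fundamental_group (fst (Ps ! i)) (snd (Ps ! i))) c \<and>
           conjugate_in (fundamental_group M p) g ((\<iota>s ! i) c))))"

lemma detects_single:
  assumes "homeomorphic_map P X f" "x \<in> topspace P" "path_from_to X p (f x) \<alpha>"
  shows "detects_generalized_torsion [(P, x)] X p [summand_map X p (topspace P) f \<alpha>]"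
proof -
  have p: "p \<in> topspace X" using path_from_to_topspace[OF assms(3)] by simp
  note s = summand_map_homeomorphism[OF assms(1,3,2)]
  have "\<exists>c. generalized_torsion (fundamental_group P x) c \<and>
      conjugate_in (fundamental_group X p) g (summand_map X p (topspace P) f \<alpha> c)"
    if g: "generalized_torsion (fundamental_group X p) g" for g
  proof -
    have "g \<in> carrier (fundamental_group X p)" using g by (simp add: generalized_torsion_def)
    from conjugate_in_refl[OF group_fundamental_group[OF p] this] show ?thesis using s(3)[OF g] by metis
  qed
  then show ?thesis unfolding detects_generalized_torsion_def using s(1,2) p assms(2) by simp
qed

text \<open>A generalized torsion element of the sum is conjugate to the image of one of \<open>Y\<close> or of \<open>P\<close>. In
  the first case the induction hypothesis moves it on into one of the earlier summands. For
  this the fundamental group of \<open>Y\<close> must be torsion-free; it is, because a torsion element is a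
  generalized torsion element, to which the induction hypothesis applies.\<close>

lemma detects_step:
  assumes IH: "detects_generalized_torsion Ps Y y \<iota>s" and sum: "connected_sum_via X Y P e1 e2 h1 h2"
    and y: "y \<in> punctured_set Y e1" and x: "x \<in> punctured_set P e2"
    and \<alpha>: "path_from_to X p (h1 y) \<alpha>" and \<beta>: "path_from_to X p (h2 x) \<beta>"
  shows "detects_generalized_torsion (Ps @ [(P, x)]) X p
     (map (\<lambda>\<iota>. summand_map X p (punctured_set Y e1) h1 \<alpha> \<circ> \<iota>) \<iota>s @ [summand_map X p (punctured_set P e2) h2 \<beta>])"
proof -
  interpret gluing X "\<lambda>t. if t then Y else P" "\<lambda>t. if t then e1 else e2" "\<lambda>t. if t then h1 else h2"
    "\<lambda>t. if t then punctured_set Y e1 else punctured_set P e2" by (rule connected_sum_gluing[OF sum])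
  let ?G = "fundamental_group X p" and ?Y = "fundamental_group Y y" and ?P = "fundamental_group P x"
  let ?A = "\<lambda>i. fundamental_group (fst (Ps ! i)) (snd (Ps ! i))"
  let ?s = "summand_map X p (punctured_set Y e1) h1 \<alpha>" and ?r = "summand_map X p (punctured_set P e2) h2 \<beta>"
  let ?n = "length Ps"
  have s: "?s \<in> hom ?Y ?G" "inj_on ?s (carrier ?Y)"
    using summand_map_injective_hom[of y True p \<alpha>] y \<alpha> by simp_all
  have r: "?r \<in> hom ?P ?G" "inj_on ?r (carrier ?P)"
    using summand_map_injective_hom[of x False p \<beta>] x \<beta> by simp_all
  have len: "length \<iota>s = ?n" and yY: "y \<in> topspace Y"
    and base_in: "\<And>i. i < ?n \<Longrightarrow> snd (Ps ! i) \<in> topspace (fst (Ps ! i))"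
    and hom: "\<And>i. i < ?n \<Longrightarrow> \<iota>s ! i \<in> hom (?A i) ?Y" and inj: "\<And>i. i < ?n \<Longrightarrow> inj_on (\<iota>s ! i) (carrier (?A i))"
    and gt: "(\<forall>i<?n. torsion_free (?A i)) \<Longrightarrow> generalized_torsion ?Y g \<Longrightarrow>
       \<exists>i<?n. \<exists>c. generalized_torsion (?A i) c \<and> conjugate_in ?Y g ((\<iota>s ! i) c)" for g
    using IH unfolding detects_generalized_torsion_def by (auto simp: Let_def)
  have pX: "p \<in> topspace X" using path_from_to_topspace[OF \<alpha>] by simp
  have xP: "x \<in> topspace P" using x by (simp add: punctured_set_def)
  have gG: "group ?G" by (rule group_fundamental_group[OF pX])
  have gY: "group ?Y" by (rule group_fundamental_group[OF yY])
  have gA: "group (?A i)" if "i < ?n" for i by (rule group_fundamental_group[OF base_in[OF that]])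
  let ?\<kappa>s = "map (\<lambda>\<iota>. ?s \<circ> \<iota>) \<iota>s @ [?r]" and ?Qs = "Ps @ [(P, x)]"
  have old: "?Qs ! i = Ps ! i" "?\<kappa>s ! i = ?s \<circ> \<iota>s ! i" if "i < ?n" for i
    using that len by (simp_all add: nth_append)
  have new: "?Qs ! ?n = (P, x)" "?\<kappa>s ! ?n = ?r" using len by (simp_all add: nth_append)
  have index: "i < ?n \<or> i = ?n" if "i < length ?Qs" for i using that by auto
  have maps: "snd (?Qs ! i) \<in> topspace (fst (?Qs ! i)) \<and>
      ?\<kappa>s ! i \<in> hom (fundamental_group (fst (?Qs ! i)) (snd (?Qs ! i))) ?G \<and>
      inj_on (?\<kappa>s ! i) (carrier (fundamental_group (fst (?Qs ! i)) (snd (?Qs ! i))))" if "i < length ?Qs" for i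
    using index[OF that]
  proof
    assume i: "i < ?n"
    have "\<iota>s ! i ` carrier (?A i) \<subseteq> carrier ?Y" using hom_in_carrier[OF hom[OF i]] by auto
    then have "inj_on (?s \<circ> \<iota>s ! i) (carrier (?A i))" using comp_inj_on[OF inj[OF i] inj_on_subset[OF s(2)]] by blast
    then show ?thesis unfolding old[OF i] using base_in[OF i] hom_compose[OF hom[OF i] s(1)] by simp
  next
    assume i: "i = ?n"
    show ?thesis unfolding i new using xP r by simp
  qed
  have detect: "\<exists>i<length ?Qs. \<exists>c. generalized_torsion (fundamental_group (fst (?Qs ! i)) (snd (?Qs ! i))) c \<and>
           conjugate_in ?G g ((?\<kappa>s ! i) c)"
    if tf: "\<forall>i<length ?Qs. torsion_free (fundamental_group (fst (?Qs ! i)) (snd (?Qs ! i)))"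
      and g: "generalized_torsion ?G g" for g
  proof -
    have tfA: "torsion_free (?A i)" if "i < ?n" for i using tf[rule_format, of i] that unfolding old[OF that] by simp
    have tfP: "torsion_free ?P" using tf[rule_format, of ?n] unfolding new by simp
    have tfY: "torsion_free ?Y"
    proof (rule ccontr)
      assume "\<not> torsion_free ?Y"
      then obtain t and k :: nat where t: "generalized_torsion ?Y t" "1 \<le> k" "t [^]\<^bsub>?Y\<^esub> k = \<one>\<^bsub>?Y\<^esub>"
        by (rule torsion_generalized_torsion[OF gY])
      then obtain i c where i: "i < ?n" and c: "generalized_torsion (?A i) c" "conjugate_in ?Y t ((\<iota>s ! i) c)"
        using gt tfA by blast
      have "c \<in> carrier (?A i)" "c \<noteq> \<one>\<^bsub>?A i\<^esub>" using c(1) by (auto simp: generalized_torsion_def)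
      then show False
        using torsion_conjugate_into_image[OF gA[OF i] gY hom[OF i] inj[OF i] tfA[OF i] _ c(2) t(2,3)] by blast
    qed
    obtain t c where c: "generalized_torsion (fundamental_group (if t then Y else P) (if t then y else x)) c"
      "conjugate_in ?G g (summand_map X p (if t then punctured_set Y e1 else punctured_set P e2)
          (if t then h1 else h2) (if t then \<alpha> else \<beta>) c)"
      by (rule generalized_torsion_from_summand_map[of "\<lambda>t. if t then y else x" p "\<lambda>t. if t then \<alpha> else \<beta>" g])
        (use y x \<alpha> \<beta> tfY tfP g in auto)
    show ?thesis
    proof (cases t)
      case True
      then have c': "generalized_torsion ?Y c" "conjugate_in ?G g (?s c)" using c by simp_all
      obtain i d where i: "i < ?n" and d: "generalized_torsion (?A i) d" "conjugate_in ?Y c ((\<iota>s ! i) d)"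
        using gt[OF _ c'(1)] tfA by blast
      have "conjugate_in ?G g (?s ((\<iota>s ! i) d))"
        by (rule conjugate_in_trans[OF gG c'(2) conjugate_in_hom[OF gY gG s(1) d(2)]])
      then have "generalized_torsion (fundamental_group (fst (?Qs ! i)) (snd (?Qs ! i))) d \<and> conjugate_in ?G g ((?\<kappa>s ! i) d)"
        unfolding old[OF i] using d(1) by simp
      moreover have "i < length ?Qs" using i by simp
      ultimately show ?thesis by blast
    next
      case False
      then have "generalized_torsion (fundamental_group (fst (?Qs ! ?n)) (snd (?Qs ! ?n))) c \<and> conjugate_in ?G g ((?\<kappa>s ! ?n) c)"
        unfolding new using c by simp
      moreover have "?n < length ?Qs" by simp
      ultimately show ?thesis by blast
    qed
  qed
  have "length ?\<kappa>s = length ?Qs" using len by simp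
  then show ?thesis unfolding detects_generalized_torsion_def Let_def using maps detect pX by blast
qed

lemma iterated_connected_sum_detects:
  assumes "iterated_connected_sum Ms xs M p \<iota>s"
  shows "length xs = length Ms \<and> detects_generalized_torsion (zip Ms xs) M p \<iota>s"
  using assms
proof induction
  case (single P X f x \<alpha> p)
  then have "path_from_to X p (f x) \<alpha>" by (simp add: path_from_to_def)
  from detects_single[OF single(1,2) this] show ?case by simp
next
  case (step Ps xs Y y \<iota>s X P e1 e2 h1 h2 x \<alpha> p \<beta>)
  then have \<alpha>: "path_from_to X p (h1 y) \<alpha>" and \<beta>: "path_from_to X p (h2 x) \<beta>"
    and l: "length xs = length Ps" and d: "detects_generalized_torsion (zip Ps xs) Y y \<iota>s"
    by (simp_all add: path_from_to_def)
  from detects_step[OF d step.hyps(2-4) \<alpha> \<beta>] show ?case using l by simp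
qed

theorem theorem1p3:
  fixes M :: "'a topology" and Ms :: "'a topology list"
    and p :: 'a and xs :: "'a list"
    and \<iota>s :: "((real \<Rightarrow> 'a) set \<Rightarrow> (real \<Rightarrow> 'a) set) list"
  assumes "compact_orientable_3manifold M"
    and "prime_decomposition Ms xs M p \<iota>s"
  shows "((\<exists>g. generalized_torsion (fundamental_group M p) g) \<longleftrightarrow>
            (\<exists>i<length Ms. \<exists>g. generalized_torsion (fundamental_group (Ms ! i) (xs ! i)) g))
       \<and> ((\<forall>i<length Ms. torsion_free (fundamental_group (Ms ! i) (xs ! i))) \<longrightarrow>
            (\<forall>g. generalized_torsion (fundamental_group M p) g \<longrightarrow>
               (\<exists>i<length Ms. \<exists>h. generalized_torsion (fundamental_group (Ms ! i) (xs ! i)) h \<and>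
                  conjugate_in (fundamental_group M p) g ((\<iota>s ! i) h))))"
proof -
  let ?A = "\<lambda>i. fundamental_group (Ms ! i) (xs ! i)" and ?G = "fundamental_group M p" and ?n = "length Ms"
  have "iterated_connected_sum Ms xs M p \<iota>s" using assms(2) by (simp add: prime_decomposition_def)
  then have l: "length xs = ?n" and d: "detects_generalized_torsion (zip Ms xs) M p \<iota>s"
    using iterated_connected_sum_detects[of Ms xs M p \<iota>s] by simp_all
  have p: "p \<in> topspace M" and x: "\<And>i. i < ?n \<Longrightarrow> xs ! i \<in> topspace (Ms ! i)"
    and hom: "\<And>i. i < ?n \<Longrightarrow> \<iota>s ! i \<in> hom (?A i) ?G" and inj: "\<And>i. i < ?n \<Longrightarrow> inj_on (\<iota>s ! i) (carrier (?A i))"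
    and gt: "(\<forall>i<?n. torsion_free (?A i)) \<Longrightarrow> generalized_torsion ?G g \<Longrightarrow>
       \<exists>i<?n. \<exists>c. generalized_torsion (?A i) c \<and> conjugate_in ?G g ((\<iota>s ! i) c)" for g
    using d l unfolding detects_generalized_torsion_def by (auto simp: Let_def cong: conj_cong)
  have gG: "group ?G" by (rule group_fundamental_group[OF p])
  have gA: "group (?A i)" if "i < ?n" for i by (rule group_fundamental_group[OF x[OF that]])
  have 1: "\<exists>g. generalized_torsion ?G g" if "i < ?n" "generalized_torsion (?A i) c" for i c
    using generalized_torsion_inj_hom[OF gA[OF that(1)] gG hom[OF that(1)] inj[OF that(1)] that(2)] by blast
  have 2: "\<exists>i<?n. \<exists>c. generalized_torsion (?A i) c" if g: "generalized_torsion ?G g" for g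
  proof (cases "\<forall>i<?n. torsion_free (?A i)")
    case True
    from gt[OF this g] show ?thesis by blast
  next
    case False
    then obtain i where i: "i < ?n" "\<not> torsion_free (?A i)" by blast
    obtain c where "generalized_torsion (?A i) c" by (rule torsion_generalized_torsion[OF gA[OF i(1)] i(2)])
    then show ?thesis using i(1) by blast
  qed
  show ?thesis using 1 2 gt by blast
qed

end
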